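(* Let $A$ be a complex affine Poisson algebra of Krull dimension at most $3$. Then the Poisson Dixmier–Moeglin equivalence holds for $A$: the sets of Poisson primitive ideals, Poisson locally closed ideals, and Poisson rational ideals of $A$ coincide.
   Context: A Poisson algebra over a field $k$ is a commutative $k$-algebra $A$ with a $k$-bilinear Lie bracket $\{-,-\}$ such that $\{-,x\}$ is a derivation for each $x\in A$. Complex affine means finitely generated over $\mathbb C$ and an integral domain. A Poisson ideal is an ideal $I$ with $\{I,A\}\subseteq I$; a Poisson prime is a prime Poisson ideal; $\mathrm{PSpec}\,A$ is the set of Poisson primes with the relative Zariski topology. A Poisson prime $P$ is Poisson locally closed if $\{P\}$ is locally closed in $\mathrm{PSpec}\,A$ (equivalently, the intersection of all Poisson primes strictly containing $P$ strictly contains $P$); Poisson primitive if it is the largest Poisson ideal contained in some maximal ideal; Poisson rational if the Poisson centre $\{z:\{z,-\}\equiv0\}$ of $\operatorname{Frac}(A/P)$ is algebraic over $\mathbb C$. *)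

theory Defs
  imports Complex_Main "HOL-Computational_Algebra.Polynomial"
begin

definition complex_algebra_map :: "(complex \<Rightarrow> 'a::comm_ring_1) \<Rightarrow> bool" where
  "complex_algebra_map \<iota> \<longleftrightarrow>
     \<iota> 1 = 1 \<and> (\<forall>c d. \<iota> (c + d) = \<iota> c + \<iota> d) \<and> (\<forall>c d. \<iota> (c * d) = \<iota> c * \<iota> d)"

inductive_set gen_subalg :: "(complex \<Rightarrow> 'a::comm_ring_1) \<Rightarrow> 'a set \<Rightarrow> 'a set"
  for \<iota> S where
  scal: "\<iota> c \<in> gen_subalg \<iota> S"
| gen: "x \<in> S \<Longrightarrow> x \<in> gen_subalg \<iota> S"
| add: "x \<in> gen_subalg \<iota> S \<Longrightarrow> y \<in> gen_subalg \<iota> S \<Longrightarrow> x + y \<in> gen_subalg \<iota> S"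
| mult: "x \<in> gen_subalg \<iota> S \<Longrightarrow> y \<in> gen_subalg \<iota> S \<Longrightarrow> x * y \<in> gen_subalg \<iota> S"

definition finitely_generated :: "(complex \<Rightarrow> 'a::comm_ring_1) \<Rightarrow> bool" where
  "finitely_generated \<iota> \<longleftrightarrow> (\<exists>S. finite S \<and> gen_subalg \<iota> S = UNIV)"

definition poisson_algebra :: "(complex \<Rightarrow> 'a::comm_ring_1) \<Rightarrow> ('a \<Rightarrow> 'a \<Rightarrow> 'a) \<Rightarrow> bool" where
  "poisson_algebra \<iota> br \<longleftrightarrow>
     complex_algebra_map \<iota> \<and>
     (\<forall>x y z. br (x + y) z = br x z + br y z) \<and>
     (\<forall>x y z. br x (y + z) = br x y + br x z) \<and>
     (\<forall>c x y. br (\<iota> c * x) y = \<iota> c * br x y) \<and>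
     (\<forall>c x y. br x (\<iota> c * y) = \<iota> c * br x y) \<and>
     (\<forall>x. br x x = 0) \<and>
     (\<forall>x y z. br x (br y z) + br y (br z x) + br z (br x y) = 0) \<and>
     (\<forall>x y z. br (x * y) z = x * br y z + y * br x z)"

definition ideal :: "'a::comm_ring_1 set \<Rightarrow> bool" where
  "ideal I \<longleftrightarrow> 0 \<in> I \<and> (\<forall>x\<in>I. \<forall>y\<in>I. x + y \<in> I) \<and> (\<forall>a. \<forall>x\<in>I. a * x \<in> I)"

definition prime_ideal :: "'a::comm_ring_1 set \<Rightarrow> bool" where
  "prime_ideal P \<longleftrightarrow> ideal P \<and> P \<noteq> UNIV \<and> (\<forall>a b. a * b \<in> P \<longrightarrow> a \<in> P \<or> b \<in> P)"

definition maximal_ideal :: "'a::comm_ring_1 set \<Rightarrow> bool" where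
  "maximal_ideal M \<longleftrightarrow> ideal M \<and> M \<noteq> UNIV \<and>
     (\<forall>J. ideal J \<and> M \<subseteq> J \<and> J \<noteq> UNIV \<longrightarrow> J = M)"

definition krull_dim_le :: "'a::comm_ring_1 itself \<Rightarrow> nat \<Rightarrow> bool" where
  "krull_dim_le _ n \<longleftrightarrow>
     \<not> (\<exists>C :: nat \<Rightarrow> 'a set. (\<forall>i \<le> Suc n. prime_ideal (C i)) \<and> (\<forall>i \<le> n. C i \<subset> C (Suc i)))"

definition poisson_ideal :: "('a::comm_ring_1 \<Rightarrow> 'a \<Rightarrow> 'a) \<Rightarrow> 'a set \<Rightarrow> bool" where
  "poisson_ideal br I \<longleftrightarrow> ideal I \<and> (\<forall>x\<in>I. \<forall>a. br x a \<in> I)"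

definition poisson_prime :: "('a::comm_ring_1 \<Rightarrow> 'a \<Rightarrow> 'a) \<Rightarrow> 'a set \<Rightarrow> bool" where
  "poisson_prime br P \<longleftrightarrow> poisson_ideal br P \<and> prime_ideal P"

definition PSpec :: "('a::comm_ring_1 \<Rightarrow> 'a \<Rightarrow> 'a) \<Rightarrow> 'a set set" where
  "PSpec br = {P. poisson_prime br P}"

text \<open>Zariski-closed subsets of PSpec are V(I) \<inter> PSpec = {Q. I \<subseteq> Q}; {P} is locally closed
  iff {P} = U \<inter> Z with U open and Z closed, i.e. {P} = V(I) - V(J) within PSpec.\<close>
definition poisson_locally_closed :: "('a::comm_ring_1 \<Rightarrow> 'a \<Rightarrow> 'a) \<Rightarrow> 'a set \<Rightarrow> bool" where
  "poisson_locally_closed br P \<longleftrightarrow> P \<in> PSpec br \<and>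
     (\<exists>I J :: 'a set. {P} = {Q \<in> PSpec br. I \<subseteq> Q \<and> \<not> J \<subseteq> Q})"

definition poisson_primitive :: "('a::comm_ring_1 \<Rightarrow> 'a \<Rightarrow> 'a) \<Rightarrow> 'a set \<Rightarrow> bool" where
  "poisson_primitive br P \<longleftrightarrow>
     (\<exists>M. maximal_ideal M \<and> poisson_ideal br P \<and> P \<subseteq> M \<and>
          (\<forall>I. poisson_ideal br I \<and> I \<subseteq> M \<longrightarrow> I \<subseteq> P))"

text \<open>Poisson rational: every element a/b (b \<notin> P) of Frac(A/P) lying in the Poisson centre
  is algebraic over the complex numbers. Written out on representatives: a/b is Poisson central in
  Frac(A/P) iff {a/b, c} = (b{a,c} - a{b,c})/b^2 = 0 for all c in A, i.e. b{a,c} - a{b,c} \<in> P;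
  and p(a/b) = 0 for p of degree n iff b^n p(a/b) = sum_i p_i a^i b^(n-i) \<in> P.\<close>
definition poisson_rational :: "(complex \<Rightarrow> 'a::comm_ring_1) \<Rightarrow> ('a \<Rightarrow> 'a \<Rightarrow> 'a) \<Rightarrow> 'a set \<Rightarrow> bool" where
  "poisson_rational \<iota> br P \<longleftrightarrow> P \<in> PSpec br \<and>
     (\<forall>a b. b \<notin> P \<and> (\<forall>c. b * br a c - a * br b c \<in> P) \<longrightarrow>
        (\<exists>p :: complex poly. p \<noteq> 0 \<and>
           (\<Sum>i\<le>degree p. \<iota> (coeff p i) * a ^ i * b ^ (degree p - i)) \<in> P))"

end

theory Submission
  imports Defs "HOL-Computational_Algebra.Computational_Algebra" "HOL-Computational_Algebra.Field_as_Ring"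
    "HOL-Analysis.Continuum_Not_Denumerable"
begin

text \<open>
  Locally closed implies primitive by the Nullstellensatz, and primitive implies rational because the residue field of a
  maximal ideal is \<open>\<complex>\<close>; both rest on \<open>A\<close> having countable dimension over the uncountable field \<open>\<complex>\<close>. If \<open>P \<noteq> 0\<close> is
  rational, the primes strictly above \<open>P\<close> have coordinate rings of transcendence degree at most one, on which every
  Poisson bracket vanishes, so all of them contain the nonzero brackets of \<open>A/P\<close>.

  There remains \<open>P = 0\<close> in dimension three. If \<open>0\<close> is not locally closed, countably many nonzero Poisson primes \<open>P\<^sub>j\<close>
  intersect in \<open>0\<close>, and they are surfaces, since the bracket does not vanish on them. Following Jouanolou and Darboux,
  project to affine space by coordinates \<open>x, y, z\<close> that are generic for all \<open>P\<^sub>j\<close> at once, let \<open>p\<^sub>j\<close> generate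
  \<open>P\<^sub>j \<inter> \<complex>[x, y, z]\<close>, and lift the conormal of \<open>P\<^sub>j\<close> to a logarithmic form \<open>\<eta>\<^sub>j\<close> with pole along \<open>P\<^sub>j\<close> only, of degree at
  most \<open>deg p\<^sub>j\<close> up to a constant. The contraction of \<open>\<eta>\<^sub>j\<close> with the Poisson structure and \<open>d\<eta>\<^sub>j\<close> are regular and of bounded
  degree, hence lie in a fixed finite-dimensional space. Linear combinations over two disjoint sets of indices therefore
  give two closed forms annihilated by the Poisson structure. Such forms are proportional, and their quotient is a Casimir
  function, which is not constant because the poles are different.
\<close>

text \<open>In a factorial ring a surface has one equation \<open>p\<close>, and \<open>dp/p\<close>
  would serve as its form. In general only the equation \<open>p\<^sub>j\<close> of the projected
  surface is at hand, and over \<open>p\<^sub>j = 0\<close> lie further components, along which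
  \<open>{p\<^sub>j, -}\<close> may be nonzero; this is why a conormal that dies on those components
  has to be lifted. The ring \<open>A\<close> may also fail to be normal, so no divisors are used:
  all estimates take place in the subring \<open>R = \<complex>[x, y, z][w]\<close>, which is free
  over \<open>\<complex>[x, y, z]\<close> and is filtered by the degrees of coefficients. The
  degrees of the \<open>p\<^sub>j\<close> may be unbounded. They drop out because dividing by
  \<open>p\<^sub>j\<close> in \<open>R\<close> lowers a degree bound by
  \<open>deg p\<^sub>j\<close>; what remains depends on the coordinates only, which is why one set
  of coordinates must serve the whole countable family. Each form yields five elements of a fixed
  space, two components of its contraction and three of its differential, so a number of indices
  fixed beforehand already forces a relation.\<close>

section \<open>Ring homomorphisms and evaluation of polynomials\<close>

definition rhom :: "('a::comm_ring_1 \<Rightarrow> 'b::comm_ring_1) \<Rightarrow> bool" where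
  "rhom h \<longleftrightarrow> h 0 = 0 \<and> h 1 = 1 \<and> (\<forall>a b. h (a + b) = h a + h b) \<and> (\<forall>a b. h (a * b) = h a * h b)"

lemma rhomI:
  "h 0 = 0 \<Longrightarrow> h 1 = 1 \<Longrightarrow> (\<And>a b. h (a + b) = h a + h b) \<Longrightarrow> (\<And>a b. h (a * b) = h a * h b) \<Longrightarrow> rhom h"
  by (auto simp: rhom_def)

lemma rhom_0: "rhom h \<Longrightarrow> h 0 = 0"
  and rhom_1: "rhom h \<Longrightarrow> h 1 = 1"
  and rhom_add: "rhom h \<Longrightarrow> h (a + b) = h a + h b"
  and rhom_mult: "rhom h \<Longrightarrow> h (a * b) = h a * h b"
  by (auto simp: rhom_def)

lemma rhom_uminus: assumes "rhom h" shows "h (- a) = - h a"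
  by (metis add.right_inverse add_eq_0_iff assms rhom_0 rhom_add)

lemma rhom_diff: assumes "rhom h" shows "h (a - b) = h a - h b"
  using rhom_add[OF assms, of a "-b"] rhom_uminus[OF assms] by simp

lemma rhom_power: "rhom h \<Longrightarrow> h (a ^ n) = h a ^ n"
  by (induction n) (auto simp: rhom_1 rhom_mult)

lemma rhom_sum: "rhom h \<Longrightarrow> h (sum f I) = (\<Sum>i\<in>I. h (f i))"
  by (induction I rule: infinite_finite_induct) (auto simp: rhom_0 rhom_add)

lemma rhom_prod: "rhom h \<Longrightarrow> h (prod f I) = (\<Prod>i\<in>I. h (f i))"
  by (induction I rule: infinite_finite_induct) (auto simp: rhom_1 rhom_mult)

lemma rhom_of_nat: "rhom h \<Longrightarrow> h (of_nat n) = of_nat n"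
  by (induction n) (auto simp: rhom_0 rhom_1 rhom_add)

lemma rhom_comp: "rhom h \<Longrightarrow> rhom k \<Longrightarrow> rhom (\<lambda>a. k (h a))"
  by (auto simp: rhom_def)

lemmas rhom_simps = rhom_0 rhom_1 rhom_add rhom_mult rhom_uminus rhom_diff rhom_power

lemma rhom_id: "rhom (\<lambda>a. a)" by (auto simp: rhom_def)

lemma rhom_const: "rhom h \<Longrightarrow> rhom (\<lambda>a. [:h a:])"
  by (auto simp: rhom_def one_pCons)

lemma rhom_pC: "rhom (\<lambda>a. [:a:])"
  by (rule rhom_const[OF rhom_id])

lemma rhom_poly: "rhom (\<lambda>p. poly p x)"
  by (auto simp: rhom_def)

lemma rhom_field_inj: fixes h :: "'a::field \<Rightarrow> 'b::comm_ring_1"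
  assumes "rhom h" "h a = h b" shows "a = b"
proof (rule ccontr)
  assume "a \<noteq> b"
  hence "h ((a - b) * inverse (a - b)) = 1" using assms by (simp add: rhom_1)
  hence "h (a - b) * h (inverse (a - b)) = 1" using assms(1) by (simp add: rhom_mult)
  thus False using assms by (simp add: rhom_diff)
qed

text \<open>Iterating adds one variable at a time: \<open>pev (pev \<iota> x) y\<close> evaluates
  complex polynomials in two variables at \<open>(x, y)\<close>, and being transcendental or
  independent becomes a statement about one further \<open>pev\<close>.\<close>

definition pev :: "('d::comm_ring_1 \<Rightarrow> 'b::comm_ring_1) \<Rightarrow> 'b \<Rightarrow> 'd poly \<Rightarrow> 'b" where
  "pev h x p = poly (map_poly h p) x"

lemma pev_0: "pev h x 0 = 0"
  by (simp add: pev_def)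

lemma pev_pCons: "rhom h \<Longrightarrow> pev h x (pCons a p) = h a + x * pev h x p"
  by (simp add: pev_def map_poly_pCons rhom_0)

lemma pev_const: "rhom h \<Longrightarrow> pev h x [:a:] = h a"
  by (simp add: pev_pCons pev_0)

lemma pev_X: "rhom h \<Longrightarrow> pev h x [:0, 1:] = x"
  by (simp add: pev_pCons pev_0 rhom_0 rhom_1)

lemma pev_add: "rhom h \<Longrightarrow> pev h x (p + q) = pev h x p + pev h x q"
  by (induction p q rule: poly_induct2) (auto simp: pev_0 pev_pCons rhom_add algebra_simps)

lemma pev_smult: "rhom h \<Longrightarrow> pev h x (smult c q) = h c * pev h x q"
  by (induction q) (auto simp: pev_0 pev_pCons rhom_mult algebra_simps)

lemma pev_mult: "rhom h \<Longrightarrow> pev h x (p * q) = pev h x p * pev h x q"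
  by (induction p) (auto simp: pev_0 pev_pCons pev_add pev_smult rhom_0 algebra_simps)

lemma pev_rhom: "rhom h \<Longrightarrow> rhom (pev h x)"
  by (rule rhomI) (auto simp: pev_0 pev_add pev_mult one_pCons pev_pCons rhom_1)

lemma pev_sum: "rhom h \<Longrightarrow> pev h x (sum f I) = (\<Sum>i\<in>I. pev h x (f i))"
  by (rule rhom_sum[OF pev_rhom])

lemma pev_monom: "rhom h \<Longrightarrow> pev h x (monom c n) = h c * x ^ n"
  by (induction n) (auto simp: monom_0 monom_Suc pev_pCons pev_0 rhom_0 algebra_simps)

lemma pev_altdef: assumes "rhom h" "degree p \<le> n"
  shows "pev h x p = (\<Sum>i\<le>n. h (coeff p i) * x ^ i)"
proof -
  have "p = (\<Sum>i\<le>n. monom (coeff p i) i)" using assms(2) by (simp add: poly_as_sum_of_monoms')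
  hence "pev h x p = pev h x (\<Sum>i\<le>n. monom (coeff p i) i)" by simp
  also have "\<dots> = (\<Sum>i\<le>n. h (coeff p i) * x ^ i)"
    by (simp add: pev_sum[OF assms(1)] pev_monom[OF assms(1)])
  finally show ?thesis .
qed

lemma pev_comp: assumes "rhom h" "rhom k" shows "k (pev h x p) = pev (\<lambda>a. k (h a)) (k x) p"
  by (induction p) (auto simp: pev_0 pev_pCons assms rhom_comp[OF assms] rhom_simps[OF assms(2)])

lemma pev_unique: assumes "rhom \<phi>" shows "\<phi> p = pev (\<lambda>a. \<phi> [:a:]) (\<phi> [:0,1:]) p"
proof (induction p)
  case 0 show ?case by (simp add: pev_0 rhom_0[OF assms])
next
  case (pCons a p)
  have "pCons a p = [:a:] + [:0,1:] * p" by simp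
  hence "\<phi> (pCons a p) = \<phi> [:a:] + \<phi> [:0,1:] * \<phi> p" by (metis rhom_add[OF assms] rhom_mult[OF assms])
  thus ?case using pCons by (simp add: pev_pCons rhom_comp[OF rhom_pC assms])
qed

lemma pev_id: "pev (\<lambda>a. a) x p = poly p x"
  by (simp add: pev_def map_poly_idI)

lemma map_poly_pev: "rhom e \<Longrightarrow> map_poly e p = pev (\<lambda>d. [:e d:]) [:0,1:] p"
  by (induction p) (auto simp: pev_0 pev_pCons[OF rhom_const] map_poly_pCons rhom_0)

lemma map_poly_rhom: assumes "rhom e" shows "rhom (map_poly e)"
proof -
  have "map_poly e = pev (\<lambda>d. [:e d:]) [:0,1:]" using map_poly_pev[OF assms] by blast
  thus ?thesis using pev_rhom[OF rhom_const[OF assms]] by simp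
qed

text \<open>Fraction-free Gaussian elimination: the pivot \<open>M i0 j\<close> is cross-multiplied
  into the other rows, so that a homogeneous system with more unknowns \<open>I\<close> than
  equations \<open>J\<close> is solved inside the domain itself.\<close>

lemma linear_dependence:
  fixes M :: "'i \<Rightarrow> 'j \<Rightarrow> 'd::idom"
  assumes "finite J" "finite I" "card I > card J"
  shows "\<exists>c. (\<exists>i\<in>I. c i \<noteq> 0) \<and> (\<forall>j\<in>J. (\<Sum>i\<in>I. c i * M i j) = 0)"
  using assms
proof (induction J arbitrary: I M rule: finite_induct)
  case empty
  then obtain i where "i \<in> I" by fastforce
  thus ?case by (intro exI[of _ "\<lambda>_. 1"]) auto
next
  case (insert j J)
  show ?case
  proof (cases "\<forall>i\<in>I. M i j = 0")
    case True
    obtain c where "\<exists>i\<in>I. c i \<noteq> 0" "\<forall>j\<in>J. (\<Sum>i\<in>I. c i * M i j) = 0"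
      using insert.IH[of I M] insert.prems insert.hyps by auto
    thus ?thesis using True by (intro exI[of _ c]) auto
  next
    case False
    then obtain i0 where i0: "i0 \<in> I" "M i0 j \<noteq> 0" by auto
    let ?I = "I - {i0}"
    have c1: "card ?I > card J" using insert.prems insert.hyps i0 by simp
    obtain c where c: "\<exists>i\<in>?I. c i \<noteq> 0"
      "\<forall>k\<in>J. (\<Sum>i\<in>?I. c i * (M i0 j * M i k - M i j * M i0 k)) = 0"
      using insert.IH[of ?I "\<lambda>i k. M i0 j * M i k - M i j * M i0 k"] c1 insert.prems by auto
    \<comment> \<open>The coefficient of the pivot row makes equation \<open>j\<close> hold: for
      \<open>k = j\<close> every summand on the right of \<open>S\<close> below cancels.\<close>
    define c' where "c' = (\<lambda>i. if i = i0 then - (\<Sum>i\<in>?I. c i * M i j) else c i * M i0 j)"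
    have S: "(\<Sum>i\<in>I. c' i * M i k) = (\<Sum>i\<in>?I. c i * (M i0 j * M i k - M i j * M i0 k))" for k
    proof -
      have "(\<Sum>i\<in>I. c' i * M i k) = c' i0 * M i0 k + (\<Sum>i\<in>?I. c' i * M i k)"
        using insert.prems i0 by (simp add: sum.remove)
      also have "(\<Sum>i\<in>?I. c' i * M i k) = (\<Sum>i\<in>?I. c i * M i0 j * M i k)"
        by (rule sum.cong) (auto simp: c'_def)
      also have "c' i0 * M i0 k = - (\<Sum>i\<in>?I. c i * M i j * M i0 k)"
        by (simp add: c'_def sum_distrib_right)
      finally show ?thesis by (simp add: right_diff_distrib sum_subtractf mult.assoc)
    qed
    have "(\<Sum>i\<in>I. c' i * M i k) = 0" if "k \<in> insert j J" for k
      using that c(2) unfolding S by (auto simp: mult.commute)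
    moreover have "\<exists>i\<in>I. c' i \<noteq> 0" using c(1) i0 by (auto simp: c'_def)
    ultimately show ?thesis by blast
  qed
qed

subsection \<open>Ideals\<close>

lemma ideal_0: "ideal I \<Longrightarrow> 0 \<in> I"
  and ideal_add: "ideal I \<Longrightarrow> x \<in> I \<Longrightarrow> y \<in> I \<Longrightarrow> x + y \<in> I"
  and ideal_mult: "ideal I \<Longrightarrow> x \<in> I \<Longrightarrow> a * x \<in> I"
  by (auto simp: ideal_def)

lemma ideal_mult': "ideal I \<Longrightarrow> x \<in> I \<Longrightarrow> x * a \<in> I"
  by (metis ideal_mult mult.commute)

lemma ideal_uminus: "ideal I \<Longrightarrow> x \<in> I \<Longrightarrow> - x \<in> I"
  using ideal_mult[of I x "-1"] by simp

lemma ideal_diff: "ideal I \<Longrightarrow> x \<in> I \<Longrightarrow> y \<in> I \<Longrightarrow> x - y \<in> I"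
  using ideal_add[of I x "-y"] ideal_uminus by fastforce

lemma ideal_sum: "ideal I \<Longrightarrow> (\<And>i. i \<in> S \<Longrightarrow> f i \<in> I) \<Longrightarrow> sum f S \<in> I"
  by (induction S rule: infinite_finite_induct) (auto simp: ideal_0 ideal_add)

lemma ideal_cong_add: assumes "ideal I" "x - y \<in> I" shows "x \<in> I \<longleftrightarrow> y \<in> I"
proof
  assume "x \<in> I" thus "y \<in> I" using ideal_diff[OF assms(1) _ assms(2), of x] by simp
next
  assume "y \<in> I" thus "x \<in> I" using ideal_add[OF assms(1) _ assms(2), of y] by simp
qed

lemma ideal_UNIV_iff: "ideal I \<Longrightarrow> I = UNIV \<longleftrightarrow> 1 \<in> I"
  by (metis UNIV_I UNIV_eq_I ideal_mult mult.right_neutral)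

lemma prime_idealD: "prime_ideal P \<Longrightarrow> ideal P"
  by (simp add: prime_ideal_def)

lemma prime_ideal_mult: "prime_ideal P \<Longrightarrow> a * b \<in> P \<longleftrightarrow> a \<in> P \<or> b \<in> P"
  by (meson ideal_mult ideal_mult' prime_ideal_def)

lemma prime_ideal_1: "prime_ideal P \<Longrightarrow> 1 \<notin> P"
  by (metis ideal_UNIV_iff prime_ideal_def)

lemma prime_ideal_power: "prime_ideal P \<Longrightarrow> a ^ n \<in> P \<Longrightarrow> a \<in> P"
  by (induction n) (auto simp: prime_ideal_1 prime_ideal_mult)

lemma prime_ideal_prod: "prime_ideal P \<Longrightarrow> prod f I \<in> P \<Longrightarrow> \<exists>i\<in>I. f i \<in> P"
  by (induction I rule: infinite_finite_induct) (auto simp: prime_ideal_1 prime_ideal_mult)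

lemma prime_ideal_zero: "prime_ideal ({0} :: 'a::idom set)"
  unfolding prime_ideal_def ideal_def by (auto dest: arg_cong[where f = "\<lambda>S. 1 \<in> S"])

lemma ideal_adjoin:
  assumes Q: "ideal Q" shows "ideal {q + r * a | q r. q \<in> Q}"
  unfolding ideal_def
proof (intro conjI ballI allI)
  have "0 = 0 + 0 * a" by simp
  thus "0 \<in> {q + r * a | q r. q \<in> Q}" using ideal_0[OF Q] by blast
next
  fix x y assume "x \<in> {q + r * a | q r. q \<in> Q}" "y \<in> {q + r * a | q r. q \<in> Q}"
  then obtain q r q' r' where h: "x = q + r * a" "y = q' + r' * a" "q \<in> Q" "q' \<in> Q" by auto
  have "x + y = (q + q') + (r + r') * a" by (simp add: h algebra_simps)
  thus "x + y \<in> {q + r * a | q r. q \<in> Q}" using ideal_add[OF Q h(3,4)] by blast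
next
  fix b x assume "x \<in> {q + r * a | q r. q \<in> Q}"
  then obtain q r where h: "x = q + r * a" "q \<in> Q" by auto
  have "b * x = b * q + (b * r) * a" by (simp add: h algebra_simps)
  thus "b * x \<in> {q + r * a | q r. q \<in> Q}" using ideal_mult[OF Q h(2)] by blast
qed

text \<open>Zorn's lemma on the ideals over \<open>I\<close> that miss the multiplicative set
  \<open>S\<close>. Maximality is kept in the conclusion because the Nullstellensatz below reads the
  residue field off from it.\<close>

lemma exists_prime_avoiding:
  assumes I: "ideal I" and S1: "1 \<in> S" and Sm: "\<And>a b. a \<in> S \<Longrightarrow> b \<in> S \<Longrightarrow> a * b \<in> S"
    and disj: "I \<inter> S = {}"
  shows "\<exists>Q. prime_ideal Q \<and> I \<subseteq> Q \<and> Q \<inter> S = {} \<and> (\<forall>J. ideal J \<and> Q \<subset> J \<longrightarrow> J \<inter> S \<noteq> {})"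
proof -
  define F where "F = {J. ideal J \<and> I \<subseteq> J \<and> J \<inter> S = {}}"
  have "\<exists>M\<in>F. \<forall>X\<in>F. M \<subseteq> X \<longrightarrow> X = M"
  proof (rule subset_Zorn_nonempty)
    show "F \<noteq> {}" using I disj by (auto simp: F_def)
  next
    fix C assume C: "C \<noteq> {}" "subset.chain F C"
    hence CF: "C \<subseteq> F" and ch: "\<And>x y. x \<in> C \<Longrightarrow> y \<in> C \<Longrightarrow> x \<subseteq> y \<or> y \<subseteq> x"
      by (auto simp: subset.chain_def)
    have "ideal (\<Union> C)"
      unfolding ideal_def
    proof (intro conjI ballI allI)
      show "0 \<in> \<Union> C" using C CF by (force simp: F_def ideal_def)
    next
      fix x y assume "x \<in> \<Union> C" "y \<in> \<Union> C"
      then obtain X Y where XY: "X \<in> C" "x \<in> X" "Y \<in> C" "y \<in> Y" by auto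
      with ch have "\<exists>Z\<in>C. x \<in> Z \<and> y \<in> Z" by (metis subsetD)
      then obtain Z where Z: "Z \<in> C" "x \<in> Z" "y \<in> Z" by auto
      hence "x + y \<in> Z" using CF by (auto simp: F_def ideal_def)
      thus "x + y \<in> \<Union> C" using Z by auto
    next
      fix a x assume "x \<in> \<Union> C"
      then obtain X where X: "X \<in> C" "x \<in> X" by auto
      hence "a * x \<in> X" using CF by (auto simp: F_def ideal_def)
      thus "a * x \<in> \<Union> C" using X by auto
    qed
    moreover have "I \<subseteq> \<Union> C" using C CF by (auto simp: F_def)
    moreover have "\<Union> C \<inter> S = {}" using CF by (auto simp: F_def)
    ultimately show "\<Union> C \<in> F" by (auto simp: F_def)
  qed
  then obtain Q where Q: "ideal Q" "I \<subseteq> Q" "Q \<inter> S = {}" and max: "\<And>X. X \<in> F \<Longrightarrow> Q \<subseteq> X \<Longrightarrow> X = Q"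
    by (auto simp: F_def)
  have mx: "J \<inter> S \<noteq> {}" if "ideal J" "Q \<subset> J" for J
    using max[of J] that Q by (auto simp: F_def)
  have gen: "\<exists>q\<in>Q. \<exists>r. q + r * a \<in> S" if "a \<notin> Q" for a
  proof -
    let ?J = "{q + r * a | q r. q \<in> Q}"
    have "ideal ?J" by (rule ideal_adjoin[OF Q(1)])
    moreover have "Q \<subseteq> ?J" by (force intro: exI[of _ 0])
    moreover have "a = 0 + 1 * a" by simp
    hence "a \<in> ?J" using ideal_0[OF Q(1)] by blast
    ultimately have "?J \<inter> S \<noteq> {}" using mx[of ?J] that by blast
    thus ?thesis by auto
  qed
  have "prime_ideal Q"
    unfolding prime_ideal_def
  proof (intro conjI allI impI)
    show "ideal Q" by (rule Q)
    show "Q \<noteq> UNIV" using Q S1 by auto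
    fix a b assume ab: "a * b \<in> Q"
    show "a \<in> Q \<or> b \<in> Q"
    proof (rule ccontr)
      assume "\<not> (a \<in> Q \<or> b \<in> Q)"
      then obtain q r q' r' where h: "q \<in> Q" "q + r * a \<in> S" "q' \<in> Q" "q' + r' * b \<in> S"
        using gen by meson
      have "(q + r * a) * (q' + r' * b) = q * (q' + r' * b) + (r * a) * q' + (r * r') * (a * b)"
        by (simp add: algebra_simps)
      also have "\<dots> \<in> Q" by (intro ideal_add ideal_mult ideal_mult' Q h ab)
      finally show False using Sm[OF h(2) h(4)] Q by auto
    qed
  qed
  thus ?thesis using Q mx by blast
qed

lemma complex_algebra_map_rhom: "complex_algebra_map \<iota> \<Longrightarrow> rhom \<iota>"
  unfolding complex_algebra_map_def rhom_def by (metis add_cancel_right_left)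

text \<open>Distinct scalars differ by a unit, so dividing by \<open>X - c0\<close> at one value in
  \<open>Q\<close> lowers the degree. It is applied to prime ideals and to the multiples of a fixed
  polynomial, and turns statements about generic scalars into statements about coefficients.\<close>

lemma vandermonde_ideal:
  fixes \<iota> :: "complex \<Rightarrow> 'a::comm_ring_1"
  assumes i: "rhom \<iota>" and Q: "ideal Q" and inf: "infinite {c. poly g (\<iota> c) \<in> Q}"
  shows "coeff g n \<in> Q"
  using inf
proof (induction "degree g" arbitrary: g n)
  case 0
  then obtain a where g: "g = [:a:]" by (metis degree_eq_zeroE)
  obtain c where "poly g (\<iota> c) \<in> Q" using 0(2) not_finite_existsD by auto
  thus ?case by (cases n) (auto simp: g ideal_0[OF Q])
next
  case (Suc d)
  obtain c0 where c0: "poly g (\<iota> c0) \<in> Q" using Suc.prems not_finite_existsD by auto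
  define g1 where "g1 = synthetic_div g (\<iota> c0)"
  have eq: "g = [:- \<iota> c0, 1:] * g1 + [:poly g (\<iota> c0):]"
    unfolding g1_def by (rule synthetic_div_correct'[symmetric])
  have dg: "d = degree g1" using Suc(2) by (simp add: g1_def degree_synthetic_div)
  have sub: "{c. poly g (\<iota> c) \<in> Q} \<subseteq> insert c0 {c. poly g1 (\<iota> c) \<in> Q}"
  proof
    fix c assume c: "c \<in> {c. poly g (\<iota> c) \<in> Q}"
    show "c \<in> insert c0 {c. poly g1 (\<iota> c) \<in> Q}"
    proof (cases "c = c0")
      case False
      have "poly g (\<iota> c) = (\<iota> c - \<iota> c0) * poly g1 (\<iota> c) + poly g (\<iota> c0)"
        by (subst eq) (simp add: algebra_simps)
      hence "(\<iota> c - \<iota> c0) * poly g1 (\<iota> c) \<in> Q"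
        using ideal_diff[OF Q, of "poly g (\<iota> c)" "poly g (\<iota> c0)"] c c0 by simp
      hence "\<iota> (inverse (c - c0)) * ((\<iota> c - \<iota> c0) * poly g1 (\<iota> c)) \<in> Q" by (rule ideal_mult[OF Q])
      also have "\<iota> (inverse (c - c0)) * ((\<iota> c - \<iota> c0) * poly g1 (\<iota> c)) = \<iota> (inverse (c - c0) * (c - c0)) * poly g1 (\<iota> c)"
        by (simp only: rhom_mult[OF i] rhom_diff[OF i] mult.assoc)
      finally show ?thesis using False by (simp add: rhom_1[OF i])
    qed auto
  qed
  have "infinite {c. poly g1 (\<iota> c) \<in> Q}"
    using Suc.prems finite_subset[OF sub] by auto
  hence IH: "coeff g1 m \<in> Q" for m using Suc.hyps(1)[OF dg] by blast
  have "coeff g n = - \<iota> c0 * coeff g1 n + coeff (pCons 0 g1) n + coeff [:poly g (\<iota> c0):] n"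
    by (subst eq) (simp)
  moreover have "coeff (pCons 0 g1) n \<in> Q" by (cases n) (auto simp: IH ideal_0[OF Q])
  moreover have "coeff [:poly g (\<iota> c0):] n \<in> Q" by (cases n) (auto simp: c0 ideal_0[OF Q])
  ultimately show ?case using IH ideal_add[OF Q] ideal_mult[OF Q] by (metis)
qed

section \<open>Algebraic dependence modulo an ideal\<close>

text \<open>Injectivity of \<open>e\<close> modulo \<open>Q\<close>. For \<open>e\<close> an
  iterated \<open>pev\<close> over the scalars this says that the evaluation point is algebraically
  independent modulo \<open>Q\<close>; quotient rings are never formed.\<close>

definition lies_over_zero :: "('d::comm_ring_1 \<Rightarrow> 'b::comm_ring_1) \<Rightarrow> 'b set \<Rightarrow> bool" where
  "lies_over_zero e Q \<longleftrightarrow> (\<forall>d. e d \<in> Q \<longrightarrow> d = 0)"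

definition algebraic_mod :: "('d::comm_ring_1 \<Rightarrow> 'b::comm_ring_1) \<Rightarrow> 'b set \<Rightarrow> 'b \<Rightarrow> bool" where
  "algebraic_mod e Q a \<longleftrightarrow> (\<exists>f. f \<noteq> 0 \<and> pev e a f \<in> Q)"

lemma lies_over_zero_pev:
  "lies_over_zero (pev e a) Q \<longleftrightarrow> \<not> algebraic_mod e Q a"
  by (auto simp: lies_over_zero_def algebraic_mod_def)

text \<open>Modulo \<open>Q\<close> all powers of \<open>t\<close> stay in the module spanned by the
  \<open>g k\<close>, and one more power than there are generators forces a linear relation.
  Counting takes the place of a characteristic polynomial.\<close>

lemma algebraic_mod_of_finite_module:
  fixes e :: "'d::idom \<Rightarrow> 'b::comm_ring_1"
  assumes e: "rhom e" and Q: "ideal Q" and fin: "finite J" and j0: "j0 \<in> J" "g j0 = 1"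
    and st: "\<And>j. j \<in> J \<Longrightarrow> \<exists>N. t * g j - (\<Sum>k\<in>J. e (N k) * g k) \<in> Q"
  shows "algebraic_mod e Q t"
proof -
  have "\<exists>M. t ^ i - (\<Sum>k\<in>J. e (M k) * g k) \<in> Q" for i
  proof (induction i)
    case 0
    have "(\<Sum>k\<in>J. e (if k = j0 then 1 else 0) * g k) = (\<Sum>k\<in>J. if k = j0 then g k else 0)"
      by (rule sum.cong) (auto simp: rhom_simps[OF e])
    also have "\<dots> = 1" using fin j0 by simp
    finally show ?case using ideal_0[OF Q] by (intro exI[of _ "\<lambda>k. if k = j0 then 1 else 0"]) simp
  next
    case (Suc i)
    then obtain M where M: "t ^ i - (\<Sum>k\<in>J. e (M k) * g k) \<in> Q" by auto
    from st obtain N where N: "\<And>j. j \<in> J \<Longrightarrow> t * g j - (\<Sum>k\<in>J. e (N j k) * g k) \<in> Q" by metis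
    have "t ^ Suc i - (\<Sum>k\<in>J. e (\<Sum>j\<in>J. M j * N j k) * g k)
       = t * (t ^ i - (\<Sum>k\<in>J. e (M k) * g k)) + (\<Sum>j\<in>J. e (M j) * (t * g j - (\<Sum>k\<in>J. e (N j k) * g k)))"
    proof -
      have "(\<Sum>k\<in>J. e (\<Sum>j\<in>J. M j * N j k) * g k) = (\<Sum>k\<in>J. \<Sum>j\<in>J. e (M j) * e (N j k) * g k)"
        by (simp add: rhom_sum[OF e] rhom_mult[OF e] sum_distrib_right)
      also have "\<dots> = (\<Sum>j\<in>J. \<Sum>k\<in>J. e (M j) * e (N j k) * g k)" by (rule sum.swap)
      finally show ?thesis
        by (simp add: right_diff_distrib sum_subtractf sum_distrib_left mult.assoc mult.left_commute)
    qed
    also have "\<dots> \<in> Q" by (intro ideal_add ideal_mult ideal_sum Q M N) auto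
    finally show ?case by (intro exI[of _ "\<lambda>k. \<Sum>j\<in>J. M j * N j k"])
  qed
  then obtain M where M: "\<And>i. t ^ i - (\<Sum>k\<in>J. e (M i k) * g k) \<in> Q" by metis
  obtain c where c: "\<exists>i\<in>{..card J}. c i \<noteq> 0" "\<forall>j\<in>J. (\<Sum>i\<in>{..card J}. c i * M i j) = 0"
    using linear_dependence[of J "{..card J}" M] fin by auto
  define f where "f = (\<Sum>i\<le>card J. monom (c i) i)"
  have cf: "coeff f i = c i" if "i \<le> card J" for i
    using that by (simp add: f_def coeff_sum)
  have nz: "f \<noteq> 0" using c(1) cf by (metis atMost_iff coeff_0)
  have "pev e t f = (\<Sum>i\<le>card J. e (c i) * t ^ i)"
    by (simp add: f_def pev_sum[OF e] pev_monom[OF e])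
  also have "\<dots> = (\<Sum>i\<le>card J. e (c i) * (t ^ i - (\<Sum>k\<in>J. e (M i k) * g k)))
      + (\<Sum>i\<le>card J. \<Sum>k\<in>J. e (c i * M i k) * g k)"
    by (simp add: right_diff_distrib sum_subtractf sum_distrib_left mult.assoc rhom_mult[OF e])
  also have "(\<Sum>i\<le>card J. \<Sum>k\<in>J. e (c i * M i k) * g k) = (\<Sum>k\<in>J. \<Sum>i\<le>card J. e (c i * M i k) * g k)"
    by (rule sum.swap)
  also have "\<dots> = (\<Sum>k\<in>J. e (\<Sum>i\<le>card J. c i * M i k) * g k)"
    by (simp add: rhom_sum[OF e] sum_distrib_right)
  also have "\<dots> = 0" using c(2) by (simp add: rhom_0[OF e])
  finally have "pev e t f = (\<Sum>i\<le>card J. e (c i) * (t ^ i - (\<Sum>k\<in>J. e (M i k) * g k)))" by simp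
  also have "\<dots> \<in> Q" by (intro ideal_sum ideal_mult Q M)
  finally have "pev e t f \<in> Q" .
  with nz show ?thesis unfolding algebraic_mod_def by blast
qed

lemma algebraic_mod_lead:
  fixes e :: "'d::idom \<Rightarrow> 'b::comm_ring_1"
  assumes e: "rhom e" and Q: "ideal Q" and z: "lies_over_zero e Q" and a: "algebraic_mod e Q a"
  shows "\<exists>m l (f::nat \<Rightarrow> 'd). m > 0 \<and> l \<noteq> 0 \<and> e l * a ^ m - (\<Sum>i<m. e (f i) * a ^ i) \<in> Q"
proof -
  obtain f where f: "f \<noteq> 0" "pev e a f \<in> Q" using a by (auto simp: algebraic_mod_def)
  have d: "degree f > 0"
  proof (rule ccontr)
    assume "\<not> degree f > 0"
    then obtain c where "f = [:c:]" by (metis degree_eq_zeroE gr0I)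
    thus False using f z by (auto simp: pev_const[OF e] lies_over_zero_def)
  qed
  have "pev e a f = (\<Sum>i\<le>degree f. e (coeff f i) * a ^ i)" by (rule pev_altdef[OF e]) simp
  also have "\<dots> = e (lead_coeff f) * a ^ degree f - (\<Sum>i<degree f. e (- coeff f i) * a ^ i)"
    by (simp add: lessThan_Suc_atMost[symmetric] rhom_uminus[OF e] sum_negf)
  finally show ?thesis using f d
    by (intro exI[of _ "degree f"] exI[of _ "lead_coeff f"] exI[of _ "\<lambda>i. - coeff f i"]) auto
qed

lemma algebraic_mod_scaled:
  fixes e :: "'d::idom \<Rightarrow> 'b::comm_ring_1"
  assumes e: "rhom e" and c: "c \<noteq> 0" and a: "algebraic_mod e Q (e c * a)"
  shows "algebraic_mod e Q a"
proof -
  obtain f where f: "f \<noteq> 0" "pev e (e c * a) f \<in> Q" using a by (auto simp: algebraic_mod_def)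
  have "pev e (e c * a) f = pev e a (pcompose f [:0, c:])"
  proof (induction f)
    case (pCons b f) thus ?case
      by (simp add: pev_pCons[OF e] pcompose_pCons pev_add[OF e] pev_mult[OF e] pev_const[OF e] pev_0 rhom_0[OF e] algebra_simps pev_smult[OF e])
  qed (simp add: pev_0)
  moreover have "pcompose f [:0, c:] \<noteq> 0" using f(1) c by (simp add: pcompose_eq_0_iff)
  ultimately show ?thesis using f unfolding algebraic_mod_def by metis
qed

text \<open>Modulo \<open>Q\<close>, the monomials \<open>u ^ a * v ^ b\<close> with
  \<open>a < m\<close> and \<open>b < n\<close> span a module stable under multiplication by
  \<open>e (l * l') * (u + v)\<close>; the leading coefficients \<open>l\<close> and
  \<open>l'\<close> pay for rewriting \<open>u ^ m\<close> and \<open>v ^ n\<close>.\<close>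

lemma algebraic_mod_add:
  fixes e :: "'d::idom \<Rightarrow> 'b::comm_ring_1"
  assumes e: "rhom e" and Q: "ideal Q" and z: "lies_over_zero e Q"
    and u: "algebraic_mod e Q u" and v: "algebraic_mod e Q v"
  shows "algebraic_mod e Q (u + v)"
proof -
  obtain m l f where m: "m > 0" "l \<noteq> 0" and fm: "e l * u ^ m - (\<Sum>i<m. e (f i) * u ^ i) \<in> Q"
    using algebraic_mod_lead[OF e Q z u] by blast
  obtain n l' f' where n: "n > 0" "l' \<noteq> 0" and fn: "e l' * v ^ n - (\<Sum>i<n. e (f' i) * v ^ i) \<in> Q"
    using algebraic_mod_lead[OF e Q z v] by blast
  define J where "J = {..<m} \<times> {..<n}"
  define g where "g = (\<lambda>(a,b). u ^ a * v ^ b)"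
  define W where "W = {y. \<exists>N. y - (\<Sum>k\<in>J. e (N k) * g k) \<in> Q}"
  have fJ: "finite J" by (simp add: J_def)
  have Wadd: "x + y \<in> W" if x: "x \<in> W" and y: "y \<in> W" for x y
  proof -
    obtain N N' where NN: "x - (\<Sum>k\<in>J. e (N k) * g k) \<in> Q" "y - (\<Sum>k\<in>J. e (N' k) * g k) \<in> Q"
      using x y unfolding W_def by blast
    have "x + y - (\<Sum>k\<in>J. e (N k + N' k) * g k)
        = (x - (\<Sum>k\<in>J. e (N k) * g k)) + (y - (\<Sum>k\<in>J. e (N' k) * g k))"
      by (simp add: rhom_add[OF e] distrib_right sum.distrib)
    also have "\<dots> \<in> Q" by (rule ideal_add[OF Q NN])
    finally show ?thesis unfolding W_def by (intro CollectI exI[of _ "\<lambda>k. N k + N' k"])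
  qed
  have Wmul: "e c * x \<in> W" if x: "x \<in> W" for c x
  proof -
    obtain N where NN: "x - (\<Sum>k\<in>J. e (N k) * g k) \<in> Q"
      using x unfolding W_def by blast
    have "e c * x - (\<Sum>k\<in>J. e (c * N k) * g k) = e c * (x - (\<Sum>k\<in>J. e (N k) * g k))"
      by (simp add: rhom_mult[OF e] right_diff_distrib sum_distrib_left mult.assoc)
    also have "\<dots> \<in> Q" by (rule ideal_mult[OF Q NN])
    finally show ?thesis unfolding W_def by (intro CollectI exI[of _ "\<lambda>k. c * N k"])
  qed
  have WQ: "x \<in> W" if yW: "y \<in> W" and xy: "x - y \<in> Q" for x y
  proof -
    obtain N where NN: "y - (\<Sum>k\<in>J. e (N k) * g k) \<in> Q" using yW unfolding W_def by blast
    have "x - (\<Sum>k\<in>J. e (N k) * g k) = (x - y) + (y - (\<Sum>k\<in>J. e (N k) * g k))" by simp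
    also have "\<dots> \<in> Q" by (rule ideal_add[OF Q xy NN])
    finally show ?thesis unfolding W_def by (intro CollectI exI[of _ N])
  qed
  have W0: "0 \<in> W" unfolding W_def using ideal_0[OF Q]
    by (intro CollectI exI[of _ "\<lambda>_. 0"]) (simp add: rhom_0[OF e])
  have Wsum: "sum h S \<in> W" if "\<And>i. i \<in> S \<Longrightarrow> h i \<in> W" for h :: "nat \<Rightarrow> 'b" and S
    using that by (induction S rule: infinite_finite_induct) (auto simp: W0 Wadd)
  have Wb: "u ^ a * v ^ b \<in> W" if "a < m" "b < n" for a b
  proof -
    have "(\<Sum>k\<in>J. e (if k = (a,b) then 1 else 0) * g k) = (\<Sum>k\<in>J. if k = (a,b) then g k else 0)"
      by (rule sum.cong) (auto simp: rhom_simps[OF e])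
    also have "\<dots> = u ^ a * v ^ b" using fJ that by (simp add: J_def g_def)
    finally show ?thesis using ideal_0[OF Q]
      unfolding W_def by (intro CollectI exI[of _ "\<lambda>k. if k = (a,b) then 1 else 0"]) simp
  qed
  have Wu: "e l * (u * (u ^ a * v ^ b)) \<in> W" if ab: "a < m" "b < n" for a b
  proof (cases "Suc a < m")
    case True thus ?thesis using Wmul[OF Wb[OF True ab(2)], of l] by (simp add: mult.assoc)
  next
    case False
    hence am: "Suc a = m" using ab by simp
    have "(\<Sum>i<m. e (f i) * (u ^ i * v ^ b)) \<in> W" by (intro Wsum Wmul Wb) (use ab in auto)
    moreover have "e l * (u * (u ^ a * v ^ b)) - (\<Sum>i<m. e (f i) * (u ^ i * v ^ b))
        = v ^ b * (e l * u ^ m - (\<Sum>i<m. e (f i) * u ^ i))"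
      by (simp add: am[symmetric] algebra_simps sum_distrib_left)
    hence "e l * (u * (u ^ a * v ^ b)) - (\<Sum>i<m. e (f i) * (u ^ i * v ^ b)) \<in> Q"
      using ideal_mult[OF Q fm] by simp
    ultimately show ?thesis by (rule WQ)
  qed
  have Wv: "e l' * (v * (u ^ a * v ^ b)) \<in> W" if ab: "a < m" "b < n" for a b
  proof (cases "Suc b < n")
    case True thus ?thesis using Wmul[OF Wb[OF ab(1) True], of l']
      by (simp add: mult.assoc mult.left_commute)
  next
    case False
    hence bn: "Suc b = n" using ab by simp
    have "(\<Sum>i<n. e (f' i) * (u ^ a * v ^ i)) \<in> W" by (intro Wsum Wmul Wb) (use ab in auto)
    moreover have "e l' * (v * (u ^ a * v ^ b)) - (\<Sum>i<n. e (f' i) * (u ^ a * v ^ i))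
        = u ^ a * (e l' * v ^ n - (\<Sum>i<n. e (f' i) * v ^ i))"
      by (simp add: bn[symmetric] algebra_simps sum_distrib_left)
    hence "e l' * (v * (u ^ a * v ^ b)) - (\<Sum>i<n. e (f' i) * (u ^ a * v ^ i)) \<in> Q"
      using ideal_mult[OF Q fn] by simp
    ultimately show ?thesis by (rule WQ)
  qed
  have st: "e (l * l') * (u + v) * g j \<in> W" if jJ: "j \<in> J" for j
  proof -
    obtain a b where j: "j = (a,b)" "a < m" "b < n" using jJ by (auto simp: J_def)
    have "e (l * l') * (u + v) * g j
        = e l' * (e l * (u * (u ^ a * v ^ b))) + e l * (e l' * (v * (u ^ a * v ^ b)))"
      by (simp add: j g_def rhom_mult[OF e] algebra_simps)
    also have "\<dots> \<in> W" by (intro Wadd Wmul Wu Wv j)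
    finally show ?thesis .
  qed
  have "algebraic_mod e Q (e (l * l') * (u + v))"
  proof (rule algebraic_mod_of_finite_module[OF e Q fJ, of "(0,0)" g])
    show "(0,0) \<in> J" using m n by (simp add: J_def)
    show "g (0,0) = 1" by (simp add: g_def)
    show "\<exists>N. e (l * l') * (u + v) * g j - (\<Sum>k\<in>J. e (N k) * g k) \<in> Q" if "j \<in> J" for j
      using st[OF that] unfolding W_def by (rule CollectD)
  qed
  moreover have "l * l' \<noteq> 0" using m n by simp
  ultimately show ?thesis using algebraic_mod_scaled[OF e] by blast
qed

lemma algebraic_mod_base: "rhom e \<Longrightarrow> ideal Q \<Longrightarrow> algebraic_mod e Q (e c)"
  unfolding algebraic_mod_def
  by (intro exI[of _ "[:-c, 1:]"]) (simp add: pev_pCons pev_0 rhom_simps ideal_0)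

lemma algebraic_mod_scale:
  fixes e :: "'d::idom \<Rightarrow> 'b::comm_ring_1"
  assumes e: "rhom e" and Q: "ideal Q" and z: "lies_over_zero e Q" and a: "algebraic_mod e Q a"
  shows "algebraic_mod e Q (e c * a)"
proof (cases "c = 0")
  case True thus ?thesis using algebraic_mod_base[OF e Q, of 0] by (simp add: rhom_0[OF e])
next
  case False
  obtain m l f where m: "m > 0" "l \<noteq> 0" and fm: "e l * a ^ m - (\<Sum>i<m. e (f i) * a ^ i) \<in> Q"
    using algebraic_mod_lead[OF e Q z a] by blast
  define h where "h = monom l m - (\<Sum>i<m. monom (f i * c ^ (m - i)) i)"
  have "coeff h m = l" by (simp add: h_def coeff_sum)
  hence "h \<noteq> 0" using m by auto
  moreover have "pev e (e c * a) h = e (c ^ m) * (e l * a ^ m - (\<Sum>i<m. e (f i) * a ^ i))"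
  proof -
    have "pev e (e c * a) h = e l * (e c * a) ^ m - (\<Sum>i<m. e (f i * c ^ (m - i)) * (e c * a) ^ i)"
      by (simp add: h_def rhom_diff[OF pev_rhom[OF e]] pev_sum[OF e] pev_monom[OF e])
    also have "(\<Sum>i<m. e (f i * c ^ (m - i)) * (e c * a) ^ i) = (\<Sum>i<m. e (c ^ m) * (e (f i) * a ^ i))"
    proof (rule sum.cong)
      fix i assume "i \<in> {..<m}"
      hence "c ^ m = c ^ (m - i) * c ^ i" by (simp add: power_add[symmetric])
      thus "e (f i * c ^ (m - i)) * (e c * a) ^ i = e (c ^ m) * (e (f i) * a ^ i)"
        by (simp add: rhom_mult[OF e] rhom_power[OF e] power_mult_distrib)
    qed simp
    finally show ?thesis by (simp add: right_diff_distrib sum_distrib_left rhom_power[OF e] power_mult_distrib)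
  qed
  ultimately show ?thesis using ideal_mult[OF Q fm] unfolding algebraic_mod_def by metis
qed

subsection \<open>Rational functions modulo a prime\<close>

text \<open>For a prime \<open>Q\<close>: the elements whose class in the fraction field of the
  quotient by \<open>Q\<close> lies in the subfield generated by \<open>t\<close> and the image of
  \<open>e\<close>.\<close>

definition rational_mod :: "('d::comm_ring_1 \<Rightarrow> 'b::comm_ring_1) \<Rightarrow> 'b set \<Rightarrow> 'b \<Rightarrow> 'b set" where
  "rational_mod e Q t = {a. \<exists>f g. pev e t g \<notin> Q \<and> pev e t g * a - pev e t f \<in> Q}"

lemma rational_modI: "pev e t g \<notin> Q \<Longrightarrow> pev e t g * a - pev e t f \<in> Q \<Longrightarrow> a \<in> rational_mod e Q t"
  by (auto simp: rational_mod_def)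

lemma rational_mod_pev:
  assumes "rhom e" "prime_ideal Q" shows "pev e t f \<in> rational_mod e Q t"
  by (rule rational_modI[where g = 1 and f = f])
     (auto simp: rhom_simps[OF pev_rhom[OF assms(1)]] prime_ideal_1[OF assms(2)] ideal_0[OF prime_idealD[OF assms(2)]])

lemma rational_mod_base:
  assumes "rhom e" "prime_ideal Q" shows "e c \<in> rational_mod e Q t"
  using rational_mod_pev[OF assms, of t "[:c:]"] by (simp add: pev_const assms)

lemma rational_mod_self:
  assumes "rhom e" "prime_ideal Q" shows "t \<in> rational_mod e Q t"
  using rational_mod_pev[OF assms, of t "[:0,1:]"] by (simp add: pev_X assms)

lemma rational_mod_add:
  assumes e: "rhom e" and Q: "prime_ideal Q" and a: "a \<in> rational_mod e Q t"
    and b: "b \<in> rational_mod e Q t"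
  shows "a + b \<in> rational_mod e Q t"
proof -
  note h = rhom_simps[OF pev_rhom[OF e]]
  have I: "ideal Q" by (rule prime_idealD[OF Q])
  obtain f g where 1: "pev e t g \<notin> Q" "pev e t g * a - pev e t f \<in> Q"
    using a by (auto simp: rational_mod_def)
  obtain f' g' where 2: "pev e t g' \<notin> Q" "pev e t g' * b - pev e t f' \<in> Q"
    using b by (auto simp: rational_mod_def)
  have "pev e t (g * g') * (a + b) - pev e t (f * g' + f' * g)
      = pev e t g' * (pev e t g * a - pev e t f) + pev e t g * (pev e t g' * b - pev e t f')"
    by (simp add: h algebra_simps)
  also have "\<dots> \<in> Q" by (intro ideal_add ideal_mult I 1 2)
  finally have "pev e t (g * g') * (a + b) - pev e t (f * g' + f' * g) \<in> Q" .
  moreover have "pev e t (g * g') \<notin> Q" using 1 2 by (simp add: h prime_ideal_mult[OF Q])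
  ultimately show ?thesis by (intro rational_modI[of _ _ "g * g'"]) auto
qed

lemma rational_mod_mult:
  assumes e: "rhom e" and Q: "prime_ideal Q" and a: "a \<in> rational_mod e Q t"
    and b: "b \<in> rational_mod e Q t"
  shows "a * b \<in> rational_mod e Q t"
proof -
  note h = rhom_simps[OF pev_rhom[OF e]]
  have I: "ideal Q" by (rule prime_idealD[OF Q])
  obtain f g where 1: "pev e t g \<notin> Q" "pev e t g * a - pev e t f \<in> Q"
    using a by (auto simp: rational_mod_def)
  obtain f' g' where 2: "pev e t g' \<notin> Q" "pev e t g' * b - pev e t f' \<in> Q"
    using b by (auto simp: rational_mod_def)
  have "pev e t (g * g') * (a * b) - pev e t (f * f')
      = (pev e t g' * b) * (pev e t g * a - pev e t f) + pev e t f * (pev e t g' * b - pev e t f')"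
    by (simp add: h algebra_simps)
  also have "\<dots> \<in> Q" by (intro ideal_add ideal_mult I 1 2)
  finally have "pev e t (g * g') * (a * b) - pev e t (f * f') \<in> Q" .
  moreover have "pev e t (g * g') \<notin> Q" using 1 2 by (simp add: h prime_ideal_mult[OF Q])
  ultimately show ?thesis by (intro rational_modI[of _ _ "g * g'"]) auto
qed

lemma rational_mod_trans:
  assumes e: "rhom e" and Q: "prime_ideal Q" and t: "t \<in> rational_mod e Q t'"
  shows "rational_mod e Q t \<subseteq> rational_mod e Q t'"
proof
  fix a assume "a \<in> rational_mod e Q t"
  then obtain f g where 1: "pev e t g \<notin> Q" "pev e t g * a - pev e t f \<in> Q"
    by (auto simp: rational_mod_def)
  note h = rhom_simps[OF pev_rhom[OF e]]
  have I: "ideal Q" by (rule prime_idealD[OF Q])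
  have P: "pev e t p \<in> rational_mod e Q t'" for p
    by (induction p) (auto simp: pev_0 pev_pCons[OF e] rhom_0[OF e, symmetric] simp del: rhom_0 intro!: rational_mod_add rational_mod_mult rational_mod_base e Q t
        rational_mod_base[OF e Q, of 0, unfolded rhom_0[OF e]])
  obtain f1 g1 where 2: "pev e t' g1 \<notin> Q" "pev e t' g1 * pev e t g - pev e t' f1 \<in> Q"
    using P[of g] by (auto simp: rational_mod_def)
  obtain f2 g2 where 3: "pev e t' g2 \<notin> Q" "pev e t' g2 * pev e t f - pev e t' f2 \<in> Q"
    using P[of f] by (auto simp: rational_mod_def)
  have nz: "pev e t' f1 \<notin> Q"
    using 1(1) 2 ideal_cong_add[OF I 2(2)] prime_ideal_mult[OF Q] by blast
  have "pev e t' (f1 * g2) * a - pev e t' (f2 * g1)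
     = - (pev e t' g2 * a) * (pev e t' g1 * pev e t g - pev e t' f1)
       + pev e t' g1 * (pev e t' g2 * pev e t f - pev e t' f2)
       + pev e t' g1 * pev e t' g2 * (pev e t g * a - pev e t f)"
    by (simp add: h algebra_simps)
  also have "\<dots> \<in> Q" by (intro ideal_add ideal_mult I 1 2 3)
  finally have "pev e t' (f1 * g2) * a - pev e t' (f2 * g1) \<in> Q" .
  moreover have "pev e t' (f1 * g2) \<notin> Q" using nz 3 by (simp add: h prime_ideal_mult[OF Q])
  ultimately show "a \<in> rational_mod e Q t'" by (intro rational_modI[of _ _ "f1 * g2"])
qed

text \<open>The chain rule for \<open>q(u + \<tau>v)\<close> in the indeterminate \<tau>. The
  coefficients of \<open>q\<close> are themselves polynomials in \<tau>, which produces the first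
  summand.\<close>

lemma pderiv_pev:
  assumes e: "rhom (e :: 'd::idom \<Rightarrow> 'a::idom)"
  shows "pderiv (pev (map_poly e) [:u, v:] q)
     = pev (map_poly e) [:u, v:] (map_poly pderiv q) + [:v:] * pev (map_poly e) [:u, v:] (pderiv q)"
proof -
  have E: "rhom (map_poly e)" by (rule map_poly_rhom[OF e])
  have Ed: "pderiv (map_poly e p) = map_poly e (pderiv p)" for p
    by (rule poly_eqI) (simp add: coeff_pderiv coeff_map_poly rhom_0[OF e] rhom_mult[OF e] rhom_add[OF e] rhom_1[OF e] rhom_of_nat[OF e])
  show ?thesis
  proof (induction q)
    case (pCons a q)
    let ?y = "[:u, v:]"
    have y: "pderiv ?y = [:v:]" by (simp add: pderiv_pCons)
    let ?R = "pev (map_poly e) ?y"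
    have 1: "pderiv (?R (pCons a q)) = map_poly e (pderiv a) + ?y * pderiv (?R q) + [:v:] * ?R q"
      by (simp only: pev_pCons[OF E] pderiv_add pderiv_mult y Ed) (simp add: algebra_simps)
    have 2: "?R (map_poly pderiv (pCons a q)) = map_poly e (pderiv a) + ?y * ?R (map_poly pderiv q)"
      by (simp add: map_poly_pCons pev_pCons[OF E])
    have 3: "?R (pderiv (pCons a q)) = ?R q + ?y * ?R (pderiv q)"
      by (simp only: pderiv_pCons pev_add[OF E] pev_pCons[OF E] rhom_0[OF E] add_0)
    show ?case unfolding 1 2 3 pCons.IH by (simp only: algebra_simps)
  qed (simp add: pev_0)
qed

text \<open>If \<open>q\<close> has least degree with \<open>q(u + \<tau>v) = 0\<close> for an indeterminate \<open>\<tau>\<close>, then differentiating in \<open>\<tau>\<close>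
  gives \<open>q\<^sub>\<tau> + v q' = 0\<close>, which expresses \<open>v\<close> rationally in \<open>u + \<tau>v\<close>; almost every value of \<open>\<tau>\<close> can be substituted.\<close>
lemma primitive_element_mod:
  fixes e :: "'d::{idom,ring_char_0} \<Rightarrow> 'a::idom" and \<iota> :: "complex \<Rightarrow> 'a" and cs :: "complex \<Rightarrow> 'd"
  assumes e: "rhom e" and i: "rhom \<iota>" and cs: "\<And>c. e (cs c) = \<iota> c" and Q: "prime_ideal Q"
    and z: "lies_over_zero e Q" and u: "algebraic_mod e Q u" and v: "algebraic_mod e Q v"
  shows "finite {c. \<not> (u \<in> rational_mod e Q (u + \<iota> c * v) \<and> v \<in> rational_mod e Q (u + \<iota> c * v))}"
proof -
  have I: "ideal Q" by (rule prime_idealD[OF Q])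
  define E :: "'d poly \<Rightarrow> 'a poly" where "E = map_poly e"
  define Q' where "Q' = {q :: 'a poly. \<forall>n. coeff q n \<in> Q}"
  define y where "y = [:u, v:]"
  have E: "rhom E" unfolding E_def by (rule map_poly_rhom[OF e])
  have cE: "coeff (E p) n = e (coeff p n)" for p n
    by (simp add: E_def coeff_map_poly rhom_0[OF e])
  have Ec: "E [:d:] = [:e d:]" for d by (simp add: E_def map_poly_pCons rhom_0[OF e])
  have I': "ideal Q'" unfolding ideal_def Q'_def
    by (auto simp: ideal_0[OF I] ideal_add[OF I] coeff_mult intro!: ideal_sum[OF I] ideal_mult[OF I])
  have z': "lies_over_zero E Q'"
    unfolding lies_over_zero_def Q'_def using z by (auto simp: cE lies_over_zero_def intro: poly_eqI)
  have au: "algebraic_mod E Q' [:u:]"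
  proof -
    obtain f where f: "f \<noteq> 0" "pev e u f \<in> Q" using u by (auto simp: algebraic_mod_def)
    have "pev E [:u:] (map_poly (\<lambda>d. [:d:]) f) = [:pev e u f:]"
    proof (induction f)
      case (pCons a f) thus ?case
        by (simp add: pev_pCons[OF E] pev_pCons[OF e] map_poly_pCons Ec)
    qed (simp add: pev_0)
    moreover have "[:pev e u f:] \<in> Q'"
      using f(2) ideal_0[OF I] by (auto simp: Q'_def coeff_pCons split: nat.split)
    moreover have "map_poly (\<lambda>d. [:d:]) f \<noteq> 0" using f(1)
      by (simp add: map_poly_eq_0_iff)
    ultimately show ?thesis unfolding algebraic_mod_def by metis
  qed
  have av: "algebraic_mod E Q' [:v:]"
  proof -
    obtain f where f: "f \<noteq> 0" "pev e v f \<in> Q" using v by (auto simp: algebraic_mod_def)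
    have "pev E [:v:] (map_poly (\<lambda>d. [:d:]) f) = [:pev e v f:]"
    proof (induction f)
      case (pCons a f) thus ?case
        by (simp add: pev_pCons[OF E] pev_pCons[OF e] map_poly_pCons Ec)
    qed (simp add: pev_0)
    moreover have "[:pev e v f:] \<in> Q'"
      using f(2) ideal_0[OF I] by (auto simp: Q'_def coeff_pCons split: nat.split)
    moreover have "map_poly (\<lambda>d. [:d:]) f \<noteq> 0" using f(1)
      by (simp add: map_poly_eq_0_iff)
    ultimately show ?thesis unfolding algebraic_mod_def by metis
  qed
  have E1: "E [:0,1:] = [:0,1:]" by (simp add: E_def map_poly_pCons rhom_simps[OF e])
  have "algebraic_mod E Q' ([:u:] + E [:0,1:] * [:v:])"
    by (intro algebraic_mod_add algebraic_mod_scale E I' z' au av)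
  hence "algebraic_mod E Q' y" by (simp add: E1 y_def)
  then obtain q0 where q0: "q0 \<noteq> 0" "pev E y q0 \<in> Q'" by (auto simp: algebraic_mod_def)
  define q where "q = arg_min degree (\<lambda>q. q \<noteq> 0 \<and> pev E y q \<in> Q')"
  have q: "q \<noteq> 0" "pev E y q \<in> Q'" and qmin: "\<And>q'. q' \<noteq> 0 \<Longrightarrow> pev E y q' \<in> Q' \<Longrightarrow> degree q \<le> degree q'"
    using arg_min_nat_lemma[where P = "\<lambda>q. q \<noteq> 0 \<and> pev E y q \<in> Q'" and m = degree and k = q0] q0
      by (auto simp: q_def)
  have dq: "degree q > 0"
  proof (rule ccontr)
    assume "\<not> degree q > 0"
    then obtain c where "q = [:c:]" by (metis degree_eq_zeroE gr0I)
    thus False using q z' by (auto simp: pev_const[OF E] lies_over_zero_def)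
  qed
  define G where "G = pev E y (pderiv q)"
  have G: "G \<notin> Q'"
  proof
    assume "G \<in> Q'"
    moreover have "pderiv q \<noteq> 0" using dq by (simp add: pderiv_eq_0_iff)
    ultimately show False using qmin[of "pderiv q"] dq by (simp add: G_def degree_pderiv)
  qed
  have rel: "pev E y (map_poly pderiv q) + [:v:] * G \<in> Q'"
  proof -
    have "pderiv (pev E y q) \<in> Q'" using q(2) by (auto simp: Q'_def coeff_pderiv intro: ideal_mult[OF I])
    thus ?thesis using pderiv_pev[OF e, of u v q] by (simp add: E_def y_def G_def)
  qed
  have fin: "finite {c. poly G (\<iota> c) \<in> Q}"
    using vandermonde_ideal[OF i I, of G] G by (auto simp: Q'_def)
  have ev: "poly (pev E y r) (\<iota> c) = pev e (u + \<iota> c * v) (map_poly (\<lambda>a. poly a (cs c)) r)" for r c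
  proof (induction r)
    case (pCons a r)
    have "poly (E a) (\<iota> c) = e (poly a (cs c))"
      using pev_comp[OF rhom_id e, of "cs c" a] by (simp add: pev_id cs pev_def E_def)
    moreover have "poly (pev E y (pCons a r)) (\<iota> c) = poly (E a) (\<iota> c) + (u + \<iota> c * v) * poly (pev E y r) (\<iota> c)"
      by (simp only: pev_pCons[OF E] y_def poly_add poly_mult poly_pCons poly_0) (simp only: mult_zero_right add_0_right)
    ultimately show ?case by (simp only: pCons.IH map_poly_pCons[where f = "\<lambda>a. poly a (cs c)", OF poly_0] pev_pCons[OF e])
  qed (simp add: pev_0)
  have evQ: "poly r (\<iota> c) \<in> Q" if "r \<in> Q'" for r c
    unfolding poly_altdef using that by (intro ideal_sum[OF I] ideal_mult'[OF I]) (auto simp: Q'_def)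
  have "u \<in> rational_mod e Q (u + \<iota> c * v) \<and> v \<in> rational_mod e Q (u + \<iota> c * v)"
    if c: "poly G (\<iota> c) \<notin> Q" for c
  proof -
    define t where "t = u + \<iota> c * v"
    define g where "g = map_poly (\<lambda>a. poly a (cs c)) (pderiv q)"
    define f where "f = map_poly (\<lambda>a. poly a (cs c)) (map_poly pderiv q)"
    note h = rhom_simps[OF pev_rhom[OF e]]
    have g: "pev e t g \<notin> Q" using c by (simp add: G_def ev t_def g_def)
    have "pev e t f + v * pev e t g \<in> Q"
      using evQ[OF rel, of c] by (simp add: ev G_def f_def g_def t_def)
    hence v: "pev e t g * v - pev e t (- f) \<in> Q" by (simp add: h algebra_simps)
    hence vr: "v \<in> rational_mod e Q t" using g by (intro rational_modI)
    have "u = t + e (- cs c) * v" by (simp add: t_def rhom_uminus[OF e] cs)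
    moreover have "t + e (- cs c) * v \<in> rational_mod e Q t"
      by (intro rational_mod_add rational_mod_mult rational_mod_self rational_mod_base vr e Q)
    ultimately show ?thesis using vr unfolding t_def by argo
  qed
  thus ?thesis by (intro finite_subset[OF _ fin]) auto
qed

lemma subset_adjoin: "Q \<subseteq> {q + r * a | q r. q \<in> Q}" for a :: "'a::comm_ring_1"
proof
  fix q assume "q \<in> Q"
  moreover have "q = q + 0 * a" by simp
  ultimately show "q \<in> {q + r * a | q r. q \<in> Q}" by blast
qed

subsection \<open>Countable dimension and the Nullstellensatz\<close>

definition cspan :: "(complex \<Rightarrow> 'a::comm_ring_1) \<Rightarrow> 'a set \<Rightarrow> 'a set" where
  "cspan \<iota> B = {a. \<exists>c. a = (\<Sum>b\<in>B. \<iota> (c b) * b)}"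

lemma cspan_0: "rhom \<iota> \<Longrightarrow> 0 \<in> cspan \<iota> B"
  unfolding cspan_def by (intro CollectI exI[of _ "\<lambda>_. 0"]) (simp add: rhom_0)

lemma cspan_add: assumes "rhom \<iota>" "x \<in> cspan \<iota> B" "y \<in> cspan \<iota> B" shows "x + y \<in> cspan \<iota> B"
proof -
  obtain c d where "x = (\<Sum>b\<in>B. \<iota> (c b) * b)" "y = (\<Sum>b\<in>B. \<iota> (d b) * b)"
    using assms by (auto simp: cspan_def)
  hence "x + y = (\<Sum>b\<in>B. \<iota> (c b + d b) * b)"
    by (simp add: rhom_add[OF assms(1)] distrib_right sum.distrib)
  thus ?thesis unfolding cspan_def by (intro CollectI exI[of _ "\<lambda>b. c b + d b"])
qed

lemma cspan_scale: assumes "rhom \<iota>" "x \<in> cspan \<iota> B" shows "\<iota> k * x \<in> cspan \<iota> B"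
proof -
  obtain c where "x = (\<Sum>b\<in>B. \<iota> (c b) * b)" using assms by (auto simp: cspan_def)
  hence "\<iota> k * x = (\<Sum>b\<in>B. \<iota> (k * c b) * b)"
    by (simp add: rhom_mult[OF assms(1)] sum_distrib_left mult.assoc)
  thus ?thesis unfolding cspan_def by (intro CollectI exI[of _ "\<lambda>b. k * c b"])
qed

lemma cspan_base: assumes "rhom \<iota>" "finite B" "x \<in> B" shows "x \<in> cspan \<iota> B"
proof -
  have "(\<Sum>b\<in>B. \<iota> (if b = x then 1 else 0) * b) = (\<Sum>b\<in>B. if b = x then b else 0)"
    by (rule sum.cong) (auto simp: rhom_0[OF assms(1)] rhom_1[OF assms(1)])
  also have "\<dots> = x" using assms by simp
  finally show ?thesis unfolding cspan_def
    by (intro CollectI exI[of _ "\<lambda>b. if b = x then 1 else 0"]) simp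
qed

lemma cspan_sum: "rhom \<iota> \<Longrightarrow> (\<And>i. i \<in> S \<Longrightarrow> f i \<in> cspan \<iota> B) \<Longrightarrow> sum f S \<in> cspan \<iota> B"
  by (induction S rule: infinite_finite_induct) (auto simp: cspan_0 cspan_add)

lemma cspan_mono: assumes "rhom \<iota>" "finite B" "A \<subseteq> B" shows "cspan \<iota> A \<subseteq> cspan \<iota> B"
proof
  fix a assume "a \<in> cspan \<iota> A"
  then obtain c where c: "a = (\<Sum>b\<in>A. \<iota> (c b) * b)" by (auto simp: cspan_def)
  show "a \<in> cspan \<iota> B" unfolding c using assms
    by (intro cspan_sum cspan_scale cspan_base) auto
qed

lemma countable_exhaustion:
  fixes \<iota> :: "complex \<Rightarrow> 'a::comm_ring_1"
  assumes i: "rhom \<iota>" and fg: "finitely_generated \<iota>"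
  shows "\<exists>B :: nat \<Rightarrow> 'a set. (\<forall>n. finite (B n)) \<and> (\<forall>a. \<exists>n. a \<in> cspan \<iota> (B n))"
proof -
  obtain S where S: "finite S" "gen_subalg \<iota> S = UNIV" using fg by (auto simp: finitely_generated_def)
  define B where "B = (\<lambda>n. prod_list ` {xs. set xs \<subseteq> S \<and> length xs \<le> n})"
  have fin: "finite (B n)" for n unfolding B_def by (intro finite_imageI finite_lists_length_le S)
  have mono: "B n \<subseteq> B m" if "n \<le> m" for n m unfolding B_def using that by auto
  have mulB: "x * y \<in> B (n + m)" if xB: "x \<in> B n" and yB: "y \<in> B m" for x y n m
  proof -
    obtain xs ys where h: "x = prod_list xs" "y = prod_list ys" "set xs \<subseteq> S" "set ys \<subseteq> S" "length xs \<le> n" "length ys \<le> m"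
      using xB yB unfolding B_def by blast
    show ?thesis unfolding B_def using h by (intro image_eqI[of _ _ "xs @ ys"]) auto
  qed
  have "\<exists>n. a \<in> cspan \<iota> (B n)" if "a \<in> gen_subalg \<iota> S" for a
    using that
  proof (induction rule: gen_subalg.induct)
    case (scal c)
    have "1 \<in> B 0" unfolding B_def by (intro image_eqI[of _ _ "[]"]) auto
    hence "\<iota> c * 1 \<in> cspan \<iota> (B 0)" by (intro cspan_scale cspan_base i fin)
    thus ?case by auto
  next
    case (gen x)
    have "x \<in> B 1" unfolding B_def using gen by (intro image_eqI[of _ _ "[x]"]) auto
    thus ?case using cspan_base[OF i fin] by blast
  next
    case (add x y)
    then obtain n m where "x \<in> cspan \<iota> (B n)" "y \<in> cspan \<iota> (B m)" by auto
    hence "x \<in> cspan \<iota> (B (n + m))" "y \<in> cspan \<iota> (B (n + m))"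
      using cspan_mono[OF i fin mono[of n "n + m"]] cspan_mono[OF i fin mono[of m "n + m"]] by auto
    thus ?case using cspan_add[OF i] by blast
  next
    case (mult x y)
    then obtain n m where "x \<in> cspan \<iota> (B n)" "y \<in> cspan \<iota> (B m)" by auto
    then obtain c d where c: "x = (\<Sum>b\<in>B n. \<iota> (c b) * b)" and d: "y = (\<Sum>b\<in>B m. \<iota> (d b) * b)"
      unfolding cspan_def by blast
    have "x * y = (\<Sum>b\<in>B n. \<Sum>b'\<in>B m. \<iota> (c b * d b') * (b * b'))"
      unfolding c d sum_product by (simp add: rhom_mult[OF i] mult_ac)
    also have "\<dots> \<in> cspan \<iota> (B (n + m))"
      by (intro cspan_sum i cspan_scale cspan_base fin mulB)
    finally show ?case by blast
  qed
  thus ?thesis using fin S by blast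
qed

text \<open>Pigeonhole: pairs of a level of the exhaustion and a label are countable in number, so
  uncountably many scalars share one pair, and their \<open>f c\<close> lie in one
  finite-dimensional space. The label makes an integer attached to \<open>c\<close>, such as an
  exponent, constant on the relation.\<close>

lemma uncountable_dependence:
  fixes \<iota> :: "complex \<Rightarrow> 'a::comm_ring_1" and f :: "complex \<Rightarrow> 'a" and lab :: "complex \<Rightarrow> nat"
  assumes i: "rhom \<iota>" and fg: "finitely_generated \<iota>"
  shows "\<exists>k I t. finite I \<and> (\<forall>c\<in>I. lab c = k) \<and> (\<exists>c\<in>I. t c \<noteq> 0) \<and> (\<Sum>c\<in>I. \<iota> (t c) * f c) = 0"
proof -
  obtain B :: "nat \<Rightarrow> 'a set" where B: "\<And>n. finite (B n)" "\<And>a. \<exists>n. a \<in> cspan \<iota> (B n)"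
    using countable_exhaustion[OF i fg] by blast
  define X where "X = (\<lambda>(n,k). {c. f c \<in> cspan \<iota> (B n) \<and> lab c = k})"
  have "(\<Union>p. X p) = UNIV" unfolding X_def using B(2) by fastforce
  hence "\<exists>p. uncountable (X p)"
    using uncountable_UNIV_complex countable_UN[of "UNIV :: (nat \<times> nat) set" X] by auto
  then obtain n k where "uncountable (X (n,k))" by auto
  hence inf: "infinite (X (n,k))" using countable_finite by blast
  obtain I where I: "I \<subseteq> X (n,k)" "finite I" "card I = Suc (card (B n))"
    using infinite_arbitrarily_large[OF inf] by blast
  have "\<forall>c\<in>I. \<exists>M. f c = (\<Sum>b\<in>B n. \<iota> (M b) * b)" using I(1) by (auto simp: X_def cspan_def)
  then obtain M where M: "\<And>c. c \<in> I \<Longrightarrow> f c = (\<Sum>b\<in>B n. \<iota> (M c b) * b)" by metis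
  obtain t where t: "\<exists>c\<in>I. t c \<noteq> 0" "\<forall>b\<in>B n. (\<Sum>c\<in>I. t c * M c b) = 0"
    using linear_dependence[OF B(1)[of n] I(2), of M] I(3) by auto
  have "(\<Sum>c\<in>I. \<iota> (t c) * f c) = (\<Sum>c\<in>I. \<Sum>b\<in>B n. \<iota> (t c * M c b) * b)"
    by (rule sum.cong) (auto simp: M sum_distrib_left rhom_mult[OF i] mult.assoc)
  also have "\<dots> = (\<Sum>b\<in>B n. \<iota> (\<Sum>c\<in>I. t c * M c b) * b)"
    by (subst sum.swap) (simp add: rhom_sum[OF i] sum_distrib_right)
  also have "\<dots> = 0" using t(2) by (simp add: rhom_0[OF i])
  finally show ?thesis using I t(1) by (intro exI[of _ k] exI[of _ I] exI[of _ t]) (auto simp: X_def)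
qed

text \<open>Modulo \<open>Q\<close>, \<open>f c\<close> plays the role of
  \<open>s c / (x - c)\<close>. A linear relation among these fractions, multiplied by the common
  denominator, becomes a polynomial relation for \<open>x\<close>.\<close>

lemma combine_inverses:
  fixes \<iota> :: "complex \<Rightarrow> 'a::comm_ring_1"
  assumes Q: "ideal Q" and fin: "finite I" and r: "\<And>c. c \<in> I \<Longrightarrow> (x - \<iota> c) * f c - s c \<in> Q"
    and dep: "(\<Sum>c\<in>I. \<iota> (t c) * f c) = 0"
  shows "(\<Sum>c\<in>I. \<iota> (t c) * s c * (\<Prod>c'\<in>I - {c}. x - \<iota> c')) \<in> Q"
proof -
  have "(\<Sum>c\<in>I. \<iota> (t c) * s c * (\<Prod>c'\<in>I - {c}. x - \<iota> c'))
     = (\<Prod>c'\<in>I. x - \<iota> c') * (\<Sum>c\<in>I. \<iota> (t c) * f c)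
      - (\<Sum>c\<in>I. \<iota> (t c) * (\<Prod>c'\<in>I - {c}. x - \<iota> c') * ((x - \<iota> c) * f c - s c))"
  proof -
    have "(\<Prod>c'\<in>I. x - \<iota> c') * (\<Sum>c\<in>I. \<iota> (t c) * f c)
        = (\<Sum>c\<in>I. \<iota> (t c) * (\<Prod>c'\<in>I - {c}. x - \<iota> c') * ((x - \<iota> c) * f c))"
      unfolding sum_distrib_left
    proof (rule sum.cong)
      fix c assume "c \<in> I"
      hence "(\<Prod>c'\<in>I. x - \<iota> c') = (x - \<iota> c) * (\<Prod>c'\<in>I - {c}. x - \<iota> c')"
        using fin by (rule prod.remove[rotated])
      thus "(\<Prod>c'\<in>I. x - \<iota> c') * (\<iota> (t c) * f c) = \<iota> (t c) * (\<Prod>c'\<in>I - {c}. x - \<iota> c') * ((x - \<iota> c) * f c)"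
        by (simp add: mult_ac)
    qed simp
    thus ?thesis by (simp add: right_diff_distrib sum_subtractf mult_ac)
  qed
  also have "\<dots> = - (\<Sum>c\<in>I. \<iota> (t c) * (\<Prod>c'\<in>I - {c}. x - \<iota> c') * ((x - \<iota> c) * f c - s c))"
    by (simp add: dep)
  also have "\<dots> \<in> Q" by (intro ideal_uminus ideal_sum ideal_mult Q r)
  finally show ?thesis .
qed

lemma lagrange_combination_nonzero:
  fixes a u :: "'i \<Rightarrow> 'd::idom"
  assumes I: "finite I" and a: "\<And>c c'. a c = a c' \<Longrightarrow> c = c'" and c0: "c0 \<in> I" "u c0 \<noteq> 0"
  shows "(\<Sum>c\<in>I. smult (u c) (\<Prod>c'\<in>I - {c}. [:- a c', 1:])) \<noteq> 0" (is "?p \<noteq> 0")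
proof
  assume p: "?p = 0"
  have "poly ?p (a c0) = (\<Sum>c\<in>I. u c * (\<Prod>c'\<in>I - {c}. a c0 - a c'))"
    by (simp add: poly_sum poly_prod)
  also have "\<dots> = (\<Sum>c\<in>I. if c = c0 then u c * (\<Prod>c'\<in>I - {c}. a c0 - a c') else 0)"
  proof (rule sum.cong)
    fix c assume "c \<in> I"
    show "u c * (\<Prod>c'\<in>I - {c}. a c0 - a c') = (if c = c0 then u c * (\<Prod>c'\<in>I - {c}. a c0 - a c') else 0)"
    proof (cases "c = c0")
      case False
      hence "(\<Prod>c'\<in>I - {c}. a c0 - a c') = 0" using c0 I by (intro prod_zero) auto
      thus ?thesis using False by simp
    qed simp
  qed simp
  also have "\<dots> = u c0 * (\<Prod>c'\<in>I - {c0}. a c0 - a c')" using I c0 by simp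
  also have "\<dots> \<noteq> 0" using c0 a I by (auto simp: prod_zero_iff)
  finally show False using p by simp
qed

text \<open>Amitsur's argument: if every ideal \<open>(Q, x - c)\<close> contained a nonzero base
  element \<open>d c\<close>, the fractions \<open>d c / (x - c)\<close> would exist modulo
  \<open>Q\<close> for uncountably many \<open>c\<close>, hence be dependent, and \<open>x\<close>
  would be algebraic. So some \<open>x - c\<close> can be adjoined to \<open>Q\<close> without
  reaching the base.\<close>

lemma prime_above_transcendental:
  fixes \<iota> :: "complex \<Rightarrow> 'a::comm_ring_1" and e :: "'d::idom \<Rightarrow> 'a"
  assumes i: "rhom \<iota>" and fg: "finitely_generated \<iota>" and e: "rhom e"
    and cs: "rhom cs" "\<And>c. e (cs c) = \<iota> c"
    and Q: "prime_ideal Q" and x: "\<not> algebraic_mod e Q x"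
  shows "\<exists>Q'. prime_ideal Q' \<and> Q \<subset> Q' \<and> lies_over_zero e Q'"
proof -
  have I: "ideal Q" by (rule prime_idealD[OF Q])
  define S where "S = e ` {d. d \<noteq> 0}"
  define J where "J = (\<lambda>c. {q + r * (x - \<iota> c) | q r. q \<in> Q})"
  have Sm: "a * b \<in> S" if "a \<in> S" "b \<in> S" for a b
    using that by (auto simp: S_def rhom_mult[OF e, symmetric])
  have S1: "1 \<in> S" by (auto simp: S_def rhom_1[OF e, symmetric])
  have "\<exists>c. J c \<inter> S = {}"
  proof (rule ccontr)
    assume "\<not> (\<exists>c. J c \<inter> S = {})"
    hence "\<forall>c. \<exists>q r d. q \<in> Q \<and> d \<noteq> 0 \<and> q + r * (x - \<iota> c) = e d" unfolding J_def S_def by blast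
    then obtain q r d where h: "\<And>c. q c \<in> Q" "\<And>c. d c \<noteq> 0" "\<And>c. q c + r c * (x - \<iota> c) = e (d c)" by metis
    obtain I t where It: "finite I" "\<exists>c\<in>I. t c \<noteq> 0" "(\<Sum>c\<in>I. \<iota> (t c) * r c) = 0"
      using uncountable_dependence[OF i fg, of "\<lambda>_. 0" r] by blast
    have rel: "(x - \<iota> c) * r c - e (d c) \<in> Q" for c
    proof -
      have "(x - \<iota> c) * r c - e (d c) = - q c" by (simp add: h(3)[symmetric] algebra_simps)
      thus ?thesis using ideal_uminus[OF I h(1)] by simp
    qed
    define p where "p = (\<Sum>c\<in>I. smult (cs (t c) * d c) (\<Prod>c'\<in>I - {c}. [:- cs c', 1:]))"
    have "pev e x p = (\<Sum>c\<in>I. \<iota> (t c) * e (d c) * (\<Prod>c'\<in>I - {c}. x - \<iota> c'))"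
      by (simp add: p_def pev_sum[OF e] pev_smult[OF e] rhom_prod[OF pev_rhom[OF e]] rhom_mult[OF e] cs
          pev_pCons[OF e] pev_0 rhom_uminus[OF e] rhom_1[OF e])
    also have "\<dots> \<in> Q" by (rule combine_inverses[OF I It(1) rel It(3)])
    finally have p0: "p = 0" using x by (auto simp: algebraic_mod_def)
    obtain c0 where c0: "c0 \<in> I" "t c0 \<noteq> 0" using It by auto
    have csi: "cs a = cs b \<Longrightarrow> a = b" for a b using rhom_field_inj[OF cs(1)] .
    have "p \<noteq> 0" unfolding p_def
      by (rule lagrange_combination_nonzero[OF It(1) csi c0(1)]) (use c0 h(2) csi[of _ 0] rhom_0[OF cs(1)] in auto)
    thus False using p0 by simp
  qed
  then obtain c where c: "J c \<inter> S = {}" by auto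
  have IJ: "ideal (J c)" unfolding J_def by (rule ideal_adjoin[OF I])
  obtain Q' where Q': "prime_ideal Q'" "J c \<subseteq> Q'" "Q' \<inter> S = {}"
    using exists_prime_avoiding[OF IJ S1 Sm c] by metis
  have "Q \<subseteq> J c" unfolding J_def by (rule subset_adjoin)
  moreover have "x - \<iota> c \<in> J c"
  proof -
    have "x - \<iota> c = 0 + 1 * (x - \<iota> c)" by simp
    thus ?thesis unfolding J_def using ideal_0[OF I] by blast
  qed
  moreover have "x - \<iota> c \<notin> Q"
  proof
    assume "x - \<iota> c \<in> Q"
    hence "pev e x [:- cs c, 1:] \<in> Q"
      by (simp add: pev_pCons[OF e] pev_0 rhom_uminus[OF e] cs rhom_1[OF e])
    moreover have "[:- cs c, 1:] \<noteq> 0" by simp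
    ultimately show False using x unfolding algebraic_mod_def by blast
  qed
  ultimately have "Q \<subset> Q'" using Q' by blast
  moreover have "lies_over_zero e Q'" using Q'(3) by (auto simp: lies_over_zero_def S_def)
  ultimately show ?thesis using Q' by blast
qed

text \<open>Over \<complex> the homogenised polynomial splits into linear factors
  \<open>a - r b\<close>, and the prime ideal must contain one of them.\<close>

lemma complex_root_mod_prime:
  fixes \<iota> :: "complex \<Rightarrow> 'a::comm_ring_1" and p :: "complex poly"
  assumes i: "rhom \<iota>" and P: "prime_ideal P" and p: "p \<noteq> 0"
    and v: "(\<Sum>k\<le>degree p. \<iota> (coeff p k) * a ^ k * b ^ (degree p - k)) \<in> P" and b: "b \<notin> P"
  shows "\<exists>c. a - \<iota> c * b \<in> P"
  using p v
proof (induction "degree p" arbitrary: p)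
  case 0
  then obtain c where c: "p = [:c:]" by (metis degree_eq_zeroE)
  hence "c \<noteq> 0" using 0 by auto
  have "\<iota> c \<in> P" using 0(3) c by simp
  hence "\<iota> (inverse c) * \<iota> c \<in> P" by (rule ideal_mult[OF prime_idealD[OF P]])
  hence False using \<open>c \<noteq> 0\<close> prime_ideal_1[OF P] by (simp add: rhom_mult[OF i, symmetric] rhom_1[OF i])
  thus ?case ..
next
  case (Suc n)
  obtain r where r: "poly p r = 0"
    using fundamental_theorem_of_algebra_alt[of p] Suc(2) by (metis degree_pCons_0 nat.distinct(1))
  define q where "q = synthetic_div p r"
  have pq: "p = [:-r, 1:] * q" using synthetic_div_correct'[of r p] r by (simp add: q_def)
  have dq: "degree q = n" using Suc(2) by (simp add: q_def degree_synthetic_div)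
  have cp: "coeff p k = (case k of 0 \<Rightarrow> 0 | Suc j \<Rightarrow> coeff q j) - r * coeff q k" for k
    by (subst pq) (auto simp: coeff_pCons split: nat.split)
  let ?s = "\<Sum>k\<le>n. \<iota> (coeff q k) * a ^ k * b ^ (n - k)"
  have "(\<Sum>k\<le>Suc n. \<iota> (coeff p k) * a ^ k * b ^ (Suc n - k)) =
     (\<Sum>k\<le>Suc n. \<iota> (case k of 0 \<Rightarrow> 0 | Suc j \<Rightarrow> coeff q j) * a ^ k * b ^ (Suc n - k))
     - (\<Sum>k\<le>Suc n. \<iota> (r * coeff q k) * a ^ k * b ^ (Suc n - k))"
    by (simp only: cp rhom_diff[OF i] left_diff_distrib sum_subtractf)
  also have "(\<Sum>k\<le>Suc n. \<iota> (case k of 0 \<Rightarrow> 0 | Suc j \<Rightarrow> coeff q j) * a ^ k * b ^ (Suc n - k)) = a * ?s"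
    by (subst sum.atMost_Suc_shift) (simp add: rhom_0[OF i] sum_distrib_left mult_ac)
  also have "(\<Sum>k\<le>Suc n. \<iota> (r * coeff q k) * a ^ k * b ^ (Suc n - k)) = \<iota> r * b * ?s"
  proof -
    have "coeff q (Suc n) = 0" using dq by (simp add: coeff_eq_0)
    hence "(\<Sum>k\<le>Suc n. \<iota> (r * coeff q k) * a ^ k * b ^ (Suc n - k)) = (\<Sum>k\<le>n. \<iota> (r * coeff q k) * a ^ k * b ^ (Suc n - k))"
      by (simp add: rhom_0[OF i])
    also have "\<dots> = (\<Sum>k\<le>n. \<iota> r * b * (\<iota> (coeff q k) * a ^ k * b ^ (n - k)))"
      by (rule sum.cong) (auto simp: rhom_mult[OF i] Suc_diff_le mult_ac)
    finally show ?thesis by (simp add: sum_distrib_left)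
  qed
  finally have "(a - \<iota> r * b) * ?s \<in> P" using Suc(2,4) by (simp add: left_diff_distrib)
  hence "a - \<iota> r * b \<in> P \<or> ?s \<in> P" using prime_ideal_mult[OF P] by blast
  thus ?case
  proof
    assume "?s \<in> P"
    moreover have "q \<noteq> 0" using Suc(3) pq by auto
    ultimately show ?thesis using Suc(1)[of q] dq by auto
  qed blast
qed

lemma algebraic_mod_complex:
  fixes \<iota> :: "complex \<Rightarrow> 'a::comm_ring_1"
  assumes i: "rhom \<iota>" and P: "prime_ideal P" and a: "algebraic_mod \<iota> P a"
  shows "\<exists>c. a - \<iota> c \<in> P"
proof -
  obtain p where p: "p \<noteq> 0" "pev \<iota> a p \<in> P" using a by (auto simp: algebraic_mod_def)
  have "(\<Sum>k\<le>degree p. \<iota> (coeff p k) * a ^ k * 1 ^ (degree p - k)) \<in> P"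
    using p(2) pev_altdef[OF i, of p "degree p" a] by simp
  from complex_root_mod_prime[OF i P p(1) this prime_ideal_1[OF P]] show ?thesis by simp
qed

text \<open>Take an ideal over \<open>P\<close> maximal among those avoiding the powers of
  \<open>f\<close>. If no \<open>x - c\<close> lay in it, each \<open>x - c\<close> would divide a
  power of \<open>f\<close> modulo it, and countability would make \<open>x\<close> algebraic over
  \<complex>. So its residue field is \<complex>, and it is a maximal ideal.\<close>

lemma jacobson_nullstellensatz:
  fixes \<iota> :: "complex \<Rightarrow> 'a::comm_ring_1"
  assumes i: "rhom \<iota>" and fg: "finitely_generated \<iota>" and P: "prime_ideal P" and f: "f \<notin> P"
  shows "\<exists>M. maximal_ideal M \<and> prime_ideal M \<and> P \<subseteq> M \<and> f \<notin> M \<and> (\<forall>x. \<exists>c. x - \<iota> c \<in> M)"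
proof -
  define S where "S = range (\<lambda>n. f ^ n)"
  have "P \<inter> S = {}" using prime_ideal_power[OF P] f by (auto simp: S_def)
  moreover have "1 \<in> S" unfolding S_def by (rule image_eqI[of _ _ 0]) auto
  moreover have "a * b \<in> S" if "a \<in> S" "b \<in> S" for a b
    using that by (auto simp: S_def power_add[symmetric])
  ultimately obtain M where M: "prime_ideal M" "P \<subseteq> M" "M \<inter> S = {}"
    "\<And>J. ideal J \<Longrightarrow> M \<subset> J \<Longrightarrow> J \<inter> S \<noteq> {}"
    using exists_prime_avoiding[OF prime_idealD[OF P]] by metis
  have fS: "f \<in> S" unfolding S_def by (rule image_eqI[of _ _ 1]) auto
  have IM: "ideal M" by (rule prime_idealD[OF M(1)])
  have res: "\<exists>c. x - \<iota> c \<in> M" for x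
  proof (rule ccontr)
    assume no: "\<nexists>c. x - \<iota> c \<in> M"
    have "\<exists>r n. (x - \<iota> c) * r - f ^ n \<in> M" for c
    proof -
      let ?J = "{q + r * (x - \<iota> c) | q r. q \<in> M}"
      have "M \<subseteq> ?J" by (rule subset_adjoin)
      moreover have "x - \<iota> c = 0 + 1 * (x - \<iota> c)" by simp
      hence "x - \<iota> c \<in> ?J" using ideal_0[OF IM] by blast
      ultimately have "M \<subset> ?J" using no by blast
      from M(4)[OF ideal_adjoin[OF IM] this] obtain s where s: "s \<in> ?J" "s \<in> S" by blast
      obtain q r where qr: "q \<in> M" "s = q + r * (x - \<iota> c)" using s(1) by blast
      obtain n where n: "s = f ^ n" using s(2) by (auto simp: S_def)
      have "(x - \<iota> c) * r - f ^ n = - q" unfolding n[symmetric] qr(2) by (simp add: algebra_simps)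
      thus ?thesis using ideal_uminus[OF IM qr(1)] by metis
    qed
    then obtain r n where rn: "\<And>c. (x - \<iota> c) * r c - f ^ n c \<in> M" by metis
    \<comment> \<open>The exponent \<open>n c\<close> is the label, so that it has one value
      \<open>k\<close> on the relation and \<open>f ^ k\<close> can be factored out.\<close>
    obtain k I t where It: "finite I" "\<forall>c\<in>I. n c = k" "\<exists>c\<in>I. t c \<noteq> 0" "(\<Sum>c\<in>I. \<iota> (t c) * r c) = 0"
      using uncountable_dependence[OF i fg, of n r] by blast
    define p where "p = (\<Sum>c\<in>I. smult (t c) (\<Prod>c'\<in>I - {c}. [:- c', 1:]))"
    have "(\<Sum>c\<in>I. \<iota> (t c) * f ^ n c * (\<Prod>c'\<in>I - {c}. x - \<iota> c')) \<in> M"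
      by (rule combine_inverses[OF IM It(1) rn It(4)])
    also have "(\<Sum>c\<in>I. \<iota> (t c) * f ^ n c * (\<Prod>c'\<in>I - {c}. x - \<iota> c')) = f ^ k * pev \<iota> x p"
      unfolding p_def pev_sum[OF i] sum_distrib_left
      by (rule sum.cong) (auto simp: It(2) pev_smult[OF i] rhom_prod[OF pev_rhom[OF i]]
          pev_pCons[OF i] pev_0 rhom_uminus[OF i] rhom_1[OF i] mult_ac)
    finally have "pev \<iota> x p \<in> M"
      using prime_ideal_mult[OF M(1)] prime_ideal_power[OF M(1)] M(3) fS by blast
    moreover have "p \<noteq> 0"
    proof -
      obtain c0 where "c0 \<in> I" "t c0 \<noteq> 0" using It by auto
      thus ?thesis unfolding p_def using lagrange_combination_nonzero[OF It(1), of "\<lambda>c. c"] by auto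
    qed
    ultimately have "algebraic_mod \<iota> M x" by (auto simp: algebraic_mod_def)
    thus False using algebraic_mod_complex[OF i M(1)] no by blast
  qed
  have "maximal_ideal M"
    unfolding maximal_ideal_def
  proof (intro conjI allI impI IM)
    show "M \<noteq> UNIV" using prime_ideal_1[OF M(1)] by auto
    fix J assume J: "ideal J \<and> M \<subseteq> J \<and> J \<noteq> UNIV"
    show "J = M"
    proof (rule ccontr)
      assume "J \<noteq> M"
      then obtain x where x: "x \<in> J" "x \<notin> M" using J by auto
      obtain c where c: "x - \<iota> c \<in> M" using res by blast
      have "c \<noteq> 0" using c x by (auto simp: rhom_0[OF i])
      have "\<iota> c \<in> J" using ideal_diff[of J x "x - \<iota> c"] c x J by auto
      hence "\<iota> (inverse c) * \<iota> c \<in> J" using J by (intro ideal_mult) auto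
      hence "1 \<in> J" using \<open>c \<noteq> 0\<close> by (simp add: rhom_mult[OF i, symmetric] rhom_1[OF i])
      thus False using J ideal_UNIV_iff by auto
    qed
  qed
  thus ?thesis using M fS res by blast
qed

lemma maximal_ideal_prime:
  fixes M :: "'a::comm_ring_1 set"
  assumes "maximal_ideal M" shows "prime_ideal M"
proof -
  have h: "ideal M" "M \<noteq> UNIV" "\<And>J. ideal J \<Longrightarrow> M \<subseteq> J \<Longrightarrow> J \<noteq> UNIV \<Longrightarrow> J = M"
    using assms by (auto simp: maximal_ideal_def)
  have "M \<inter> {1} = {}" using h ideal_UNIV_iff by auto
  then obtain Q where "prime_ideal Q" "M \<subseteq> Q"
    using exists_prime_avoiding[OF h(1), of "{1}"] by auto
  moreover have "Q = M" using h(3)[of Q] calculation prime_ideal_def by blast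
  ultimately show ?thesis by simp
qed

text \<open>Each independent element is traded for one step in a chain of primes. This is how a
  bound on chains of primes limits the number of independent elements.\<close>

lemma independent_chain2:
  fixes \<iota> :: "complex \<Rightarrow> 'a::comm_ring_1"
  assumes i: "rhom \<iota>" and fg: "finitely_generated \<iota>" and Q: "prime_ideal Q"
    and xy: "lies_over_zero (pev (pev \<iota> x) y) Q"
  shows "\<exists>Q1 Q2. prime_ideal Q1 \<and> prime_ideal Q2 \<and> Q \<subset> Q1 \<and> Q1 \<subset> Q2"
proof -
  obtain Q1 where Q1: "prime_ideal Q1" "Q \<subset> Q1" "lies_over_zero (pev \<iota> x) Q1"
    using prime_above_transcendental[OF i fg pev_rhom[OF i] rhom_pC pev_const[OF i] Q, of x y] xy
    by (auto simp: lies_over_zero_pev)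
  obtain Q2 where Q2: "prime_ideal Q2" "Q1 \<subset> Q2"
    using prime_above_transcendental[OF i fg i rhom_id _ Q1(1)] Q1(3)
    by (auto simp: lies_over_zero_pev)
  show ?thesis using Q1 Q2 by blast
qed

lemma independent_chain3:
  fixes \<iota> :: "complex \<Rightarrow> 'a::comm_ring_1"
  assumes i: "rhom \<iota>" and fg: "finitely_generated \<iota>" and Q: "prime_ideal Q"
    and xy: "lies_over_zero (pev (pev (pev \<iota> x) y) z) Q"
  shows "\<exists>Q1 Q2 Q3. prime_ideal Q1 \<and> prime_ideal Q2 \<and> prime_ideal Q3 \<and> Q \<subset> Q1 \<and> Q1 \<subset> Q2 \<and> Q2 \<subset> Q3"
proof -
  have cs: "rhom (\<lambda>c. [:[:c:]:])" by (intro rhom_const rhom_pC)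
  obtain Q1 where Q1: "prime_ideal Q1" "Q \<subset> Q1" "lies_over_zero (pev (pev \<iota> x) y) Q1"
    using prime_above_transcendental[OF i fg pev_rhom[OF pev_rhom[OF i]] cs _ Q, of x y z] xy
    by (auto simp: lies_over_zero_pev pev_const[OF i] pev_const[OF pev_rhom[OF i]])
  show ?thesis using Q1 independent_chain2[OF i fg Q1(1,3)] by blast
qed

lemma independent_chain4:
  fixes \<iota> :: "complex \<Rightarrow> 'a::comm_ring_1"
  assumes i: "rhom \<iota>" and fg: "finitely_generated \<iota>" and Q: "prime_ideal Q"
    and xy: "lies_over_zero (pev (pev (pev (pev \<iota> x) y) z) w) Q"
  shows "\<exists>Q1 Q2 Q3 Q4. prime_ideal Q1 \<and> prime_ideal Q2 \<and> prime_ideal Q3 \<and> prime_ideal Q4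
     \<and> Q \<subset> Q1 \<and> Q1 \<subset> Q2 \<and> Q2 \<subset> Q3 \<and> Q3 \<subset> Q4"
proof -
  have cs: "rhom (\<lambda>c. [:[:[:c:]:]:])" by (intro rhom_const rhom_pC)
  obtain Q1 where Q1: "prime_ideal Q1" "Q \<subset> Q1" "lies_over_zero (pev (pev (pev \<iota> x) y) z) Q1"
    using prime_above_transcendental[OF i fg pev_rhom[OF pev_rhom[OF pev_rhom[OF i]]] cs _ Q, of x y z w] xy
    by (auto simp: lies_over_zero_pev pev_const[OF i] pev_const[OF pev_rhom[OF i]] pev_const[OF pev_rhom[OF pev_rhom[OF i]]])
  show ?thesis using Q1 independent_chain3[OF i fg Q1(1,3)] by blast
qed

lemma krull_dim_le_3D:
  assumes "krull_dim_le TYPE('a::comm_ring_1) 3"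
    and "prime_ideal (Q0::'a set)" "prime_ideal Q1" "prime_ideal Q2" "prime_ideal Q3" "prime_ideal Q4"
    and "Q0 \<subset> Q1" "Q1 \<subset> Q2" "Q2 \<subset> Q3" "Q3 \<subset> Q4"
  shows False
proof -
  define C where "C = (\<lambda>n::nat. [Q0,Q1,Q2,Q3,Q4] ! n)"
  have "\<forall>i\<le>Suc 3. prime_ideal (C i)"
    using assms by (auto simp: C_def nth_Cons numeral_eq_Suc le_Suc_eq)
  moreover have "\<forall>i\<le>3. C i \<subset> C (Suc i)"
    using assms by (auto simp: C_def nth_Cons numeral_eq_Suc le_Suc_eq)
  ultimately show False using assms(1) unfolding krull_dim_le_def by blast
qed

section \<open>Poisson brackets and algebraic dependence\<close>

locale poisson =
  fixes \<iota> :: "complex \<Rightarrow> 'a::idom" and br :: "'a \<Rightarrow> 'a \<Rightarrow> 'a"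
  assumes pa: "poisson_algebra \<iota> br"
begin

lemma i: "rhom \<iota>"
  using pa by (auto simp: poisson_algebra_def intro: complex_algebra_map_rhom)

lemma br_add_l: "br (x + y) z = br x z + br y z"
  and br_add_r: "br x (y + z) = br x y + br x z"
  and br_scale_l: "br (\<iota> c * x) y = \<iota> c * br x y"
  and br_self: "br x x = 0"
  and br_mult_l: "br (x * y) z = x * br y z + y * br x z"
  using pa by (auto simp: poisson_algebra_def)

lemma br_anti: "br x y = - br y x"
proof -
  have "br (x + y) (x + y) = 0" by (rule br_self)
  hence "br x x + br y x + (br x y + br y y) = 0" by (simp only: br_add_l br_add_r)
  hence "br x y + br y x = 0" by (simp add: br_self add.commute)
  thus ?thesis by (simp add: add_eq_0_iff)
qed

lemma br_mult_r: "br x (y * z) = y * br x z + z * br x y"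
  using br_mult_l[of y z x] br_anti[of x]
    by (metis (no_types, lifting) br_anti minus_add_distrib mult_minus_right)

lemma br_1: "br 1 z = 0"
proof -
  have "br 1 z = br 1 z + br 1 z" using br_mult_l[of 1 1 z] by (simp only: mult_1_left)
  thus ?thesis by (metis add_cancel_right_right)
qed

lemma br_const: "br (\<iota> c) z = 0"
  using br_scale_l[of c 1 z] by (simp add: br_1)

lemma br_const_r: "br z (\<iota> c) = 0"
  using br_anti[of z "\<iota> c"] br_const by simp

lemma br_0: "br 0 z = 0" "br z 0 = 0"
  using br_const[of 0] br_const_r[of _ 0] by (auto simp: rhom_0[OF i])

lemma br_uminus: "br (- x) z = - br x z"
  using br_add_l[of x "-x" z] by (simp add: br_0 eq_neg_iff_add_eq_0 add.commute)

lemma br_diff: "br (x - y) z = br x z - br y z"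
  using br_add_l[of x "-y" z] by (simp add: br_uminus)

lemma poisson_idealD: "poisson_ideal br I \<Longrightarrow> ideal I"
  by (simp add: poisson_ideal_def)

lemma poisson_ideal_br: "poisson_ideal br I \<Longrightarrow> x \<in> I \<Longrightarrow> br x a \<in> I"
  by (simp add: poisson_ideal_def)

lemma poisson_ideal_br_r: "poisson_ideal br I \<Longrightarrow> x \<in> I \<Longrightarrow> br a x \<in> I"
  using ideal_uminus[OF poisson_idealD, of I "br x a"] br_anti[of a x] by (auto simp: poisson_ideal_br)

lemma br_pev:
  assumes e: "rhom e" and k: "\<And>d. br a (e d) = 0"
  shows "br a (pev e b f) = pev e b (pderiv f) * br a b"
proof (induction f)
  case (pCons c f)
  show ?case
    by (simp add: pev_pCons[OF e] br_add_r br_mult_r k pCons pderiv_pCons pev_add[OF e] rhom_0[OF e] algebra_simps)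
qed (simp add: pev_0 br_0)

text \<open>Apply \<open>{a, -}\<close> to an equation of least degree for \<open>b\<close> over
  \<open>\<complex>[a]\<close>: the coefficients are killed, and the derivative of the equation at
  \<open>b\<close> is outside \<open>Q\<close> by minimality. If \<open>a\<close> is itself
  algebraic over \<complex>, it is a scalar modulo \<open>Q\<close>.\<close>

lemma br_in_of_algebraic:
  assumes Q: "prime_ideal Q" "poisson_ideal br Q"
    and al: "algebraic_mod (pev \<iota> a) Q b"
  shows "br a b \<in> Q"
proof (cases "algebraic_mod \<iota> Q a")
  case True
  then obtain c where "a - \<iota> c \<in> Q" using algebraic_mod_complex[OF i Q(1)] by blast
  hence "br (a - \<iota> c) b \<in> Q" by (rule poisson_ideal_br[OF Q(2)])
  thus ?thesis by (simp add: br_diff br_const)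
next
  case False
  define e where "e = pev \<iota> a"
  have e: "rhom e" unfolding e_def by (rule pev_rhom[OF i])
  have z: "lies_over_zero e Q" using False by (simp add: e_def lies_over_zero_pev)
  have k: "br a (e d) = 0" for d
    unfolding e_def using br_pev[OF i br_const_r, of a a d] by (simp add: br_self)
  obtain f0 where f0: "f0 \<noteq> 0" "pev e b f0 \<in> Q" using al by (auto simp: algebraic_mod_def e_def)
  define f where "f = arg_min degree (\<lambda>q. q \<noteq> 0 \<and> pev e b q \<in> Q)"
  have f: "f \<noteq> 0" "pev e b f \<in> Q" and fmin: "\<And>q'. q' \<noteq> 0 \<Longrightarrow> pev e b q' \<in> Q \<Longrightarrow> degree f \<le> degree q'"
    using arg_min_nat_lemma[where P = "\<lambda>q. q \<noteq> 0 \<and> pev e b q \<in> Q" and m = degree and k = f0] f0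
      by (auto simp: f_def)
  have df: "degree f > 0"
  proof (rule ccontr)
    assume "\<not> degree f > 0"
    then obtain c where "f = [:c:]" by (metis degree_eq_zeroE gr0I)
    thus False using f z by (auto simp: pev_const[OF e] lies_over_zero_def)
  qed
  have "pev e b (pderiv f) \<notin> Q"
    using fmin[of "pderiv f"] df by (auto simp: degree_pderiv pderiv_eq_0_iff)
  moreover have "pev e b (pderiv f) * br a b \<in> Q"
    using poisson_ideal_br_r[OF Q(2) f(2), of a] by (simp add: br_pev[OF e k])
  ultimately show ?thesis using prime_ideal_mult[OF Q(1)] by blast
qed

lemma independent_of_br_notin:
  assumes "prime_ideal Q" "poisson_ideal br Q" "br a b \<notin> Q"
  shows "lies_over_zero (pev (pev \<iota> a) b) Q"
  using br_in_of_algebraic[OF assms(1,2), of a b] assms(3) by (auto simp: lies_over_zero_pev)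

subsection \<open>The Poisson core\<close>

text \<open>For an ideal \<open>M\<close> the plain union is an ideal, because the sum of two
  Poisson ideals inside \<open>M\<close> is again one.\<close>

definition core :: "'a set \<Rightarrow> 'a set" where
  "core M = \<Union> {I. poisson_ideal br I \<and> I \<subseteq> M}"

lemma poisson_ideal_sum:
  assumes "poisson_ideal br I" "poisson_ideal br J"
  shows "poisson_ideal br {x + y | x y. x \<in> I \<and> y \<in> J}"
  unfolding poisson_ideal_def ideal_def
proof (intro conjI ballI allI)
  note IJ = poisson_idealD[OF assms(1)] poisson_idealD[OF assms(2)]
  let ?S = "{x + y | x y. x \<in> I \<and> y \<in> J}"
  have "0 = 0 + (0::'a)" by simp
  thus "0 \<in> ?S" using ideal_0[OF IJ(1)] ideal_0[OF IJ(2)] by blast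
  fix u assume "u \<in> ?S"
  then obtain x y where u: "u = x + y" "x \<in> I" "y \<in> J" by auto
  { fix v assume "v \<in> ?S"
    then obtain x' y' where v: "v = x' + y'" "x' \<in> I" "y' \<in> J" by auto
    have "u + v = (x + x') + (y + y')" by (simp add: u v)
    thus "u + v \<in> ?S" using ideal_add[OF IJ(1) u(2) v(2)] ideal_add[OF IJ(2) u(3) v(3)] by blast }
  { fix a have "a * u = a * x + a * y" by (simp add: u algebra_simps)
    thus "a * u \<in> ?S" using ideal_mult[OF IJ(1) u(2)] ideal_mult[OF IJ(2) u(3)] by blast }
  { fix a have "br u a = br x a + br y a" by (simp add: u br_add_l)
    thus "br u a \<in> ?S" using poisson_ideal_br[OF assms(1) u(2)] poisson_ideal_br[OF assms(2) u(3)]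
      by blast }
qed

lemma core_subset: "core M \<subseteq> M"
  by (auto simp: core_def)

lemma core_max: "poisson_ideal br I \<Longrightarrow> I \<subseteq> M \<Longrightarrow> I \<subseteq> core M"
  by (auto simp: core_def)

lemma poisson_ideal_0: "poisson_ideal br {0}"
  by (auto simp: poisson_ideal_def ideal_def br_0)

lemma core_poisson_ideal:
  assumes M: "ideal M" shows "poisson_ideal br (core M)"
  unfolding poisson_ideal_def ideal_def
proof (intro conjI ballI allI)
  show "0 \<in> core M" using core_max[OF poisson_ideal_0] ideal_0[OF M] by auto
next
  fix x y assume "x \<in> core M" "y \<in> core M"
  then obtain I J where IJ: "poisson_ideal br I" "I \<subseteq> M" "x \<in> I" "poisson_ideal br J" "J \<subseteq> M" "y \<in> J"
    by (auto simp: core_def)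
  have "{x + y | x y. x \<in> I \<and> y \<in> J} \<subseteq> core M"
    using IJ ideal_add[OF M] by (intro core_max poisson_ideal_sum) auto
  thus "x + y \<in> core M" using IJ by auto
next
  fix a x assume "x \<in> core M"
  thus "a * x \<in> core M" by (auto simp: core_def) (meson ideal_mult poisson_idealD)
next
  fix x a assume "x \<in> core M"
  thus "br x a \<in> core M" by (auto simp: core_def) (meson poisson_ideal_br)
qed

lemma scale_mem: fixes x :: 'a assumes "ideal I" "of_nat (Suc n) * x \<in> I" shows "x \<in> I"
proof -
  have "\<iota> (inverse (of_nat (Suc n))) * (of_nat (Suc n) * x) \<in> I" by (rule ideal_mult[OF assms])
  also have "\<iota> (inverse (of_nat (Suc n))) * (of_nat (Suc n) * x) = \<iota> (inverse (of_nat (Suc n)) * of_nat (Suc n)) * x"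
    by (simp only: rhom_mult[OF i] rhom_of_nat[OF i] mult.assoc)
  also have "\<dots> = x" using of_nat_neq_0[of n, where 'a = complex]
    by (simp add: rhom_1[OF i] del: of_nat_Suc)
  finally show ?thesis .
qed

lemma br_power: "br (x ^ Suc n) z = of_nat (Suc n) * x ^ n * br x z"
  by (induction n) (auto simp: br_mult_l algebra_simps)

text \<open>With \<open>y = {x, z}\<close>, bracketing \<open>x ^ Suc m * y ^ (2 * k)\<close> with
  \<open>z\<close> and multiplying by \<open>y\<close> lowers the exponent of \<open>x\<close> by
  one and raises that of \<open>y\<close> by two. The term from differentiating \<open>y\<close>
  stays in \<open>C\<close>, and the factor \<open>Suc m\<close> is a unit in characteristic
  zero.\<close>

lemma radical_derivative:
  assumes C: "poisson_ideal br C" and x: "x ^ n \<in> C"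
  shows "br x z ^ (2 * n) \<in> C"
proof -
  have I: "ideal C" by (rule poisson_idealD[OF C])
  let ?y = "br x z"
  have "k \<le> n \<Longrightarrow> x ^ (n - k) * ?y ^ (2 * k) \<in> C" for k
  proof (induction k)
    case 0 thus ?case using x by simp
  next
    case (Suc k)
    define m where "m = n - Suc k"
    have m: "n - k = Suc m" using Suc by (simp add: m_def)
    define w where "w = x ^ Suc m * ?y ^ (2 * k)"
    have w: "w \<in> C" using Suc m by (simp add: w_def)
    have "br (?y ^ (2 * k)) z * ?y = of_nat (2 * k) * ?y ^ (2 * k) * br ?y z"
    proof (cases "2 * k")
      case (Suc j) thus ?thesis by (simp only: br_power) (simp add: mult_ac)
    qed (simp add: br_1)
    hence "?y * br w z = of_nat (Suc m) * (x ^ m * ?y ^ (2 * Suc k)) + of_nat (2 * k) * br ?y z * w"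
      by (simp only: w_def br_mult_l br_power) (simp add: algebra_simps power2_eq_square)
    moreover have "?y * br w z \<in> C" by (intro ideal_mult I poisson_ideal_br[OF C w])
    ultimately have "of_nat (Suc m) * (x ^ m * ?y ^ (2 * Suc k)) + of_nat (2 * k) * br ?y z * w \<in> C"
      by simp
    moreover have "of_nat (2 * k) * br ?y z * w \<in> C" by (intro ideal_mult I w)
    ultimately have "of_nat (Suc m) * (x ^ m * ?y ^ (2 * Suc k)) \<in> C"
      using ideal_diff[OF I] by fastforce
    thus ?case unfolding m_def by (rule scale_mem[OF I])
  qed
  from this[of n] show ?thesis by simp
qed

lemma poisson_ideal_saturation:
  assumes C: "poisson_ideal br C"
  shows "poisson_ideal br {x. \<exists>n. b ^ n * x \<in> C}"
  unfolding poisson_ideal_def ideal_def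
proof (intro conjI ballI allI)
  have I: "ideal C" by (rule poisson_idealD[OF C])
  show "0 \<in> {x. \<exists>n. b ^ n * x \<in> C}" using ideal_0[OF I] by auto
  fix x assume "x \<in> {x. \<exists>n. b ^ n * x \<in> C}"
  then obtain n where n: "b ^ n * x \<in> C" by auto
  { fix y assume "y \<in> {x. \<exists>n. b ^ n * x \<in> C}"
    then obtain m where m: "b ^ m * y \<in> C" by auto
    have "b ^ (n + m) * (x + y) = b ^ m * (b ^ n * x) + b ^ n * (b ^ m * y)"
      by (simp add: power_add algebra_simps)
    also have "\<dots> \<in> C" by (intro ideal_add ideal_mult I n m)
    finally show "x + y \<in> {x. \<exists>n. b ^ n * x \<in> C}" by blast }
  { fix a have "b ^ n * (a * x) \<in> C" using ideal_mult[OF I n, of a] by (simp add: mult_ac)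
    thus "a * x \<in> {x. \<exists>n. b ^ n * x \<in> C}" by blast }
  { fix a
    have "br (b ^ n) a * b = of_nat n * b ^ n * br b a"
    proof (cases n)
      case (Suc j) thus ?thesis by (simp only: br_power) (simp add: mult_ac)
    qed (simp add: br_1)
    hence "b ^ Suc n * br x a = b * br (b ^ n * x) a - of_nat n * br b a * (b ^ n * x)"
      by (simp add: br_mult_l algebra_simps)
    also have "\<dots> \<in> C" by (intro ideal_diff ideal_mult I poisson_ideal_br[OF C] n)
    finally show "br x a \<in> {x. \<exists>n. b ^ n * x \<in> C}" by blast }
qed

lemma poisson_ideal_radical:
  assumes C: "poisson_ideal br C"
  shows "poisson_ideal br {x. \<exists>n. x ^ n \<in> C}"
  unfolding poisson_ideal_def ideal_def
proof (intro conjI ballI allI)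
  have I: "ideal C" by (rule poisson_idealD[OF C])
  have "(0::'a) ^ 1 \<in> C" using ideal_0[OF I] by simp
  thus "0 \<in> {x. \<exists>n. x ^ n \<in> C}" by blast
  fix x assume "x \<in> {x. \<exists>n. x ^ n \<in> C}"
  then obtain n where n: "x ^ n \<in> C" by auto
  { fix y assume "y \<in> {x. \<exists>n. x ^ n \<in> C}"
    then obtain m where m: "y ^ m \<in> C" by auto
    have "(x + y) ^ (n + m) = (\<Sum>k\<le>n + m. of_nat (n + m choose k) * x ^ k * y ^ (n + m - k))"
      by (rule binomial_ring)
    also have "\<dots> \<in> C"
    proof (rule ideal_sum[OF I])
      fix k assume "k \<in> {..n + m}"
      show "of_nat (n + m choose k) * x ^ k * y ^ (n + m - k) \<in> C"
      proof (cases "n \<le> k")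
        case True
        hence "x ^ k = x ^ (k - n) * x ^ n" by (simp add: power_add[symmetric])
        thus ?thesis using ideal_mult[OF I n] ideal_mult'[OF I] by (simp add: mult.assoc[symmetric])
      next
        case False
        hence "y ^ (n + m - k) = y ^ (n - k) * y ^ m" by (simp add: power_add[symmetric])
        thus ?thesis using ideal_mult[OF I m] by (simp add: mult.assoc[symmetric])
      qed
    qed
    finally show "x + y \<in> {x. \<exists>n. x ^ n \<in> C}" by blast }
  { fix a have "(a * x) ^ n \<in> C" using ideal_mult[OF I n] by (simp add: power_mult_distrib)
    thus "a * x \<in> {x. \<exists>n. x ^ n \<in> C}" by blast }
  { fix a show "br x a \<in> {x. \<exists>n. x ^ n \<in> C}" using radical_derivative[OF C n] by blast }
qed

text \<open>The radical of the core and its saturation by an element outside \<open>M\<close> are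
  Poisson ideals inside \<open>M\<close>, hence equal to the core. If \<open>a * b\<close> is in the
  core and \<open>b\<close> is not, the saturation by \<open>a\<close> leaves \<open>M\<close>; this
  gives \<open>y\<close> outside \<open>M\<close> with \<open>a ^ n * y\<close> in the core, and
  removing \<open>y\<close> and then the exponent puts \<open>a\<close> there.\<close>

lemma core_prime:
  assumes M: "prime_ideal M" shows "prime_ideal (core M)"
  unfolding prime_ideal_def
proof (intro conjI allI impI)
  have IM: "ideal M" by (rule prime_idealD[OF M])
  have C: "poisson_ideal br (core M)" by (rule core_poisson_ideal[OF IM])
  show "ideal (core M)" by (rule poisson_idealD[OF C])
  show "core M \<noteq> UNIV" using core_subset[of M] prime_ideal_1[OF M] by auto
  have rad: "x \<in> core M" if "x ^ n \<in> core M" for x n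
  proof -
    have "{x. \<exists>n. x ^ n \<in> core M} \<subseteq> M" using prime_ideal_power[OF M] core_subset by blast
    thus ?thesis using core_max[OF poisson_ideal_radical[OF C]] that by blast
  qed
  have nzd: "x \<in> core M" if y: "y \<notin> M" and xy: "y ^ n * x \<in> core M" for x y n
  proof -
    have "{x. \<exists>n. y ^ n * x \<in> core M} \<subseteq> M"
      using prime_ideal_power[OF M] core_subset y prime_ideal_mult[OF M] by blast
    thus ?thesis using core_max[OF poisson_ideal_saturation[OF C]] xy by blast
  qed
  fix a b assume ab: "a * b \<in> core M"
  show "a \<in> core M \<or> b \<in> core M"
  proof (rule disjCI)
    assume b: "b \<notin> core M"
    show "a \<in> core M"
    proof (rule ccontr)
      assume a: "a \<notin> core M"
      have "b \<in> {x. \<exists>n. a ^ n * x \<in> core M}" using ab by (auto intro: exI[of _ 1])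
      hence "\<not> {x. \<exists>n. a ^ n * x \<in> core M} \<subseteq> M"
        using core_max[OF poisson_ideal_saturation[OF C]] b by blast
      then obtain y n where y: "a ^ n * y \<in> core M" "y \<notin> M" by blast
      hence "a ^ n \<in> core M" using nzd[of y 1 "a ^ n"] by (simp add: mult.commute)
      thus False using rad a by blast
    qed
  qed
qed

subsection \<open>The general implications\<close>

text \<open>For \<open>f\<close> in \<open>J\<close> but not in \<open>P\<close>, a maximal ideal
  over \<open>P\<close> without \<open>f\<close> has a core that still lies in
  \<open>V(I) - V(J)\<close>, a set whose only point is \<open>P\<close>.\<close>

lemma locally_closed_imp_primitive:
  assumes fg: "finitely_generated \<iota>" and P: "poisson_locally_closed br P"
  shows "poisson_primitive br P"
proof -
  have PS: "P \<in> PSpec br" using P by (simp add: poisson_locally_closed_def)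
  obtain I J where IJ: "{P} = {Q \<in> PSpec br. I \<subseteq> Q \<and> \<not> J \<subseteq> Q}"
    using P unfolding poisson_locally_closed_def by blast
  have pp: "prime_ideal P" "poisson_ideal br P" using PS by (auto simp: PSpec_def poisson_prime_def)
  have "I \<subseteq> P" "\<not> J \<subseteq> P" using IJ by auto
  then obtain f where f: "f \<in> J" "f \<notin> P" by auto
  obtain M where M: "maximal_ideal M" "prime_ideal M" "P \<subseteq> M" "f \<notin> M"
    using jacobson_nullstellensatz[OF i fg pp(1) f(2)] by blast
  have PC: "P \<subseteq> core M" by (rule core_max[OF pp(2) M(3)])
  have "core M \<in> PSpec br"
    using core_prime[OF M(2)] core_poisson_ideal[OF prime_idealD[OF M(2)]]
    by (simp add: PSpec_def poisson_prime_def)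
  moreover have "I \<subseteq> core M" using \<open>I \<subseteq> P\<close> PC by simp
  moreover have "\<not> J \<subseteq> core M" using f M(4) core_subset by blast
  ultimately have "core M \<in> {P}" using IJ by blast
  hence eq: "core M = P" by simp
  show ?thesis unfolding poisson_primitive_def
    using M pp core_max eq by (intro exI[of _ M]) auto
qed

text \<open>The denominators \<open>y\<close> and the numerators \<open>x\<close> of a Poisson
  central fraction \<open>a/b = x/y\<close>. Centrality gives \<open>a {y, c} = b {x, c}\<close>
  modulo \<open>P\<close>, so both sets are stable under brackets.\<close>

lemma poisson_ideal_fraction_multiples:
  assumes P: "prime_ideal P" "poisson_ideal br P" and b: "b \<notin> P"
    and ct: "\<And>c. b * br a c - a * br b c \<in> P"
  shows "poisson_ideal br {y. \<exists>x. a * y - b * x \<in> P}"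
    and "poisson_ideal br {x. \<exists>y. a * y - b * x \<in> P}"
proof -
  have I: "ideal P" by (rule prime_idealD[OF P(1)])
  have key: "a * br y c - b * br x c \<in> P" if xy: "a * y - b * x \<in> P" for x y c
  proof -
    have "b * (a * br y c - b * br x c)
       = b * br (a * y - b * x) c - y * (b * br a c - a * br b c) - br b c * (a * y - b * x)"
      by (simp add: br_diff br_mult_l algebra_simps)
    also have "\<dots> \<in> P" by (intro ideal_diff ideal_mult I ct xy poisson_ideal_br[OF P(2)])
    finally show ?thesis using b prime_ideal_mult[OF P(1)] by blast
  qed
  have add: "a * (y + y') - b * (x + x') \<in> P" if "a * y - b * x \<in> P" "a * y' - b * x' \<in> P" for x y x' y'
    using ideal_add[OF I that] by (simp add: algebra_simps)
  have mul: "a * (t * y) - b * (t * x) \<in> P" if "a * y - b * x \<in> P" for x y t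
    using ideal_mult[OF I that, of t] by (simp add: algebra_simps)
  have zero: "a * 0 - b * 0 \<in> P" using ideal_0[OF I] by simp
  show "poisson_ideal br {y. \<exists>x. a * y - b * x \<in> P}"
    unfolding poisson_ideal_def ideal_def mem_Collect_eq using key add mul zero by blast
  show "poisson_ideal br {x. \<exists>y. a * y - b * x \<in> P}"
    unfolding poisson_ideal_def ideal_def mem_Collect_eq using key add mul zero by blast
qed

text \<open>The denominators of a central fraction \<open>a/b\<close> form a Poisson ideal not
  contained in \<open>P\<close>, hence not in \<open>M\<close>: the fraction is defined at
  \<open>M\<close> and has a value \<open>c\<close> there. The numerators of \<open>a/b - c\<close>
  then form a Poisson ideal inside \<open>M\<close>, hence inside \<open>P\<close>, and the
  difference vanishes.\<close>

lemma primitive_imp_rational: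
  assumes fg: "finitely_generated \<iota>" and Pp: "poisson_primitive br P"
  shows "poisson_rational \<iota> br P"
proof -
  obtain M where h: "maximal_ideal M \<and> poisson_ideal br P \<and> P \<subseteq> M \<and>
      (\<forall>I. poisson_ideal br I \<and> I \<subseteq> M \<longrightarrow> I \<subseteq> P)"
    using Pp unfolding poisson_primitive_def by (elim exE)
  hence M: "maximal_ideal M" "poisson_ideal br P" "P \<subseteq> M" by simp_all
  have mx: "I \<subseteq> P" if "poisson_ideal br I" "I \<subseteq> M" for I using h that by simp
  have pM: "prime_ideal M" by (rule maximal_ideal_prime[OF M(1)])
  have IM: "ideal M" by (rule prime_idealD[OF pM])
  have "P = core M"
    using mx[OF core_poisson_ideal[OF IM] core_subset] core_max[OF M(2,3)] by auto
  hence P: "prime_ideal P" using core_prime[OF pM] by simp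
  have I: "ideal P" by (rule prime_idealD[OF P])
  obtain M' where M': "maximal_ideal M'" "M \<subseteq> M'" "\<forall>x. \<exists>c. x - \<iota> c \<in> M'"
    using jacobson_nullstellensatz[OF i fg pM prime_ideal_1[OF pM]] by blast
  have "M' = M" using M(1) M' unfolding maximal_ideal_def by blast
  hence res: "\<And>x. \<exists>c. x - \<iota> c \<in> M" using M' by blast
  have "\<exists>p::complex poly. p \<noteq> 0 \<and> (\<Sum>k\<le>degree p. \<iota> (coeff p k) * a ^ k * b ^ (degree p - k)) \<in> P"
    if b: "b \<notin> P" and ct: "\<forall>c. b * br a c - a * br b c \<in> P" for a b
  proof -
    have "b \<in> {y. \<exists>x. a * y - b * x \<in> P}"
      using ideal_0[OF I] by (auto intro!: exI[of _ a] simp: mult.commute)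
    hence "\<not> {y. \<exists>x. a * y - b * x \<in> P} \<subseteq> M"
      using mx[OF poisson_ideal_fraction_multiples(1)[OF P M(2) b]] ct b by blast
    then obtain y x where y: "y \<notin> M" and axy: "a * y - b * x \<in> P" by blast
    obtain x0 y0 where x0: "x - \<iota> x0 \<in> M" and y0: "y - \<iota> y0 \<in> M" using res by metis
    have y0nz: "y0 \<noteq> 0" using y0 y by (auto simp: rhom_0[OF i])
    define c where "c = x0 / y0"
    have "x - \<iota> c * y = (x - \<iota> x0) - \<iota> c * (y - \<iota> y0)"
    proof -
      have "\<iota> c * \<iota> y0 = \<iota> x0" using y0nz by (simp add: c_def rhom_mult[OF i, symmetric])
      thus ?thesis by (simp add: algebra_simps)
    qed
    also have "\<dots> \<in> M" by (intro ideal_diff ideal_mult IM x0 y0)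
    finally have xM: "x - \<iota> c * y \<in> M" .
    have yP: "y \<notin> P" using y M(3) by auto
    have bracket: "y * br x d - x * br y d \<in> P" for d
    proof -
      have 1: "a * br y d - b * br x d \<in> P"
      proof -
        have "b * (a * br y d - b * br x d)
          = b * br (a * y - b * x) d - y * (b * br a d - a * br b d) - br b d * (a * y - b * x)"
          by (simp add: br_diff br_mult_l algebra_simps)
        also have "\<dots> \<in> P"
        proof (intro ideal_diff[OF I])
          show "y * (b * br a d - a * br b d) \<in> P" using ct by (intro ideal_mult[OF I]) simp
        qed (intro ideal_mult I axy poisson_ideal_br[OF M(2)])+
        finally show ?thesis using b prime_ideal_mult[OF P] by blast
      qed
      have "b * (y * br x d - x * br y d) = br y d * (a * y - b * x) - y * (a * br y d - b * br x d)"
        by (simp add: algebra_simps)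
      also have "\<dots> \<in> P" by (intro ideal_diff ideal_mult I 1 axy)
      finally show ?thesis using b prime_ideal_mult[OF P] by blast
    qed
    define u where "u = x - \<iota> c * y"
    have ct': "y * br u d - u * br y d \<in> P" for d
    proof -
      have "y * br u d - u * br y d = y * br x d - x * br y d"
        by (simp only: u_def br_diff br_scale_l) (simp add: algebra_simps)
      thus ?thesis using bracket by simp
    qed
    have "{t. \<exists>s. u * s - y * t \<in> P} \<subseteq> M"
    proof
      fix t assume "t \<in> {t. \<exists>s. u * s - y * t \<in> P}"
      then obtain s where s: "u * s - y * t \<in> P" by auto
      have "u * s \<in> M" using ideal_mult'[OF IM xM] by (simp add: u_def)
      hence "y * t \<in> M" using ideal_diff[OF IM, of "u * s" "u * s - y * t"] s M(3) by auto
      thus "t \<in> M" using prime_ideal_mult[OF pM] y by blast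
    qed
    hence "{t. \<exists>s. u * s - y * t \<in> P} \<subseteq> P"
      using mx[OF poisson_ideal_fraction_multiples(2)[OF P M(2) yP ct']] by blast
    moreover have "u \<in> {t. \<exists>s. u * s - y * t \<in> P}"
      using ideal_0[OF I] by (auto intro!: exI[of _ y] simp: mult.commute)
    ultimately have uP: "u \<in> P" by blast
    have "y * (a - \<iota> c * b) = (a * y - b * x) + b * u" by (simp add: u_def algebra_simps)
    also have "\<dots> \<in> P" by (intro ideal_add ideal_mult I uP axy)
    finally have "a - \<iota> c * b \<in> P" using yP prime_ideal_mult[OF P] by blast
    thus ?thesis
      by (intro exI[of _ "[:-c, 1:]"]) (simp add: rhom_uminus[OF i] rhom_1[OF i] algebra_simps)
  qed
  thus ?thesis unfolding poisson_rational_def using P M(2) by (auto simp: PSpec_def poisson_prime_def)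
qed

lemma rational_imp_locally_closed_nonzero:
  assumes fg: "finitely_generated \<iota>" and kd: "krull_dim_le TYPE('a) 3"
    and P: "poisson_rational \<iota> br P" and P0: "P \<noteq> {0}"
  shows "poisson_locally_closed br P"
proof -
  have PS: "P \<in> PSpec br" using P by (simp add: poisson_rational_def)
  have pp: "prime_ideal P" "poisson_ideal br P" using PS by (auto simp: PSpec_def poisson_prime_def)
  have I: "ideal P" by (rule prime_idealD[OF pp(1)])
  have zP: "{0} \<subset> P" using P0 ideal_0[OF I] by auto
  show ?thesis
  proof (cases "\<forall>a b. br a b \<in> P")
    case True
    \<comment> \<open>When all brackets vanish modulo \<open>P\<close>, every element is central
      there. Rationality makes the quotient equal to \<complex>, so \<open>P\<close> is a maximal
      ideal.\<close>
    have res: "\<exists>c. a - \<iota> c \<in> P" for a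
    proof -
      have "1 \<notin> P \<and> (\<forall>c. 1 * br a c - a * br 1 c \<in> P)"
        using True prime_ideal_1[OF pp(1)] by (simp add: br_1)
      then obtain p :: "complex poly" where p: "p \<noteq> 0"
        "(\<Sum>k\<le>degree p. \<iota> (coeff p k) * a ^ k * 1 ^ (degree p - k)) \<in> P"
        using P unfolding poisson_rational_def by blast
      show ?thesis using complex_root_mod_prime[OF i pp(1) p prime_ideal_1[OF pp(1)]] by simp
    qed
    have "Q = P" if QP: "Q \<in> PSpec br" "P \<subseteq> Q" for Q
    proof (rule ccontr)
      assume "Q \<noteq> P"
      then obtain x where x: "x \<in> Q" "x \<notin> P" using QP by auto
      have Q: "prime_ideal Q" using QP by (auto simp: PSpec_def poisson_prime_def)
      obtain c where c: "x - \<iota> c \<in> P" using res by blast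
      have "c \<noteq> 0" using c x by (auto simp: rhom_0[OF i])
      have "\<iota> c \<in> Q" using ideal_diff[OF prime_idealD[OF Q], of x "x - \<iota> c"] c x QP by auto
      hence "\<iota> (inverse c) * \<iota> c \<in> Q" by (intro ideal_mult prime_idealD Q)
      thus False using \<open>c \<noteq> 0\<close> prime_ideal_1[OF Q] by (simp add: rhom_mult[OF i, symmetric] rhom_1[OF i])
    qed
    moreover have "\<not> UNIV \<subseteq> Q" if "Q \<in> PSpec br" for Q
      using that by (auto simp: PSpec_def poisson_prime_def prime_ideal_def)
    ultimately have "{P} = {Q \<in> PSpec br. P \<subseteq> Q \<and> \<not> UNIV \<subseteq> Q}" using PS by blast
    thus ?thesis using PS unfolding poisson_locally_closed_def by blast
  next
    case False
    then obtain a b where ab: "br a b \<notin> P" by auto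
    have "Q = P" if Q: "Q \<in> PSpec br" "P \<subseteq> Q" "br a b \<notin> Q" for Q
    proof (rule ccontr)
      assume ne: "Q \<noteq> P"
      have Q': "prime_ideal Q" "poisson_ideal br Q" using Q by (auto simp: PSpec_def poisson_prime_def)
      \<comment> \<open>A bracket outside \<open>Q\<close> gives two independent elements modulo
        \<open>Q\<close> and so two further primes; together with \<open>{0}\<close>,
        \<open>P\<close> and \<open>Q\<close> these are five in a chain.\<close>
      obtain Q1 Q2 where "prime_ideal Q1" "prime_ideal Q2" "Q \<subset> Q1" "Q1 \<subset> Q2"
        using independent_chain2[OF i fg Q'(1) independent_of_br_notin[OF Q' Q(3)]] by blast
      thus False using krull_dim_le_3D[OF kd prime_ideal_zero pp(1) Q'(1)] zP Q(2) ne by blast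
    qed
    hence "{P} = {Q \<in> PSpec br. P \<subseteq> Q \<and> \<not> {br a b} \<subseteq> Q}" using PS ab by auto
    thus ?thesis using PS unfolding poisson_locally_closed_def by blast
  qed
qed

lemma zero_locally_closed:
  assumes D: "D \<noteq> 0" "\<And>Q. poisson_prime br Q \<Longrightarrow> Q \<noteq> {0} \<Longrightarrow> D \<in> Q"
  shows "poisson_locally_closed br {0}"
proof -
  have z: "{0} \<in> PSpec br" by (simp add: PSpec_def poisson_prime_def poisson_ideal_0 prime_ideal_zero)
  have "{{0}} = {Q \<in> PSpec br. {} \<subseteq> Q \<and> \<not> {D} \<subseteq> Q}" using D z by (auto simp: PSpec_def)
  thus ?thesis using z unfolding poisson_locally_closed_def by blast
qed

end

section \<open>Elimination of a variable and division\<close>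

lemma degree_map_poly_le: "f 0 = 0 \<Longrightarrow> degree (map_poly f p) \<le> degree p"
  by (intro degree_le) (auto simp: coeff_map_poly coeff_eq_0)

text \<open>By pseudo-division, an element \<open>m\<close> of least degree in the ideal
  \<open>(p, q)\<close> divides every element of it up to a nonzero scalar. If \<open>m\<close> had
  positive degree, primality of \<open>p\<close> would give \<open>p dvd m\<close> and then
  \<open>p dvd q\<close>. So \<open>m\<close> is a constant \<open>d\<close>, which serves as a
  resultant.\<close>

lemma elimination:
  fixes p q :: "'r::idom poly"
  assumes p: "prime_elem p" "degree p > 0" and q: "\<not> p dvd q"
  shows "\<exists>u v d. d \<noteq> 0 \<and> u * p + v * q = [:d:]"
proof -
  define I where "I = {u * p + v * q | u v. True}"
  have Ip: "p \<in> I" unfolding I_def by (intro CollectI exI[of _ 1] exI[of _ 0]) simp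
  have Iq: "q \<in> I" unfolding I_def by (intro CollectI exI[of _ 0] exI[of _ 1]) simp
  have Id: "smult c a - m * s \<in> I" if am: "a \<in> I" "m \<in> I" for a m c s
  proof -
    obtain u v u' v' where "a = u * p + v * q" "m = u' * p + v' * q" using am unfolding I_def by auto
    hence "smult c a - m * s = (smult c u - u' * s) * p + (smult c v - v' * s) * q"
      by (simp add: algebra_simps smult_add_right)
    thus ?thesis unfolding I_def by blast
  qed
  have pnz: "p \<noteq> 0" using p by auto
  define m where "m = arg_min degree (\<lambda>a. a \<noteq> 0 \<and> a \<in> I)"
  have m: "m \<noteq> 0" "m \<in> I" and mmin: "\<And>a. a \<noteq> 0 \<Longrightarrow> a \<in> I \<Longrightarrow> degree m \<le> degree a"
    using arg_min_nat_lemma[where P = "\<lambda>a. a \<noteq> 0 \<and> a \<in> I" and m = degree and k = p] Ip pnz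
      by (auto simp: m_def)
  have dv: "\<exists>c s. c \<noteq> 0 \<and> smult c a = m * s" if a: "a \<in> I" for a
  proof -
    obtain s \<rho> where sr: "pseudo_divmod a m = (s, \<rho>)" by fastforce
    define c where "c = coeff m (degree m) ^ (Suc (degree a) - degree m)"
    have e: "smult c a = m * s + \<rho>" and d: "\<rho> = 0 \<or> degree \<rho> < degree m"
      using pseudo_divmod[OF m(1) sr] by (auto simp: c_def)
    have "\<rho> = smult c a - m * s" using e by simp
    hence "\<rho> \<in> I" using Id[OF a m(2)] by simp
    hence "\<rho> = 0" using d mmin[of \<rho>] by force
    thus ?thesis using e m by (intro exI[of _ c] exI[of _ s]) (auto simp: c_def)
  qed
  have "degree m = 0"
  proof (rule ccontr)
    assume dm: "degree m \<noteq> 0"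
    obtain c s where c: "c \<noteq> 0" "smult c p = m * s" using dv[OF Ip] by blast
    have "p dvd m * s" using c(2) by (metis dvd_smult dvd_refl)
    hence "p dvd m \<or> p dvd s" using p(1) by (simp add: prime_elem_dvd_mult_iff)
    moreover have "\<not> p dvd s"
    proof
      assume "p dvd s"
      then obtain s' where "s = p * s'" by auto
      hence "p * [:c:] = p * (m * s')" using c(2) by (simp add: mult_ac)
      hence "[:c:] = m * s'" using pnz mult_left_cancel by blast
      moreover have "s' \<noteq> 0" using calculation c(1) by auto
      ultimately have "degree m + degree s' = 0" using m(1) by (metis degree_mult_eq degree_pCons_0)
      thus False using dm by simp
    qed
    ultimately have pm: "p dvd m" by blast
    obtain c' s' where c': "c' \<noteq> 0" "smult c' q = m * s'" using dv[OF Iq] by blast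
    have "p dvd [:c':] * q" using pm c'(2) by (simp add: dvd_mult2)
    hence "p dvd [:c':] \<or> p dvd q" using p(1) prime_elem_dvd_mult_iff by blast
    hence "p dvd [:c':]" using q by blast
    hence "degree p \<le> 0" using c'(1) dvd_imp_degree_le[of p "[:c':]"] by simp
    thus False using p(2) by simp
  qed
  then obtain d where d: "m = [:d:]" by (metis degree_eq_zeroE)
  hence "d \<noteq> 0" using m(1) by auto
  moreover obtain u v where "m = u * p + v * q" using m(2) unfolding I_def by auto
  ultimately show ?thesis using d by metis
qed

lemma division_unit_lead:
  fixes a p :: "'r::idom poly"
  assumes l: "l * lead_coeff p = 1" and d: "degree p > 0"
  shows "\<exists>s N. a = p * s + N \<and> degree N < degree p"
proof -
  have pnz: "p \<noteq> 0" using d by auto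
  obtain s \<rho> where sr: "pseudo_divmod a p = (s, \<rho>)" by fastforce
  define n where "n = Suc (degree a) - degree p"
  have e: "smult (lead_coeff p ^ n) a = p * s + \<rho>" and dr: "\<rho> = 0 \<or> degree \<rho> < degree p"
    using pseudo_divmod[OF pnz sr] by (auto simp: n_def)
  have "a = smult (l ^ n) (smult (lead_coeff p ^ n) a)"
    by (simp add: power_mult_distrib[symmetric] l)
  also have "\<dots> = p * smult (l ^ n) s + smult (l ^ n) \<rho>" by (simp add: e smult_add_right)
  finally show ?thesis using dr d
    by (intro exI[of _ "smult (l ^ n) s"] exI[of _ "smult (l ^ n) \<rho>"] conjI)
       (auto intro: le_less_trans[OF degree_smult_le])
qed

subsection \<open>Polynomials in three variables and their total degree\<close>

text \<open>The innermost variable is \<open>x\<close>, then comes \<open>y\<close>, and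
  \<open>z\<close> is outermost. So \<open>degree\<close> and \<open>pderiv\<close> on
  \<open>mp3\<close> refer to \<open>z\<close>, the fibre variable of the projection to the
  \<open>(x, y)\<close>-plane, and coefficients are polynomials in \<open>x, y\<close>.\<close>

type_synonym mp2 = "complex poly poly"
type_synonym mp3 = "complex poly poly poly"

definition K3 :: "complex \<Rightarrow> mp3" where "K3 c = [:[:[:c:]:]:]"
definition X3 :: mp3 where "X3 = [:[:[:0,1:]:]:]"
definition Y3 :: mp3 where "Y3 = [:[:0,1:]:]"
definition Z3 :: mp3 where "Z3 = [:0,1:]"

definition ev3 :: "(complex \<Rightarrow> 'b::comm_ring_1) \<Rightarrow> 'b \<Rightarrow> 'b \<Rightarrow> 'b \<Rightarrow> mp3 \<Rightarrow> 'b" where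
  "ev3 \<iota> x y z = pev (pev (pev \<iota> x) y) z"

lemma K3_rhom: "rhom K3"
proof -
  have "K3 = (\<lambda>c. [:[:[:c:]:]:])" by (simp add: K3_def fun_eq_iff)
  moreover have "rhom (\<lambda>c::complex. [:[:[:c:]:]:])" by (intro rhom_const rhom_pC)
  ultimately show ?thesis by (simp only:)
qed

lemma ev3_rhom: "rhom \<iota> \<Longrightarrow> rhom (ev3 \<iota> x y z)"
  unfolding ev3_def by (intro pev_rhom)

lemma ev3_gens: assumes "rhom \<iota>"
  shows "ev3 \<iota> x y z (K3 c) = \<iota> c" "ev3 \<iota> x y z X3 = x" "ev3 \<iota> x y z Y3 = y" "ev3 \<iota> x y z Z3 = z"
  by (simp_all add: ev3_def K3_def X3_def Y3_def Z3_def pev_const pev_X pev_rhom assms)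

lemma poly_hom_eqI:
  assumes "rhom \<phi>" "rhom \<psi>" "\<And>a. \<phi> [:a:] = \<psi> [:a:]" "\<phi> [:0,1:] = \<psi> [:0,1:]"
  shows "\<phi> p = \<psi> p"
  using pev_unique[OF assms(1), of p] pev_unique[OF assms(2), of p] assms(3,4) by simp

lemma mp3_hom_eqI:
  assumes h: "rhom \<phi>" "rhom \<psi>" and "\<And>c. \<phi> (K3 c) = \<psi> (K3 c)" "\<phi> X3 = \<psi> X3" "\<phi> Y3 = \<psi> Y3" "\<phi> Z3 = \<psi> Z3"
  shows "\<phi> p = \<psi> p"
proof (rule poly_hom_eqI[OF h])
  show "\<phi> [:0, 1:] = \<psi> [:0, 1:]" using assms by (simp add: Z3_def)
  fix a :: mp2
  show "\<phi> [:a:] = \<psi> [:a:]"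
  proof (rule poly_hom_eqI[of "\<lambda>a. \<phi> [:a:]" "\<lambda>a. \<psi> [:a:]"])
    show "rhom (\<lambda>a. \<phi> [:a:])" "rhom (\<lambda>a. \<psi> [:a:])" by (intro rhom_comp[OF rhom_pC] h)+
    show "\<phi> [:[:0, 1:]:] = \<psi> [:[:0, 1:]:]" using assms by (simp add: Y3_def)
    fix b :: "complex poly"
    show "\<phi> [:[:b:]:] = \<psi> [:[:b:]:]"
    proof (rule poly_hom_eqI[of "\<lambda>a. \<phi> [:[:a:]:]" "\<lambda>a. \<psi> [:[:a:]:]"])
      show "rhom (\<lambda>a. \<phi> [:[:a:]:])" "rhom (\<lambda>a. \<psi> [:[:a:]:])"
        by (intro rhom_comp[OF rhom_const[OF rhom_pC]] h)+
    qed (use assms in \<open>simp_all add: K3_def X3_def\<close>)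
  qed
qed

text \<open>One layer of the substitution \<open>p(tx, ty, tz)\<close>: \<open>h\<close> has already
  treated the coefficients, and the new variable \<open>X\<close> goes to \<open>t * X\<close>. The
  variable \<open>t\<close> stays outermost, so layers can be stacked.\<close>

definition hlay :: "('d::comm_ring_1 \<Rightarrow> 'e::comm_ring_1 poly) \<Rightarrow> 'd poly \<Rightarrow> 'e poly poly" where
  "hlay h = pev (\<lambda>a. map_poly (\<lambda>b. [:b:]) (h a)) (monom [:0,1:] 1)"

lemma hlay_inner: "rhom h \<Longrightarrow> rhom (\<lambda>a. map_poly (\<lambda>b. [:b:]) (h a))"
  by (rule rhom_comp[OF _ map_poly_rhom[OF rhom_pC]])

lemma hlay_rhom: "rhom h \<Longrightarrow> rhom (hlay h)"
  unfolding hlay_def by (intro pev_rhom hlay_inner)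

lemma hlay_const: "rhom h \<Longrightarrow> hlay h [:a:] = map_poly (\<lambda>b. [:b:]) (h a)"
  unfolding hlay_def by (simp add: pev_const hlay_inner)

lemma hlay_X: "rhom h \<Longrightarrow> hlay h [:0,1:] = monom [:0,1:] 1"
  unfolding hlay_def by (simp add: pev_X hlay_inner)

lemma coeff_hlay:
  assumes h: "rhom h"
  shows "coeff (coeff (hlay h p) n) k = (if k \<le> n then coeff (h (coeff p k)) (n - k) else 0)"
proof (induction p arbitrary: n k)
  case 0 show ?case by (simp add: hlay_def pev_0 rhom_0[OF h])
next
  case (pCons a p)
  have "hlay h (pCons a p) = map_poly (\<lambda>b. [:b:]) (h a) + monom [:0,1:] 1 * hlay h p"
    unfolding hlay_def by (rule pev_pCons[OF hlay_inner[OF h]])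
  hence e: "coeff (hlay h (pCons a p)) n = [:coeff (h a) n:] + (if 1 \<le> n then [:0,1:] * coeff (hlay h p) (n - 1) else 0)"
    by (simp add: coeff_map_poly coeff_monom_mult)
  show ?case
  proof (cases k)
    case 0 thus ?thesis by (simp add: e)
  next
    case (Suc j)
    have "coeff (coeff (hlay h (pCons a p)) n) k = (if 1 \<le> n then coeff (coeff (hlay h p) (n - 1)) j else 0)"
      by (simp add: e Suc)
    also have "\<dots> = (if 1 \<le> n \<and> j \<le> n - 1 then coeff (h (coeff p j)) (n - 1 - j) else 0)"
      by (simp add: pCons.IH)
    also have "\<dots> = (if k \<le> n then coeff (h (coeff (pCons a p) k)) (n - k) else 0)"
      using Suc by auto
    finally show ?thesis .
  qed
qed

text \<open>\<open>H3 p = p(tx, ty, tz)\<close> as a polynomial in \<open>t\<close>, so that the total degree is an ordinary degree.\<close>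
definition H3 :: "mp3 \<Rightarrow> mp3 poly" where
  "H3 = hlay (hlay (hlay (\<lambda>c. [:c:])))"

definition mcoeff :: "mp3 \<Rightarrow> nat \<Rightarrow> nat \<Rightarrow> nat \<Rightarrow> complex" where
  "mcoeff p i j k = coeff (coeff (coeff p k) j) i"

definition tdeg :: "mp3 \<Rightarrow> nat" where "tdeg p = degree (H3 p)"

lemma H3_rhom: "rhom H3"
  unfolding H3_def by (intro hlay_rhom rhom_pC)

lemma H3_gens: "H3 (K3 c) = [:K3 c:]" "H3 X3 = monom X3 1" "H3 Y3 = monom Y3 1" "H3 Z3 = monom Z3 1"
  by (simp_all add: H3_def K3_def X3_def Y3_def Z3_def hlay_const hlay_X hlay_rhom rhom_pC map_poly_pCons map_poly_monom)

lemma mcoeff_H3: "mcoeff (coeff (H3 p) n) i j k = (if n = i + j + k then mcoeff p i j k else 0)"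
  by (auto simp: mcoeff_def H3_def coeff_hlay hlay_rhom rhom_pC coeff_pCons split: nat.split)

lemma mcoeff_eqI: "(\<And>i j k. mcoeff p i j k = mcoeff q i j k) \<Longrightarrow> p = q"
  by (intro poly_eqI) (auto simp: mcoeff_def)

lemma mcoeff_0: "mcoeff 0 i j k = 0" by (simp add: mcoeff_def)

lemma tdeg_le_iff: "tdeg p \<le> n \<longleftrightarrow> (\<forall>i j k. n < i + j + k \<longrightarrow> mcoeff p i j k = 0)"
proof
  assume "tdeg p \<le> n"
  hence "coeff (H3 p) m = 0" if "n < m" for m using that by (simp add: tdeg_def coeff_eq_0)
  thus "\<forall>i j k. n < i + j + k \<longrightarrow> mcoeff p i j k = 0" by (metis mcoeff_0 mcoeff_H3)
next
  assume h: "\<forall>i j k. n < i + j + k \<longrightarrow> mcoeff p i j k = 0"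
  have "coeff (H3 p) m = 0" if "n < m" for m
    by (rule mcoeff_eqI) (use h that in \<open>auto simp: mcoeff_H3 mcoeff_0\<close>)
  thus "tdeg p \<le> n" unfolding tdeg_def by (intro degree_le) auto
qed

lemma H3_eq_0: "H3 p = 0 \<longleftrightarrow> p = 0"
proof
  assume h: "H3 p = 0"
  show "p = 0" by (rule mcoeff_eqI) (metis h mcoeff_H3 coeff_0 mcoeff_0)
qed (simp add: rhom_0[OF H3_rhom])

lemma tdeg_mult: "p \<noteq> 0 \<Longrightarrow> q \<noteq> 0 \<Longrightarrow> tdeg (p * q) = tdeg p + tdeg q"
  by (simp add: tdeg_def rhom_mult[OF H3_rhom] degree_mult_eq H3_eq_0)

lemma tdeg_mult_le: "tdeg (p * q) \<le> tdeg p + tdeg q"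
  unfolding tdeg_def rhom_mult[OF H3_rhom] by (rule degree_mult_le)

lemma tdeg_add_le: "tdeg p \<le> n \<Longrightarrow> tdeg q \<le> n \<Longrightarrow> tdeg (p + q) \<le> n"
  unfolding tdeg_def rhom_add[OF H3_rhom] by (rule degree_add_le)

lemma tdeg_diff_le: "tdeg p \<le> n \<Longrightarrow> tdeg q \<le> n \<Longrightarrow> tdeg (p - q) \<le> n"
  unfolding tdeg_def rhom_diff[OF H3_rhom] by (rule degree_diff_le)

lemma tdeg_uminus: "tdeg (- p) = tdeg p"
  by (simp add: tdeg_def rhom_uminus[OF H3_rhom])

lemma tdeg_K3: "tdeg (K3 c) = 0" and tdeg_0: "tdeg 0 = 0" and tdeg_1: "tdeg 1 = 0"
  by (simp_all add: tdeg_def H3_gens rhom_0[OF H3_rhom] rhom_1[OF H3_rhom])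

lemma tdeg_scale_le: "tdeg (K3 c * p) \<le> tdeg p"
  using tdeg_mult_le[of "K3 c" p] by (simp add: tdeg_K3)

abbreviation cev :: "complex \<Rightarrow> complex \<Rightarrow> complex \<Rightarrow> mp3 \<Rightarrow> complex" where
  "cev \<equiv> ev3 (\<lambda>c. c)"

definition cev2 :: "complex \<Rightarrow> complex \<Rightarrow> mp2 \<Rightarrow> complex" where
  "cev2 x y = pev (pev (\<lambda>c. c) x) y"

lemma cev2_rhom: "rhom (cev2 x y)"
  unfolding cev2_def by (intro pev_rhom rhom_id)

lemma cev_rhom: "rhom (cev x y z)" by (rule ev3_rhom[OF rhom_id])

lemma cev_eq_pev: "cev x y z p = pev (cev2 x y) z p"
  by (simp add: ev3_def cev2_def)

lemma cev_const: "cev x y z [:a:] = cev2 x y a"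
  by (simp add: cev_eq_pev pev_const cev2_rhom)

lemma cev_H3: "pev (cev x y z) t (H3 p) = cev (t * x) (t * y) (t * z) p"
proof -
  have "rhom (\<lambda>p. pev (cev x y z) t (H3 p))" by (intro rhom_comp[OF H3_rhom] pev_rhom cev_rhom)
  thus ?thesis
    by (rule mp3_hom_eqI[OF _ cev_rhom])
       (simp_all add: H3_gens pev_const pev_monom cev_rhom ev3_gens rhom_id mult.commute)
qed

lemma cev_expand:
  "cev x y z p = (\<Sum>k\<le>degree p. \<Sum>j\<le>degree (coeff p k). \<Sum>i\<le>degree (coeff (coeff p k) j). mcoeff p i j k * x ^ i * y ^ j * z ^ k)"
  unfolding ev3_def mcoeff_def
  by (subst pev_altdef[OF _ order_refl], intro pev_rhom rhom_id, rule sum.cong[OF refl],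
      subst pev_altdef[OF _ order_refl], intro pev_rhom rhom_id, simp only: sum_distrib_right, rule sum.cong[OF refl],
      subst pev_altdef[OF _ order_refl], intro pev_rhom rhom_id, simp only: sum_distrib_right)

text \<open>The converse is \<open>tdeg_le_of_growth\<close>; together they allow degrees to be read
  off from analytic estimates.\<close>

lemma cev_bound:
  assumes t: "tdeg p \<le> n"
  shows "\<exists>C\<ge>0. \<forall>x y z \<rho>. 1 \<le> \<rho> \<longrightarrow> norm x \<le> \<rho> \<longrightarrow> norm y \<le> \<rho> \<longrightarrow> norm z \<le> \<rho> \<longrightarrow> norm (cev x y z p) \<le> C * \<rho> ^ n"
proof -
  define C where "C = (\<Sum>k\<le>degree p. \<Sum>j\<le>degree (coeff p k). \<Sum>i\<le>degree (coeff (coeff p k) j). norm (mcoeff p i j k))"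
  have C: "C \<ge> 0" unfolding C_def by (intro sum_nonneg) auto
  have "norm (cev x y z p) \<le> C * \<rho> ^ n" if h: "1 \<le> \<rho>" "norm x \<le> \<rho>" "norm y \<le> \<rho>" "norm z \<le> \<rho>" for x y z \<rho>
  proof -
    have b: "norm (mcoeff p i j k * x ^ i * y ^ j * z ^ k) \<le> norm (mcoeff p i j k) * \<rho> ^ n" for i j k
    proof (cases "mcoeff p i j k = 0")
      case False
      hence ijk: "i + j + k \<le> n" using t by (metis leI tdeg_le_iff)
      have "norm (mcoeff p i j k * x ^ i * y ^ j * z ^ k) = norm (mcoeff p i j k) * (norm x ^ i * norm y ^ j * norm z ^ k)"
        by (simp add: norm_mult norm_power mult.assoc)
      also have "norm x ^ i * norm y ^ j * norm z ^ k \<le> \<rho> ^ i * \<rho> ^ j * \<rho> ^ k"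
        using h by (intro mult_mono power_mono) auto
      also have "\<dots> = \<rho> ^ (i + j + k)" by (simp add: power_add)
      also have "\<dots> \<le> \<rho> ^ n" using h(1) ijk by (intro power_increasing)
      finally show ?thesis by (simp add: mult_left_mono)
    qed simp
    have "norm (cev x y z p) \<le> (\<Sum>k\<le>degree p. \<Sum>j\<le>degree (coeff p k). \<Sum>i\<le>degree (coeff (coeff p k) j). norm (mcoeff p i j k) * \<rho> ^ n)"
      unfolding cev_expand by (intro sum_norm_le b)
    thus ?thesis by (simp add: C_def sum_distrib_right)
  qed
  thus ?thesis using C by blast
qed

subsection \<open>Shears\<close>

definition shear :: "complex \<Rightarrow> complex \<Rightarrow> mp3 \<Rightarrow> mp3" where
  "shear \<alpha> \<beta> = ev3 K3 (X3 + K3 \<alpha> * Z3) (Y3 + K3 \<beta> * Z3) Z3"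

lemma shear_rhom: "rhom (shear \<alpha> \<beta>)"
  unfolding shear_def by (rule ev3_rhom[OF K3_rhom])

lemma shear_gens: "shear \<alpha> \<beta> (K3 c) = K3 c" "shear \<alpha> \<beta> X3 = X3 + K3 \<alpha> * Z3"
  "shear \<alpha> \<beta> Y3 = Y3 + K3 \<beta> * Z3" "shear \<alpha> \<beta> Z3 = Z3"
  by (simp_all add: shear_def ev3_gens K3_rhom)

lemma ev3_shear: assumes i: "rhom \<iota>"
  shows "ev3 \<iota> x y z (shear \<alpha> \<beta> p) = ev3 \<iota> (x + \<iota> \<alpha> * z) (y + \<iota> \<beta> * z) z p"
  by (rule mp3_hom_eqI[OF rhom_comp[OF shear_rhom ev3_rhom[OF i]] ev3_rhom[OF i]])
     (simp_all add: shear_gens ev3_gens[OF i] rhom_add[OF ev3_rhom[OF i]] rhom_mult[OF ev3_rhom[OF i]])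

lemma shear_inverse: "shear (-\<alpha>) (-\<beta>) (shear \<alpha> \<beta> p) = p"
  by (rule mp3_hom_eqI[OF rhom_comp[OF shear_rhom shear_rhom] rhom_id])
     (simp_all add: shear_gens rhom_add[OF shear_rhom] rhom_mult[OF shear_rhom] rhom_uminus[OF K3_rhom])

lemma shear_inverse': "shear \<alpha> \<beta> (shear (-\<alpha>) (-\<beta>) p) = p"
  using shear_inverse[of "-\<alpha>" "-\<beta>" p] by simp

lemma H3_shear: "H3 (shear \<alpha> \<beta> p) = map_poly (shear \<alpha> \<beta>) (H3 p)"
  by (rule mp3_hom_eqI[OF rhom_comp[OF shear_rhom H3_rhom] rhom_comp[OF H3_rhom map_poly_rhom[OF shear_rhom]]])
     (simp_all add: shear_gens H3_gens rhom_add[OF H3_rhom] rhom_mult[OF H3_rhom] map_poly_pCons map_poly_monom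
       rhom_0[OF shear_rhom] add_monom[symmetric] smult_monom)

lemma tdeg_shear: "tdeg (shear \<alpha> \<beta> p) \<le> tdeg p"
  unfolding tdeg_def H3_shear by (intro degree_map_poly_le rhom_0 shear_rhom)

lemma degree_le_tdeg: "degree p \<le> tdeg p"
proof (rule degree_le, intro allI impI)
  fix k assume "tdeg p < k"
  hence "mcoeff p i j k = 0" for i j using tdeg_le_iff[of p "tdeg p"] by auto
  thus "coeff p k = 0" unfolding mcoeff_def by (intro poly_eqI) auto
qed

lemma coeff_top: assumes "tdeg p \<le> D" shows "coeff p D = [:[:mcoeff p 0 0 D:]:]"
proof (intro poly_eqI)
  fix j i
  show "coeff (coeff (coeff p D) j) i = coeff (coeff [:[:mcoeff p 0 0 D:]:] j) i"
    using assms[unfolded tdeg_le_iff, rule_format, of i j D]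
    by (cases i; cases j) (auto simp: mcoeff_def)
qed

lemma cev_001: "cev 0 0 1 r = (\<Sum>k\<le>degree r. mcoeff r 0 0 k)"
proof -
  have c: "pev h 0 p = h (coeff p 0)" if "rhom h" for h :: "'x::comm_ring_1 \<Rightarrow> 'y::comm_ring_1" and p
    by (cases p) (simp add: pev_pCons[OF that])
  have "cev 0 0 1 r = (\<Sum>k\<le>degree r. pev (pev (\<lambda>c. c) 0) 0 (coeff r k) * 1 ^ k)"
    unfolding ev3_def by (rule pev_altdef) (auto intro!: pev_rhom rhom_id)
  also have "\<dots> = (\<Sum>k\<le>degree r. mcoeff r 0 0 k)"
    by (simp add: c[OF rhom_id] c[OF pev_rhom[OF rhom_id]] mcoeff_def)
  finally show ?thesis .
qed

text \<open>After the shear, the coefficient of \<open>z ^ D\<close> is the part of degree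
  \<open>D\<close> evaluated at the direction \<open>(\<alpha>, \<beta>, 1)\<close>. For
  \<open>D\<close> the total degree, a nonzero value makes the sheared polynomial monic in
  \<open>z\<close> up to a scalar.\<close>

lemma mcoeff_shear_top:
  "mcoeff (shear \<alpha> \<beta> p) 0 0 D = cev \<alpha> \<beta> 1 (coeff (H3 p) D)"
proof -
  define r where "r = coeff (H3 (shear \<alpha> \<beta> p)) D"
  have r: "r = shear \<alpha> \<beta> (coeff (H3 p) D)"
    by (simp add: r_def H3_shear coeff_map_poly rhom_0[OF shear_rhom])
  have "cev \<alpha> \<beta> 1 (coeff (H3 p) D) = cev 0 0 1 r"
    by (simp add: r ev3_shear[OF rhom_id])
  also have "\<dots> = (\<Sum>k\<le>degree r. if k = D then mcoeff r 0 0 D else 0)"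
    unfolding cev_001 by (rule sum.cong) (auto simp: r_def mcoeff_H3)
  also have "\<dots> = mcoeff r 0 0 D"
    by (simp add: mcoeff_def coeff_eq_0)
  also have "\<dots> = mcoeff (shear \<alpha> \<beta> p) 0 0 D" by (simp add: r_def mcoeff_H3)
  finally show ?thesis by simp
qed

lemma cev2_pev: "cev2 x y R = pev (\<lambda>a. poly a x) y R"
proof -
  have "pev (\<lambda>c. c) x = (\<lambda>a. poly a x)" by (simp add: fun_eq_iff pev_id)
  thus ?thesis by (simp add: cev2_def)
qed

lemma cev2_univariate: "cev2 x y R = poly (map_poly (\<lambda>a. poly a x) R) y"
  by (simp add: cev2_pev pev_def)

lemma cev2_swap: "cev2 x y R = poly (poly R [:y:]) x"
  unfolding cev2_pev
  by (induction R) (simp_all add: pev_0 pev_pCons[OF rhom_poly])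

lemma map_poly_eval_nonzero:
  fixes R :: mp2 assumes "poly (lead_coeff R) x \<noteq> 0"
  shows "map_poly (\<lambda>a. poly a x) R \<noteq> 0" "degree (map_poly (\<lambda>a. poly a x) R) = degree R"
proof -
  have "coeff (map_poly (\<lambda>a. poly a x) R) (degree R) \<noteq> 0" using assms by (simp add: coeff_map_poly)
  thus "map_poly (\<lambda>a. poly a x) R \<noteq> 0" by auto
  show "degree (map_poly (\<lambda>a. poly a x) R) = degree R"
    using \<open>coeff _ _ \<noteq> 0\<close> by (intro antisym degree_map_poly_le le_degree) auto
qed

lemma finite_bad_x: "(R::mp2) \<noteq> 0 \<Longrightarrow> finite {x. poly (lead_coeff R) x = 0}"
  by (intro poly_roots_finite) simp

lemma finite_bad_y: "poly (lead_coeff (R::mp2)) x \<noteq> 0 \<Longrightarrow> finite {y. cev2 x y R = 0}"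
  unfolding cev2_univariate by (intro poly_roots_finite map_poly_eval_nonzero)

lemma finite_complex_avoid: "finite A \<Longrightarrow> finite B \<Longrightarrow> \<exists>x::complex. x \<notin> A \<and> x \<notin> B"
  using ex_new_if_finite[OF infinite_UNIV_char_0, of "A \<union> B"] by auto

lemma nonzero_point: assumes "(q::mp3) \<noteq> 0" shows "\<exists>x y z. cev x y z q \<noteq> 0"
proof -
  let ?R = "lead_coeff q"
  have R: "?R \<noteq> 0" using assms by simp
  obtain x where x: "poly (lead_coeff ?R) x \<noteq> 0"
    using finite_complex_avoid[OF finite_bad_x[OF R] finite.emptyI] by auto
  obtain y where y: "cev2 x y ?R \<noteq> 0"
    using finite_complex_avoid[OF finite_bad_y[OF x] finite.emptyI] by auto
  have "coeff (map_poly (cev2 x y) q) (degree q) \<noteq> 0"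
    using y by (simp add: coeff_map_poly rhom_0[OF cev2_rhom])
  hence "map_poly (cev2 x y) q \<noteq> 0" by auto
  then obtain z where "poly (map_poly (cev2 x y) q) z \<noteq> 0"
    using finite_complex_avoid[OF poly_roots_finite finite.emptyI] by blast
  thus ?thesis by (auto simp: cev_eq_pev pev_def)
qed

text \<open>The three directions \<open>(\<alpha>, \<beta>, 1)\<close>, \<open>(\<alpha>', \<beta>, 1)\<close>, \<open>(\<alpha>, \<beta>', 1)\<close> span \<open>\<complex>\<^sup>3\<close>.\<close>
lemma three_good_shears:
  assumes p: "p \<noteq> 0" and D: "D = tdeg p"
  shows "\<exists>\<alpha> \<alpha>' \<beta> \<beta>'. \<alpha> \<noteq> \<alpha>' \<and> \<beta> \<noteq> \<beta>' \<and> cev \<alpha> \<beta> 1 (coeff (H3 p) D) \<noteq> 0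
     \<and> cev \<alpha>' \<beta> 1 (coeff (H3 p) D) \<noteq> 0 \<and> cev \<alpha> \<beta>' 1 (coeff (H3 p) D) \<noteq> 0"
proof -
  define r where "r = coeff (H3 p) D"
  have r0: "r \<noteq> 0" using p by (simp add: r_def D tdeg_def H3_eq_0)
  have rh: "mcoeff r i j k = 0" if "i + j + k \<noteq> D" for i j k using that by (auto simp: r_def mcoeff_H3)
  \<comment> \<open>Setting \<open>z = 1\<close> in the form \<open>r\<close> of degree
    \<open>D\<close> keeps monomials apart, because the exponent of \<open>z\<close> is determined
    by the other two; hence \<open>R\<close> is nonzero.\<close>
  define R where "R = poly r 1"
  have cR: "cev a b 1 r = cev2 a b R" for a b
  proof -
    have "cev2 a b (poly r 1) = pev (cev2 a b) 1 r"
      using pev_comp[OF rhom_id cev2_rhom, of a b 1 r] by (simp add: pev_id rhom_1[OF cev2_rhom])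
    thus ?thesis by (simp add: R_def cev_eq_pev)
  qed
  obtain i j k where ijk: "mcoeff r i j k \<noteq> 0" using r0 mcoeff_eqI[of r 0] by (auto simp: mcoeff_0)
  have kD: "i + j + k = D" using rh ijk by blast
  have "R = (\<Sum>k\<le>degree r. coeff r k)" by (simp add: R_def poly_altdef)
  hence "coeff (coeff R j) i = (\<Sum>k'\<le>degree r. mcoeff r i j k')" by (simp add: coeff_sum mcoeff_def)
  also have "\<dots> = (\<Sum>k'\<le>degree r. if k' = k then mcoeff r i j k else 0)"
    by (rule sum.cong) (use rh kD in auto)
  also have "\<dots> = mcoeff r i j k" by (simp add: mcoeff_def coeff_eq_0)
  finally have R0: "R \<noteq> 0" using ijk by auto
  obtain \<alpha> where a: "poly (lead_coeff R) \<alpha> \<noteq> 0"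
    using finite_complex_avoid[OF finite_bad_x[OF R0] finite.emptyI] by auto
  obtain \<alpha>' where a': "poly (lead_coeff R) \<alpha>' \<noteq> 0" "\<alpha> \<noteq> \<alpha>'"
    using finite_complex_avoid[OF finite_bad_x[OF R0], of "{\<alpha>}"] by auto
  obtain \<beta> where b: "cev2 \<alpha> \<beta> R \<noteq> 0" "cev2 \<alpha>' \<beta> R \<noteq> 0"
    using finite_complex_avoid[OF finite_bad_y[OF a] finite_bad_y[OF a'(1)]] by auto
  obtain \<beta>' where b': "cev2 \<alpha> \<beta>' R \<noteq> 0" "\<beta> \<noteq> \<beta>'"
    using finite_complex_avoid[OF finite_bad_y[OF a], of "{\<beta>}"] by auto
  show ?thesis unfolding r_def[symmetric] cR
    using a' b b' by blast
qed

subsection \<open>Growth and divisibility\<close>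

text \<open>The estimate is assumed only off the finitely many zeros of \<open>E\<close> and passes
  to \<open>y0\<close> by continuity.\<close>

lemma limit_zero:
  fixes A B E :: "complex poly"
  assumes E: "E \<noteq> 0" and bd: "\<And>y. norm y \<le> \<rho> \<Longrightarrow> poly E y \<noteq> 0 \<Longrightarrow> norm (poly A y) \<le> C * norm (poly B y)"
    and y0: "norm y0 < \<rho>" and B: "poly B y0 = 0"
  shows "poly A y0 = 0"
proof -
  have "finite {y. poly E y = 0}" by (rule poly_roots_finite[OF E])
  hence "open (- ({y. poly E y = 0} - {y0}))" by (intro open_Compl finite_imp_closed) auto
  hence ev1: "eventually (\<lambda>y. y \<in> - ({y. poly E y = 0} - {y0})) (nhds y0)"
    by (rule eventually_nhds_in_open) auto
  have "open {y::complex. norm y < \<rho>}" by (intro open_Collect_less continuous_intros)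
  hence ev2: "eventually (\<lambda>y. y \<in> {y. norm y < \<rho>}) (nhds y0)"
    using y0 by (intro eventually_nhds_in_open) auto
  have ev: "eventually (\<lambda>y. norm (poly A y) \<le> C * norm (poly B y)) (at y0)"
    using ev1 ev2 unfolding eventually_at_filter
    by eventually_elim (use bd in auto)
  have l1: "((\<lambda>y. norm (poly A y)) \<longlongrightarrow> norm (poly A y0)) (at y0)" by (intro tendsto_intros)
  have l2: "((\<lambda>y. C * norm (poly B y)) \<longlongrightarrow> C * norm (poly B y0)) (at y0)" by (intro tendsto_intros)
  have "norm (poly A y0) \<le> C * norm (poly B y0)"
    by (rule tendsto_le[OF at_neq_bot l2 l1 ev])
  thus ?thesis using B by simp
qed

text \<open>The reversed polynomial at \<open>s = 1/t\<close> tends to the leading coefficient as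
  \<open>s\<close> tends to 0, whereas a degree above \<open>m\<close> would bound it by
  \<open>C * s\<close>.\<close>

lemma univariate_growth:
  fixes q E :: "complex poly"
  assumes E: "E \<noteq> 0" and bd: "\<And>t::real. t \<ge> 1 \<Longrightarrow> poly E (of_real t) \<noteq> 0 \<Longrightarrow> norm (poly q (of_real t)) \<le> C * t ^ m"
  shows "degree q \<le> m"
proof (rule ccontr)
  assume "\<not> degree q \<le> m"
  define n where "n = degree q"
  have nm: "m < n" using \<open>\<not> degree q \<le> m\<close> by (simp add: n_def)
  have q0: "q \<noteq> 0" using nm n_def by auto
  have fE: "finite {y. poly E y = 0}" by (rule poly_roots_finite[OF E])
  define B where "B = (\<Sum>y\<in>{y. poly E y = 0}. norm y)"
  have B: "norm y \<le> B" if "poly E y = 0" for y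
    unfolding B_def using that fE by (intro member_le_sum) auto
  define b where "b = max 1 (B + 1)"
  have b: "b \<ge> 1" "b > B" by (auto simp: b_def)
  have ev: "eventually (\<lambda>s. norm (poly (reflect_poly q) (of_real s)) \<le> C * s) (at_right 0)"
  proof -
    have "eventually (\<lambda>s::real. s \<in> {0<..<1 / b}) (at_right 0)"
      using b by (intro eventually_at_right_real) auto
    thus ?thesis
    proof eventually_elim
      case (elim s)
      have s: "s > 0" "1 / s > b" using elim b by (auto simp: field_simps)
      have s1: "s \<le> 1" using elim b by (auto simp: field_simps) (smt (verit, best) mult_le_cancel_left1)
      have Ez: "poly E (of_real (1 / s)) \<noteq> 0"
      proof
        assume "poly E (of_real (1 / s)) = 0"
        hence "norm (of_real (1 / s) :: complex) \<le> B" by (rule B)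
        thus False using s b by (simp add: norm_divide)
      qed
      have bq: "norm (poly q (of_real (1 / s))) \<le> C * (1 / s) ^ m"
        using bd[OF _ Ez] s s1 b by auto
      have Cnn: "C * (1 / s) ^ m \<ge> 0" using bq norm_ge_zero order_trans by blast
      hence C0: "C \<ge> 0" using s by (simp add: zero_le_mult_iff power_le_zero_eq)
      have "norm (poly (reflect_poly q) (of_real s)) = s ^ n * norm (poly q (of_real (1 / s)))"
        using s by (simp add: poly_reflect_poly_nz n_def norm_mult norm_power inverse_eq_divide)
      also have "\<dots> \<le> s ^ n * (C * (1 / s) ^ m)" using s bq by (intro mult_left_mono) auto
      also have "\<dots> = C * s ^ (n - m)"
        using s nm by (simp add: power_diff power_divide field_simps)
      also have "\<dots> \<le> C * s ^ 1"
        using s s1 nm C0 by (intro mult_left_mono power_decreasing) auto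
      finally show ?case by simp
    qed
  qed
  have l1: "((\<lambda>s. norm (poly (reflect_poly q) (of_real s))) \<longlongrightarrow> norm (poly (reflect_poly q) (of_real 0))) (at_right 0)"
    by (intro tendsto_intros)
  have l2: "((\<lambda>s. C * s) \<longlongrightarrow> C * 0) (at_right 0)" by (intro tendsto_intros)
  have "norm (poly (reflect_poly q) (of_real 0)) \<le> C * 0"
    by (rule tendsto_le[OF trivial_limit_at_right_real l2 l1 ev])
  thus False using q0 by simp
qed

text \<open>Restrict to the line \<open>(t x, t y, t z)\<close> through a point where the leading
  forms of \<open>T\<close> and of \<open>E\<close> are both nonzero: along it \<open>T\<close> has
  degree at least \<open>tdeg T\<close>, and \<open>E\<close> vanishes at finitely many
  \<open>t\<close> only.\<close>

lemma tdeg_le_of_growth: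
  assumes E: "(E::mp2) \<noteq> 0"
    and bd: "\<And>x y z \<rho>. 1 \<le> \<rho> \<Longrightarrow> norm x \<le> \<rho> \<Longrightarrow> norm y \<le> \<rho> \<Longrightarrow> norm z \<le> \<rho> \<Longrightarrow> cev2 x y E \<noteq> 0
      \<Longrightarrow> norm (cev x y z T) \<le> C * \<rho> ^ m"
  shows "tdeg T \<le> m"
proof (cases "T = 0")
  case False
  define r where "r = lead_coeff (H3 T)"
  define r' where "r' = lead_coeff (H3 [:E:])"
  have "r * r' \<noteq> 0" using False E by (simp add: r_def r'_def H3_eq_0)
  then obtain x y z where xyz: "cev x y z (r * r') \<noteq> 0" using nonzero_point by blast
  hence nz: "cev x y z r \<noteq> 0" "cev x y z r' \<noteq> 0" by (auto simp: rhom_mult[OF cev_rhom])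
  define q where "q = map_poly (cev x y z) (H3 T)"
  define e where "e = map_poly (cev x y z) (H3 [:E:])"
  have c0: "cev x y z 0 = 0" by (rule rhom_0[OF cev_rhom])
  have e0: "e \<noteq> 0"
  proof -
    have "coeff e (degree (H3 [:E:])) \<noteq> 0" using nz by (simp add: e_def coeff_map_poly c0 r'_def)
    thus ?thesis by auto
  qed
  have "coeff q (degree (H3 T)) \<noteq> 0" using nz by (simp add: q_def coeff_map_poly c0 r_def)
  hence dq: "degree q \<ge> tdeg T" unfolding tdeg_def by (rule le_degree)
  define V where "V = max 1 (max (norm x) (max (norm y) (norm z)))"
  have V: "V \<ge> 1" "norm x \<le> V" "norm y \<le> V" "norm z \<le> V" by (auto simp: V_def)
  have "degree q \<le> m"
  proof (rule univariate_growth[OF e0, where C = "C * V ^ m"])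
    fix t :: real assume t: "t \<ge> 1" "poly e (of_real t) \<noteq> 0"
    have "poly e (of_real t) = cev (t * x) (t * y) (t * z) [:E:]"
      using cev_H3[of x y z "of_real t" "[:E:]"] by (simp add: e_def pev_def)
    hence Et: "cev2 (t * x) (t * y) E \<noteq> 0" using t by (simp add: cev_const)
    have "1 * 1 \<le> t * V" using t V by (intro mult_mono) auto
    hence "norm (cev (t * x) (t * y) (t * z) T) \<le> C * (t * V) ^ m"
      using t V Et by (intro bd) (auto simp: norm_mult intro!: mult_left_mono)
    moreover have "poly q (of_real t) = cev (t * x) (t * y) (t * z) T"
      using cev_H3[of x y z "of_real t" T] by (simp add: q_def pev_def)
    ultimately show "norm (poly q (of_real t)) \<le> C * V ^ m * t ^ m"
      by (simp add: power_mult_distrib mult_ac)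
  qed
  thus ?thesis using dq by simp
qed (simp add: tdeg_0)

text \<open>A form of Riemann's extension theorem: if \<open>N/d\<close> is locally bounded off the
  curve \<open>E = 0\<close>, it is a polynomial. After the gcd is cancelled, a prime factor of the
  denominator would by continuity force the numerator to vanish on its zero set, against
  coprimality.\<close>

lemma dvd_of_locally_bounded:
  fixes N d E :: mp2
  assumes d: "d \<noteq> 0" and E: "E \<noteq> 0"
    and bd: "\<And>\<rho>. \<exists>C. \<forall>x y. norm x \<le> \<rho> \<longrightarrow> norm y \<le> \<rho> \<longrightarrow> cev2 x y E \<noteq> 0 \<longrightarrow> norm (cev2 x y N) \<le> C * norm (cev2 x y d)"
  shows "d dvd N"
proof -
  note m = rhom_mult[OF cev2_rhom]
  define g where "g = gcd N d"
  have g0: "g \<noteq> 0" using d by (simp add: g_def)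
  obtain N1 d1 where h: "N = N1 * g" "d = d1 * g" and cop: "coprime N1 d1"
    using gcd_coprime_exists[of N d] g0 unfolding g_def by blast
  have N1: "N = g * N1" and d1: "d = g * d1" using h by (simp_all add: mult.commute)
  define E1 where "E1 = E * g"
  have E1: "E1 \<noteq> 0" using E g0 by (simp add: E1_def)
  have bd1: "\<exists>C. \<forall>x y. norm x \<le> \<rho> \<longrightarrow> norm y \<le> \<rho> \<longrightarrow> cev2 x y E1 \<noteq> 0 \<longrightarrow> norm (cev2 x y N1) \<le> C * norm (cev2 x y d1)" for \<rho>
  proof -
    obtain C where C: "\<And>x y. norm x \<le> \<rho> \<Longrightarrow> norm y \<le> \<rho> \<Longrightarrow> cev2 x y E \<noteq> 0 \<Longrightarrow> norm (cev2 x y N) \<le> C * norm (cev2 x y d)"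
      using bd[of \<rho>] by blast
    have "norm (cev2 x y N1) \<le> C * norm (cev2 x y d1)" if h: "norm x \<le> \<rho>" "norm y \<le> \<rho>" "cev2 x y E1 \<noteq> 0"
      for x y
    proof -
      have g: "cev2 x y g \<noteq> 0" "cev2 x y E \<noteq> 0" using h by (auto simp: E1_def m)
      have "norm (cev2 x y g) * norm (cev2 x y N1) \<le> norm (cev2 x y g) * (C * norm (cev2 x y d1))"
        using C[OF h(1,2) g(2)] by (simp add: N1 d1 m norm_mult mult_ac)
      thus ?thesis using g by simp
    qed
    thus ?thesis by blast
  qed
  have "is_unit d1"
  proof (rule ccontr)
    assume nu: "\<not> is_unit d1"
    have "d1 \<noteq> 0" using d d1 by auto
    then obtain \<pi> where pd: "\<pi> dvd d1" and pp: "prime \<pi>" using prime_divisor_exists nu by blast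
    have pe: "prime_elem \<pi>" using pp by (rule prime_imp_prime_elem)
    have pN: "\<not> \<pi> dvd N1"
      using cop pd pe by (meson coprime_common_divisor not_prime_unit pp)
    obtain s where s: "d1 = \<pi> * s" using pd by (elim dvdE)
    show False
    proof (cases "degree \<pi> > 0")
      case True
      \<comment> \<open>If \<open>\<pi>\<close> involves \<open>y\<close>, a general
        \<open>x\<close> admits a root \<open>y\<close> of \<open>\<pi>\<close>, where the numerator
        vanishes as well, although the eliminant \<open>e\<close> is nonzero at this
        \<open>x\<close>.\<close>
      obtain u v e where e: "e \<noteq> 0" "u * \<pi> + v * N1 = [:e:]" using elimination[OF pe True pN] by blast
      have pi0: "\<pi> \<noteq> 0" using True by auto
      have "e * lead_coeff \<pi> * lead_coeff E1 \<noteq> 0" using e pi0 E1 by simp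
      then obtain x where "poly (e * lead_coeff \<pi> * lead_coeff E1) x \<noteq> 0"
        using finite_complex_avoid[OF poly_roots_finite finite.emptyI] by blast
      hence x: "poly e x \<noteq> 0" "poly (lead_coeff \<pi>) x \<noteq> 0" "poly (lead_coeff E1) x \<noteq> 0" by auto
      let ?M = "map_poly (\<lambda>a. poly a x)"
      have "degree (?M \<pi>) > 0" using map_poly_eval_nonzero[OF x(2)] True by simp
      then obtain y where y: "poly (?M \<pi>) y = 0"
        using fundamental_theorem_of_algebra_alt[of "?M \<pi>"] by (metis degree_pCons_0 less_irrefl)
      obtain C where C: "\<And>x' y'. norm x' \<le> norm x + norm y + 1 \<Longrightarrow> norm y' \<le> norm x + norm y + 1 \<Longrightarrow> cev2 x' y' E1 \<noteq> 0
           \<Longrightarrow> norm (cev2 x' y' N1) \<le> C * norm (cev2 x' y' d1)"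
        using bd1[of "norm x + norm y + 1"] by blast
      have "poly (?M N1) y = 0"
      proof (rule limit_zero[OF map_poly_eval_nonzero(1)[OF x(3)], where \<rho> = "norm x + norm y + 1"
        and C = C and B = "?M d1"])
        fix y' assume "norm y' \<le> norm x + norm y + 1" "poly (?M E1) y' \<noteq> 0"
        thus "norm (poly (?M N1) y') \<le> C * norm (poly (?M d1) y')"
          using C[of x y'] by (simp add: cev2_univariate)
      next
        show "norm y < norm x + norm y + 1" using norm_ge_zero[of x] by linarith
        have "cev2 x y d1 = 0" using y by (simp add: s m) (simp add: cev2_univariate)
        thus "poly (?M d1) y = 0" by (simp add: cev2_univariate)
      qed
      hence "cev2 x y (u * \<pi> + v * N1) = 0"
        using y by (simp add: m rhom_add[OF cev2_rhom]) (simp add: cev2_univariate)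
      thus False using x(1) unfolding e(2) by (simp add: cev2_pev pev_const[OF rhom_poly])
    next
      case False
      \<comment> \<open>If \<open>\<pi>\<close> depends on \<open>x\<close> alone, its zero set
        contains a line of constant \<open>x\<close>; the numerator vanishes at all but finitely
        many points of this line, hence on all of it.\<close>
      then obtain a where a: "\<pi> = [:a:]" by (metis degree_eq_zeroE gr0I)
      have "a \<noteq> 0" using pe a by auto
      have "degree a > 0"
      proof (rule ccontr)
        assume "\<not> degree a > 0"
        then obtain c where "a = [:c:]" by (metis degree_eq_zeroE gr0I)
        hence "is_unit \<pi>" using \<open>a \<noteq> 0\<close> by (simp add: a is_unit_const_poly_iff is_unit_pCons_iff)
        thus False using pp not_prime_unit by blast
      qed
      then obtain x where x: "poly a x = 0"
        using fundamental_theorem_of_algebra_alt[of a] by (metis degree_pCons_0 less_irrefl)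
      have "{y. poly E1 [:y:] = 0} = (\<lambda>y. [:y:]) -` {w. poly E1 w = 0}" by auto
      also have "finite \<dots>" by (intro finite_vimageI poly_roots_finite E1) (auto simp: inj_def)
      finally have fy: "finite {y. poly E1 [:y:] = 0}" .
      have zz: "cev2 x y N1 = 0" if y: "poly E1 [:y:] \<noteq> 0" for y
      proof -
        obtain C where C: "\<And>x' y'. norm x' \<le> norm x + norm y + 1 \<Longrightarrow> norm y' \<le> norm x + norm y + 1 \<Longrightarrow> cev2 x' y' E1 \<noteq> 0
           \<Longrightarrow> norm (cev2 x' y' N1) \<le> C * norm (cev2 x' y' d1)"
          using bd1[of "norm x + norm y + 1"] by blast
        have "poly (poly N1 [:y:]) x = 0"
        proof (rule limit_zero[OF y, where \<rho> = "norm x + norm y + 1" and C = C and B = "poly d1 [:y:]"])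
          fix x' assume "norm x' \<le> norm x + norm y + 1" "poly (poly E1 [:y:]) x' \<noteq> 0"
          thus "norm (poly (poly N1 [:y:]) x') \<le> C * norm (poly (poly d1 [:y:]) x')"
            using C[of x' y] by (simp add: cev2_swap)
        next
          show "norm x < norm x + norm y + 1" using norm_ge_zero[of y] by linarith
          show "poly (poly d1 [:y:]) x = 0" using x by (simp add: s a)
        qed
        thus ?thesis by (simp add: cev2_swap)
      qed
      have "map_poly (\<lambda>a. poly a x) N1 = 0"
      proof (rule ccontr)
        assume "map_poly (\<lambda>a. poly a x) N1 \<noteq> 0"
        hence "finite {y. poly (map_poly (\<lambda>a. poly a x) N1) y = 0}" by (rule poly_roots_finite)
        from finite_complex_avoid[OF this fy] show False using zz by (auto simp: cev2_univariate)
      qed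
      hence "poly (coeff N1 n) x = 0" for n by (metis coeff_0 coeff_map_poly poly_0)
      hence "[:-x, 1:] dvd coeff N1 n" for n by (simp add: poly_eq_0_iff_dvd)
      hence dN: "[:[:-x, 1:]:] dvd N1" by (simp add: const_poly_dvd_iff)
      obtain b where b: "a = [:-x, 1:] * b" using x by (auto simp: poly_eq_0_iff_dvd elim: dvdE)
      have "\<pi> = [:[:-x,1:]:] * [:b:]" by (simp add: a b)
      hence "\<pi> dvd [:[:-x,1:]:] \<or> \<pi> dvd [:b:]" using pe by (metis dvd_refl prime_elem_dvd_mult_iff)
      moreover have "\<not> \<pi> dvd [:b:]"
      proof
        assume "\<pi> dvd [:b:]"
        hence "a dvd b" by (simp add: a)
        moreover have "b \<noteq> 0" using \<open>a \<noteq> 0\<close> b by auto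
        ultimately have "degree a \<le> degree b" by (rule dvd_imp_degree_le)
        moreover have "degree a = Suc (degree b)"
          using \<open>b \<noteq> 0\<close> by (subst b) (simp add: degree_mult_eq del: mult_pCons_left)
        ultimately show False by simp
      qed
      ultimately show False using dN pN dvd_trans by blast
    qed
  qed
  thus ?thesis using N1 d1 by (metis dvd_times_left_cancel_iff g0 unit_imp_dvd)
qed

text \<open>The hypothesis describes a root of a polynomial whose coefficient of
  \<open>z ^ k\<close> is of size at most \<open>A k * s ^ (n - k)\<close>. The bound is linear in
  the scale \<open>s\<close>, because beyond it the leading term dominates.\<close>

lemma root_bound:
  fixes z :: complex and A :: "nat \<Rightarrow> real"
  assumes c: "c > 0" and s: "s > 0" and A: "\<And>k. k < n \<Longrightarrow> A k \<ge> 0"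
    and h: "c * norm z ^ n \<le> (\<Sum>k<n. A k * s ^ (n - k) * norm z ^ k)"
  shows "norm z \<le> (1 + (\<Sum>k<n. A k) / c) * s"
proof (rule ccontr)
  assume "\<not> norm z \<le> (1 + (\<Sum>k<n. A k) / c) * s"
  hence big: "norm z > (1 + (\<Sum>k<n. A k) / c) * s" by simp
  have nn: "(\<Sum>k<n. A k) / c \<ge> 0" using A c by (intro divide_nonneg_pos sum_nonneg) auto
  hence "1 * s \<le> (1 + (\<Sum>k<n. A k) / c) * s" using s by (intro mult_right_mono) auto
  hence zs: "norm z > s" using big by linarith
  have n0: "n > 0" using h c by (cases n) auto
  have "c * norm z ^ n \<le> (\<Sum>k<n. A k * (s * norm z ^ (n - 1)))"
  proof (rule order_trans[OF h], rule sum_mono)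
    fix k assume k: "k \<in> {..<n}"
    have "s ^ (n - k) * norm z ^ k = s * (s ^ (n - k - 1) * norm z ^ k)"
      using k by (simp flip: power_Suc add: mult.assoc[symmetric] Suc_diff_Suc)
    also have "\<dots> \<le> s * (norm z ^ (n - k - 1) * norm z ^ k)"
      using s zs by (intro mult_left_mono mult_right_mono power_mono) auto
    also have "norm z ^ (n - k - 1) * norm z ^ k = norm z ^ (n - 1)"
      using k by (simp add: power_add[symmetric])
    finally show "A k * s ^ (n - k) * norm z ^ k \<le> A k * (s * norm z ^ (n - 1))"
      using A k by (simp add: mult.assoc mult_left_mono)
  qed
  also have "\<dots> = (\<Sum>k<n. A k) * s * norm z ^ (n - 1)" by (simp add: sum_distrib_right mult.assoc)
  finally have "c * norm z * norm z ^ (n - 1) \<le> (\<Sum>k<n. A k) * s * norm z ^ (n - 1)"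
    using n0 by (cases n) (auto simp: mult_ac)
  moreover have "norm z ^ (n - 1) > 0" by (rule zero_less_power) (use zs s in linarith)
  ultimately have "c * norm z \<le> (\<Sum>k<n. A k) * s" by (rule mult_right_le_imp_le)
  hence "norm z \<le> (\<Sum>k<n. A k) / c * s" using c by (simp add: field_simps)
  thus False using big s by (simp add: algebra_simps)
qed

text \<open>The factor \<open>p'(a)\<close> in the prescribed values cancels the denominators of the
  Lagrange basis: \<open>N\<close> is \<open>c\<close> times the sum of the \<open>h(a)\<close>
  times the products of \<open>X - b\<close> over the other roots. Hence the bound does not involve
  the distances between the roots.\<close>

lemma lagrange_bound:
  fixes p N :: "complex poly"
  assumes p: "degree p = D" "lead_coeff p = c" "D > 0" and sf: "\<And>a. poly p a = 0 \<Longrightarrow> poly (pderiv p) a \<noteq> 0"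
    and N: "degree N < D" and val: "\<And>a. poly p a = 0 \<Longrightarrow> poly N a = h a * poly (pderiv p) a"
    and hb: "\<And>a. poly p a = 0 \<Longrightarrow> norm (h a) \<le> B" and rb: "\<And>a. poly p a = 0 \<Longrightarrow> norm a \<le> r"
    and z: "norm z \<le> r" and B: "B \<ge> 0"
  shows "norm (poly N z) \<le> D * (norm c * B * (2 * r) ^ (D - 1))"
proof -
  define R where "R = {a. poly p a = 0}"
  have p0: "p \<noteq> 0" using p by auto
  have fR: "finite R" unfolding R_def by (rule poly_roots_finite[OF p0])
  have rs: "rsquarefree p" unfolding rsquarefree_roots using sf by auto
  have dec: "p = smult c (\<Prod>a\<in>R. [:-a, 1:])"
    using complex_poly_decompose_rsquarefree[OF rs] p(2) by (simp add: R_def)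
  have c0: "c \<noteq> 0" using p0 p(2) by auto
  have cR: "card R = D"
  proof -
    have "D = degree (\<Prod>a\<in>R. [:-a, 1:])" using p(1) c0 by (subst (asm) dec) simp
    also have "\<dots> = (\<Sum>a\<in>R. degree [:-a, 1:])" by (rule degree_prod_eq_sum_degree) auto
    also have "\<dots> = card R" by simp
    finally show ?thesis by simp
  qed
  define Q where "Q = (\<lambda>a. \<Prod>b\<in>R - {a}. [:-b, 1:])"
  have pd: "poly (pderiv p) a = c * poly (Q a) a" if a: "a \<in> R" for a
  proof -
    have "p = smult c ([:-a, 1:] * Q a)" unfolding Q_def using a fR dec by (simp add: prod.remove)
    hence "pderiv p = smult c (pderiv ([:-a, 1:] * Q a))" by (metis pderiv_smult)
    also have "\<dots> = smult c ([:-a, 1:] * pderiv (Q a) + Q a * pderiv [:-a, 1:])"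
      by (simp only: pderiv_mult)
    finally show ?thesis by (simp add: pderiv_pCons)
  qed
  have Q0: "poly (Q a) b = 0" if "b \<in> R" "a \<noteq> b" for a b
    using that fR by (auto simp: Q_def poly_prod intro!: prod_zero bexI[of _ b])
  have dQ: "degree (Q a) \<le> D - 1" if "a \<in> R" for a
  proof -
    have "degree (Q a) = (\<Sum>b\<in>R - {a}. degree [:-b, 1:])"
      unfolding Q_def by (rule degree_prod_eq_sum_degree) auto
    also have "\<dots> = D - 1" using that fR cR by simp
    finally show ?thesis by simp
  qed
  have eq: "N = (\<Sum>a\<in>R. smult (c * h a) (Q a))"
  proof (rule poly_eqI_degree[of R])
    fix b assume b: "b \<in> R"
    have "poly (\<Sum>a\<in>R. smult (c * h a) (Q a)) b = (\<Sum>a\<in>R. if a = b then c * h b * poly (Q b) b else 0)"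
      unfolding poly_sum by (rule sum.cong) (use Q0 b in auto)
    also have "\<dots> = h b * poly (pderiv p) b" using b fR pd by simp
    also have "\<dots> = poly N b" using val[of b] b by (simp add: R_def)
    finally show "poly N b = poly (\<Sum>a\<in>R. smult (c * h a) (Q a)) b" by simp
  next
    show "card R > degree N" using N cR by simp
    have "degree (\<Sum>a\<in>R. smult (c * h a) (Q a)) \<le> D - 1"
      using fR by (intro degree_sum_le order_trans[OF degree_smult_le] dQ)
    thus "card R > degree (\<Sum>a\<in>R. smult (c * h a) (Q a))" using p(3) cR by simp
  qed
  have "norm (poly N z) \<le> (\<Sum>a\<in>R. norm c * B * (2 * r) ^ (D - 1))"
    unfolding eq poly_sum
  proof (rule sum_norm_le)
    fix a assume a: "a \<in> R"
    have "norm (poly (Q a) z) = (\<Prod>b\<in>R - {a}. norm (z - b))"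
      by (simp add: Q_def poly_prod prod_norm[symmetric])
    also have "\<dots> \<le> (\<Prod>b\<in>R - {a}. 2 * r)"
    proof (rule prod_mono, intro conjI)
      fix b assume b: "b \<in> R - {a}"
      have "norm (z - b) \<le> norm z + norm b" by (rule norm_triangle_ineq4)
      thus "norm (z - b) \<le> 2 * r" using z rb[of b] b by (auto simp: R_def)
    qed simp
    also have "\<dots> = (2 * r) ^ (D - 1)" using a fR cR by simp
    finally have q: "norm (poly (Q a) z) \<le> (2 * r) ^ (D - 1)" .
    have "norm (c * h a) \<le> norm c * B"
      using hb[of a] a by (auto simp: R_def norm_mult intro: mult_left_mono)
    hence "norm (c * h a) * norm (poly (Q a) z) \<le> (norm c * B) * (2 * r) ^ (D - 1)"
      using q B by (intro mult_mono) auto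
    thus "norm (poly (smult (c * h a) (Q a)) z) \<le> norm c * B * (2 * r) ^ (D - 1)"
      by (simp add: norm_mult)
  qed
  thus ?thesis using cR by simp
qed

subsection \<open>Lifting the conormal of a surface\<close>

lemma ideal_cong_mult:
  assumes I: "ideal I" and "a - b \<in> I" "c - d \<in> I" shows "a * c - b * d \<in> I"
proof -
  have "a * c - b * d = c * (a - b) + b * (c - d)" by (simp add: algebra_simps)
  also have "\<dots> \<in> I" by (intro ideal_add ideal_mult assms)
  finally show ?thesis .
qed

lemma ideal_cong_power: "ideal I \<Longrightarrow> a - b \<in> I \<Longrightarrow> a ^ n - b ^ n \<in> I"
  by (induction n) (auto simp: ideal_0 intro: ideal_cong_mult)

lemma prime_elem_of_ideal:
  assumes e: "rhom (ev :: 'd::idom \<Rightarrow> 'a::comm_ring_1)" and P: "prime_ideal P" and p0: "p \<noteq> 0"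
    and pP: "\<And>q. ev q \<in> P \<longleftrightarrow> p dvd q"
  shows "prime_elem p"
  unfolding prime_elem_def
proof (intro conjI allI impI p0)
  show "\<not> p dvd 1" using pP[of 1] prime_ideal_1[OF P] by (simp add: rhom_1[OF e])
  fix a b assume "p dvd a * b"
  thus "p dvd a \<or> p dvd b" using pP[of "a * b"] pP prime_ideal_mult[OF P] by (simp add: rhom_mult[OF e])
qed

text \<open>On \<open>V(P)\<close>, a branched cover of the \<open>(x, y)\<close>-plane with fibres the roots of \<open>p\<close>, Lagrange interpolation
  writes \<open>w\<^sup>k \<partial>\<^sub>z p\<close> as the polynomial \<open>\<Sum> w(\<zeta>)\<^sup>k p(z)/(z - \<zeta>)\<close> in \<open>z\<close>. Its coefficients are a priori rational in \<open>x, y\<close>;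
  they have no poles and bounded degree because the roots \<open>\<zeta>\<close> and the values \<open>w(\<zeta>)\<close> satisfy monic equations.\<close>
lemma conductor_lift_monic:
  fixes \<iota> :: "complex \<Rightarrow> 'a::idom" and f :: "nat \<Rightarrow> mp3" and p d g :: mp3
  assumes i: "rhom \<iota>" and P: "prime_ideal P" and pP: "\<And>q. ev3 \<iota> x y z q \<in> P \<longleftrightarrow> p dvd q"
    and D: "degree p = D" "D > 0" "coeff p D = [:[:c:]:]" "c \<noteq> 0" "tdeg p \<le> D"
    and F: "\<And>k. k < r \<Longrightarrow> tdeg (f k) \<le> e" "w ^ r + (\<Sum>k<r. ev3 \<iota> x y z (f k) * w ^ k) \<in> P"
    and rat: "ev3 \<iota> x y z d \<notin> P" "ev3 \<iota> x y z d * w - ev3 \<iota> x y z g \<in> P"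
  shows "\<exists>T. tdeg T \<le> D + k * e \<and> ev3 \<iota> x y z T - w ^ k * ev3 \<iota> x y z (pderiv p) \<in> P"
proof -
  define ev where "ev = ev3 \<iota> x y z"
  have e: "rhom ev" unfolding ev_def by (rule ev3_rhom[OF i])
  note h = rhom_simps[OF e]
  note cm = rhom_simps[OF cev2_rhom]
  have pP: "ev q \<in> P \<longleftrightarrow> p dvd q" for q using pP by (simp add: ev_def)
  have I: "ideal P" by (rule prime_idealD[OF P])
  have p0: "p \<noteq> 0" using D by auto
  have pp: "prime_elem p" by (rule prime_elem_of_ideal[OF e P p0 pP])
  have dp: "degree p > 0" using D by simp
  have "\<not> p dvd d" using rat pP[of d] by (simp add: ev_def)
  \<comment> \<open>Eliminating \<open>z\<close> from the denominator of \<open>w\<close> leaves one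
    in \<open>\<complex>[x, y]\<close>, by which polynomials in \<open>z\<close> can be divided
    coefficientwise.\<close>
  then obtain u v d0 where d0: "d0 \<noteq> 0" "u * p + v * d = [:d0:]" using elimination[OF pp dp] by blast
  have "\<not> p dvd pderiv p"
  proof
    assume "p dvd pderiv p"
    moreover have "pderiv p \<noteq> 0" using dp by (simp add: pderiv_eq_0_iff)
    ultimately have "degree p \<le> degree (pderiv p)" by (rule dvd_imp_degree_le)
    thus False using dp by (simp add: degree_pderiv)
  qed
  \<comment> \<open>\<open>\<delta>\<close> plays the role of the discriminant: off its zeros the
    roots of \<open>p\<close> in the fibre are distinct.\<close>
  then obtain u1 v1 \<delta> where del: "\<delta> \<noteq> 0" "u1 * p + v1 * pderiv p = [:\<delta>:]"
    using elimination[OF pp dp] by blast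
  have evp: "ev p \<in> P" using pP by simp
  define g0 where "g0 = v * g"
  have rat0: "ev [:d0:] * w - ev g0 \<in> P"
  proof -
    have "ev [:d0:] * w - ev g0 = (ev u * w) * ev p + ev v * (ev d * w - ev g)"
      unfolding d0(2)[symmetric] g0_def by (simp add: h algebra_simps)
    also have "\<dots> \<in> P" using rat(2) by (intro ideal_add ideal_mult I evp) (simp add: ev_def)
    finally show ?thesis .
  qed
  have d0P: "ev [:d0:] \<notin> P"
  proof
    assume "ev [:d0:] \<in> P"
    hence "p dvd [:d0:]" using pP by simp
    hence "degree p \<le> degree [:d0:]" using d0(1) by (intro dvd_imp_degree_le) auto
    thus False using dp by simp
  qed
  \<comment> \<open>The equation of \<open>w\<close> with \<open>w = g0/d0\<close> inserted and
    denominators cleared. Being divisible by \<open>p\<close>, it holds at every root of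
    \<open>p\<close> in a fibre, so it bounds the values of \<open>g0/d0\<close> there.\<close>
  define G where "G = g0 ^ r + (\<Sum>k<r. f k * g0 ^ k * [:d0:] ^ (r - k))"
  have "ev G \<in> P"
  proof -
    have gk: "ev g0 ^ k - (ev [:d0:] * w) ^ k \<in> P" for k
      using ideal_cong_power[OF I, of "ev g0" "ev [:d0:] * w" k] ideal_uminus[OF I rat0] by simp
    have "ev G - ev [:d0:] ^ r * (w ^ r + (\<Sum>k<r. ev (f k) * w ^ k))
      = (ev g0 ^ r - (ev [:d0:] * w) ^ r) + (\<Sum>k<r. ev (f k) * ev [:d0:] ^ (r - k) * (ev g0 ^ k - (ev [:d0:] * w) ^ k))"
    proof -
      have "ev [:d0:] ^ r * (\<Sum>k<r. ev (f k) * w ^ k) = (\<Sum>k<r. ev (f k) * ev [:d0:] ^ (r - k) * (ev [:d0:] * w) ^ k)"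
        unfolding sum_distrib_left
      proof (rule sum.cong)
        fix k assume "k \<in> {..<r}"
        hence "ev [:d0:] ^ r = ev [:d0:] ^ (r - k) * ev [:d0:] ^ k" by (simp add: power_add[symmetric])
        thus "ev [:d0:] ^ r * (ev (f k) * w ^ k) = ev (f k) * ev [:d0:] ^ (r - k) * (ev [:d0:] * w) ^ k"
          by (simp add: power_mult_distrib mult_ac)
      qed simp
      moreover have "ev G = ev g0 ^ r + (\<Sum>k<r. ev (f k) * ev [:d0:] ^ (r - k) * ev g0 ^ k)"
        by (simp add: G_def h rhom_sum[OF e] mult_ac)
      ultimately show ?thesis
        by (simp add: right_diff_distrib distrib_left sum_subtractf power_mult_distrib)
    qed
    also have "\<dots> \<in> P" by (intro ideal_add ideal_sum ideal_mult I gk)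
    finally have "ev G - ev [:d0:] ^ r * (w ^ r + (\<Sum>k<r. ev (f k) * w ^ k)) \<in> P" .
    moreover have "ev [:d0:] ^ r * (w ^ r + (\<Sum>k<r. ev (f k) * w ^ k)) \<in> P"
      using F(2) by (intro ideal_mult I) (simp add: ev_def)
    ultimately show ?thesis using ideal_cong_add[OF I] by blast
  qed
  hence pG: "p dvd G" using pP by simp
  define l :: mp2 where "l = [:[:inverse c:]:]"
  have "l * lead_coeff p = 1" using D by (simp add: l_def one_pCons)
  \<comment> \<open>\<open>g0 ^ k\<close> is the numerator of \<open>w ^ k\<close>; the remainder
    \<open>N\<close> will turn out to be \<open>d0 ^ k\<close> times the wanted
    \<open>T\<close>.\<close>
  then obtain s N where sN: "g0 ^ k * pderiv p = p * s + N" "degree N < D"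
    using division_unit_lead[OF _ dp] D(1) by metis

  have fb: "\<exists>C. C \<ge> 0 \<and> (\<forall>x y z \<rho>. 1 \<le> \<rho> \<longrightarrow> norm x \<le> \<rho> \<longrightarrow> norm y \<le> \<rho> \<longrightarrow> norm z \<le> \<rho> \<longrightarrow> norm (cev x y z (f k)) \<le> C * \<rho> ^ e)"
    if "k < r" for k using cev_bound[OF F(1)[OF that]] by blast
  then obtain Cf where Cf: "\<And>k. k < r \<Longrightarrow> Cf k \<ge> 0"
     "\<And>k x y z \<rho>. k < r \<Longrightarrow> 1 \<le> \<rho> \<Longrightarrow> norm x \<le> \<rho> \<Longrightarrow> norm y \<le> \<rho> \<Longrightarrow> norm z \<le> \<rho> \<Longrightarrow> norm (cev x y z (f k)) \<le> Cf k * \<rho> ^ e"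
    by metis
  have pb: "\<exists>C. C \<ge> 0 \<and> (\<forall>x y \<rho>. 1 \<le> \<rho> \<longrightarrow> norm x \<le> \<rho> \<longrightarrow> norm y \<le> \<rho> \<longrightarrow> norm (cev2 x y (coeff p k)) \<le> C * \<rho> ^ (D - k))"
    if "k < D" for k
  proof -
    have "tdeg [:coeff p k:] \<le> D - k"
      unfolding tdeg_le_iff
    proof (intro allI impI)
      fix i j m assume "D - k < i + j + m"
      thus "mcoeff [:coeff p k:] i j m = 0"
        using D(5)[unfolded tdeg_le_iff, rule_format, of i j k] that
        by (cases m) (auto simp: mcoeff_def)
    qed
    from cev_bound[OF this] obtain C where "C \<ge> 0"
      "\<And>x y z \<rho>. 1 \<le> \<rho> \<Longrightarrow> norm x \<le> \<rho> \<Longrightarrow> norm y \<le> \<rho> \<Longrightarrow> norm z \<le> \<rho> \<Longrightarrow> norm (cev x y z [:coeff p k:]) \<le> C * \<rho> ^ (D - k)"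
      by blast
    note C = this
    have "norm (cev2 x y (coeff p k)) \<le> C * \<rho> ^ (D - k)" if "1 \<le> \<rho>" "norm x \<le> \<rho>" "norm y \<le> \<rho>" for x y \<rho>
      using C(2)[OF that, of 0] that by (simp add: cev_const)
    thus ?thesis using C(1) by blast
  qed
  then obtain Cp where Cp: "\<And>k. k < D \<Longrightarrow> Cp k \<ge> 0"
     "\<And>k x y \<rho>. k < D \<Longrightarrow> 1 \<le> \<rho> \<Longrightarrow> norm x \<le> \<rho> \<Longrightarrow> norm y \<le> \<rho> \<Longrightarrow> norm (cev2 x y (coeff p k)) \<le> Cp k * \<rho> ^ (D - k)"
    by metis
  \<comment> \<open>Over a point of size at most \<rho> the roots of \<open>p\<close> are bounded by
    \<open>c1 * \<rho>\<close>, and the values of \<open>w\<close> at them by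
    \<open>c2 * \<rho> ^ e\<close>.\<close>
  define c1 where "c1 = 1 + (\<Sum>k<D. Cp k) / norm c"
  have c1: "c1 \<ge> 1" unfolding c1_def using Cp(1) by (auto intro!: divide_nonneg_nonneg sum_nonneg)
  define c2 where "c2 = 1 + (\<Sum>k<r. Cf k * c1 ^ e)"
  have c2: "c2 \<ge> 1" unfolding c2_def using Cf(1) c1 by (auto intro!: sum_nonneg)
  define C4 where "C4 = D * (norm c * c2 ^ k * (2 * c1) ^ (D - 1))"
  have main: "norm (cev x y z N) \<le> (C4 * \<rho> ^ (D + k * e)) * norm (cev2 x y (d0 ^ k))"
    if \<rho>: "1 \<le> \<rho>" "norm x \<le> \<rho>" "norm y \<le> \<rho>" "norm z \<le> \<rho>" and nz: "cev2 x y (d0 * \<delta>) \<noteq> 0" for x y z \<rho>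
  proof -
    let ?M = "map_poly (cev2 x y)"
    have M: "rhom ?M" by (rule map_poly_rhom[OF cev2_rhom])
    have c0: "cev2 x y 0 = 0" by (rule rhom_0[OF cev2_rhom])
    have evM: "poly (?M q) t = cev x y t q" for q t by (simp add: cev_eq_pev pev_def)
    have Md: "?M (pderiv q) = pderiv (?M q)" for q
      by (rule poly_eqI) (simp add: coeff_pderiv coeff_map_poly c0 cm rhom_of_nat[OF cev2_rhom])
    have Mc: "?M [:a:] = [:cev2 x y a:]" for a by (simp add: map_poly_pCons c0)
    have d0nz: "cev2 x y d0 \<noteq> 0" and dnz: "cev2 x y \<delta> \<noteq> 0" using nz by (auto simp: cm)
    have cc: "cev2 x y [:[:c:]:] = c" by (simp add: cev2_pev pev_const[OF rhom_poly])
    have Mp: "coeff (?M p) D = c" using D(3) by (simp add: coeff_map_poly c0 cc)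
    have dM: "degree (?M p) = D"
      using Mp D by (intro antisym le_degree) (auto intro: degree_map_poly_le[of "cev2 x y" p, OF c0, THEN order_trans])
    have rb: "norm a \<le> c1 * \<rho>" if a: "poly (?M p) a = 0" for a
    proof -
      have "poly (?M p) a = (\<Sum>k<D. cev2 x y (coeff p k) * a ^ k) + c * a ^ D"
        unfolding poly_altdef dM using Mp by (simp add: lessThan_Suc_atMost[symmetric] coeff_map_poly c0)
      hence "c * a ^ D = - (\<Sum>k<D. cev2 x y (coeff p k) * a ^ k)" using a by (simp add: add_eq_0_iff2)
      hence "norm c * norm a ^ D = norm (\<Sum>k<D. cev2 x y (coeff p k) * a ^ k)"
        by (metis norm_minus_cancel norm_mult norm_power)
      also have "\<dots> \<le> (\<Sum>k<D. Cp k * \<rho> ^ (D - k) * norm a ^ k)"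
        using Cp(2)[OF _ \<rho>(1-3)]
          by (intro sum_norm_le) (auto simp: norm_mult norm_power intro!: mult_right_mono)
      finally show ?thesis unfolding c1_def using Cp(1) D \<rho> by (intro root_bound[where n = D]) auto
    qed
    define b where "b = (\<lambda>a. poly (?M g0) a / cev2 x y d0)"
    have bb: "norm (b a) \<le> c2 * \<rho> ^ e" if a: "poly (?M p) a = 0" for a
    proof -
      have "poly (?M G) a = 0" using pG a by (auto simp: dvd_def rhom_mult[OF M])
      moreover have "poly (?M G) a = cev2 x y d0 ^ r * (b a ^ r + (\<Sum>k<r. cev x y a (f k) * b a ^ k))"
      proof -
        have "poly (?M G) a = poly (?M g0) a ^ r + (\<Sum>k<r. poly (?M (f k)) a * poly (?M g0) a ^ k * cev2 x y d0 ^ (r - k))"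
          by (simp add: G_def rhom_simps[OF M] rhom_sum[OF M] Mc poly_sum)
        also have "poly (?M g0) a = cev2 x y d0 * b a" using d0nz by (simp add: b_def)
        also have "(\<Sum>k<r. poly (?M (f k)) a * (cev2 x y d0 * b a) ^ k * cev2 x y d0 ^ (r - k))
          = (\<Sum>k<r. cev2 x y d0 ^ r * (cev x y a (f k) * b a ^ k))"
        proof (rule sum.cong)
          fix k assume "k \<in> {..<r}"
          hence "cev2 x y d0 ^ r = cev2 x y d0 ^ k * cev2 x y d0 ^ (r - k)"
            by (simp add: power_add[symmetric])
          thus "poly (?M (f k)) a * (cev2 x y d0 * b a) ^ k * cev2 x y d0 ^ (r - k) = cev2 x y d0 ^ r * (cev x y a (f k) * b a ^ k)"
            by (simp add: evM power_mult_distrib mult_ac)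
        qed simp
        finally show ?thesis by (simp add: power_mult_distrib distrib_left sum_distrib_left)
      qed
      ultimately have "b a ^ r = - (\<Sum>k<r. cev x y a (f k) * b a ^ k)"
        using d0nz by (simp add: add_eq_0_iff2)
      hence "norm (b a) ^ r = norm (\<Sum>k<r. cev x y a (f k) * b a ^ k)"
        by (metis norm_minus_cancel norm_power)
      also have "\<dots> \<le> (\<Sum>k<r. (Cf k * c1 ^ e) * (\<rho> ^ e) * norm (b a) ^ k)"
      proof (rule sum_norm_le)
        fix k assume k: "k \<in> {..<r}"
        have r1: "\<rho> \<le> c1 * \<rho>" using c1 \<rho>(1) by simp
        have "1 \<le> c1 * \<rho>" "norm x \<le> c1 * \<rho>" "norm y \<le> c1 * \<rho>" using r1 \<rho> by linarith+
        hence "norm (cev x y a (f k)) \<le> Cf k * (c1 * \<rho>) ^ e"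
          using k rb[OF a] by (intro Cf(2)) auto
        hence "norm (cev x y a (f k)) * norm (b a) ^ k \<le> (Cf k * (c1 * \<rho>) ^ e) * norm (b a) ^ k"
          by (intro mult_right_mono) auto
        thus "norm (cev x y a (f k) * b a ^ k) \<le> (Cf k * c1 ^ e) * (\<rho> ^ e) * norm (b a) ^ k"
          by (simp add: norm_mult norm_power power_mult_distrib mult_ac)
      qed
      \<comment> \<open>Weakened to the shape of \<open>root_bound\<close> with scale
        \<open>\<rho> ^ e\<close>; this is where \<open>1 \<le> \<rho>\<close> enters.\<close>
      also have "\<dots> \<le> (\<Sum>k<r. (Cf k * c1 ^ e) * (\<rho> ^ e) ^ (r - k) * norm (b a) ^ k)"
      proof (rule sum_mono)
        fix k assume k: "k \<in> {..<r}"
        have "1 \<le> \<rho> ^ e" using \<rho> by simp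
        hence "(\<rho> ^ e) ^ 1 \<le> (\<rho> ^ e) ^ (r - k)" using k by (intro power_increasing) auto
        thus "(Cf k * c1 ^ e) * (\<rho> ^ e) * norm (b a) ^ k \<le> (Cf k * c1 ^ e) * (\<rho> ^ e) ^ (r - k) * norm (b a) ^ k"
          using Cf(1)[of k] k c1 by (intro mult_right_mono mult_left_mono) auto
      qed
      finally have "1 * norm (b a) ^ r \<le> (\<Sum>k<r. (Cf k * c1 ^ e) * (\<rho> ^ e) ^ (r - k) * norm (b a) ^ k)"
        by simp
      hence "norm (b a) \<le> (1 + (\<Sum>k<r. Cf k * c1 ^ e) / 1) * \<rho> ^ e"
        using Cf(1) c1 \<rho> by (intro root_bound[where n = r]) auto
      thus ?thesis by (simp add: c2_def)
    qed
    have "norm (poly (?M N) z) \<le> D * (norm c * ((c2 * \<rho> ^ e) ^ k * norm (cev2 x y d0) ^ k) * (2 * (c1 * \<rho>)) ^ (D - 1))"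
    proof (rule lagrange_bound[where p = "?M p" and h = "\<lambda>a. poly (?M g0) a ^ k"])
      show "degree (?M p) = D" "lead_coeff (?M p) = c" "D > 0" using dM Mp D by auto
      show "degree (?M N) < D" using degree_map_poly_le[of "cev2 x y" N, OF c0] sN(2) by simp
      fix a assume a: "poly (?M p) a = 0"
      have "poly (?M (u1 * p + v1 * pderiv p)) a = cev2 x y \<delta>" unfolding del(2) Mc by simp
      thus "poly (pderiv (?M p)) a \<noteq> 0" using a dnz by (auto simp: rhom_simps[OF M] Md)
      have "poly (?M (g0 ^ k * pderiv p)) a = poly (?M N) a"
        unfolding sN(1) using a by (simp add: rhom_simps[OF M])
      thus "poly (?M N) a = poly (?M g0) a ^ k * poly (pderiv (?M p)) a"
        by (simp add: rhom_simps[OF M] Md)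
      have "poly (?M g0) a = b a * cev2 x y d0" using d0nz by (simp add: b_def)
      thus "norm (poly (?M g0) a ^ k) \<le> (c2 * \<rho> ^ e) ^ k * norm (cev2 x y d0) ^ k"
        using bb[OF a] by (simp add: norm_mult norm_power power_mult_distrib[symmetric] power_mono mult_right_mono)
      show "norm a \<le> c1 * \<rho>" by (rule rb[OF a])
    next
      have "1 * \<rho> \<le> c1 * \<rho>" using c1 \<rho>(1) by (intro mult_right_mono) auto
      thus "norm z \<le> c1 * \<rho>" using \<rho>(4) by simp
      show "(c2 * \<rho> ^ e) ^ k * norm (cev2 x y d0) ^ k \<ge> 0" using c2 \<rho>(1) by simp
    qed
    also have "\<dots> = C4 * \<rho> ^ (D - 1 + k * e) * norm (cev2 x y (d0 ^ k))"
      by (simp add: C4_def power_mult_distrib power_add power_mult[symmetric] norm_power cm mult_ac)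
    also have "\<dots> \<le> C4 * \<rho> ^ (D + k * e) * norm (cev2 x y (d0 ^ k))"
    proof -
      have "\<rho> ^ (D - 1 + k * e) \<le> \<rho> ^ (D + k * e)" using \<rho>(1) by (intro power_increasing) auto
      moreover have "C4 \<ge> 0" using c1 c2 by (simp add: C4_def)
      ultimately show ?thesis by (intro mult_right_mono mult_left_mono) auto
    qed
    finally show ?thesis by (simp add: evM)
  qed
  have E0: "d0 * \<delta> \<noteq> 0" using d0 del by simp
  \<comment> \<open>The divisibility criterion is one for two variables, so \<open>z\<close> is
    frozen at a scalar \<open>t\<close>; divisibility for infinitely many \<open>t\<close> is then
    transferred to the coefficients of \<open>N\<close>.\<close>
  have dvdk: "d0 ^ k dvd poly N [:[:t:]:]" for t
  proof (rule dvd_of_locally_bounded[OF _ E0])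
    show "d0 ^ k \<noteq> 0" using d0 by simp
    fix \<rho> :: real
    define \<rho>' where "\<rho>' = max 1 (max \<rho> (norm t))"
    have ce: "cev x y t N = cev2 x y (poly N [:[:t:]:])" for x y
    proof -
      have "cev2 x y [:[:t:]:] = t" by (simp add: cev2_pev pev_const[OF rhom_poly])
      thus ?thesis using pev_comp[OF rhom_id cev2_rhom, of x y "[:[:t:]:]" N]
        by (simp add: pev_id cev_eq_pev)
    qed
    have "norm (cev2 x y (poly N [:[:t:]:])) \<le> (C4 * \<rho>' ^ (D + k * e)) * norm (cev2 x y (d0 ^ k))"
      if "norm x \<le> \<rho>" "norm y \<le> \<rho>" "cev2 x y (d0 * \<delta>) \<noteq> 0" for x y
      using main[of \<rho>' x y t] that by (simp add: ce[symmetric] \<rho>'_def)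
    thus "\<exists>C. \<forall>x y. norm x \<le> \<rho> \<longrightarrow> norm y \<le> \<rho> \<longrightarrow> cev2 x y (d0 * \<delta>) \<noteq> 0 \<longrightarrow>
       norm (cev2 x y (poly N [:[:t:]:])) \<le> C * norm (cev2 x y (d0 ^ k))" by blast
  qed
  have "d0 ^ k dvd coeff N n" for n
  proof -
    have "rhom (\<lambda>c::complex. [:[:c:]:])" by (intro rhom_const rhom_pC)
    moreover have "ideal {a. d0 ^ k dvd a}" by (auto simp: ideal_def)
    moreover have "infinite {t. poly N [:[:t:]:] \<in> {a. d0 ^ k dvd a}}"
      using dvdk infinite_UNIV_char_0[where 'a = complex] by simp
    ultimately have "coeff N n \<in> {a. d0 ^ k dvd a}" by (rule vandermonde_ideal)
    thus ?thesis by simp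
  qed
  hence "[:d0 ^ k:] dvd N" by (simp add: const_poly_dvd_iff)
  then obtain T where T: "N = [:d0 ^ k:] * T" by (elim dvdE)
  have tT: "tdeg T \<le> D + k * e"
  proof (rule tdeg_le_of_growth[OF E0])
    fix x y z :: complex and \<rho> :: real assume h: "1 \<le> \<rho>" "norm x \<le> \<rho>" "norm y \<le> \<rho>" "norm z \<le> \<rho>" "cev2 x y (d0 * \<delta>) \<noteq> 0"
    have nz: "cev2 x y (d0 ^ k) \<noteq> 0" using h(5) by (simp add: cm)
    have "norm (cev x y z N) = norm (cev x y z T) * norm (cev2 x y (d0 ^ k))"
      unfolding T rhom_mult[OF cev_rhom] cev_const by (simp add: norm_mult)
    thus "norm (cev x y z T) \<le> C4 * \<rho> ^ (D + k * e)" using main[OF h] nz by simp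
  qed
  have "ev [:d0:] ^ k * (ev T - w ^ k * ev (pderiv p)) \<in> P"
  proof -
    have "[:d0 ^ k:] = [:d0:] ^ k" by (rule rhom_power[OF rhom_pC])
    hence "ev [:d0:] ^ k * ev T = ev N" by (simp add: T h)
    moreover have "ev N = ev g0 ^ k * ev (pderiv p) - ev s * ev p"
      using arg_cong[OF sN(1), of ev] by (simp add: h algebra_simps)
    ultimately have "ev [:d0:] ^ k * (ev T - w ^ k * ev (pderiv p))
       = ev (pderiv p) * (ev g0 ^ k - (ev [:d0:] * w) ^ k) - ev s * ev p"
      by (simp add: algebra_simps)
    also have "\<dots> \<in> P"
    proof (rule ideal_diff[OF I ideal_mult[OF I] ideal_mult[OF I evp]])
      have "ev g0 - ev [:d0:] * w \<in> P" using ideal_uminus[OF I rat0] by simp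
      thus "ev g0 ^ k - (ev [:d0:] * w) ^ k \<in> P" by (rule ideal_cong_power[OF I])
    qed
    finally show ?thesis .
  qed
  hence "ev T - w ^ k * ev (pderiv p) \<in> P"
    using d0P prime_ideal_mult[OF P] prime_ideal_power[OF P] by blast
  thus ?thesis using tT by (auto simp: ev_def)
qed

section \<open>Derivations along a homomorphism and partial derivatives\<close>

text \<open>Only additivity and the product rule are recorded, so the comparison lemmas for three
  variables also test the scalars.\<close>

definition der_along :: "('d::comm_ring_1 \<Rightarrow> 'b::comm_ring_1) \<Rightarrow> ('d \<Rightarrow> 'b) \<Rightarrow> bool" where
  "der_along h \<delta> \<longleftrightarrow> (\<forall>a b. \<delta> (a + b) = \<delta> a + \<delta> b) \<and> (\<forall>a b. \<delta> (a * b) = h a * \<delta> b + h b * \<delta> a)"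

lemma der_along_0: "der_along h \<delta> \<Longrightarrow> \<delta> 0 = 0"
  unfolding der_along_def by (metis add_cancel_right_right)

lemma der_along_poly_eqI:
  assumes "der_along h \<delta>1" "der_along h \<delta>2" "\<And>a. \<delta>1 [:a:] = \<delta>2 [:a:]" "\<delta>1 [:0,1:] = \<delta>2 [:0,1:]"
  shows "\<delta>1 p = \<delta>2 p"
proof (induction p)
  case 0 show ?case using assms by (simp add: der_along_0)
next
  case (pCons a p)
  have e: "pCons a p = [:a:] + [:0,1:] * p" by simp
  have key: "\<delta> (pCons a p) = \<delta> [:a:] + (h [:0,1:] * \<delta> p + h p * \<delta> [:0,1:])" if "der_along h \<delta>" for \<delta>
    unfolding e using that unfolding der_along_def by metis
  show ?case unfolding key[OF assms(1)] key[OF assms(2)] assms(3,4) pCons.IH ..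
qed

lemma der_along_comp_hom: "der_along h \<delta> \<Longrightarrow> rhom k \<Longrightarrow> der_along (\<lambda>a. h (k a)) (\<lambda>a. \<delta> (k a))"
  by (auto simp: der_along_def rhom_add rhom_mult)

lemma der_along_hom_comp: "der_along h \<delta> \<Longrightarrow> rhom k \<Longrightarrow> der_along (\<lambda>a. k (h a)) (\<lambda>a. k (\<delta> a))"
  by (auto simp: der_along_def rhom_add rhom_mult)

lemma mp3_der_eqI:
  assumes d: "der_along h \<delta>1" "der_along h \<delta>2"
    and "\<And>c. \<delta>1 (K3 c) = \<delta>2 (K3 c)" "\<delta>1 X3 = \<delta>2 X3" "\<delta>1 Y3 = \<delta>2 Y3" "\<delta>1 Z3 = \<delta>2 Z3"
  shows "\<delta>1 p = \<delta>2 p"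
proof (rule der_along_poly_eqI[OF d])
  show "\<delta>1 [:0, 1:] = \<delta>2 [:0, 1:]" using assms by (simp add: Z3_def)
  fix a :: mp2
  show "\<delta>1 [:a:] = \<delta>2 [:a:]"
  proof (rule der_along_poly_eqI[of "\<lambda>a. h [:a:]" "\<lambda>a. \<delta>1 [:a:]" "\<lambda>a. \<delta>2 [:a:]"])
    show "der_along (\<lambda>a. h [:a:]) (\<lambda>a. \<delta>1 [:a:])" "der_along (\<lambda>a. h [:a:]) (\<lambda>a. \<delta>2 [:a:])"
      by (intro der_along_comp_hom[OF _ rhom_pC] d)+
    show "\<delta>1 [:[:0, 1:]:] = \<delta>2 [:[:0, 1:]:]" using assms by (simp add: Y3_def)
    fix b :: "complex poly"
    show "\<delta>1 [:[:b:]:] = \<delta>2 [:[:b:]:]"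
    proof (rule der_along_poly_eqI[of "\<lambda>a. h [:[:a:]:]" "\<lambda>a. \<delta>1 [:[:a:]:]" "\<lambda>a. \<delta>2 [:[:a:]:]"])
      show "der_along (\<lambda>a. h [:[:a:]:]) (\<lambda>a. \<delta>1 [:[:a:]:])" "der_along (\<lambda>a. h [:[:a:]:]) (\<lambda>a. \<delta>2 [:[:a:]:])"
        by (intro der_along_comp_hom[OF _ rhom_const[OF rhom_pC]] d)+
    qed (use assms in \<open>simp_all add: K3_def X3_def\<close>)
  qed
qed

lemma map_poly_der: assumes d: "der_along (\<lambda>a. a) \<delta>" shows "der_along (\<lambda>a. a) (map_poly \<delta>)"
proof -
  have z: "\<delta> 0 = 0" by (rule der_along_0[OF d])
  have a: "\<delta> (a + b) = \<delta> a + \<delta> b" and m: "\<delta> (a * b) = a * \<delta> b + \<delta> a * b" for a b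
    using d by (auto simp: der_along_def mult.commute)
  have s: "\<delta> (sum f S) = (\<Sum>i\<in>S. \<delta> (f i))" for f :: "nat \<Rightarrow> 'a" and S
    by (induction S rule: infinite_finite_induct) (auto simp: z a)
  show ?thesis
    unfolding der_along_def
  proof (intro conjI allI)
    fix p q :: "'a poly"
    show "map_poly \<delta> (p + q) = map_poly \<delta> p + map_poly \<delta> q"
      by (rule poly_eqI) (simp add: coeff_map_poly z a)
    show "map_poly \<delta> (p * q) = p * map_poly \<delta> q + q * map_poly \<delta> p"
    proof (rule poly_eqI)
      fix n
      have "coeff (q * map_poly \<delta> p) n = coeff (map_poly \<delta> p * q) n" by (simp add: mult.commute)
      thus "coeff (map_poly \<delta> (p * q)) n = coeff (p * map_poly \<delta> q + q * map_poly \<delta> p) n"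
        by (simp add: coeff_map_poly z coeff_mult s m sum.distrib)
    qed
  qed
qed

text \<open>Every index other than 0 and 1 stands for the variable \<open>z\<close>, so that
  statements can quantify over all indices.\<close>

definition pd :: "nat \<Rightarrow> mp3 \<Rightarrow> mp3" where
  "pd i = (if i = 0 then map_poly (map_poly pderiv) else if i = 1 then map_poly pderiv else pderiv)"

lemma pderiv_der: "der_along (\<lambda>a. a) (pderiv :: 'a::idom poly \<Rightarrow> 'a poly)"
  by (auto simp: der_along_def pderiv_add pderiv_mult)

lemma pd_der: "der_along (\<lambda>a. a) (pd i)"
  by (auto simp: pd_def intro!: map_poly_der pderiv_der)

lemma pd_gens: "pd i (K3 c) = 0" "pd i X3 = (if i = 0 then 1 else 0)" "pd i Y3 = (if i = 1 then 1 else 0)"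
  "pd i Z3 = (if i \<noteq> 0 \<and> i \<noteq> 1 then 1 else 0)"
  by (simp_all add: pd_def K3_def X3_def Y3_def Z3_def map_poly_pCons pderiv_pCons one_pCons)

lemma tdeg_pd: "tdeg (pd i p) \<le> tdeg p"
  unfolding tdeg_le_iff
proof (intro allI impI)
  fix a b c assume h: "tdeg p < a + b + c"
  have z: "mcoeff p a' b' c' = 0" if "tdeg p < a' + b' + c'" for a' b' c'
    using that tdeg_le_iff[of p "tdeg p"] by auto
  have "mcoeff p (Suc a) b c = 0" "mcoeff p a (Suc b) c = 0" "mcoeff p a b (Suc c) = 0"
    using h by (auto intro!: z)
  thus "mcoeff (pd i p) a b c = 0"
    by (auto simp: pd_def mcoeff_def coeff_map_poly coeff_pderiv of_nat_poly)
qed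

lemma pderiv_gens: "pderiv (K3 c) = 0" "pderiv X3 = 0" "pderiv Y3 = 0" "pderiv Z3 = 1"
  by (simp_all add: K3_def X3_def Y3_def Z3_def pderiv_pCons one_pCons)

lemma pderiv_shear: "pderiv (shear \<alpha> \<beta> p) = shear \<alpha> \<beta> (K3 \<alpha> * pd 0 p + K3 \<beta> * pd 1 p + pd 2 p)"
proof (rule mp3_der_eqI[where h = "shear \<alpha> \<beta>" and ?\<delta>1.0 = "\<lambda>p. pderiv (shear \<alpha> \<beta> p)"
      and ?\<delta>2.0 = "\<lambda>p. shear \<alpha> \<beta> (K3 \<alpha> * pd 0 p + K3 \<beta> * pd 1 p + pd 2 p)"])
  show "der_along (shear \<alpha> \<beta>) (\<lambda>p. pderiv (shear \<alpha> \<beta> p))"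
    using der_along_comp_hom[OF pderiv_der shear_rhom] by simp
  have "der_along (\<lambda>a. a) (\<lambda>p. K3 \<alpha> * pd 0 p + K3 \<beta> * pd 1 p + pd 2 p)"
    using pd_der[of 0] pd_der[of 1] pd_der[of 2] unfolding der_along_def
    by (auto simp: algebra_simps)
  from der_along_hom_comp[OF this shear_rhom]
  show "der_along (shear \<alpha> \<beta>) (\<lambda>p. shear \<alpha> \<beta> (K3 \<alpha> * pd 0 p + K3 \<beta> * pd 1 p + pd 2 p))" by simp
qed (simp_all add: shear_gens pd_gens rhom_simps[OF shear_rhom] pderiv_add pderiv_mult pderiv_gens)

text \<open>The shear makes \<open>p\<close> monic in \<open>z\<close> up to a scalar, so the monic
  case applies. Undoing the shear, which does not raise total degrees, turns the
  \<open>z\<close>-derivative into the derivative of \<open>p\<close> in the direction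
  \<open>(\<alpha>, \<beta>, 1)\<close>.\<close>

lemma conductor_lift_direction:
  fixes \<iota> :: "complex \<Rightarrow> 'a::idom" and f :: "nat \<Rightarrow> mp3" and p d g :: mp3
  assumes i: "rhom \<iota>" and P: "prime_ideal P" and pP: "\<And>q. ev3 \<iota> x y z q \<in> P \<longleftrightarrow> p dvd q" and p0: "p \<noteq> 0"
    and F: "\<And>k. k < r \<Longrightarrow> tdeg (f k) \<le> e" "w ^ r + (\<Sum>k<r. ev3 \<iota> x y z (f k) * w ^ k) \<in> P"
    and rat: "ev3 \<iota> x y z d \<notin> P" "ev3 \<iota> x y z d * w - ev3 \<iota> x y z g \<in> P"
    and top: "cev \<alpha> \<beta> 1 (coeff (H3 p) (tdeg p)) \<noteq> 0"
  shows "\<exists>T. tdeg T \<le> tdeg p + k * e \<and> ev3 \<iota> x y z T -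
     w ^ k * ev3 \<iota> x y z (K3 \<alpha> * pd 0 p + K3 \<beta> * pd 1 p + pd 2 p) \<in> P"
proof -
  define ev where "ev = ev3 \<iota> x y z"
  define ev' where "ev' = ev3 \<iota> (x - \<iota> \<alpha> * z) (y - \<iota> \<beta> * z) z"
  have e: "rhom ev" unfolding ev_def by (rule ev3_rhom[OF i])
  let ?s = "shear \<alpha> \<beta>" and ?t = "shear (-\<alpha>) (-\<beta>)"
  have es: "ev' (?s q) = ev q" for q
    unfolding ev'_def ev_def ev3_shear[OF i] by simp
  have et: "ev (?t q) = ev' q" for q
    using es[of "?t q"] by (simp add: shear_inverse')
  have ps: "ev' q \<in> P \<longleftrightarrow> ?s p dvd q" for q
  proof -
    have "ev' q \<in> P \<longleftrightarrow> p dvd ?t q" using pP by (simp add: et[symmetric] ev_def)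
    also have "\<dots> \<longleftrightarrow> ?s p dvd q"
    proof
      assume "p dvd ?t q"
      then obtain u where "?t q = p * u" by (elim dvdE)
      hence "?s (?t q) = ?s p * ?s u" by (simp add: rhom_mult[OF shear_rhom])
      thus "?s p dvd q" by (simp add: shear_inverse')
    next
      assume "?s p dvd q"
      then obtain u where "q = ?s p * u" by (elim dvdE)
      thus "p dvd ?t q" by (simp add: rhom_mult[OF shear_rhom] shear_inverse)
    qed
    finally show ?thesis .
  qed
  define D where "D = tdeg p"
  define c where "c = cev \<alpha> \<beta> 1 (coeff (H3 p) D)"
  have c0: "c \<noteq> 0" using top by (simp add: c_def D_def)
  have tD: "tdeg (?s p) \<le> D" unfolding D_def by (rule tdeg_shear)
  have cD: "coeff (?s p) D = [:[:c:]:]"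
    using coeff_top[OF tD] by (simp add: mcoeff_shear_top c_def)
  have dD: "degree (?s p) = D"
    using degree_le_tdeg[of "?s p"] tD cD c0 by (intro antisym le_degree) auto
  have Dpos: "D > 0"
  proof (rule ccontr)
    assume "\<not> D > 0"
    hence "?s p = [:[:[:c:]:]:]" using cD dD by (metis degree_0_id gr0I)
    hence "?s p dvd 1" using c0 by (simp add: is_unit_pCons_iff is_unit_const_poly_iff)
    hence "ev' 1 \<in> P" using ps by blast
    thus False using prime_ideal_1[OF P] by (simp add: ev'_def rhom_1[OF ev3_rhom[OF i]])
  qed
  obtain T where T: "tdeg T \<le> D + k * e" "ev' T - w ^ k * ev' (pderiv (?s p)) \<in> P"
  proof -
    have "\<exists>T. tdeg T \<le> D + k * e \<and> ev3 \<iota> (x - \<iota> \<alpha> * z) (y - \<iota> \<beta> * z) z T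
        - w ^ k * ev3 \<iota> (x - \<iota> \<alpha> * z) (y - \<iota> \<beta> * z) z (pderiv (?s p)) \<in> P"
    proof (rule conductor_lift_monic[OF i P ps[unfolded ev'_def] dD Dpos cD c0 tD])
      show "tdeg (?s (f k)) \<le> e" if "k < r" for k using tdeg_shear F(1)[OF that] order_trans by blast
      show "w ^ r + (\<Sum>k<r. ev3 \<iota> (x - \<iota> \<alpha> * z) (y - \<iota> \<beta> * z) z (?s (f k)) * w ^ k) \<in> P"
        using F(2) by (simp add: ev'_def[symmetric] es) (simp add: ev_def)
      show "ev3 \<iota> (x - \<iota> \<alpha> * z) (y - \<iota> \<beta> * z) z (?s d) \<notin> P"
        using rat by (simp add: ev'_def[symmetric] es) (simp add: ev_def)
      show "ev3 \<iota> (x - \<iota> \<alpha> * z) (y - \<iota> \<beta> * z) z (?s d) * w - ev3 \<iota> (x - \<iota> \<alpha> * z) (y - \<iota> \<beta> * z) z (?s g) \<in> P"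
        using rat by (simp add: ev'_def[symmetric] es) (simp add: ev_def)
    qed
    thus ?thesis using that by (auto simp: ev'_def)
  qed
  have "tdeg (?t T) \<le> tdeg p + k * e" using T(1) tdeg_shear[of "-\<alpha>" "-\<beta>" T] by (simp add: D_def)
  moreover have "ev (?t T) - w ^ k * ev (K3 \<alpha> * pd 0 p + K3 \<beta> * pd 1 p + pd 2 p) \<in> P"
    using T(2) unfolding pderiv_shear es et .
  ultimately show ?thesis by (auto simp: ev_def)
qed

text \<open>Scaled differences of the lifts in three independent directions give lifts of the single
  partial derivatives, with the same degree bound.\<close>

lemma conductor_lift:
  fixes \<iota> :: "complex \<Rightarrow> 'a::idom" and f :: "nat \<Rightarrow> mp3" and p d g :: mp3
  assumes i: "rhom \<iota>" and P: "prime_ideal P" and pP: "\<And>q. ev3 \<iota> x y z q \<in> P \<longleftrightarrow> p dvd q" and p0: "p \<noteq> 0"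
    and F: "\<And>k. k < r \<Longrightarrow> tdeg (f k) \<le> e" "w ^ r + (\<Sum>k<r. ev3 \<iota> x y z (f k) * w ^ k) \<in> P"
    and rat: "ev3 \<iota> x y z d \<notin> P" "ev3 \<iota> x y z d * w - ev3 \<iota> x y z g \<in> P"
  shows "\<exists>T. \<forall>j. tdeg (T j) \<le> tdeg p + k * e \<and> ev3 \<iota> x y z (T j) - w ^ k * ev3 \<iota> x y z (pd j p) \<in> P"
proof -
  define ev where "ev = ev3 \<iota> x y z"
  have e: "rhom ev" unfolding ev_def by (rule ev3_rhom[OF i])
  have eK: "ev (K3 c) = \<iota> c" for c by (simp add: ev_def ev3_gens[OF i])
  note h = rhom_simps[OF e]
  have I: "ideal P" by (rule prime_idealD[OF P])
  obtain \<alpha> \<alpha>' \<beta> \<beta>' where ab: "\<alpha> \<noteq> \<alpha>'" "\<beta> \<noteq> \<beta>'"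
    and tops: "cev \<alpha> \<beta> 1 (coeff (H3 p) (tdeg p)) \<noteq> 0" "cev \<alpha>' \<beta> 1 (coeff (H3 p) (tdeg p)) \<noteq> 0"
      "cev \<alpha> \<beta>' 1 (coeff (H3 p) (tdeg p)) \<noteq> 0"
    using three_good_shears[OF p0 refl] by blast
  define n where "n = tdeg p + k * e"
  define V where "V = (\<lambda>a b T. ev T - w ^ k * (\<iota> a * ev (pd 0 p) + \<iota> b * ev (pd 1 p) + ev (pd 2 p)))"
  have ex: "\<exists>T. tdeg T \<le> n \<and> V a b T \<in> P" if "cev a b 1 (coeff (H3 p) (tdeg p)) \<noteq> 0" for a b
    using conductor_lift_direction[OF i P pP p0 F rat that, of k]
    by (simp add: ev_def[symmetric] h eK n_def V_def)
  obtain T1 where T1: "tdeg T1 \<le> n" "V \<alpha> \<beta> T1 \<in> P" using ex[OF tops(1)] by blast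
  obtain T2 where T2: "tdeg T2 \<le> n" "V \<alpha>' \<beta> T2 \<in> P" using ex[OF tops(2)] by blast
  obtain T3 where T3: "tdeg T3 \<le> n" "V \<alpha> \<beta>' T3 \<in> P" using ex[OF tops(3)] by blast
  define s where "s = inverse (\<alpha>' - \<alpha>)"
  define s' where "s' = inverse (\<beta>' - \<beta>)"
  have s: "\<iota> s * (\<iota> \<alpha>' - \<iota> \<alpha>) = 1" "\<iota> s' * (\<iota> \<beta>' - \<iota> \<beta>) = 1"
    using ab by (simp_all add: s_def s'_def rhom_diff[OF i, symmetric] rhom_mult[OF i, symmetric] rhom_1[OF i])
  define Tx where "Tx = K3 s * (T2 - T1)"
  define Ty where "Ty = K3 s' * (T3 - T1)"
  define Tz where "Tz = T1 - K3 \<alpha> * Tx - K3 \<beta> * Ty"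
  have dx: "tdeg Tx \<le> n" unfolding Tx_def by (intro order_trans[OF tdeg_scale_le] tdeg_diff_le T1 T2)
  have dy: "tdeg Ty \<le> n" unfolding Ty_def by (intro order_trans[OF tdeg_scale_le] tdeg_diff_le T1 T3)
  have dz: "tdeg Tz \<le> n" unfolding Tz_def
    by (intro tdeg_diff_le order_trans[OF tdeg_scale_le] dx dy T1)
  have x: "ev Tx - w ^ k * ev (pd 0 p) \<in> P"
  proof -
    have "ev Tx - w ^ k * ev (pd 0 p) = \<iota> s * (V \<alpha>' \<beta> T2 - V \<alpha> \<beta> T1) + (\<iota> s * (\<iota> \<alpha>' - \<iota> \<alpha>) - 1) * (w ^ k * ev (pd 0 p))"
      by (simp add: Tx_def V_def h eK algebra_simps)
    also have "\<dots> = \<iota> s * (V \<alpha>' \<beta> T2 - V \<alpha> \<beta> T1)" by (simp add: s)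
    also have "\<dots> \<in> P" by (intro ideal_mult ideal_diff I T1 T2)
    finally show ?thesis .
  qed
  have y: "ev Ty - w ^ k * ev (pd 1 p) \<in> P"
  proof -
    have "ev Ty - w ^ k * ev (pd 1 p) = \<iota> s' * (V \<alpha> \<beta>' T3 - V \<alpha> \<beta> T1) + (\<iota> s' * (\<iota> \<beta>' - \<iota> \<beta>) - 1) * (w ^ k * ev (pd 1 p))"
      by (simp add: Ty_def V_def h eK algebra_simps)
    also have "\<dots> = \<iota> s' * (V \<alpha> \<beta>' T3 - V \<alpha> \<beta> T1)" by (simp add: s)
    also have "\<dots> \<in> P" by (intro ideal_mult ideal_diff I T1 T3)
    finally show ?thesis .
  qed
  have z: "ev Tz - w ^ k * ev (pd 2 p) \<in> P"
  proof -
    have "ev Tz - w ^ k * ev (pd 2 p) = V \<alpha> \<beta> T1 - \<iota> \<alpha> * (ev Tx - w ^ k * ev (pd 0 p)) - \<iota> \<beta> * (ev Ty - w ^ k * ev (pd 1 p))"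
      by (simp add: Tz_def V_def h eK algebra_simps)
    also have "\<dots> \<in> P" by (intro ideal_mult ideal_diff I T1 x y)
    finally show ?thesis .
  qed
  define T where "T = (\<lambda>j::nat. if j = 0 then Tx else if j = 1 then Ty else Tz)"
  have "tdeg (T j) \<le> tdeg p + k * e \<and> ev (T j) - w ^ k * ev (pd j p) \<in> P" for j
  proof -
    have "pd j p = pd 2 p" if "j \<noteq> 0" "j \<noteq> 1" using that by (simp add: pd_def)
    thus ?thesis using dx dy dz x y z by (auto simp: T_def n_def)
  qed
  thus ?thesis unfolding ev_def by blast
qed

subsection \<open>Generic generators\<close>

lemma countable_avoid: "countable (A :: complex set) \<Longrightarrow> \<exists>c. c \<notin> A"
  using uncountable_UNIV_complex by (metis UNIV_eq_I)

text \<open>One element has to generate over the whole countable family at once: the members of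
  \<open>S\<close> are added one by one, each with a scalar outside a countable set of bad values.
  \<open>good\<close> carries along a further condition that fails for countably many scalars
  only.\<close>

lemma generic_generator:
  fixes e :: "'d::{idom,ring_char_0} \<Rightarrow> 'a::idom" and \<iota> :: "complex \<Rightarrow> 'a" and cs :: "complex \<Rightarrow> 'd"
    and Q :: "nat \<Rightarrow> 'a set"
  assumes e: "rhom e" and i: "rhom \<iota>" and cs: "\<And>c. e (cs c) = \<iota> c" and Q: "\<And>j. prime_ideal (Q j)"
    and z: "\<And>j. lies_over_zero e (Q j)" and al: "\<And>j a. algebraic_mod e (Q j) a" and fin: "finite S"
    and g0: "good u0" and g: "\<And>u a. good u \<Longrightarrow> countable {c. \<not> good (u + \<iota> c * a)}"
  shows "\<exists>u. good u \<and> (\<forall>j. S \<subseteq> rational_mod e (Q j) u)"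
  using fin
proof (induction S rule: finite_induct)
  case empty thus ?case using g0 by blast
next
  case (insert a S)
  then obtain u where u: "good u" "\<And>j. S \<subseteq> rational_mod e (Q j) u" by blast
  define B where "B = (\<Union>j. {c. \<not> (u \<in> rational_mod e (Q j) (u + \<iota> c * a) \<and> a \<in> rational_mod e (Q j) (u + \<iota> c * a))})"
  have "countable B" unfolding B_def
    by (intro countable_UN countableI_type countable_finite primitive_element_mod[OF e i cs Q z al al])
  hence "countable (B \<union> {c. \<not> good (u + \<iota> c * a)})" using g[OF u(1)] by simp
  then obtain c where c: "c \<notin> B \<union> {c. \<not> good (u + \<iota> c * a)}" using countable_avoid by blast
  have "insert a S \<subseteq> rational_mod e (Q j) (u + \<iota> c * a)" for j
    using c u(2)[of j] rational_mod_trans[OF e Q, of u j "u + \<iota> c * a"] unfolding B_def by blast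
  thus ?case using c by blast
qed

lemma rational_mod_UNIV:
  assumes e: "rhom e" and cs: "\<And>c. e (cs c) = \<iota> c" and Q: "prime_ideal Q"
    and S: "gen_subalg \<iota> S = UNIV" "S \<subseteq> rational_mod e Q u"
  shows "a \<in> rational_mod e Q u"
proof -
  have "a \<in> gen_subalg \<iota> S" using S by simp
  thus ?thesis
  proof (induction rule: gen_subalg.induct)
    case (scal c) thus ?case using rational_mod_base[OF e Q, of "cs c" u] by (simp add: cs)
  qed (use S rational_mod_add[OF e Q] rational_mod_mult[OF e Q] in auto)
qed

text \<open>The constant term of a relation for \<open>f\<close> would lie in \<open>P\<close> and
  hence vanish; cancelling \<open>f\<close> leaves a relation of smaller degree.\<close>

lemma transcendental_of_mem_prime:
  fixes e :: "'d::idom \<Rightarrow> 'a::idom"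
  assumes e: "rhom e" and z: "lies_over_zero e P" and I: "ideal P" and f: "f \<in> P" "f \<noteq> 0"
  shows "\<not> algebraic_mod e {0} f"
proof -
  have "pev e f q = 0 \<Longrightarrow> q = 0" for q
  proof (induction q)
    case (pCons c q)
    have eq: "e c + f * pev e f q = 0" using pCons.prems by (simp add: pev_pCons[OF e])
    hence "e c = - (f * pev e f q)" by (simp add: eq_neg_iff_add_eq_0)
    hence "e c \<in> P" using ideal_uminus[OF I ideal_mult'[OF I f(1)]] by simp
    hence "c = 0" using z by (auto simp: lies_over_zero_def)
    thus ?case using eq f pCons.IH by (simp add: rhom_0[OF e])
  qed simp
  thus ?thesis by (auto simp: algebraic_mod_def)
qed

text \<open>After cancelling powers of \<open>a\<close> in a relation for it, the constant term is
  nonzero and, up to sign, equal to the rest of the relation, a multiple of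
  \<open>a\<close>.\<close>

lemma multiple_in_base:
  fixes e :: "'d::idom \<Rightarrow> 'a::idom"
  assumes e: "rhom e" and a: "a \<noteq> 0" and al: "algebraic_mod e {0} a"
  shows "\<exists>g s. s \<noteq> 0 \<and> pev e a g * a = e s"
proof -
  obtain q0 where "q0 \<noteq> 0" "pev e a q0 = 0" using al by (auto simp: algebraic_mod_def)
  thus ?thesis
  proof (induction q0)
    case (pCons c q)
    have eq: "e c + a * pev e a q = 0" using pCons.prems by (simp add: pev_pCons[OF e])
    show ?case
    proof (cases "c = 0")
      case True
      hence "q \<noteq> 0" "pev e a q = 0" using pCons.prems eq a by (auto simp: rhom_0[OF e])
      thus ?thesis by (rule pCons.IH)
    next
      case False
      have "pev e a (- q) * a = e c"
        using eq by (simp add: rhom_uminus[OF pev_rhom[OF e]] eq_neg_iff_add_eq_0[symmetric] mult.commute add_eq_0_iff2)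
      thus ?thesis using False by blast
    qed
  qed simp
qed

text \<open>Multiplying \<open>w0\<close> by the leading coefficient of an equation of least degree
  makes the equation monic. Minimality passes to \<open>w\<close>, since a shorter relation for
  \<open>w\<close> would rescale to one for \<open>w0\<close>.\<close>

lemma monic_generator:
  fixes e :: "'d::{idom,ring_char_0} \<Rightarrow> 'a::idom"
  assumes e: "rhom e" and z: "lies_over_zero e {0}" and al: "algebraic_mod e {0} w0"
  shows "\<exists>w r f. r > 0 \<and> w ^ r + (\<Sum>k<r. e (f k) * w ^ k) = 0 \<and> (\<forall>G. degree G < r \<longrightarrow> pev e w G = 0 \<longrightarrow> G = 0)
    \<and> w0 \<in> rational_mod e {0} w"
proof -
  obtain q0 where q0: "q0 \<noteq> 0" "pev e w0 q0 = 0" using al by (auto simp: algebraic_mod_def)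
  define q where "q = arg_min degree (\<lambda>q. q \<noteq> 0 \<and> pev e w0 q = 0)"
  have q: "q \<noteq> 0" "pev e w0 q = 0" and qmin: "\<And>q'. q' \<noteq> 0 \<Longrightarrow> pev e w0 q' = 0 \<Longrightarrow> degree q \<le> degree q'"
    using arg_min_nat_lemma[where P = "\<lambda>q. q \<noteq> 0 \<and> pev e w0 q = 0" and m = degree and k = q0] q0
      by (auto simp: q_def)
  define r where "r = degree q"
  define l where "l = lead_coeff q"
  define w where "w = e l * w0"
  have l0: "l \<noteq> 0" using q by (simp add: l_def)
  have r0: "r > 0"
  proof (rule ccontr)
    assume "\<not> r > 0"
    then obtain c where "q = [:c:]" unfolding r_def by (metis degree_eq_zeroE gr0I)
    thus False using q z by (auto simp: pev_const[OF e] lies_over_zero_def)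
  qed
  define f where "f = (\<lambda>k. coeff q k * l ^ (r - 1 - k))"
  have "w ^ r + (\<Sum>k<r. e (f k) * w ^ k) = e l ^ (r - 1) * pev e w0 q"
  proof -
    have "pev e w0 q = e l * w0 ^ r + (\<Sum>k<r. e (coeff q k) * w0 ^ k)"
      using pev_altdef[OF e, of q r w0]
        by (simp add: r_def l_def lessThan_Suc_atMost[symmetric] add.commute)
    moreover have "e l ^ (r - 1) * (e l * w0 ^ r) = w ^ r"
      using r0 by (cases r) (auto simp: w_def power_mult_distrib mult_ac)
    moreover have "e l ^ (r - 1) * (\<Sum>k<r. e (coeff q k) * w0 ^ k) = (\<Sum>k<r. e (f k) * w ^ k)"
      unfolding sum_distrib_left
    proof (rule sum.cong)
      fix k assume "k \<in> {..<r}"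
      hence "e l ^ (r - 1) = e l ^ (r - 1 - k) * e l ^ k" by (simp add: power_add[symmetric])
      thus "e l ^ (r - 1) * (e (coeff q k) * w0 ^ k) = e (f k) * w ^ k"
        by (simp add: f_def w_def rhom_mult[OF e] rhom_power[OF e] power_mult_distrib mult_ac)
    qed simp
    ultimately show ?thesis by (simp add: distrib_left)
  qed
  hence 1: "w ^ r + (\<Sum>k<r. e (f k) * w ^ k) = 0" using q by simp
  have 2: "G = 0" if G: "degree G < r" "pev e w G = 0" for G
  proof (rule ccontr)
    assume "G \<noteq> 0"
    define G' where "G' = pcompose G [:0, l:]"
    have "pev e w G = pev e w0 G'"
      unfolding G'_def
    proof (induction G)
      case (pCons b G) thus ?case
        by (simp add: pev_pCons[OF e] pcompose_pCons pev_add[OF e] pev_const[OF e] pev_0 rhom_0[OF e] algebra_simps pev_smult[OF e] w_def)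
    qed (simp add: pev_0)
    moreover have "G' \<noteq> 0" using \<open>G \<noteq> 0\<close> l0 by (simp add: G'_def pcompose_eq_0_iff)
    moreover have "degree G' \<le> degree G"
      unfolding G'_def using degree_pcompose_le[of G "[:0,l:]"] l0 by simp
    ultimately show False using qmin[of G'] G by (simp add: r_def)
  qed
  have "w0 \<in> rational_mod e {0} w"
  proof (rule rational_modI[where g = "[:l:]" and f = "[:0,1:]"])
    show "pev e w [:l:] \<notin> {0}" using l0 z by (auto simp: pev_const[OF e] lies_over_zero_def)
    show "pev e w [:l:] * w0 - pev e w [:0, 1:] \<in> {0}" by (simp add: pev_const[OF e] pev_X[OF e] w_def)
  qed
  thus ?thesis using 1 2 r0 by blast
qed

lemma exists_prime_factor_in_prime_ideal:
  fixes ev :: "mp3 \<Rightarrow> 'a::comm_ring_1"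
  assumes e: "rhom ev" and P: "prime_ideal P" and s: "s \<noteq> 0" "ev s \<in> P"
  shows "\<exists>p. prime_elem p \<and> ev p \<in> P"
proof -
  obtain A where A: "\<forall>x. x \<in># A \<longrightarrow> prime_elem x" "normalize (prod_mset A) = normalize s"
    using prime_factorization_exists[OF s(1)] by blast
  have "s dvd prod_mset A" using A(2) by (metis associated_iff_dvd)
  hence "ev (prod_mset A) \<in> P" using s(2) ideal_mult'[OF prime_idealD[OF P]]
    by (auto simp: dvd_def rhom_mult[OF e])
  hence "\<exists>p\<in>#A. ev p \<in> P"
    by (induction A) (auto simp: rhom_1[OF e] rhom_mult[OF e] prime_ideal_1[OF P] prime_ideal_mult[OF P])
  thus ?thesis using A by auto
qed

text \<open>A prime factor \<open>p\<close> of \<open>s\<close> lies in \<open>P\<close>, and it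
  involves \<open>z\<close> because \<open>x, y\<close> are independent modulo \<open>P\<close>. A
  member of the contracted ideal not divisible by \<open>p\<close> would, by elimination of
  \<open>z\<close>, give a nonzero polynomial in \<open>x, y\<close> in \<open>P\<close>.\<close>

lemma prime_generator:
  fixes \<iota> :: "complex \<Rightarrow> 'a::idom"
  assumes i: "rhom \<iota>" and P: "prime_ideal P" and xy: "lies_over_zero (pev (pev \<iota> x) y) P"
    and s: "s \<noteq> 0" "ev3 \<iota> x y z s \<in> P"
  shows "\<exists>p. p \<noteq> 0 \<and> (\<forall>q. ev3 \<iota> x y z q \<in> P \<longleftrightarrow> p dvd q)"
proof -
  define ev where "ev = ev3 \<iota> x y z"
  have e: "rhom ev" unfolding ev_def by (rule ev3_rhom[OF i])
  have I: "ideal P" by (rule prime_idealD[OF P])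
  obtain p where p: "prime_elem p" "ev p \<in> P"
    using exists_prime_factor_in_prime_ideal[OF e P s[folded ev_def]] by blast
  have c: "ev [:d:] = pev (pev \<iota> x) y d" for d
    by (simp add: ev_def ev3_def pev_const[OF pev_rhom[OF pev_rhom[OF i]]])
  have "p \<noteq> 0" using p by auto
  have dp: "degree p > 0"
  proof (rule ccontr)
    assume "\<not> degree p > 0"
    then obtain d where "p = [:d:]" by (metis degree_eq_zeroE gr0I)
    thus False using p xy \<open>p \<noteq> 0\<close> by (auto simp: c lies_over_zero_def)
  qed
  have "p dvd q" if q: "ev q \<in> P" for q
  proof (rule ccontr)
    assume "\<not> p dvd q"
    then obtain u v d where d: "d \<noteq> 0" "u * p + v * q = [:d:]" using elimination[OF p(1) dp] by blast
    have "ev (u * p + v * q) \<in> P"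
      using p q by (simp add: rhom_simps[OF e] ideal_add[OF I] ideal_mult[OF I])
    thus False using d xy by (auto simp: c lies_over_zero_def)
  qed
  moreover have "ev q \<in> P" if "p dvd q" for q
    using that p ideal_mult'[OF I] by (auto simp: dvd_def rhom_mult[OF e])
  ultimately show ?thesis using \<open>p \<noteq> 0\<close> by (auto simp: ev_def)
qed

lemma to_fract_rhom: "rhom (to_fract :: 'a::idom \<Rightarrow> 'a fract)"
  by (rule rhomI) simp_all

lemma fract_cases: fixes Y :: "'a::idom fract"
  obtains a b where "b \<noteq> 0" "Y * to_fract b = to_fract a"
proof -
  obtain a b where "Y = Fract a b" "b \<noteq> 0" by (cases Y)
  thus ?thesis using that[of b a] by (simp add: to_fract_def eq_fract)
qed

section \<open>The subring generated by coordinates and a primitive element\<close>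

text \<open>\<open>x, y, z\<close> form a transcendence basis over \<complex>, and \<open>w\<close>
  is a primitive element over \<open>\<complex>(x, y, z)\<close> with monic minimal polynomial of
  degree \<open>r\<close>. So \<open>R = range pw\<close> is free over
  \<open>\<complex>[x, y, z]\<close> on \<open>1, ..., w ^ (r - 1)\<close> and has the same fraction
  field as the whole ring.\<close>

locale coords =
  fixes \<iota> :: "complex \<Rightarrow> 'a::idom" and x y z w :: 'a and r :: nat and f :: "nat \<Rightarrow> mp3"
  assumes i: "rhom \<iota>" and z0: "lies_over_zero (ev3 \<iota> x y z) {0}" and r0: "r > 0"
    and F: "w ^ r + (\<Sum>k<r. ev3 \<iota> x y z (f k) * w ^ k) = 0"
    and min: "\<And>G. degree G < r \<Longrightarrow> pev (ev3 \<iota> x y z) w G = 0 \<Longrightarrow> G = 0"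
    and rat: "\<And>a. a \<in> rational_mod (ev3 \<iota> x y z) {0} w"
    and alg: "\<And>a. algebraic_mod (ev3 \<iota> x y z) {0} a"
begin

definition ev :: "mp3 \<Rightarrow> 'a" where "ev = ev3 \<iota> x y z"
definition pw :: "mp3 poly \<Rightarrow> 'a" where "pw = pev ev w"
definition FF :: "mp3 poly" where "FF = monom 1 r + (\<Sum>k<r. monom (f k) k)"
text \<open>The derivative of the minimal polynomial at \<open>w\<close>, which generates the
  different of \<open>R\<close>. It is the common denominator of the partial derivatives and of the
  dual basis below.\<close>

definition Fw :: 'a where "Fw = pw (pderiv FF)"

abbreviation (input) \<kappa> :: "'a \<Rightarrow> 'a fract" where "\<kappa> \<equiv> to_fract"

lemma ev: "rhom ev" unfolding ev_def by (rule ev3_rhom[OF i])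

lemma pw: "rhom pw" unfolding pw_def by (rule pev_rhom[OF ev])

lemmas ev_simps = rhom_simps[OF ev]
lemmas pw_simps = rhom_simps[OF pw]

lemma ev_eq_0: "ev q = 0 \<longleftrightarrow> q = 0"
  using z0 by (auto simp: lies_over_zero_def ev_def[symmetric] rhom_0[OF ev])

lemma ev_K3: "ev (K3 c) = \<iota> c"
  by (simp add: ev_def ev3_gens i)

lemma pw_const: "pw [:q:] = ev q" by (simp add: pw_def pev_const ev)

lemma pw_smult: "pw (smult q G) = ev q * pw G" by (simp add: pw_def pev_smult ev)

lemma pw_pCons: "pw (pCons q G) = ev q + w * pw G" by (simp add: pw_def pev_pCons ev)

lemma pw_monom: "pw (monom q n) = ev q * w ^ n" by (simp add: pw_def pev_monom ev)

lemma pw_min: "degree G < r \<Longrightarrow> pw G = 0 \<Longrightarrow> G = 0"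
  using min by (simp add: pw_def ev_def)

lemma coeff_FF: "coeff FF k = (if k = r then 1 else if k < r then f k else 0)"
  by (auto simp: FF_def coeff_sum)

lemma degree_FF: "degree FF = r"
  by (intro antisym degree_le le_degree) (auto simp: coeff_FF)

lemma pw_FF: "pw FF = 0"
  using F by (simp add: FF_def pw_simps rhom_sum[OF pw] pw_monom ev_simps) (simp add: ev_def)

lemma FF_monic: "1 * lead_coeff FF = 1" by (simp add: degree_FF coeff_FF)

lemma pw_reduce: "\<exists>G'. degree G' < r \<and> pw G' = pw G \<and> (\<exists>U. G = FF * U + G')"
proof -
  obtain s N where "G = FF * s + N" "degree N < r"
    using division_unit_lead[OF FF_monic, of G] r0 degree_FF by auto
  thus ?thesis by (intro exI[of _ N]) (auto simp: pw_simps pw_FF)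
qed

lemma pw_kernel: assumes "pw G = 0" shows "\<exists>U. G = FF * U"
proof -
  obtain G' U where "degree G' < r" "pw G' = pw G" "G = FF * U + G'" using pw_reduce by metis
  thus ?thesis using pw_min[of G'] assms by auto
qed

lemma Fw_nz: "Fw \<noteq> 0"
proof
  assume "Fw = 0"
  moreover have "degree (pderiv FF) < r" using r0 by (simp add: degree_pderiv degree_FF)
  ultimately have "pderiv FF = 0" using pw_min by (simp add: Fw_def)
  thus False using r0 by (simp add: pderiv_eq_0_iff degree_FF)
qed

lemma multiple_in_S: assumes "a \<noteq> 0" shows "\<exists>g s. s \<noteq> 0 \<and> pev ev a g * a = ev s"
  unfolding ev_def by (rule multiple_in_base[OF ev3_rhom[OF i] assms alg])

lemma range_pw_add: "a \<in> range pw \<Longrightarrow> b \<in> range pw \<Longrightarrow> a + b \<in> range pw"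
  by (auto simp: pw_simps[symmetric] simp del: pw_simps)

lemma range_pw_diff: "a \<in> range pw \<Longrightarrow> b \<in> range pw \<Longrightarrow> a - b \<in> range pw"
  by (auto simp: rhom_diff[OF pw, symmetric])

lemma range_pw_mult: "a \<in> range pw \<Longrightarrow> b \<in> range pw \<Longrightarrow> a * b \<in> range pw"
  by (auto simp: rhom_mult[OF pw, symmetric])

lemma range_pw_ev: "ev q \<in> range pw"
  using pw_const by (metis rangeI)

lemma range_pw_w: "w \<in> range pw"
  using pw_monom[of 1 1] by (metis ev_simps(2) mult_1 power_one_right rangeI)

lemma range_pw_sum: "(\<And>k. k \<in> S \<Longrightarrow> h k \<in> range pw) \<Longrightarrow> sum h S \<in> range pw"
  by (induction S rule: infinite_finite_induct) (auto simp: range_pw_add intro: range_pw_ev[of 0, unfolded ev_simps(1)])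

lemma range_pw_power: "a \<in> range pw \<Longrightarrow> a ^ n \<in> range pw"
  by (auto simp: rhom_power[OF pw, symmetric])

lemma range_pw_pev: "a \<in> range pw \<Longrightarrow> pev ev a g \<in> range pw"
  by (induction g)
     (auto simp: pev_0 pev_pCons[OF ev] intro: range_pw_add range_pw_mult range_pw_ev range_pw_ev[of 0, unfolded ev_simps(1)])

lemma Fw_range: "Fw \<in> range pw" by (simp add: Fw_def)

lemma denominator: "\<exists>s. s \<noteq> 0 \<and> ev s * a \<in> range pw"
proof -
  obtain G H where h: "pw H \<noteq> 0" "pw H * a = pw G"
    using rat[of a] by (auto simp: rational_mod_def pw_def ev_def)
  obtain g s where s: "s \<noteq> 0" "pev ev (pw H) g * pw H = ev s" using multiple_in_S[OF h(1)] by blast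
  have "ev s * a = pev ev (pw H) g * pw G" by (simp add: s(2)[symmetric] h(2)[symmetric] mult.assoc)
  thus ?thesis using s(1) range_pw_mult[OF range_pw_pev] by (metis rangeI)
qed

subsection \<open>Partial derivatives on the fraction field\<close>

text \<open>Implicit differentiation of \<open>FF(w) = 0\<close>: the derivative of \<open>w\<close>
  has to be minus the coefficientwise derivative of \<open>FF\<close> at \<open>w\<close>, divided
  by \<open>Fw\<close>. The definition is on polynomials in \<open>w\<close>; \<open>D0_cong\<close>
  makes it descend to \<open>R\<close>.\<close>

definition D0 :: "nat \<Rightarrow> mp3 poly \<Rightarrow> 'a fract" where
  "D0 j G = \<kappa> (pw (map_poly (pd j) G)) - \<kappa> (pw (pderiv G)) * \<kappa> (pw (map_poly (pd j) FF)) / \<kappa> Fw"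

lemma D0_der: "der_along (\<lambda>G. \<kappa> (pw G)) (D0 j)"
proof -
  have k: "rhom (\<lambda>G. \<kappa> (pw G))" by (rule rhom_comp[OF pw to_fract_rhom])
  have 1: "der_along (\<lambda>G. \<kappa> (pw G)) (\<lambda>G. \<kappa> (pw (map_poly (pd j) G)))"
    using der_along_hom_comp[OF map_poly_der[OF pd_der] k] .
  have 2: "der_along (\<lambda>G. \<kappa> (pw G)) (\<lambda>G. \<kappa> (pw (pderiv G)))"
    using der_along_hom_comp[OF pderiv_der k] .
  show ?thesis using 1 2 unfolding der_along_def D0_def
    by (simp only: distrib_left distrib_right add_divide_distrib) (simp add: algebra_simps diff_divide_distrib add_divide_distrib)
qed

lemma D0_add: "D0 j (G + H) = D0 j G + D0 j H"
  and D0_mult: "D0 j (G * H) = \<kappa> (pw G) * D0 j H + \<kappa> (pw H) * D0 j G"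
  using D0_der by (auto simp: der_along_def)

lemma D0_FF: "D0 j FF = 0"
  using Fw_nz by (simp add: D0_def Fw_def[symmetric])

lemma D0_kernel: "pw G = 0 \<Longrightarrow> D0 j G = 0"
proof -
  assume "pw G = 0"
  then obtain U where "G = FF * U" using pw_kernel by blast
  thus ?thesis by (simp add: D0_mult D0_FF pw_FF)
qed

lemma D0_diff: "D0 j (G - H) = D0 j G - D0 j H"
  using D0_add[of j "G - H" H] by simp

lemma D0_cong: "pw G = pw H \<Longrightarrow> D0 j G = D0 j H"
  using D0_kernel[of "G - H" j] by (simp add: D0_diff pw_simps)

lemma fraction_form: "\<exists>G H. pw H \<noteq> 0 \<and> Y * \<kappa> (pw H) = \<kappa> (pw G)"
proof -
  obtain a b where ab: "b \<noteq> 0" "Y * \<kappa> b = \<kappa> a" by (rule fract_cases)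
  obtain s where s: "s \<noteq> 0" "ev s * a \<in> range pw" using denominator by blast
  obtain t where t: "t \<noteq> 0" "ev t * b \<in> range pw" using denominator by blast
  have "ev t * (ev s * a) \<in> range pw" "ev s * (ev t * b) \<in> range pw"
    by (intro range_pw_mult range_pw_ev s t)+
  then obtain G H where GH: "ev t * (ev s * a) = pw G" "ev s * (ev t * b) = pw H" by blast
  have "Y * \<kappa> (pw H) = \<kappa> (pw G)" by (simp add: GH[symmetric] ab(2)[symmetric])
  moreover have "pw H \<noteq> 0" using s t ab by (simp add: GH[symmetric] ev_eq_0)
  ultimately show ?thesis by blast
qed

text \<open>The quotient rule for some representation of \<open>Y\<close> as a fraction of elements
  of \<open>R\<close>; \<open>der_eq\<close> shows that the choice does not matter.\<close>

definition der :: "nat \<Rightarrow> 'a fract \<Rightarrow> 'a fract" where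
  "der j Y = (SOME d. \<exists>G H. pw H \<noteq> 0 \<and> Y * \<kappa> (pw H) = \<kappa> (pw G) \<and> d = (D0 j G - Y * D0 j H) / \<kappa> (pw H))"

lemma der_eq:
  assumes h: "pw H \<noteq> 0" "Y * \<kappa> (pw H) = \<kappa> (pw G)"
  shows "der j Y = (D0 j G - Y * D0 j H) / \<kappa> (pw H)"
proof -
  have "\<exists>d G H. pw H \<noteq> 0 \<and> Y * \<kappa> (pw H) = \<kappa> (pw G) \<and> d = (D0 j G - Y * D0 j H) / \<kappa> (pw H)"
    using h by blast
  then obtain G' H' where h': "pw H' \<noteq> 0" "Y * \<kappa> (pw H') = \<kappa> (pw G')"
    and d: "der j Y = (D0 j G' - Y * D0 j H') / \<kappa> (pw H')"
    unfolding der_def using someI_ex[of "\<lambda>d. \<exists>G H. pw H \<noteq> 0 \<and> Y * \<kappa> (pw H) = \<kappa> (pw G) \<and> d = (D0 j G - Y * D0 j H) / \<kappa> (pw H)"] by blast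
  have "\<kappa> (pw (G * H')) = \<kappa> (pw (G' * H))"
    by (simp add: pw_simps h(2)[symmetric] h'(2)[symmetric])
  hence "pw (G * H') = pw (G' * H)" by simp
  hence "D0 j (G * H') = D0 j (G' * H)" by (rule D0_cong)
  hence e: "Y * \<kappa> (pw H) * D0 j H' + \<kappa> (pw H') * D0 j G = Y * \<kappa> (pw H') * D0 j H + \<kappa> (pw H) * D0 j G'"
    by (simp only: D0_mult h(2) h'(2))
  have "(D0 j G' - Y * D0 j H') * \<kappa> (pw H) = (D0 j G - Y * D0 j H) * \<kappa> (pw H')"
    using e by (simp add: algebra_simps)
  thus ?thesis unfolding d using h h' by (simp add: frac_eq_eq)
qed

lemma der_pw: "der j (\<kappa> (pw G)) = D0 j G"
proof -
  have "D0 j 1 = D0 j 1 + D0 j 1" using D0_mult[of j 1 1] by (simp only: mult_1_left pw_simps to_fract_1)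
  hence "D0 j 1 = 0" by (metis add_cancel_right_right)
  thus ?thesis using der_eq[of 1 "\<kappa> (pw G)" G j] by (simp add: pw_simps)
qed

lemma der_ev: "der j (\<kappa> (ev q)) = \<kappa> (ev (pd j q))"
proof -
  have "pd j 0 = 0" by (rule der_along_0[OF pd_der])
  thus ?thesis using der_pw[of j "[:q:]"]
    by (simp add: pw_const D0_def map_poly_pCons pw_simps pderiv_pCons)
qed

lemma der_add: "der j (Y + Y') = der j Y + der j Y'"
proof -
  obtain G H where h: "pw H \<noteq> 0" "Y * \<kappa> (pw H) = \<kappa> (pw G)" using fraction_form by blast
  obtain G' H' where h': "pw H' \<noteq> 0" "Y' * \<kappa> (pw H') = \<kappa> (pw G')" using fraction_form by blast
  have n: "\<kappa> (pw H) \<noteq> 0" "\<kappa> (pw H') \<noteq> 0" using h h' by auto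
  have e: "(Y + Y') * \<kappa> (pw (H * H')) = \<kappa> (pw (G * H' + G' * H))"
    by (simp add: pw_simps h(2)[symmetric] h'(2)[symmetric] algebra_simps)
  have "der j (Y + Y') = (D0 j (G * H' + G' * H) - (Y + Y') * D0 j (H * H')) / \<kappa> (pw (H * H'))"
    by (rule der_eq) (use h h' e in \<open>auto simp: pw_simps\<close>)
  also have "\<dots> = (D0 j G - Y * D0 j H) / \<kappa> (pw H) + (D0 j G' - Y' * D0 j H') / \<kappa> (pw H')"
    using n by (simp add: D0_add D0_mult h(2)[symmetric] h'(2)[symmetric] pw_simps divide_simps) (simp add: algebra_simps)
  finally show ?thesis using der_eq[OF h] der_eq[OF h'] by simp
qed

lemma der_mult: "der j (Y * Y') = Y * der j Y' + Y' * der j Y"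
proof -
  obtain G H where h: "pw H \<noteq> 0" "Y * \<kappa> (pw H) = \<kappa> (pw G)" using fraction_form by blast
  obtain G' H' where h': "pw H' \<noteq> 0" "Y' * \<kappa> (pw H') = \<kappa> (pw G')" using fraction_form by blast
  have n: "\<kappa> (pw H) \<noteq> 0" "\<kappa> (pw H') \<noteq> 0" using h h' by auto
  have e: "(Y * Y') * \<kappa> (pw (H * H')) = \<kappa> (pw (G * G'))"
    by (simp add: pw_simps h(2)[symmetric] h'(2)[symmetric] algebra_simps)
  have "der j (Y * Y') = (D0 j (G * G') - (Y * Y') * D0 j (H * H')) / \<kappa> (pw (H * H'))"
    by (rule der_eq) (use h h' e in \<open>auto simp: pw_simps\<close>)
  also have "\<dots> = Y * ((D0 j G' - Y' * D0 j H') / \<kappa> (pw H')) + Y' * ((D0 j G - Y * D0 j H) / \<kappa> (pw H))"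
    using n by (simp add: D0_add D0_mult h(2)[symmetric] h'(2)[symmetric] pw_simps divide_simps) (simp add: algebra_simps)
  finally show ?thesis using der_eq[OF h] der_eq[OF h'] by simp
qed

lemma der_0: "der j 0 = 0" using der_add[of j 0 0] by (metis add_0 add_cancel_right_right)

lemma der_const: "der j (\<kappa> (\<iota> c)) = 0"
  using der_ev[of j "K3 c"] by (simp add: ev_K3 pd_gens ev_simps)

lemma der_sum: "der j (sum h S) = (\<Sum>k\<in>S. der j (h k))"
  by (induction S rule: infinite_finite_induct) (auto simp: der_0 der_add)

lemma der_quotient: assumes "Y' \<noteq> 0" shows "der j (Y / Y') = (der j Y - Y / Y' * der j Y') / Y'"
proof -
  have "der j Y = der j (Y / Y' * Y')" using assms by simp
  also have "\<dots> = Y / Y' * der j Y' + Y' * der j (Y / Y')" by (rule der_mult)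
  finally show ?thesis using assms by (simp add: field_simps)
qed

text \<open>The difference of the two derivations kills \<open>\<complex>[x, y, z]\<close>, so the
  equation of \<open>w\<close> forces \<open>Fw\<close> times its value at \<open>w\<close> to
  vanish, and every element is a fraction in \<open>w\<close>. This is what expresses brackets
  through partial derivatives.\<close>

lemma derivation_eqI:
  assumes d: "der_along \<kappa> \<delta>1" "der_along \<kappa> \<delta>2"
    and e: "\<And>c. \<delta>1 (\<iota> c) = \<delta>2 (\<iota> c)" "\<delta>1 x = \<delta>2 x" "\<delta>1 y = \<delta>2 y" "\<delta>1 z = \<delta>2 z"
  shows "\<delta>1 a = \<delta>2 a"
proof -
  have g: "ev X3 = x" "ev Y3 = y" "ev Z3 = z" by (simp_all add: ev_def ev3_gens i)
  have eq: "\<delta>1 (ev q) = \<delta>2 (ev q)" for q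
    by (rule mp3_der_eqI[where h = "\<lambda>q. \<kappa> (ev q)" and ?\<delta>1.0 = "\<lambda>q. \<delta>1 (ev q)"
      and ?\<delta>2.0 = "\<lambda>q. \<delta>2 (ev q)"])
       (use e g der_along_comp_hom[OF _ ev] d in \<open>auto simp: ev_K3\<close>)
  define \<delta> where "\<delta> = (\<lambda>a. \<delta>1 a - \<delta>2 a)"
  have dd: "der_along \<kappa> \<delta>" using d unfolding der_along_def \<delta>_def by (simp add: algebra_simps)
  have add: "\<delta> (a + b) = \<delta> a + \<delta> b" and mult: "\<delta> (a * b) = \<kappa> a * \<delta> b + \<kappa> b * \<delta> a" for a b
    using dd by (auto simp: der_along_def)
  have ez: "\<delta> (ev q) = 0" for q using eq by (simp add: \<delta>_def)
  have d0: "\<delta> 0 = 0" by (rule der_along_0[OF dd])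
  have dpw: "\<delta> (pw G) = \<kappa> (pw (pderiv G)) * \<delta> w" for G
  proof (induction G)
    case 0 show ?case by (simp add: pw_simps d0)
  next
    case (pCons q G)
    have "pw (pderiv (pCons q G)) = pw G + w * pw (pderiv G)"
      by (simp add: pderiv_pCons pw_simps pw_pCons ev_simps)
    thus ?case using pCons by (simp add: pw_pCons add mult ez algebra_simps)
  qed
  have "\<kappa> Fw * \<delta> w = 0" using dpw[of FF] by (simp add: pw_FF d0 Fw_def)
  hence dw: "\<delta> w = 0" using Fw_nz by simp
  obtain G H where h: "pw H \<noteq> 0" "pw H * a = pw G"
    using rat[of a] by (auto simp: rational_mod_def pw_def ev_def)
  have "\<delta> (pw H * a) = 0" by (simp add: h(2) dpw dw)
  hence "\<kappa> (pw H) * \<delta> a = 0" by (simp add: mult dpw dw)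
  thus ?thesis using h(1) by (simp add: \<delta>_def)
qed

subsection \<open>Filtration by degree\<close>

text \<open>A filtration of \<open>R\<close> by spaces of dimension at most
  \<open>r * (n + 1) ^ 3\<close>. Multiplying by a fixed element of \<open>R\<close> raises the
  level by a constant that depends on that element.\<close>

definition Rn :: "nat \<Rightarrow> 'a set" where
  "Rn n = {pw G | G. degree G < r \<and> (\<forall>k. tdeg (coeff G k) \<le> n)}"

definition emax :: nat where "emax = (\<Sum>k<r. tdeg (f k))"

lemma tdeg_f: "k < r \<Longrightarrow> tdeg (f k) \<le> emax"
  unfolding emax_def by (rule member_le_sum) auto

lemma RnI: "degree G < r \<Longrightarrow> (\<And>k. tdeg (coeff G k) \<le> n) \<Longrightarrow> pw G \<in> Rn n"
  by (auto simp: Rn_def)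

lemma RnE: assumes "a \<in> Rn n" obtains G where "a = pw G" "degree G < r" "\<And>k. tdeg (coeff G k) \<le> n"
  using assms by (auto simp: Rn_def)

lemma Rn_range: "a \<in> Rn n \<Longrightarrow> a \<in> range pw" by (auto simp: Rn_def)

lemma Rn_mono: assumes "a \<in> Rn n" "n \<le> m" shows "a \<in> Rn m"
  using assms(1) by (rule RnE) (auto intro!: RnI order_trans[OF _ assms(2)])

lemma Rn_add: assumes "a \<in> Rn n" "b \<in> Rn n" shows "a + b \<in> Rn n"
proof -
  obtain G where G: "a = pw G" "degree G < r" "\<And>k. tdeg (coeff G k) \<le> n"
    using assms(1) by (rule RnE) blast
  obtain H where H: "b = pw H" "degree H < r" "\<And>k. tdeg (coeff H k) \<le> n"
    using assms(2) by (rule RnE) blast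
  have "a + b = pw (G + H)" by (simp add: G H pw_simps)
  thus ?thesis using G H by (auto intro!: RnI degree_add_less tdeg_add_le)
qed

lemma Rn_uminus: assumes "a \<in> Rn n" shows "- a \<in> Rn n"
proof -
  obtain G where G: "a = pw G" "degree G < r" "\<And>k. tdeg (coeff G k) \<le> n"
    using assms(1) by (rule RnE) blast
  have "- a = pw (- G)" by (simp add: G pw_simps)
  thus ?thesis using G by (auto intro!: RnI simp: tdeg_uminus)
qed

lemma Rn_diff: "a \<in> Rn n \<Longrightarrow> b \<in> Rn n \<Longrightarrow> a - b \<in> Rn n"
  using Rn_add[of a n "-b"] Rn_uminus by simp

lemma Rn_0: "0 \<in> Rn n"
  using RnI[of 0 n] r0 by (simp add: pw_simps tdeg_0)

lemma Rn_sum: "(\<And>k. k \<in> S \<Longrightarrow> h k \<in> Rn n) \<Longrightarrow> sum h S \<in> Rn n"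
  by (induction S rule: infinite_finite_induct) (auto simp: Rn_0 Rn_add)

lemma Rn_ev: "tdeg q \<le> n \<Longrightarrow> ev q \<in> Rn n"
  using RnI[of "[:q:]" n] r0 by (simp add: pw_const coeff_pCons tdeg_0 split: nat.split)

lemma Rn_ev_mult: assumes "a \<in> Rn n" "tdeg q \<le> m" shows "ev q * a \<in> Rn (n + m)"
proof -
  obtain G where G: "a = pw G" "degree G < r" "\<And>k. tdeg (coeff G k) \<le> n"
    using assms(1) by (rule RnE) blast
  have "ev q * a = pw (smult q G)" by (simp add: G pw_smult)
  moreover have "tdeg (coeff (smult q G) k) \<le> n + m" for k
    using tdeg_mult_le[of q "coeff G k"] G(3)[of k] assms(2) by simp
  moreover have "degree (smult q G) < r" using G(2) degree_smult_le[of q G] by simp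
  ultimately show ?thesis using RnI by metis
qed

text \<open>Multiplication by \<open>w\<close> shifts the coefficients and creates at most one power
  \<open>w ^ r\<close>, which a single multiple of \<open>FF\<close> removes.\<close>

lemma Rn_w: assumes "a \<in> Rn n" shows "w * a \<in> Rn (n + emax)"
proof -
  obtain G where G: "a = pw G" "degree G < r" "\<And>k. tdeg (coeff G k) \<le> n"
    using assms(1) by (rule RnE) blast
  define G' where "G' = pCons 0 G - smult (coeff G (r - 1)) FF"
  have cz: "coeff G k = 0" if "k \<ge> r" for k using that G(2) by (simp add: coeff_eq_0)
  have c: "coeff G' k = (case k of 0 \<Rightarrow> 0 | Suc m \<Rightarrow> coeff G m) - coeff G (r - 1) * coeff FF k" for k
    by (simp add: G'_def coeff_pCons)
  have "coeff G' k = 0" if "k \<ge> r" for k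
    using that cz[of "k - 1"] r0 by (cases k) (auto simp: c coeff_FF)
  hence d: "degree G' < r" using r0 by (intro degree_lessI) auto
  have "tdeg (coeff G' k) \<le> n + emax" for k
  proof (cases "k < r")
    case True
    have "tdeg (case k of 0 \<Rightarrow> 0 | Suc m \<Rightarrow> coeff G m) \<le> n + emax"
      using G(3) by (auto simp: tdeg_0 split: nat.split intro: trans_le_add1)
    moreover have "tdeg (coeff G (r - 1) * coeff FF k) \<le> n + emax"
      using tdeg_mult_le[of "coeff G (r - 1)" "coeff FF k"] G(3)[of "r - 1"] tdeg_f[OF True] True
        by (simp add: coeff_FF)
    ultimately show ?thesis unfolding c by (rule tdeg_diff_le)
  next
    case False thus ?thesis using \<open>\<And>k. r \<le> k \<Longrightarrow> coeff G' k = 0\<close> by (simp add: tdeg_0)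
  qed
  moreover have "pw G' = w * a" by (simp add: G'_def pw_simps pw_pCons pw_smult pw_FF ev_simps G)
  ultimately show ?thesis using RnI[OF d] by metis
qed

lemma Rn_mult: "u \<in> range pw \<Longrightarrow> \<exists>c. \<forall>n a. a \<in> Rn n \<longrightarrow> u * a \<in> Rn (n + c)"
proof -
  assume "u \<in> range pw"
  then obtain G where u: "u = pw G" by blast
  have "\<exists>c. \<forall>n a. a \<in> Rn n \<longrightarrow> pw G * a \<in> Rn (n + c)"
  proof (induction G)
    case 0 show ?case by (auto simp: pw_simps Rn_0)
  next
    case (pCons q G)
    then obtain c where c: "\<And>n a. a \<in> Rn n \<Longrightarrow> pw G * a \<in> Rn (n + c)" by blast
    have "pw (pCons q G) * a \<in> Rn (n + (tdeg q + c + emax))" if a: "a \<in> Rn n" for n a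
    proof -
      have "pw (pCons q G) * a = ev q * a + w * (pw G * a)" by (simp add: pw_pCons algebra_simps)
      moreover have "ev q * a \<in> Rn (n + (tdeg q + c + emax))"
        by (rule Rn_mono[OF Rn_ev_mult[OF a order_refl]]) simp
      moreover have "w * (pw G * a) \<in> Rn (n + (tdeg q + c + emax))"
        by (rule Rn_mono[OF Rn_w[OF c[OF a]]]) simp
      ultimately show ?thesis by (simp add: Rn_add)
    qed
    thus ?case by blast
  qed
  thus ?thesis by (simp add: u)
qed

text \<open>By freeness the division takes place in the coefficients, where the total degree is
  additive. Here the degree of \<open>p\<close> leaves the bounds for the forms.\<close>

lemma Rn_div:
  assumes a: "ev q * a \<in> Rn (tdeg q + n)" and q: "q \<noteq> 0" and ar: "a \<in> range pw"
  shows "a \<in> Rn n"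
proof -
  obtain G where G: "ev q * a = pw G" "degree G < r" "\<And>k. tdeg (coeff G k) \<le> tdeg q + n"
    using a by (rule RnE) blast
  obtain H0 where "a = pw H0" using ar by blast
  then obtain H where H: "degree H < r" "pw H = a" using pw_reduce[of H0] by metis
  have "pw (G - smult q H) = 0" by (simp add: pw_simps pw_smult G(1)[symmetric] H)
  moreover have "degree (G - smult q H) < r"
    using G(2) H(1) degree_smult_le[of q H] by (intro degree_diff_less) auto
  ultimately have "G = smult q H" using pw_min by fastforce
  hence "tdeg (coeff H k) \<le> n" for k
    using G(3)[of k] tdeg_mult[OF q, of "coeff H k"] by (cases "coeff H k = 0") (auto simp: tdeg_0)
  thus ?thesis using RnI[OF H(1)] H(2) by metis
qed

lemma Rn_der:
  "\<exists>c. \<forall>n a. a \<in> Rn n \<longrightarrow> (\<exists>b. b \<in> Rn (n + c) \<and> \<kappa> Fw * der j (\<kappa> a) = \<kappa> b)"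
proof -
  obtain c1 where c1: "\<And>n a. a \<in> Rn n \<Longrightarrow> Fw * a \<in> Rn (n + c1)" using Rn_mult[OF Fw_range] by blast
  obtain c2 where c2: "\<And>n a. a \<in> Rn n \<Longrightarrow> pw (map_poly (pd j) FF) * a \<in> Rn (n + c2)"
    using Rn_mult[of "pw (map_poly (pd j) FF)"] by blast
  have "\<exists>b. b \<in> Rn (n + (c1 + c2)) \<and> \<kappa> Fw * der j (\<kappa> a) = \<kappa> b" if a: "a \<in> Rn n" for n a
  proof -
    obtain G where G: "a = pw G" "degree G < r" "\<And>k. tdeg (coeff G k) \<le> n" using a by (rule RnE) blast
    have z: "pd j 0 = 0" by (rule der_along_0[OF pd_der])
    have g1: "pw (map_poly (pd j) G) \<in> Rn n"
      using G by (intro RnI) (auto simp: coeff_map_poly z intro: order_trans[OF tdeg_pd] le_less_trans[OF degree_map_poly_le])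
    have g2: "pw (pderiv G) \<in> Rn n"
    proof (rule RnI)
      show "degree (pderiv G) < r" using G(2) by (simp add: degree_pderiv)
      fix k
      have "tdeg (of_nat (Suc k) * coeff G (Suc k)) \<le> 0 + tdeg (coeff G (Suc k))"
        using tdeg_mult_le[of "of_nat (Suc k)" "coeff G (Suc k)"] tdeg_K3[of "of_nat (Suc k)"]
        by (simp add: rhom_of_nat[OF K3_rhom] del: of_nat_Suc)
      thus "tdeg (coeff (pderiv G) k) \<le> n"
        using G(3)[of "Suc k"] by (simp add: coeff_pderiv del: of_nat_Suc)
    qed
    define b where "b = Fw * pw (map_poly (pd j) G) - pw (map_poly (pd j) FF) * pw (pderiv G)"
    have "b \<in> Rn (n + (c1 + c2))" unfolding b_def
      by (intro Rn_diff Rn_mono[OF c1[OF g1]] Rn_mono[OF c2[OF g2]]) simp_all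
    moreover have "\<kappa> Fw * der j (\<kappa> a) = \<kappa> b"
      using Fw_nz by (simp add: G der_pw D0_def b_def right_diff_distrib)
    ultimately show ?thesis by blast
  qed
  thus ?thesis by blast
qed

text \<open>\<open>N\<close> elements of \<open>Rn n\<close> have
  \<open>N * (r * (n + 1) ^ 3)\<close> coefficients in all, the simplex of exponents being enlarged
  to a cube. With more indices than that, one relation \<open>t\<close> serves all
  \<open>l < N\<close> simultaneously.\<close>

lemma finite_dimensional:
  assumes M: "finite M" "card M > N * (r * (n + 1) ^ 3)" and a: "\<And>m l. m \<in> M \<Longrightarrow> l < N \<Longrightarrow> a m l \<in> Rn n"
  shows "\<exists>t. (\<exists>m\<in>M. t m \<noteq> 0) \<and> (\<forall>l<N. (\<Sum>m\<in>M. \<iota> (t m) * a m l) = 0)"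
proof -
  define G where "G = (\<lambda>m l. SOME G. a m l = pw G \<and> degree G < r \<and> (\<forall>k. tdeg (coeff G k) \<le> n))"
  have Gp: "a m l = pw (G m l) \<and> degree (G m l) < r \<and> (\<forall>k. tdeg (coeff (G m l) k) \<le> n)"
    if "m \<in> M" "l < N" for m l
    unfolding G_def by (rule someI_ex) (use a[OF that] in \<open>auto simp: Rn_def\<close>)
  hence G: "\<And>m l. m \<in> M \<Longrightarrow> l < N \<Longrightarrow> a m l = pw (G m l)"
     "\<And>m l. m \<in> M \<Longrightarrow> l < N \<Longrightarrow> degree (G m l) < r"
     "\<And>m l k. m \<in> M \<Longrightarrow> l < N \<Longrightarrow> tdeg (coeff (G m l) k) \<le> n" by blast+
  define J where "J = {..<N} \<times> {..<r} \<times> {..n} \<times> {..n} \<times> {..n}"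
  have cJ: "card J = N * (r * (n + 1) ^ 3)" by (simp add: J_def power3_eq_cube)
  define C where "C = (\<lambda>m (l,k,i1,i2,i3). mcoeff (coeff (G m l) k) i1 i2 i3)"
  obtain t where lam: "\<exists>m\<in>M. t m \<noteq> 0" "\<forall>q\<in>J. (\<Sum>m\<in>M. t m * C m q) = 0"
  proof -
    have "finite J" by (simp add: J_def)
    moreover have "card J < card M" using M(2) unfolding cJ .
    ultimately show ?thesis using linear_dependence[of J M C] M(1) that by blast
  qed
  have "(\<Sum>m\<in>M. \<iota> (t m) * a m l) = 0" if l: "l < N" for l
  proof -
    define H where "H = (\<Sum>m\<in>M. smult (K3 (t m)) (G m l))"
    have ms: "mcoeff (sum h S) i1 i2 i3 = (\<Sum>s\<in>S. mcoeff (h s) i1 i2 i3)" for h :: "'b \<Rightarrow> mp3"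
      and S i1 i2 i3
      by (simp add: mcoeff_def coeff_sum)
    have mk: "mcoeff (K3 c * q) i1 i2 i3 = c * mcoeff q i1 i2 i3" for c q i1 i2 i3
      by (simp add: mcoeff_def K3_def)
    have "coeff H k = 0" for k
    proof (rule mcoeff_eqI)
      fix i1 i2 i3
      have e: "mcoeff (coeff H k) i1 i2 i3 = (\<Sum>m\<in>M. t m * C m (l,k,i1,i2,i3))"
        by (simp add: H_def coeff_sum ms mk C_def)
      show "mcoeff (coeff H k) i1 i2 i3 = mcoeff 0 i1 i2 i3"
      proof (cases "k < r \<and> i1 \<le> n \<and> i2 \<le> n \<and> i3 \<le> n")
        case True
        hence "(l,k,i1,i2,i3) \<in> J" using l by (simp add: J_def)
        thus ?thesis using lam(2) e by (simp add: mcoeff_0)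
      next
        case False
        have "C m (l,k,i1,i2,i3) = 0" if m: "m \<in> M" for m
        proof (cases "k < r")
          case True
          hence "n < i1 + i2 + i3" using False by auto
          thus ?thesis using G(3)[OF m l, of k] by (simp add: C_def tdeg_le_iff)
        next
          case F: False
          hence "coeff (G m l) k = 0" using G(2)[OF m l] by (intro coeff_eq_0) simp
          thus ?thesis by (simp add: C_def mcoeff_0)
        qed
        thus ?thesis unfolding e by (simp add: mcoeff_0)
      qed
    qed
    hence "H = 0" by (intro poly_eqI) simp
    moreover have "pw H = (\<Sum>m\<in>M. \<iota> (t m) * a m l)"
      using G(1) l by (simp add: H_def rhom_sum[OF pw] pw_smult ev_K3)
    ultimately show ?thesis by (simp add: pw_simps)
  qed
  thus ?thesis using lam(1) by blast
qed

end

subsection \<open>The logarithmic form of an invariant surface\<close>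

lemma mcoeff_pd:
  "mcoeff (pd j p) a b c = (if j = 0 then of_nat (Suc a) * mcoeff p (Suc a) b c
     else if j = 1 then of_nat (Suc b) * mcoeff p a (Suc b) c else of_nat (Suc c) * mcoeff p a b (Suc c))"
  by (auto simp: pd_def mcoeff_def coeff_map_poly coeff_pderiv of_nat_poly simp del: of_nat_Suc)

lemma pd_commute: "pd i (pd j p) = pd j (pd i p)"
  by (rule mcoeff_eqI) (simp add: mcoeff_pd mult_ac del: of_nat_Suc)

lemma prime_elem_power_dvd:
  assumes "prime_elem p" "\<not> p dvd a" "p ^ n dvd a * b" shows "p ^ n dvd (b :: 'r::idom)"
  using assms(3)
proof (induction n arbitrary: b)
  case (Suc n)
  have p0: "p \<noteq> 0" using assms(1) by auto
  have "p dvd a * b" using Suc.prems by (metis dvd_mult_left power_Suc)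
  hence "p dvd b" using assms by (simp add: prime_elem_dvd_mult_iff)
  then obtain b' where b': "b = p * b'" by (elim dvdE)
  have "p * p ^ n dvd p * (a * b')" using Suc.prems by (simp add: b' mult_ac)
  hence "p ^ n dvd a * b'" using p0 by simp
  hence "p ^ n dvd b'" by (rule Suc.IH)
  thus ?case by (simp add: b')
qed simp

context coords
begin

text \<open>Fixed once for each \<open>u\<close>, so that later bounds depend on the coordinates
  only and are the same for all primes of the family.\<close>

definition mc :: "'a \<Rightarrow> nat" where
  "mc u = (SOME c. \<forall>n a. a \<in> Rn n \<longrightarrow> u * a \<in> Rn (n + c))"

lemma Rn_mc: "u \<in> range pw \<Longrightarrow> a \<in> Rn n \<Longrightarrow> u * a \<in> Rn (n + mc u)"
  using someI_ex[OF Rn_mult[of u]] unfolding mc_def by blast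

definition cder :: "nat \<Rightarrow> nat" where
  "cder j = (SOME c. \<forall>n a. a \<in> Rn n \<longrightarrow> (\<exists>b. b \<in> Rn (n + c) \<and> \<kappa> Fw * der j (\<kappa> a) = \<kappa> b))"

lemma Rn_cder: "a \<in> Rn n \<Longrightarrow> \<exists>b. b \<in> Rn (n + cder j) \<and> \<kappa> Fw * der j (\<kappa> a) = \<kappa> b"
  using someI_ex[OF Rn_der[of j]] unfolding cder_def by blast

lemma range_Rn: assumes "u \<in> range pw" shows "u \<in> Rn (mc u)"
  using Rn_mc[OF assms Rn_ev[of 1 0]] by (simp add: tdeg_1 ev_simps)

lemma der_range: assumes "u \<in> range pw" shows "\<exists>b. b \<in> range pw \<and> \<kappa> Fw * der j (\<kappa> u) = \<kappa> b"
  using Rn_cder[OF range_Rn[OF assms], of j] Rn_range by blast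

text \<open>The coefficient of \<open>W ^ k\<close> in \<open>FF(W) / (W - w)\<close>. Divided by
  \<open>Fw\<close>, these elements form the basis dual to \<open>1, ..., w ^ (r - 1)\<close> under
  the trace form (Euler).\<close>

definition cc :: "nat \<Rightarrow> 'a" where
  "cc k = (\<Sum>m\<in>{Suc k..r}. ev (coeff FF m) * w ^ (m - Suc k))"

text \<open>If \<open>T k j\<close> agrees with \<open>w ^ k * g\<close> on \<open>V(P)\<close> for
  all \<open>k\<close>, this sum agrees with \<open>Fw * g\<close> there, by \<open>Fw_cc\<close>.
  Below, \<open>g\<close> is a partial derivative of \<open>p\<close>.\<close>

definition nn :: "(nat \<Rightarrow> nat \<Rightarrow> mp3) \<Rightarrow> nat \<Rightarrow> 'a" where
  "nn T j = (\<Sum>k<r. cc k * ev (T k j))"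

lemma cc_range: "cc k \<in> range pw"
  unfolding cc_def by (intro range_pw_sum range_pw_mult range_pw_ev range_pw_power range_pw_w)

lemma nn_range: "nn T j \<in> range pw"
  unfolding nn_def by (intro range_pw_sum range_pw_mult range_pw_ev cc_range)

definition cnn :: nat where "cnn = (\<Sum>k<r. k * emax + mc (cc k))"

lemma nn_Rn: assumes "\<And>k. k < r \<Longrightarrow> tdeg (T k j) \<le> D + k * emax" shows "nn T j \<in> Rn (D + cnn)"
  unfolding nn_def
proof (rule Rn_sum)
  fix k assume k: "k \<in> {..<r}"
  have "cc k * ev (T k j) \<in> Rn ((D + k * emax) + mc (cc k))"
    using k by (intro Rn_mc cc_range Rn_ev assms) simp
  moreover have "k * emax + mc (cc k) \<le> cnn" unfolding cnn_def using k by (intro member_le_sum) auto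
  ultimately show "cc k * ev (T k j) \<in> Rn (D + cnn)" by (elim Rn_mono) simp
qed

lemma cc_Suc: assumes "k < r" shows "cc k = ev (coeff FF (Suc k)) + w * cc (Suc k)"
proof -
  have "cc k = ev (coeff FF (Suc k)) * w ^ 0 + (\<Sum>m\<in>{Suc (Suc k)..r}. ev (coeff FF m) * w ^ (m - Suc k))"
    unfolding cc_def using assms by (subst sum.atLeast_Suc_atMost) auto
  also have "(\<Sum>m\<in>{Suc (Suc k)..r}. ev (coeff FF m) * w ^ (m - Suc k)) = w * cc (Suc k)"
    unfolding cc_def sum_distrib_left
  proof (rule sum.cong)
    fix m assume "m \<in> {Suc (Suc k)..r}"
    hence "m - Suc k = Suc (m - Suc (Suc k))" by auto
    thus "ev (coeff FF m) * w ^ (m - Suc k) = w * (ev (coeff FF m) * w ^ (m - Suc (Suc k)))"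
      by (simp add: mult_ac)
  qed simp
  finally show ?thesis by simp
qed

lemma pw_FF_sum: "pw FF = (\<Sum>m\<le>r. ev (coeff FF m) * w ^ m)"
  unfolding pw_def by (rule pev_altdef[OF ev]) (simp add: degree_FF)

lemma cc_0: "w * cc 0 = - ev (coeff FF 0)"
proof -
  have "w * cc 0 = (\<Sum>m\<in>{Suc 0..r}. ev (coeff FF m) * w ^ m)"
    unfolding cc_def sum_distrib_left
  proof (rule sum.cong)
    fix m assume "m \<in> {Suc 0..r}"
    hence "w ^ m = w * w ^ (m - Suc 0)" by (simp flip: power_Suc)
    thus "w * (ev (coeff FF m) * w ^ (m - Suc 0)) = ev (coeff FF m) * w ^ m" by (simp add: mult_ac)
  qed simp
  moreover have "pw FF = ev (coeff FF 0) + (\<Sum>m\<in>{Suc 0..r}. ev (coeff FF m) * w ^ m)"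
    unfolding pw_FF_sum by (simp add: sum.atLeast_Suc_atMost atMost_atLeast0)
  ultimately show ?thesis using pw_FF by (simp add: add_eq_0_iff)
qed

lemma cc_r: "cc r = 0" by (simp add: cc_def)

text \<open>The value of \<open>FF(W) / (W - w)\<close> at \<open>W = w\<close>. The double sum
  counts the term of degree \<open>m\<close> once for each \<open>k < m\<close>.\<close>

lemma Fw_cc: "Fw = (\<Sum>k<r. cc k * w ^ k)"
proof -
  define G where "G = (\<lambda>m. ev (coeff FF m) * w ^ (m - 1))"
  have "Fw = (\<Sum>m\<le>r - 1. ev (of_nat (Suc m) * coeff FF (Suc m)) * w ^ m)"
    unfolding Fw_def pw_def
    by (subst pev_altdef[OF ev, of _ "r - 1"]) (auto simp: degree_pderiv degree_FF coeff_pderiv simp del: of_nat_Suc)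
  also have "\<dots> = (\<Sum>m<r. of_nat (Suc m) * G (Suc m))"
    using r0 by (intro sum.cong) (auto simp: G_def rhom_mult[OF ev] rhom_of_nat[OF ev] mult.assoc simp del: of_nat_Suc)
  also have "\<dots> = (\<Sum>m\<in>{1..r}. of_nat m * G m)"
    using sum.atLeast1_atMost_eq[of "\<lambda>m. of_nat m * G m" r] by simp
  also have "\<dots> = (\<Sum>m\<in>{1..r}. \<Sum>k<m. G m)" by simp
  also have "\<dots> = (\<Sum>k<r. \<Sum>m\<in>{Suc k..r}. G m)"
  proof -
    have "(\<Sum>m\<in>{1..r}. \<Sum>k<m. G m) = (\<Sum>(m, k)\<in>Sigma {1..r} (\<lambda>m. {..<m}). G m)"
      by (rule sum.Sigma) auto
    also have "\<dots> = (\<Sum>(k, m)\<in>Sigma {..<r} (\<lambda>k. {Suc k..r}). G m)"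
      by (rule sum.reindex_bij_witness[of _ "\<lambda>(k,m). (m,k)" "\<lambda>(m,k). (k,m)"]) auto
    also have "\<dots> = (\<Sum>k<r. \<Sum>m\<in>{Suc k..r}. G m)" by (rule sum.Sigma[symmetric]) auto
    finally show ?thesis .
  qed
  also have "\<dots> = (\<Sum>k<r. cc k * w ^ k)"
  proof (rule sum.cong)
    fix k assume "k \<in> {..<r}"
    show "(\<Sum>m\<in>{Suc k..r}. G m) = cc k * w ^ k"
      unfolding cc_def sum_distrib_right
    proof (rule sum.cong)
      fix m assume "m \<in> {Suc k..r}"
      hence "m - 1 = (m - Suc k) + k" by auto
      thus "G m = ev (coeff FF m) * w ^ (m - Suc k) * w ^ k"
        unfolding G_def by (simp add: power_add mult.assoc)
    qed simp
  qed simp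
  finally show ?thesis .
qed

end

text \<open>One surface \<open>P\<close> of the family, with \<open>p\<close> generating its
  contraction to \<open>\<complex>[x, y, z]\<close>. The relation \<open>u0 * Fw = ev s0\<close>
  outside \<open>P\<close> makes \<open>Fw\<close> invertible once polynomials outside
  \<open>P\<close> are inverted: \<open>R\<close> is unramified over the generic point of
  \<open>p = 0\<close>.\<close>

locale coords_prime = coords +
  fixes P :: "'a set" and p :: mp3 and T :: "nat \<Rightarrow> nat \<Rightarrow> mp3" and s0 :: mp3 and u0 :: 'a
  assumes P: "prime_ideal P" and pP: "\<And>q. ev3 \<iota> x y z q \<in> P \<longleftrightarrow> p dvd q" and p0: "p \<noteq> 0"
    and xy: "lies_over_zero (pev (pev \<iota> x) y) P"
    and Tt: "\<And>k j. tdeg (T k j) \<le> tdeg p + k * emax"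
    and Tc: "\<And>k j. ev (T k j) - w ^ k * ev (pd j p) \<in> P"
    and u0: "u0 \<in> range pw" "u0 * Fw = ev s0" "ev s0 \<notin> P"
begin

lemma I: "ideal P" by (rule prime_idealD[OF P])

lemma pP': "ev q \<in> P \<longleftrightarrow> p dvd q" using pP by (simp add: ev_def)

lemma pp: "prime_elem p" by (rule prime_elem_of_ideal[OF ev P p0 pP'])

lemma evp_P: "ev p \<in> P" by (simp add: pP')

lemma FwP: "Fw \<notin> P" using u0 ideal_mult[OF I, of Fw u0] by auto

text \<open>The ideal generated by \<open>p\<close> in \<open>R\<close>. Congruences modulo it
  concern all components over \<open>p = 0\<close>, whereas \<open>P\<close> is only one of
  them.\<close>

definition pR :: "'a set" where "pR = {ev p * u | u. u \<in> range pw}"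

lemma pR_0: "0 \<in> pR"
  unfolding pR_def using range_pw_ev[of 0] by (auto simp: ev_simps intro!: exI[of _ 0])

lemma pR_add: assumes "a \<in> pR" "b \<in> pR" shows "a + b \<in> pR"
proof -
  obtain u v where h: "a = ev p * u" "b = ev p * v" "u \<in> range pw" "v \<in> range pw"
    using assms unfolding pR_def by blast
  have "a + b = ev p * (u + v)" by (simp add: h distrib_left)
  thus ?thesis unfolding pR_def using range_pw_add[OF h(3,4)] by blast
qed

lemma pR_mult: assumes "a \<in> pR" "v \<in> range pw" shows "v * a \<in> pR"
proof -
  obtain u where h: "a = ev p * u" "u \<in> range pw" using assms unfolding pR_def by blast
  have "v * a = ev p * (v * u)" by (simp add: h mult_ac)
  thus ?thesis unfolding pR_def using range_pw_mult[OF assms(2) h(2)] by blast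
qed

lemma pR_uminus: assumes "a \<in> pR" shows "- a \<in> pR"
proof -
  have "ev (-1) * a \<in> pR" by (rule pR_mult[OF assms range_pw_ev])
  thus ?thesis by (simp add: ev_simps)
qed

lemma pR_diff: "a \<in> pR \<Longrightarrow> b \<in> pR \<Longrightarrow> a - b \<in> pR"
  using pR_add[of a "-b"] pR_uminus by simp

lemma pR_sum: "(\<And>k. k \<in> S \<Longrightarrow> h k \<in> pR) \<Longrightarrow> sum h S \<in> pR"
  by (induction S rule: infinite_finite_induct) (auto simp: pR_0 pR_add)

lemma pR_ev: "ev q \<in> P \<Longrightarrow> ev q \<in> pR"
  unfolding pP' pR_def by (auto simp: dvd_def ev_simps intro: range_pw_ev)

text \<open>\<open>ev t \<notin> P\<close> means that the prime \<open>p\<close> does not divide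
  \<open>t\<close>. Since \<open>R\<close> is free over \<open>\<complex>[x, y, z]\<close>, powers
  of \<open>p\<close> can be split off coefficient by coefficient.\<close>

lemma cancel:
  assumes t: "ev t \<notin> P" and a: "a \<in> range pw" and b: "b \<in> range pw" and e: "ev t * a = ev (p ^ n) * b"
  shows "\<exists>a'. a' \<in> range pw \<and> a = ev (p ^ n) * a'"
proof -
  obtain G where G: "degree G < r" "pw G = a" using a pw_reduce by (metis rangeE)
  obtain H where H: "degree H < r" "pw H = b" using b pw_reduce by (metis rangeE)
  have "pw (smult t G - smult (p ^ n) H) = 0" using e by (simp add: pw_simps pw_smult G H)
  moreover have "degree (smult t G - smult (p ^ n) H) < r"
    using G(1) H(1) degree_smult_le[of t G] degree_smult_le[of "p ^ n" H]
      by (intro degree_diff_less) auto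
  ultimately have "smult t G = smult (p ^ n) H" using pw_min by fastforce
  hence c: "t * coeff G k = p ^ n * coeff H k" for k by (metis coeff_smult)
  have "\<not> p dvd t" using t pP' by simp
  hence "p ^ n dvd coeff G k" for k
    using prime_elem_power_dvd[OF pp, of t n "coeff G k"] c by simp
  hence "[:p ^ n:] dvd G" by (simp add: const_poly_dvd_iff)
  then obtain G' where "G = [:p ^ n:] * G'" by (elim dvdE)
  hence "a = ev (p ^ n) * pw G'" by (simp add: G(2)[symmetric] pw_smult)
  thus ?thesis by blast
qed

lemma pR_cancel: assumes "ev t \<notin> P" "a \<in> range pw" "ev t * a \<in> pR" shows "a \<in> pR"
proof -
  obtain b where "b \<in> range pw" "ev t * a = ev (p ^ 1) * b" using assms(3) by (auto simp: pR_def)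
  from cancel[OF assms(1,2) this] show ?thesis by (auto simp: pR_def)
qed

abbreviation n :: "nat \<Rightarrow> 'a" where "n \<equiv> nn T"
abbreviation dp :: "nat \<Rightarrow> 'a" where "dp j \<equiv> ev (pd j p)"

lemma n_Rn: "n j \<in> Rn (tdeg p + cnn)" by (rule nn_Rn[OF Tt])

lemma n_mod: "n j - Fw * dp j \<in> P"
proof -
  have "n j - Fw * dp j = (\<Sum>k<r. cc k * (ev (T k j) - w ^ k * dp j))"
    by (simp add: nn_def Fw_cc right_diff_distrib sum_subtractf sum_distrib_right mult.assoc)
  also have "\<dots> \<in> P" by (intro ideal_sum ideal_mult I Tc)
  finally show ?thesis .
qed

text \<open>Each \<open>T k a * pd b p - T k b * pd a p\<close> is a polynomial in
  \<open>x, y, z\<close> whose value lies in \<open>P\<close>, hence it is divisible by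
  \<open>p\<close>. So the lifts are parallel to the gradient of \<open>p\<close> on every
  component, not only on \<open>V(P)\<close>.\<close>

lemma n_cross: "n a * dp b - n b * dp a \<in> pR"
proof -
  have "n a * dp b - n b * dp a = (\<Sum>k<r. cc k * ev (T k a * pd b p - T k b * pd a p))"
    by (simp add: nn_def right_diff_distrib sum_subtractf sum_distrib_right mult.assoc ev_simps)
  also have "\<dots> \<in> pR"
  proof (intro pR_sum pR_mult[OF _ cc_range] pR_ev)
    fix k
    have "ev (T k a * pd b p - T k b * pd a p) = dp b * (ev (T k a) - w ^ k * dp a) - dp a * (ev (T k b) - w ^ k * dp b)"
      by (simp add: ev_simps algebra_simps)
    also have "\<dots> \<in> P" by (rule ideal_diff[OF I]; rule ideal_mult[OF I Tc])
    finally show "ev (T k a * pd b p - T k b * pd a p) \<in> P" .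
  qed
  finally show ?thesis .
qed

text \<open>Multiplication by \<open>w\<close> acts on \<open>\<Sum> cc k T\<^sub>k\<close> modulo \<open>p\<close> by the shift \<open>T\<^sub>k \<mapsto> T\<^bsub>k+1\<^esub>\<close>, exactly as on \<open>V(P)\<close>,
  where \<open>T\<^sub>k\<close> restricts to \<open>w\<^sup>k \<partial>p\<close>. Hence \<open>n j\<close> is annihilated modulo \<open>p\<close> by all functions vanishing on \<open>V(P)\<close>:
  it vanishes on the other components of \<open>V(p)\<close>.\<close>
lemma shift: "w ^ l * n j - (\<Sum>k<r. cc k * ev (T (k + l) j)) \<in> pR"
proof (induction l)
  case 0 show ?case by (simp add: nn_def pR_0)
next
  case (Suc l)
  define M where "M = (\<lambda>l. \<Sum>k<r. cc k * ev (T (k + l) j))"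
  have "M (Suc l) = (\<Sum>k<r. ev (coeff FF (Suc k)) * ev (T (Suc k + l) j) + w * (cc (Suc k) * ev (T (Suc k + l) j)))"
    unfolding M_def by (rule sum.cong) (auto simp: cc_Suc algebra_simps)
  also have "\<dots> = (\<Sum>k<r. ev (coeff FF (Suc k)) * ev (T (Suc k + l) j)) + w * (\<Sum>k<r. cc (Suc k) * ev (T (Suc k + l) j))"
    by (simp add: sum.distrib sum_distrib_left)
  also have "(\<Sum>k<r. cc (Suc k) * ev (T (Suc k + l) j)) = M l - cc 0 * ev (T l j)"
  proof -
    have "(\<Sum>k<Suc r. cc k * ev (T (k + l) j)) = M l" by (simp add: M_def cc_r)
    thus ?thesis by (subst (asm) sum.lessThan_Suc_shift) (simp add: algebra_simps)
  qed
  also have "(\<Sum>k<r. ev (coeff FF (Suc k)) * ev (T (Suc k + l) j)) = (\<Sum>k\<le>r. ev (coeff FF k) * ev (T (k + l) j)) - ev (coeff FF 0) * ev (T l j)"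
    unfolding lessThan_Suc_atMost[symmetric] by (subst sum.lessThan_Suc_shift) simp
  finally have e: "M (Suc l) = w * M l + ev (\<Sum>k\<le>r. coeff FF k * T (k + l) j)"
    using cc_0 by (simp add: right_diff_distrib mult.assoc[symmetric] rhom_sum[OF ev] ev_simps)
  have "ev (\<Sum>k\<le>r. coeff FF k * T (k + l) j) \<in> P"
  proof -
    have "ev (\<Sum>k\<le>r. coeff FF k * T (k + l) j)
       = (\<Sum>k\<le>r. ev (coeff FF k) * (ev (T (k + l) j) - w ^ (k + l) * dp j)) + w ^ l * dp j * pw FF"
      by (simp add: pw_FF_sum rhom_sum[OF ev] ev_simps right_diff_distrib sum_subtractf sum_distrib_left power_add mult_ac)
    also have "\<dots> = (\<Sum>k\<le>r. ev (coeff FF k) * (ev (T (k + l) j) - w ^ (k + l) * dp j))"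
      by (simp add: pw_FF)
    also have "\<dots> \<in> P" by (intro ideal_sum ideal_mult I Tc)
    finally show ?thesis .
  qed
  hence q: "ev (\<Sum>k\<le>r. coeff FF k * T (k + l) j) \<in> pR" by (rule pR_ev)
  have "w ^ Suc l * n j - M (Suc l) = w * (w ^ l * n j - M l) - ev (\<Sum>k\<le>r. coeff FF k * T (k + l) j)"
    by (simp add: e algebra_simps)
  also have "\<dots> \<in> pR"
  proof -
    have "w ^ l * n j - M l \<in> pR" using Suc by (simp add: M_def)
    thus ?thesis by (rule pR_diff[OF pR_mult[OF _ range_pw_w] q])
  qed
  finally show ?case by (simp add: M_def)
qed

lemma annihilate: assumes g: "g \<in> range pw" "g \<in> P" shows "g * n j \<in> pR"
proof -
  obtain G where G: "g = pw G" using g by blast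
  have gs: "g = (\<Sum>l\<le>degree G. ev (coeff G l) * w ^ l)"
    unfolding G pw_def by (rule pev_altdef[OF ev]) simp
  have "g * n j = (\<Sum>l\<le>degree G. ev (coeff G l) * (w ^ l * n j - (\<Sum>k<r. cc k * ev (T (k + l) j))))
      + (\<Sum>l\<le>degree G. \<Sum>k<r. ev (coeff G l) * (cc k * ev (T (k + l) j)))"
    by (subst gs) (simp add: right_diff_distrib sum_subtractf sum_distrib_left sum_distrib_right mult.assoc)
  also have "(\<Sum>l\<le>degree G. \<Sum>k<r. ev (coeff G l) * (cc k * ev (T (k + l) j)))
     = (\<Sum>k<r. cc k * ev (\<Sum>l\<le>degree G. coeff G l * T (k + l) j))"
    by (subst sum.swap) (simp add: rhom_sum[OF ev] ev_simps sum_distrib_left mult_ac)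
  also have "(\<Sum>l\<le>degree G. ev (coeff G l) * (w ^ l * n j - (\<Sum>k<r. cc k * ev (T (k + l) j)))) + \<dots> \<in> pR"
  proof (intro pR_add pR_sum pR_mult[OF _ range_pw_ev] shift pR_mult[OF _ cc_range] pR_ev)
    fix k
    have "ev (\<Sum>l\<le>degree G. coeff G l * T (k + l) j)
       = (\<Sum>l\<le>degree G. ev (coeff G l) * (ev (T (k + l) j) - w ^ (k + l) * dp j)) + w ^ k * dp j * g"
      by (subst gs) (simp add: rhom_sum[OF ev] ev_simps right_diff_distrib sum_subtractf sum_distrib_left power_add mult_ac)
    also have "\<dots> \<in> P" by (intro ideal_add ideal_sum ideal_mult I Tc g)
    finally show "ev (\<Sum>l\<le>degree G. coeff G l * T (k + l) j) \<in> P" .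
  qed
  finally show ?thesis .
qed

lemma dp2: "dp 2 \<notin> P"
proof
  assume "dp 2 \<in> P"
  hence d: "p dvd pderiv p" by (simp add: pP' pd_def)
  have c: "ev [:d:] = pev (pev \<iota> x) y d" for d
    by (simp add: ev_def ev3_def pev_const[OF pev_rhom[OF pev_rhom[OF i]]])
  have dg: "degree p > 0"
  proof (rule ccontr)
    assume "\<not> degree p > 0"
    then obtain d where "p = [:d:]" by (metis degree_eq_zeroE gr0I)
    thus False using evp_P xy p0 by (auto simp: c lies_over_zero_def)
  qed
  hence "pderiv p \<noteq> 0" by (simp add: pderiv_eq_0_iff)
  hence "degree p \<le> degree (pderiv p)" using d by (intro dvd_imp_degree_le)
  thus False using dg by (simp add: degree_pderiv)
qed

lemma n2P: "n 2 \<notin> P"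
  using n_mod[of 2] ideal_cong_add[OF I] FwP dp2 prime_ideal_mult[OF P] by blast

text \<open>The hypothesis concerns \<open>V(P)\<close> only. Multiplied by \<open>n 2\<close> it
  extends to all components by \<open>annihilate\<close>; \<open>n_cross\<close> then exchanges
  \<open>n 2\<close> for \<open>dp 2\<close>, which can be cancelled, and dividing by
  \<open>p\<close> takes \<open>tdeg p\<close> out of the bound.\<close>

lemma contraction_bound:
  assumes u: "u \<in> range pw" and v: "v \<in> range pw" and uv: "u * dp b - v * dp a \<in> P"
  shows "\<exists>h. h \<in> Rn (cnn + (mc u + mc v)) \<and> u * n b - v * n a = ev p * h"
proof -
  have "dp 2 * (u * n b - v * n a) = n 2 * (u * dp b - v * dp a) + u * (n b * dp 2 - n 2 * dp b) - v * (n a * dp 2 - n 2 * dp a)"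
    by (simp add: algebra_simps)
  also have "\<dots> \<in> pR"
  proof (intro pR_diff pR_add)
    have "(u * dp b - v * dp a) * n 2 \<in> pR"
      by (intro annihilate range_pw_diff range_pw_mult range_pw_ev u v uv)
    thus "n 2 * (u * dp b - v * dp a) \<in> pR" by (simp add: mult.commute)
  qed (intro pR_mult n_cross u v)+
  finally have "dp 2 * (u * n b - v * n a) \<in> pR" .
  hence "u * n b - v * n a \<in> pR"
    using dp2 by (rule pR_cancel[rotated 2]) (intro range_pw_diff range_pw_mult nn_range u v)
  then obtain h where h: "h \<in> range pw" "u * n b - v * n a = ev p * h" by (auto simp: pR_def)
  have "u * n b - v * n a \<in> Rn (tdeg p + (cnn + (mc u + mc v)))"
    by (intro Rn_diff Rn_mono[OF Rn_mc[OF u n_Rn]] Rn_mono[OF Rn_mc[OF v n_Rn]]) auto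
  hence "h \<in> Rn (cnn + (mc u + mc v))" unfolding h(2) by (rule Rn_div[OF _ p0 h(1)])
  thus ?thesis using h by blast
qed

text \<open>\<open>R\<close> with all polynomials outside \<open>(p)\<close> inverted, that is, the
  fractions without poles along the components over \<open>p = 0\<close>. It is stable under
  \<open>der\<close> because \<open>Fw\<close> is invertible in it.\<close>

definition Loc :: "'a fract set" where
  "Loc = {Y. \<exists>t u. ev t \<notin> P \<and> u \<in> range pw \<and> \<kappa> (ev t) * Y = \<kappa> u}"

lemma LocI: "ev t \<notin> P \<Longrightarrow> u \<in> range pw \<Longrightarrow> \<kappa> (ev t) * Y = \<kappa> u \<Longrightarrow> Y \<in> Loc"
  unfolding Loc_def by blast

lemma Loc_range: "u \<in> range pw \<Longrightarrow> \<kappa> u \<in> Loc"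
  by (rule LocI[of 1]) (auto simp: ev_simps prime_ideal_1[OF P])

lemma Loc_add: assumes "Y \<in> Loc" "Y' \<in> Loc" shows "Y + Y' \<in> Loc"
proof -
  obtain t u where h: "ev t \<notin> P" "u \<in> range pw" "\<kappa> (ev t) * Y = \<kappa> u"
    using assms(1) by (auto simp: Loc_def)
  obtain t' u' where h': "ev t' \<notin> P" "u' \<in> range pw" "\<kappa> (ev t') * Y' = \<kappa> u'"
    using assms(2) by (auto simp: Loc_def)
  have "\<kappa> (ev (t * t')) * (Y + Y') = \<kappa> (ev t' * u + ev t * u')"
    by (simp add: ev_simps h(3)[symmetric] h'(3)[symmetric] algebra_simps)
  thus ?thesis by (rule LocI[rotated 2])
    (use h h' prime_ideal_mult[OF P] in \<open>auto simp: ev_simps intro!: range_pw_add range_pw_mult range_pw_ev\<close>)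
qed

lemma Loc_mult: assumes "Y \<in> Loc" "Y' \<in> Loc" shows "Y * Y' \<in> Loc"
proof -
  obtain t u where h: "ev t \<notin> P" "u \<in> range pw" "\<kappa> (ev t) * Y = \<kappa> u"
    using assms(1) by (auto simp: Loc_def)
  obtain t' u' where h': "ev t' \<notin> P" "u' \<in> range pw" "\<kappa> (ev t') * Y' = \<kappa> u'"
    using assms(2) by (auto simp: Loc_def)
  have "\<kappa> (ev (t * t')) * (Y * Y') = \<kappa> (u * u')"
    by (simp add: ev_simps h(3)[symmetric] h'(3)[symmetric] algebra_simps)
  thus ?thesis by (rule LocI[rotated 2])
    (use h h' prime_ideal_mult[OF P] in \<open>auto simp: ev_simps intro!: range_pw_mult\<close>)
qed

lemma Loc_ev: "\<kappa> (ev q) \<in> Loc" by (rule Loc_range[OF range_pw_ev])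

lemma Loc_of_nat: "of_nat m \<in> Loc"
  using Loc_ev[of "of_nat m"] by (simp add: rhom_of_nat[OF ev] rhom_of_nat[OF to_fract_rhom])

lemma Loc_uminus: assumes "Y \<in> Loc" shows "- Y \<in> Loc"
  using Loc_mult[OF Loc_ev[of "-1"] assms] by (simp add: ev_simps rhom_uminus[OF to_fract_rhom])

lemma Loc_diff: "Y \<in> Loc \<Longrightarrow> Y' \<in> Loc \<Longrightarrow> Y - Y' \<in> Loc"
  using Loc_add[of Y "-Y'"] Loc_uminus by simp

lemma ev_nonzero: "ev t \<notin> P \<Longrightarrow> ev t \<noteq> 0" using ideal_0[OF I] by auto

lemma Loc_div: assumes "Y \<in> Loc" "ev t \<notin> P" shows "Y / \<kappa> (ev t) \<in> Loc"
proof -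
  obtain t' u where h: "ev t' \<notin> P" "u \<in> range pw" "\<kappa> (ev t') * Y = \<kappa> u"
    using assms(1) by (auto simp: Loc_def)
  have "\<kappa> (ev (t' * t)) * (Y / \<kappa> (ev t)) = \<kappa> u"
    using ev_nonzero[OF assms(2)] by (simp add: ev_simps h(3)[symmetric])
  thus ?thesis by (rule LocI[rotated 2])
    (use h assms prime_ideal_mult[OF P] in \<open>auto simp: ev_simps\<close>)
qed

lemma Loc_div_Fw: assumes "Y \<in> Loc" shows "Y / \<kappa> Fw \<in> Loc"
proof -
  have u0nz: "u0 \<noteq> 0" using u0 ev_nonzero by fastforce
  have "\<kappa> u0 * \<kappa> Fw = \<kappa> (ev s0)" by (simp add: u0(2)[symmetric])
  hence "Y / \<kappa> Fw = (Y * \<kappa> u0) / \<kappa> (ev s0)"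
    using u0nz Fw_nz ev_nonzero[OF u0(3)] by (simp add: field_simps)
  thus ?thesis using Loc_div[OF Loc_mult[OF assms Loc_range[OF u0(1)]] u0(3)] by simp
qed

lemma Loc_pR: assumes "a \<in> pR" shows "\<kappa> a / \<kappa> (ev p) \<in> Loc"
proof -
  obtain u where "a = ev p * u" "u \<in> range pw" using assms by (auto simp: pR_def)
  thus ?thesis using p0 by (simp add: ev_eq_0 Loc_range)
qed

lemma Loc_der: assumes "Y \<in> Loc" shows "der j Y \<in> Loc"
proof -
  obtain t u where h: "ev t \<notin> P" "u \<in> range pw" "\<kappa> (ev t) * Y = \<kappa> u" using assms by (auto simp: Loc_def)
  obtain b where b: "b \<in> range pw" "\<kappa> Fw * der j (\<kappa> u) = \<kappa> b" using der_range[OF h(2)] by blast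
  have "der j (\<kappa> u) = \<kappa> b / \<kappa> Fw" using b(2) Fw_nz by (simp add: field_simps)
  hence 1: "der j (\<kappa> u) \<in> Loc" using Loc_div_Fw[OF Loc_range[OF b(1)]] by simp
  have "der j (\<kappa> u) = \<kappa> (ev t) * der j Y + Y * \<kappa> (ev (pd j t))"
    unfolding h(3)[symmetric] der_mult der_ev ..
  hence "der j Y = (der j (\<kappa> u) - Y * \<kappa> (ev (pd j t))) / \<kappa> (ev t)"
    using ev_nonzero[OF h(1)] by (simp add: field_simps)
  also have "\<dots> \<in> Loc" by (intro Loc_div[OF _ h(1)] Loc_diff 1 Loc_mult assms Loc_ev)
  finally show ?thesis .
qed

text \<open>The components in \<open>dx, dy, dz\<close>. Since \<open>n j\<close> agrees with
  \<open>Fw\<close> times the partial derivative of \<open>p\<close> on \<open>V(P)\<close>, the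
  polar part along \<open>V(P)\<close> is that of \<open>dp/p\<close>.\<close>

definition eta :: "nat \<Rightarrow> 'a fract" where
  "eta j = \<kappa> (n j) / (\<kappa> (ev p) * \<kappa> Fw)"

definition curl :: "nat \<Rightarrow> nat \<Rightarrow> 'a fract" where
  "curl a b = der a (eta b) - der b (eta a)"

text \<open>The residue \<open>e\<close> of \<open>eta\<close> along \<open>V(p)\<close> is idempotent modulo \<open>p\<close>: it is \<open>1\<close> on \<open>V(P)\<close> and \<open>0\<close> on the other components.
  Differentiating \<open>e\<^sup>2 - e \<equiv> 0\<close> gives \<open>de \<in> (p, dp)\<close>, so \<open>d eta\<close> has no pole along \<open>V(p)\<close>.\<close>
lemma curl_Loc: "curl a b \<in> Loc"
proof -
  define q where "q = \<kappa> (ev p)"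
  define \<Phi> where "\<Phi> = \<kappa> Fw"
  define \<delta> where "\<delta> = (\<lambda>j. \<kappa> (dp j))"
  define \<nu> where "\<nu> = (\<lambda>j. \<kappa> (n j))"
  have q0: "q \<noteq> 0" using p0 by (simp add: q_def ev_eq_0)
  have F0: "\<Phi> \<noteq> 0" using Fw_nz by (simp add: \<Phi>_def)
  have d0: "\<delta> 2 \<noteq> 0" using ev_nonzero[OF dp2] by (simp add: \<delta>_def)
  have dq: "der j q = \<delta> j" for j by (simp add: q_def \<delta>_def der_ev)
  have dd: "der a (\<delta> b) = der b (\<delta> a)" for a b by (simp add: \<delta>_def der_ev pd_commute[of a b])
  \<comment> \<open>Up to a form regular along \<open>p = 0\<close>, the form is \<open>e\<close>
    times \<open>dp/p\<close>. The index 2 can serve as reference because \<open>\<delta> 2\<close>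
    is invertible in \<open>Loc\<close>.\<close>
  define e where "e = \<nu> 2 / \<Phi> / \<delta> 2"
  define \<mu> where "\<mu> = (\<lambda>j. (\<nu> j / \<Phi> - e * \<delta> j) / q)"
  define \<theta> where "\<theta> = (e ^ 2 - e) / q"
  have eL: "e \<in> Loc" unfolding e_def \<nu>_def \<Phi>_def \<delta>_def
    by (intro Loc_div[OF _ dp2] Loc_div_Fw Loc_range nn_range)
  have dL: "\<delta> j \<in> Loc" for j unfolding \<delta>_def by (rule Loc_ev)
  have mL: "\<mu> j \<in> Loc" for j
  proof -
    have "\<mu> j = \<kappa> (n j * dp 2 - n 2 * dp j) / q / \<Phi> / \<delta> 2"
      using q0 F0 d0 by (simp add: \<mu>_def e_def \<nu>_def \<delta>_def field_simps)
    also have "\<dots> \<in> Loc" unfolding q_def \<Phi>_def \<delta>_def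
      by (intro Loc_div[OF _ dp2] Loc_div_Fw Loc_pR n_cross)
    finally show ?thesis .
  qed
  have tL: "\<theta> \<in> Loc"
  proof -
    have g: "n 2 - Fw * dp 2 \<in> range pw"
      by (intro range_pw_diff range_pw_mult nn_range Fw_range range_pw_ev)
    have "\<theta> = \<kappa> ((n 2 - Fw * dp 2) * n 2) / q / \<Phi> / \<Phi> / \<delta> 2 / \<delta> 2"
      using q0 F0 d0 by (simp add: \<theta>_def e_def \<nu>_def \<delta>_def \<Phi>_def field_simps power2_eq_square)
    also have "\<dots> \<in> Loc" unfolding q_def \<Phi>_def \<delta>_def
      by (intro Loc_div[OF _ dp2] Loc_div_Fw Loc_pR annihilate g n_mod)
    finally show ?thesis .
  qed
  have et: "e * e = e + q * \<theta>" using q0 by (simp add: \<theta>_def power2_eq_square)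
  define \<chi> where "\<chi> = (\<lambda>j. (of_nat 2 * e - 1) * der j \<theta> - of_nat 4 * \<theta> * der j e)"
  have chL: "\<chi> j \<in> Loc" for j
  proof -
    have "1 \<in> Loc" using Loc_of_nat[of 1] by simp
    thus ?thesis unfolding \<chi>_def by (intro Loc_diff Loc_mult Loc_der tL eL Loc_of_nat)
  qed
  have de: "der j e = (2 * e - 1) * \<delta> j * \<theta> + q * \<chi> j" for j
  proof -
    have "der j (e * e) = der j e + (q * der j \<theta> + \<theta> * \<delta> j)"
      unfolding et by (simp add: der_add der_mult dq)
    hence 1: "(2 * e - 1) * der j e = q * der j \<theta> + \<theta> * \<delta> j" by (simp add: der_mult algebra_simps)
    \<comment> \<open>Modulo \<open>p\<close> the factor \<open>2 * e - 1\<close> is its own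
      inverse, so the differentiated relation can be solved for \<open>der j e\<close>;
      \<open>\<chi>\<close> collects the part carrying a factor \<open>q\<close>.\<close>
    have "(2 * e - 1) * (2 * e - 1) = 1 + 4 * (q * \<theta>)"
    proof -
      have "(2 * e - 1) * (2 * e - 1) = 4 * (e * e) - 4 * e + 1" by (simp add: algebra_simps)
      thus ?thesis unfolding et by (simp add: algebra_simps)
    qed
    hence "(2 * e - 1) * ((2 * e - 1) * der j e) = (1 + 4 * (q * \<theta>)) * der j e"
      by (simp add: mult.assoc[symmetric])
    hence "der j e = (2 * e - 1) * (q * der j \<theta> + \<theta> * \<delta> j) - 4 * (q * \<theta>) * der j e"
      unfolding 1 by (simp add: algebra_simps)
    thus ?thesis by (simp add: \<chi>_def algebra_simps)
  qed
  have eta: "eta j = e * \<delta> j / q + \<mu> j" for j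
    using q0 F0 by (simp add: eta_def \<mu>_def \<nu>_def \<Phi>_def[symmetric] q_def[symmetric] diff_divide_distrib)
  have dE: "der a (eta b) = (e * der a (\<delta> b) + \<delta> b * der a e) / q - e * \<delta> b * \<delta> a / (q * q) + der a (\<mu> b)" for a b
    unfolding eta der_add der_quotient[OF q0] der_mult dq using q0 by (simp add: field_simps)
  have "curl a b = (\<delta> b * der a e - \<delta> a * der b e) / q + (der a (\<mu> b) - der b (\<mu> a))"
    unfolding curl_def dE dd[of a b] using q0 by (simp add: field_simps)
  \<comment> \<open>The parts with \<open>(2 * e - 1) * \<theta>\<close> cancel by symmetry in
    \<open>a\<close> and \<open>b\<close>; what is left has a factor \<open>q\<close>, which removes
    the pole.\<close>
  also have "\<delta> b * der a e - \<delta> a * der b e = q * (\<delta> b * \<chi> a - \<delta> a * \<chi> b)"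
    unfolding de by (simp add: algebra_simps)
  finally have "curl a b = (\<delta> b * \<chi> a - \<delta> a * \<chi> b) + (der a (\<mu> b) - der b (\<mu> a))" using q0 by simp
  also have "\<dots> \<in> Loc" by (intro Loc_add Loc_diff Loc_mult Loc_der dL chL mL)
  finally show ?thesis .
qed

end

definition (in coords) dFw :: "nat \<Rightarrow> 'a" where
  "dFw j = (SOME b. b \<in> range pw \<and> \<kappa> Fw * der j (\<kappa> Fw) = \<kappa> b)"

lemma (in coords) dFw: "dFw j \<in> range pw" "\<kappa> Fw * der j (\<kappa> Fw) = \<kappa> (dFw j)"
  using someI_ex[OF der_range[OF Fw_range, of j]] unfolding dFw_def by auto

text \<open>Independent of the prime, and symmetric in \<open>a\<close> and \<open>b\<close> so that
  both halves of the curl share one bound.\<close>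

definition (in coords) ccurl :: "nat \<Rightarrow> nat \<Rightarrow> nat" where
  "ccurl a b = cnn + cder a + cder b + 2 * mc Fw + mc (dFw a) + mc (dFw b)"

context coords_prime
begin

text \<open>Differentiating \<open>n / (p * Fw)\<close> costs the square of the denominator, and one
  more \<open>Fw\<close> because derivatives of elements of \<open>R\<close> have denominator
  \<open>Fw\<close>.\<close>

lemma half_curl:
  "\<exists>Y. Y \<in> Rn (2 * tdeg p + ccurl a b) \<and> \<kappa> Fw ^ 3 * \<kappa> (ev p) ^ 2 * der a (eta b) = \<kappa> Y"
proof -
  obtain b1 where b1: "b1 \<in> Rn (tdeg p + cnn + cder a)" "\<kappa> Fw * der a (\<kappa> (n b)) = \<kappa> b1"
    using Rn_cder[OF n_Rn] by blast
  define Y1 where "Y1 = Fw * (ev p * b1)"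
  define Y2 where "Y2 = Fw * (Fw * (dp a * n b))"
  define Y3 where "Y3 = ev p * (dFw a * n b)"
  have nz: "\<kappa> Fw \<noteq> 0" "\<kappa> (ev p) \<noteq> 0" using Fw_nz p0 by (simp_all add: ev_eq_0)
  have 1: "Y1 \<in> Rn (2 * tdeg p + ccurl a b)" unfolding Y1_def
    by (rule Rn_mono[OF Rn_mc[OF Fw_range Rn_ev_mult[OF b1(1) order_refl]]]) (simp add: ccurl_def)
  have 2: "Y2 \<in> Rn (2 * tdeg p + ccurl a b)" unfolding Y2_def
    by (rule Rn_mono[OF Rn_mc[OF Fw_range Rn_mc[OF Fw_range Rn_ev_mult[OF n_Rn tdeg_pd]]]]) (simp add: ccurl_def)
  have 3: "Y3 \<in> Rn (2 * tdeg p + ccurl a b)" unfolding Y3_def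
    by (rule Rn_mono[OF Rn_ev_mult[OF Rn_mc[OF dFw(1) n_Rn] order_refl]]) (simp add: ccurl_def)
  have de: "der a (eta b) = (der a (\<kappa> (n b)) - \<kappa> (n b) / (\<kappa> (ev p) * \<kappa> Fw) * (\<kappa> (ev p) * der a (\<kappa> Fw) + \<kappa> Fw * \<kappa> (dp a)))
      / (\<kappa> (ev p) * \<kappa> Fw)"
    unfolding eta_def using nz by (subst der_quotient) (simp_all add: der_mult der_ev)
  have h: "(\<kappa> (ev p) * \<kappa> Fw) * ((\<kappa> (ev p) * \<kappa> Fw) * der a (eta b))
     = \<kappa> (ev p) * \<kappa> Fw * der a (\<kappa> (n b)) - \<kappa> (n b) * (\<kappa> (ev p) * der a (\<kappa> Fw) + \<kappa> Fw * \<kappa> (dp a))"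
  proof -
    have aux: "Q * (Q * D) = Q * A - B * C" if "D = (A - B / Q * C) / Q" "Q \<noteq> 0"
      for A B C D Q :: "'a fract"
      using that by (simp add: field_simps)
    show ?thesis by (rule aux) (use nz in \<open>simp_all add: de\<close>)
  qed
  have "\<kappa> Fw ^ 3 * \<kappa> (ev p) ^ 2 * der a (eta b)
     = \<kappa> Fw * ((\<kappa> (ev p) * \<kappa> Fw) * ((\<kappa> (ev p) * \<kappa> Fw) * der a (eta b)))"
    by (simp add: power2_eq_square power3_eq_cube mult_ac)
  also have "\<dots> = \<kappa> Fw * \<kappa> (ev p) * (\<kappa> Fw * der a (\<kappa> (n b))) - \<kappa> Fw * \<kappa> Fw * \<kappa> (dp a) * \<kappa> (n b)
       - \<kappa> (ev p) * \<kappa> (n b) * (\<kappa> Fw * der a (\<kappa> Fw))"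
    unfolding h by (simp add: algebra_simps)
  also have "\<dots> = \<kappa> (Y1 - Y2 - Y3)"
    unfolding b1(2) dFw(2) by (simp add: Y1_def Y2_def Y3_def mult_ac)
  finally show ?thesis using Rn_diff[OF Rn_diff[OF 1 2] 3] by blast
qed

text \<open>By \<open>curl_Loc\<close> the pole along \<open>p\<close> is only apparent, so
  \<open>p ^ 2\<close> divides the numerator in \<open>R\<close>, and its degree
  \<open>2 * tdeg p\<close> leaves the bound.\<close>

lemma curl_bound: "\<exists>Y. Y \<in> Rn (ccurl a b) \<and> \<kappa> Fw ^ 3 * curl a b = \<kappa> Y"
proof -
  obtain Y1 where Y1: "Y1 \<in> Rn (2 * tdeg p + ccurl a b)" "\<kappa> Fw ^ 3 * \<kappa> (ev p) ^ 2 * der a (eta b) = \<kappa> Y1"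
    using half_curl by blast
  obtain Y2 where Y2: "Y2 \<in> Rn (2 * tdeg p + ccurl b a)" "\<kappa> Fw ^ 3 * \<kappa> (ev p) ^ 2 * der b (eta a) = \<kappa> Y2"
    using half_curl by blast
  have "ccurl b a = ccurl a b" by (simp add: ccurl_def)
  hence Y: "Y1 - Y2 \<in> Rn (2 * tdeg p + ccurl a b)" using Y1 Y2 by (auto intro: Rn_diff)
  have eY: "\<kappa> Fw ^ 3 * \<kappa> (ev p) ^ 2 * curl a b = \<kappa> (Y1 - Y2)"
    unfolding curl_def using Y1 Y2 by (simp add: right_diff_distrib)
  obtain t u where h: "ev t \<notin> P" "u \<in> range pw" "\<kappa> (ev t) * curl a b = \<kappa> u"
    using curl_Loc[of a b] unfolding Loc_def by blast
  have "\<kappa> (ev t * (Y1 - Y2)) = \<kappa> (ev (p ^ 2) * (Fw ^ 3 * u))"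
  proof -
    have "\<kappa> (ev t * (Y1 - Y2)) = \<kappa> (ev t) * (\<kappa> Fw ^ 3 * \<kappa> (ev p) ^ 2 * curl a b)"
      unfolding eY by (rule rhom_mult[OF to_fract_rhom])
    also have "\<dots> = \<kappa> (ev p) ^ 2 * (\<kappa> Fw ^ 3 * (\<kappa> (ev t) * curl a b))" by (simp only: mult_ac)
    also have "\<dots> = \<kappa> (ev (p ^ 2) * (Fw ^ 3 * u))"
      unfolding h(3) by (simp only: rhom_mult[OF to_fract_rhom] rhom_power[OF to_fract_rhom] rhom_power[OF ev])
    finally show ?thesis .
  qed
  hence c: "ev t * (Y1 - Y2) = ev (p ^ 2) * (Fw ^ 3 * u)" by (simp only: to_fract_eq_iff)
  obtain Y' where Y': "Y' \<in> range pw" "Y1 - Y2 = ev (p ^ 2) * Y'"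
    using cancel[OF h(1) Rn_range[OF Y] range_pw_mult[OF range_pw_power[OF Fw_range] h(2)] c]
      by (elim exE conjE)
  have t2: "tdeg (p ^ 2) = 2 * tdeg p" using p0 by (simp add: power2_eq_square tdeg_mult)
  have "Y' \<in> Rn (ccurl a b)"
    using Y unfolding Y'(2) t2[symmetric] by (rule Rn_div[OF _ _ Y'(1)]) (use p0 in simp)
  moreover have "\<kappa> Fw ^ 3 * curl a b = \<kappa> Y'"
  proof -
    have "\<kappa> (ev p) ^ 2 * (\<kappa> Fw ^ 3 * curl a b) = \<kappa> (ev p) ^ 2 * \<kappa> Y'"
    proof -
      have "\<kappa> (ev p) ^ 2 * (\<kappa> Fw ^ 3 * curl a b) = \<kappa> (Y1 - Y2)"
        unfolding eY[symmetric] by (simp only: mult_ac)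
      also have "\<dots> = \<kappa> (ev p) ^ 2 * \<kappa> Y'"
        unfolding Y'(2) by (simp only: rhom_mult[OF to_fract_rhom] rhom_power[OF to_fract_rhom] rhom_power[OF ev])
      finally show ?thesis .
    qed
    thus ?thesis using p0 by (simp add: ev_eq_0)
  qed
  ultimately show ?thesis by blast
qed

end

subsection \<open>Coordinates for a dense family of Poisson primes\<close>

lemma cspan_insert:
  assumes "finite B" "b \<notin> B" "v \<in> cspan \<iota> (insert b B)"
  shows "\<exists>k v'. v' \<in> cspan \<iota> B \<and> v = \<iota> k * b + v'"
proof -
  obtain c where "v = (\<Sum>a\<in>insert b B. \<iota> (c a) * a)" using assms(3) by (auto simp: cspan_def)
  hence "v = \<iota> (c b) * b + (\<Sum>a\<in>B. \<iota> (c a) * a)" using assms by simp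
  moreover have "(\<Sum>a\<in>B. \<iota> (c a) * a) \<in> cspan \<iota> B" by (auto simp: cspan_def)
  ultimately show ?thesis by blast
qed

text \<open>Adding one vector to \<open>B\<close> lets at most one line of the span survive all
  members of \<open>G\<close>, and one further ideal that misses a generator \<open>u\<close> of
  this line kills it.\<close>

lemma finite_separating_subfamily:
  fixes \<iota> :: "complex \<Rightarrow> 'a::comm_ring_1"
  assumes i: "rhom \<iota>" and I: "\<And>Q. Q \<in> \<Q> \<Longrightarrow> ideal Q" and sep: "\<And>u. u \<noteq> 0 \<Longrightarrow> \<exists>Q\<in>\<Q>. u \<notin> Q" and B: "finite B"
  shows "\<exists>G. finite G \<and> G \<subseteq> \<Q> \<and> (\<forall>v\<in>cspan \<iota> B. (\<forall>Q\<in>G. v \<in> Q) \<longrightarrow> v = 0)"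
  using B
proof (induction B rule: finite_induct)
  case empty show ?case by (intro exI[of _ "{}"]) (auto simp: cspan_def)
next
  case (insert b B)
  then obtain G where "finite G \<and> G \<subseteq> \<Q> \<and> (\<forall>v\<in>cspan \<iota> B. (\<forall>Q\<in>G. v \<in> Q) \<longrightarrow> v = 0)" by (elim exE)
  hence G: "finite G" "G \<subseteq> \<Q>" "\<And>v. v \<in> cspan \<iota> B \<Longrightarrow> (\<And>Q. Q \<in> G \<Longrightarrow> v \<in> Q) \<Longrightarrow> v = 0" by simp_all
  show ?case
  proof (cases "\<exists>u. u \<noteq> 0 \<and> u \<in> cspan \<iota> (insert b B) \<and> (\<forall>Q\<in>G. u \<in> Q)")
    case False thus ?thesis using G by blast
  next
    case True
    then obtain u where u: "u \<noteq> 0" "u \<in> cspan \<iota> (insert b B)" "\<And>Q. Q \<in> G \<Longrightarrow> u \<in> Q" by blast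
    obtain Q0 where Q0: "Q0 \<in> \<Q>" "u \<notin> Q0" using sep[OF u(1)] by blast
    obtain k u' where k: "u' \<in> cspan \<iota> B" "u = \<iota> k * b + u'"
      using cspan_insert[OF insert.hyps u(2)] by blast
    have k0: "k \<noteq> 0" using k u G(3)[of u] by (auto simp: rhom_0[OF i])
    have "v = 0" if v: "v \<in> cspan \<iota> (insert b B)" "\<And>Q. Q \<in> insert Q0 G \<Longrightarrow> v \<in> Q" for v
    proof -
      obtain l v' where l: "v' \<in> cspan \<iota> B" "v = \<iota> l * b + v'"
        using cspan_insert[OF insert.hyps v(1)] by blast
      define d where "d = v - \<iota> (l / k) * u"
      have "\<iota> (l / k) * \<iota> k = \<iota> l" using k0 by (simp add: rhom_mult[OF i, symmetric])
      hence "d = v' + \<iota> (- (l / k)) * u'"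
        by (simp add: d_def l(2) k(2) rhom_uminus[OF i] distrib_left mult.assoc[symmetric])
      hence "d \<in> cspan \<iota> B" using cspan_add[OF i l(1) cspan_scale[OF i k(1)]] by simp
      moreover have "d \<in> Q" if "Q \<in> G" for Q
        unfolding d_def using that v(2)[of Q] u(3)[OF that] G(2) I by (intro ideal_diff ideal_mult) auto
      ultimately have "d = 0" by (rule G(3))
      hence v_eq: "v = \<iota> (l / k) * u" by (simp add: d_def)
      show ?thesis
      proof (cases "l = 0")
        case False
        hence "\<iota> (k / l) * \<iota> (l / k) = 1" using k0 by (simp add: rhom_mult[OF i, symmetric] rhom_1[OF i])
        hence "u = \<iota> (k / l) * v" by (simp add: v_eq mult.assoc[symmetric])
        hence "u \<in> Q0" using v(2)[of Q0] ideal_mult[OF I[OF Q0(1)]] by simp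
        thus ?thesis using Q0 by simp
      qed (simp add: v_eq rhom_0[OF i])
    qed
    thus ?thesis using G Q0 by (intro exI[of _ "insert Q0 G"]) auto
  qed
qed

context poisson
begin

text \<open>Each finite-dimensional piece of the ring is separated by finitely many primes, and
  countably many pieces exhaust the ring. Density is used for \<open>u * h\<close>, which keeps
  \<open>h\<close> outside the primes chosen.\<close>

lemma countable_dense_family:
  assumes fg: "finitely_generated \<iota>" and h: "h \<noteq> 0"
    and dense: "\<And>D. D \<noteq> 0 \<Longrightarrow> \<exists>Q. poisson_prime br Q \<and> Q \<noteq> {0} \<and> D \<notin> Q"
  shows "\<exists>P :: nat \<Rightarrow> 'a set. (\<forall>j. poisson_prime br (P j) \<and> P j \<noteq> {0} \<and> h \<notin> P j) \<and> (\<forall>D. D \<noteq> 0 \<longrightarrow> (\<exists>j. D \<notin> P j))"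
proof -
  define \<Q> where "\<Q> = {Q. poisson_prime br Q \<and> Q \<noteq> {0} \<and> h \<notin> Q}"
  have I: "ideal Q" if "Q \<in> \<Q>" for Q using that by (auto simp: \<Q>_def poisson_prime_def prime_ideal_def)
  have sep: "\<exists>Q\<in>\<Q>. u \<notin> Q" if u0: "u \<noteq> 0" for u
  proof -
    obtain Q where Q: "poisson_prime br Q" "Q \<noteq> {0}" "u * h \<notin> Q" using dense[of "u * h"] u0 h by auto
    have "ideal Q" using Q by (auto simp: poisson_prime_def prime_ideal_def)
    hence "u \<notin> Q" "h \<notin> Q" using Q(3) ideal_mult ideal_mult' by blast+
    thus ?thesis using Q by (auto simp: \<Q>_def)
  qed
  obtain B :: "nat \<Rightarrow> 'a set" where B: "\<And>n. finite (B n)" "\<And>a. \<exists>n. a \<in> cspan \<iota> (B n)"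
    using countable_exhaustion[OF i fg] by blast
  have "\<forall>n. \<exists>G. finite G \<and> G \<subseteq> \<Q> \<and> (\<forall>v\<in>cspan \<iota> (B n). (\<forall>Q\<in>G. v \<in> Q) \<longrightarrow> v = 0)"
    using finite_separating_subfamily[OF i I sep B(1)] by blast
  then obtain G where G: "\<And>n. finite (G n)" "\<And>n. G n \<subseteq> \<Q>" "\<And>n v. v \<in> cspan \<iota> (B n) \<Longrightarrow> (\<forall>Q\<in>G n. v \<in> Q) \<Longrightarrow> v = 0"
    by metis
  define U where "U = (\<Union>n. G n)"
  have cU: "countable U" unfolding U_def
    using G(1) by (intro countable_UN countableI_type countable_finite)
  have UQ: "U \<subseteq> \<Q>" unfolding U_def using G(2) by blast
  have Usep: "\<exists>Q\<in>U. D \<notin> Q" if "D \<noteq> 0" for D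
  proof -
    obtain n where "D \<in> cspan \<iota> (B n)" using B(2) by blast
    hence "\<not> (\<forall>Q\<in>G n. D \<in> Q)" using G(3) that by blast
    thus ?thesis unfolding U_def by blast
  qed
  have "U \<noteq> {}" using Usep[of 1] by auto
  hence r: "range (from_nat_into U) = U" using cU by (rule range_from_nat_into)
  have "from_nat_into U j \<in> \<Q>" for j using r UQ by blast
  moreover have "\<exists>j. D \<notin> from_nat_into U j" if "D \<noteq> 0" for D
    using Usep[OF that] r by (metis imageE)
  ultimately show ?thesis unfolding \<Q>_def by (intro exI[of _ "from_nat_into U"]) auto
qed

lemma br_in_of_generators:
  assumes S: "gen_subalg \<iota> S = UNIV" and Q: "ideal Q" and g: "\<And>a b. a \<in> S \<Longrightarrow> b \<in> S \<Longrightarrow> br a b \<in> Q"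
  shows "br a b \<in> Q"
proof -
  have 1: "br a b \<in> Q" if b: "b \<in> S" for a b
  proof -
    have "a \<in> gen_subalg \<iota> S" using S by simp
    thus ?thesis
      by (induction rule: gen_subalg.induct)
         (auto simp: br_const ideal_0[OF Q] g b br_add_l br_mult_l intro: ideal_add[OF Q] ideal_mult[OF Q])
  qed
  have "b \<in> gen_subalg \<iota> S" using S by simp
  thus ?thesis
    by (induction rule: gen_subalg.induct)
       (auto simp: br_const_r ideal_0[OF Q] 1 br_add_r br_mult_r intro: ideal_add[OF Q] ideal_mult[OF Q])
qed

text \<open>\<open>x\<close> and \<open>y\<close> are values at scalars of the polynomial
  \<open>A\<close> whose coefficients are the generators. For each \<open>P j\<close> only finitely
  many scalars are bad, since otherwise all brackets of generators, or all brackets with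
  \<open>x\<close>, would lie in \<open>P j\<close>.\<close>

lemma generic_pair:
  assumes fg: "finitely_generated \<iota>" and P: "\<And>j::nat. poisson_prime br (P j)" and h: "\<And>j. br a0 b0 \<notin> P j"
  shows "\<exists>x y. \<forall>j. br x y \<notin> P j"
proof -
  obtain S where S: "finite S" "gen_subalg \<iota> S = UNIV" using fg by (auto simp: finitely_generated_def)
  obtain as where as: "set as = S" using finite_list[OF S(1)] by blast
  define A where "A = Poly as"
  have cA: "\<exists>n. coeff A n = a" if "a \<in> S" for a
    using that as unfolding A_def by (metis coeff_Poly_eq in_set_conv_nth nth_default_nth)
  have I: "ideal (P j)" for j using P by (auto simp: poisson_prime_def prime_ideal_def)
  have l: "br (poly A (\<iota> c)) b = poly (map_poly (\<lambda>a. br a b) A) (\<iota> c)" for b c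
    by (induction A) (simp_all add: br_0 br_add_l br_scale_l map_poly_pCons)
  have r: "br a (poly A (\<iota> c)) = poly (map_poly (br a) A) (\<iota> c)" for a c
  proof (induction A)
    case (pCons d A) thus ?case by (simp add: br_0 br_add_r br_mult_r br_const_r map_poly_pCons)
  qed (simp add: br_0)
  have f1: "finite {c. \<forall>b\<in>S. br (poly A (\<iota> c)) b \<in> P j}" for j
  proof (rule ccontr)
    assume inf: "infinite {c. \<forall>b\<in>S. br (poly A (\<iota> c)) b \<in> P j}"
    have "br a b \<in> P j" if ab: "a \<in> S" "b \<in> S" for a b
    proof -
      have "infinite {c. poly (map_poly (\<lambda>a. br a b) A) (\<iota> c) \<in> P j}"
        by (rule infinite_super[OF _ inf]) (use ab l in auto)
      hence "coeff (map_poly (\<lambda>a. br a b) A) n \<in> P j" for n by (rule vandermonde_ideal[OF i I])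
      thus ?thesis using cA[OF ab(1)] by (auto simp: coeff_map_poly br_0)
    qed
    thus False using br_in_of_generators[OF S(2) I, of j a0 b0] h by blast
  qed
  have "countable (\<Union>j. {c. \<forall>b\<in>S. br (poly A (\<iota> c)) b \<in> P j})"
    by (intro countable_UN countableI_type countable_finite f1)
  then obtain c where c: "c \<notin> (\<Union>j. {c. \<forall>b\<in>S. br (poly A (\<iota> c)) b \<in> P j})" using countable_avoid by blast
  define x where "x = poly A (\<iota> c)"
  have f2: "finite {c. br x (poly A (\<iota> c)) \<in> P j}" for j
  proof (rule ccontr)
    assume "infinite {c. br x (poly A (\<iota> c)) \<in> P j}"
    hence "coeff (map_poly (br x) A) n \<in> P j" for n
      unfolding r by (rule vandermonde_ideal[OF i I])
    hence "br x b \<in> P j" if "b \<in> S" for b using cA[OF that] by (auto simp: coeff_map_poly br_0)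
    thus False using c by (auto simp: x_def)
  qed
  have "countable (\<Union>j. {c. br x (poly A (\<iota> c)) \<in> P j})"
    by (intro countable_UN countableI_type countable_finite f2)
  then obtain c' where "c' \<notin> (\<Union>j. {c. br x (poly A (\<iota> c)) \<in> P j})" using countable_avoid by blast
  thus ?thesis by auto
qed

end

text \<open>Coordinates that are generic for all members of a dense countable family of
  Poisson primes, together with generators \<open>pp j\<close> of \<open>P j \<inter> \<complex>[x, y, z]\<close> and the lifts \<open>T j k l\<close> of \<open>w\<^sup>k \<partial>\<^sub>l (pp j)\<close>.\<close>
locale poisson_coords = poisson \<iota> br + coords \<iota> x y z w r f
  for \<iota> :: "complex \<Rightarrow> 'a::idom" and br x y z w r f +
  fixes P :: "nat \<Rightarrow> 'a set" and pp :: "nat \<Rightarrow> mp3" and T :: "nat \<Rightarrow> nat \<Rightarrow> nat \<Rightarrow> mp3"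
  assumes Pp: "\<And>j. poisson_prime br (P j)"
    and dense: "\<And>D. D \<noteq> 0 \<Longrightarrow> \<exists>j. D \<notin> P j"
    and xyP: "\<And>j. br x y \<notin> P j"
    and pp0: "\<And>j. pp j \<noteq> 0" and ppP: "\<And>j q. ev3 \<iota> x y z q \<in> P j \<longleftrightarrow> pp j dvd q"
    and TT: "\<And>j k l. tdeg (T j k l) \<le> tdeg (pp j) + k * emax"
      "\<And>j k l. ev (T j k l) - w ^ k * ev (pd l (pp j)) \<in> P j"

text \<open>Since \<open>br x y\<close> avoids every \<open>P j\<close>, the elements
  \<open>x, y\<close> form a transcendence basis of each residue field, and \<open>z\<close>
  generates each of these fields over them. So every \<open>P j\<close> is birational to its
  projected surface \<open>pp j = 0\<close>, and \<open>w\<close> is rational on it.\<close>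

lemma (in poisson) generic_coordinates:
  assumes fg: "finitely_generated \<iota>" and kd: "krull_dim_le TYPE('a) 3"
    and h: "br a0 b0 \<noteq> 0"
    and dense: "\<And>D. D \<noteq> 0 \<Longrightarrow> \<exists>Q. poisson_prime br Q \<and> Q \<noteq> {0} \<and> D \<notin> Q"
  shows "\<exists>x y z w r f P pp T. poisson_coords \<iota> br x y z w r f P pp T"
proof -
  obtain P :: "nat \<Rightarrow> 'a set" where P: "\<And>j. poisson_prime br (P j)" "\<And>j. P j \<noteq> {0}" "\<And>j. br a0 b0 \<notin> P j"
    and Pd: "\<And>D. D \<noteq> 0 \<Longrightarrow> \<exists>j. D \<notin> P j"
    using countable_dense_family[OF fg h dense] by blast
  have PP: "prime_ideal (P j)" "poisson_ideal br (P j)" for j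
    using P(1) by (auto simp: poisson_prime_def)
  have I: "ideal (P j)" for j by (rule prime_idealD[OF PP(1)])
  have zP: "{0} \<subset> P j" for j using P(2)[of j] ideal_0[OF I] by auto
  obtain S where S: "finite S" "gen_subalg \<iota> S = UNIV" using fg by (auto simp: finitely_generated_def)
  obtain x y where xy: "\<And>j. br x y \<notin> P j" using generic_pair[where P = P, OF fg P(1,3)] by blast
  define e2 where "e2 = pev (pev \<iota> x) y"
  have e2: "rhom e2" unfolding e2_def by (intro pev_rhom i)
  have cs2: "e2 [:[:c:]:] = \<iota> c" for c by (simp add: e2_def pev_const pev_rhom i)
  have z2: "lies_over_zero e2 (P j)" for j
    unfolding e2_def by (rule independent_of_br_notin[OF PP xy])
  have al2: "algebraic_mod e2 (P j) a" for j a
  proof (rule ccontr)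
    assume "\<not> algebraic_mod e2 (P j) a"
    hence "lies_over_zero (pev e2 a) (P j)" by (simp add: lies_over_zero_pev)
    from independent_chain3[OF i fg PP(1) this[unfolded e2_def]]
    obtain Q1 Q2 Q3 where "prime_ideal Q1" "prime_ideal Q2" "prime_ideal Q3" "P j \<subset> Q1" "Q1 \<subset> Q2" "Q2 \<subset> Q3"
      by (elim exE conjE)
    thus False by (rule krull_dim_le_3D[OF kd prime_ideal_zero PP(1) _ _ _ zP])
  qed
  \<comment> \<open>The starting value for \<open>z\<close>: a nonzero element of one of the primes
    is transcendental over \<open>\<complex>[x, y]\<close>.\<close>
  obtain f0 where f0: "f0 \<in> P 0" "f0 \<noteq> 0" using zP[of 0] by auto
  have f0t: "\<not> algebraic_mod e2 {0} f0" by (rule transcendental_of_mem_prime[OF e2 z2 I f0])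
  have I0: "ideal {0::'a}" by (rule prime_idealD[OF prime_ideal_zero])
  have z20: "lies_over_zero e2 {0}" using z2[of 0] ideal_0[OF I, of 0] by (auto simp: lies_over_zero_def)
  \<comment> \<open>At most one scalar is bad, because \<open>u\<close> is a combination of
    \<open>u + c * a\<close> and \<open>u + c' * a\<close> for distinct \<open>c\<close> and
    \<open>c'\<close>.\<close>
  have cnt: "countable {c. \<not> \<not> algebraic_mod e2 {0} (u + \<iota> c * a)}" if u: "\<not> algebraic_mod e2 {0} u"
    for u a
  proof -
    have "c = c'" if c: "algebraic_mod e2 {0} (u + \<iota> c * a)" "algebraic_mod e2 {0} (u + \<iota> c' * a)"
      for c c'
    proof (rule ccontr)
      assume ne: "c \<noteq> c'"
      define k where "k = inverse (c' - c)"
      have k: "\<iota> k * (\<iota> c' - \<iota> c) = 1" using ne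
        by (simp add: k_def rhom_diff[OF i, symmetric] rhom_mult[OF i, symmetric] rhom_1[OF i])
      have "algebraic_mod e2 {0} (e2 [:[:k * c':]:] * (u + \<iota> c * a) + e2 [:[:- (k * c):]:] * (u + \<iota> c' * a))"
        by (intro algebraic_mod_add algebraic_mod_scale e2 I0 z20 c)
      also have "e2 [:[:k * c':]:] * (u + \<iota> c * a) + e2 [:[:- (k * c):]:] * (u + \<iota> c' * a)
          = (\<iota> k * (\<iota> c' - \<iota> c)) * u"
        unfolding cs2 rhom_uminus[OF i] rhom_mult[OF i] by (simp add: algebra_simps)
      also have "\<dots> = u" by (simp add: k)
      finally show False using u by simp
    qed
    hence "is_singleton {c. algebraic_mod e2 {0} (u + \<iota> c * a)} \<or> {c. algebraic_mod e2 {0} (u + \<iota> c * a)} = {}"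
      unfolding is_singleton_def by blast
    thus ?thesis by (auto simp: is_singleton_def)
  qed
  have "\<exists>u. \<not> algebraic_mod e2 {0} u \<and> (\<forall>j. S \<subseteq> rational_mod e2 (P j) u)"
    by (rule generic_generator[where good = "\<lambda>u. \<not> algebraic_mod e2 {0} u", OF e2 i cs2 PP(1) z2 al2 S(1) f0t]) (rule cnt)
  then obtain z where z: "\<not> algebraic_mod e2 {0} z" "\<And>j. S \<subseteq> rational_mod e2 (P j) z" by blast
  have rz: "a \<in> rational_mod e2 (P j) z" for a j
    by (rule rational_mod_UNIV[OF e2 cs2 PP(1) S(2) z(2)])
  define ev where "ev = ev3 \<iota> x y z"
  have eve: "ev = pev e2 z" by (simp add: ev_def ev3_def e2_def)
  have ev: "rhom ev" unfolding eve by (rule pev_rhom[OF e2])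
  have z3: "lies_over_zero ev {0}" unfolding eve lies_over_zero_pev by (rule z(1))
  have al3: "algebraic_mod ev {0} a" for a
  proof (rule ccontr)
    assume "\<not> algebraic_mod ev {0} a"
    hence "lies_over_zero (pev ev a) {0}" by (simp add: lies_over_zero_pev)
    from independent_chain4[OF i fg prime_ideal_zero this[unfolded eve e2_def]]
    obtain Q1 Q2 Q3 Q4 :: "'a set"
      where "prime_ideal Q1" "prime_ideal Q2" "prime_ideal Q3" "prime_ideal Q4"
       "{0} \<subset> Q1" "Q1 \<subset> Q2" "Q2 \<subset> Q3" "Q3 \<subset> Q4"
      by (elim exE conjE)
    thus False by (rule krull_dim_le_3D[OF kd prime_ideal_zero])
  qed
  have cs3: "ev (K3 c) = \<iota> c" for c by (simp add: ev_def ev3_gens i)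
  obtain w0 where w0: "\<And>j::nat. S \<subseteq> rational_mod ev {0} w0"
    using generic_generator[where good = "\<lambda>_. True" and Q = "\<lambda>_. {0}"
      and cs = K3, OF ev i cs3 prime_ideal_zero z3 al3 S(1)] by auto
  obtain w r f where w: "r > 0" "w ^ r + (\<Sum>k<r. ev (f k) * w ^ k) = 0" "\<And>G. degree G < r \<Longrightarrow> pev ev w G = 0 \<Longrightarrow> G = 0"
    "w0 \<in> rational_mod ev {0} w"
    using monic_generator[OF ev z3 al3] by blast
  have rw: "a \<in> rational_mod ev {0} w" for a
    using rational_mod_UNIV[OF ev cs3 prime_ideal_zero S(2) w0] rational_mod_trans[OF ev prime_ideal_zero w(4)] by blast
  interpret C: coords \<iota> x y z w r f
    by unfold_locales (use i z3 w rw al3 in \<open>auto simp: ev_def\<close>)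
  have evC: "C.ev = ev" by (simp add: ev_def C.ev_def)
  have "\<exists>p. p \<noteq> 0 \<and> (\<forall>q. ev3 \<iota> x y z q \<in> P j \<longleftrightarrow> p dvd q)" for j
  proof -
    obtain a where a: "a \<in> P j" "a \<noteq> 0" using zP[of j] by auto
    obtain g s where "s \<noteq> 0" "pev C.ev a g * a = C.ev s" using C.multiple_in_S[OF a(2)] by blast
    hence "s \<noteq> 0" "ev3 \<iota> x y z s \<in> P j"
      using ideal_mult[OF I a(1), of "pev C.ev a g"] by (auto simp: C.ev_def)
    thus ?thesis by (rule prime_generator[OF i PP(1) z2[unfolded e2_def]])
  qed
  then obtain pp where pp: "\<And>j. pp j \<noteq> 0" "\<And>j q. ev3 \<iota> x y z q \<in> P j \<longleftrightarrow> pp j dvd q" by metis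
  have "\<exists>T. \<forall>l. tdeg (T l) \<le> tdeg (pp j) + k * C.emax \<and> ev3 \<iota> x y z (T l) - w ^ k * ev3 \<iota> x y z (pd l (pp j)) \<in> P j" for j k
  proof -
    \<comment> \<open>Modulo \<open>P j\<close> the element \<open>w\<close> is a fraction in
      \<open>x, y, z\<close>, as \<open>z\<close> generates the residue field; this is what allows
      it to be evaluated on the projected surface.\<close>
    obtain g d where gd: "pev e2 z d \<notin> P j" "pev e2 z d * w - pev e2 z g \<in> P j"
      using rz[of w j] by (auto simp: rational_mod_def)
    show ?thesis
      by (rule conductor_lift[OF i PP(1) pp(2) pp(1), where f = f and r = r and d = d and g = g])
         (use C.tdeg_f w(2) ideal_0[OF I] gd in \<open>auto simp: eve[symmetric] ev_def\<close>)
  qed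
  then obtain T where T: "\<And>j k l. tdeg (T j k l) \<le> tdeg (pp j) + k * C.emax"
    "\<And>j k l. ev3 \<iota> x y z (T j k l) - w ^ k * ev3 \<iota> x y z (pd l (pp j)) \<in> P j" by metis
  have "poisson_coords \<iota> br x y z w r f P pp T"
    by unfold_locales (use P(1) Pd xy pp T in \<open>auto simp: C.ev_def\<close>)
  thus ?thesis by blast
qed

subsection \<open>The Casimir function\<close>

context poisson_coords
begin

lemma prime_P: "prime_ideal (P j)" and poisson_P: "poisson_ideal br (P j)"
  using Pp[of j] by (auto simp: poisson_prime_def)

lemma ev_gens: "ev X3 = x" "ev Y3 = y" "ev Z3 = z"
  by (simp_all add: ev_def ev3_gens i)

text \<open>The Poisson bivector turned into a vector field by means of \<open>dx dy dz\<close>: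
  \<open>{a, b}\<close> is the scalar product of \<open>A\<close> with the cross product of the
  gradients of \<open>a\<close> and \<open>b\<close>.\<close>

definition A :: "nat \<Rightarrow> 'a" where
  "A j = (if j = 0 then br y z else if j = 1 then br z x else br x y)"

lemma br_der_along: "der_along \<kappa> (\<lambda>a. \<kappa> (br a b))"
  by (simp add: der_along_def br_add_l br_mult_l)

lemma br_der_along_r: "der_along \<kappa> (\<lambda>b. \<kappa> (br a b))"
  by (simp add: der_along_def br_add_r br_mult_r)

lemma der_kappa_along: "der_along \<kappa> (\<lambda>a. der j (\<kappa> a))"
  by (simp add: der_along_def der_add der_mult)

lemma der_gens: "der j (\<kappa> x) = (if j = 0 then 1 else 0)" "der j (\<kappa> y) = (if j = 1 then 1 else 0)"
  "der j (\<kappa> z) = (if j \<noteq> 0 \<and> j \<noteq> 1 then 1 else 0)"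
  using der_ev[of j X3] der_ev[of j Y3] der_ev[of j Z3] by (simp_all add: ev_gens pd_gens ev_simps)

lemma der_along_combination:
  assumes "der_along \<kappa> \<delta>1" "der_along \<kappa> \<delta>2"
  shows "der_along \<kappa> (\<lambda>a. b * \<delta>1 a + c * \<delta>2 a)"
  using assms unfolding der_along_def by (simp add: algebra_simps)

lemma br_x: "\<kappa> (br a x) = \<kappa> (A 1) * der 2 (\<kappa> a) - \<kappa> (A 2) * der 1 (\<kappa> a)"
proof -
  have "\<kappa> (br a x) = \<kappa> (A 1) * der 2 (\<kappa> a) + (- \<kappa> (A 2)) * der 1 (\<kappa> a)"
    by (rule derivation_eqI[OF br_der_along der_along_combination[OF der_kappa_along der_kappa_along]])
       (simp_all add: br_const der_const der_gens br_self A_def br_anti[of y x] rhom_uminus[OF to_fract_rhom])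
  thus ?thesis by simp
qed

lemma br_y: "\<kappa> (br a y) = \<kappa> (A 2) * der 0 (\<kappa> a) - \<kappa> (A 0) * der 2 (\<kappa> a)"
proof -
  have "\<kappa> (br a y) = \<kappa> (A 2) * der 0 (\<kappa> a) + (- \<kappa> (A 0)) * der 2 (\<kappa> a)"
    by (rule derivation_eqI[OF br_der_along der_along_combination[OF der_kappa_along der_kappa_along]])
       (simp_all add: br_const der_const der_gens br_self A_def br_anti[of z y] rhom_uminus[OF to_fract_rhom])
  thus ?thesis by simp
qed

lemma br_z: "\<kappa> (br a z) = \<kappa> (A 0) * der 1 (\<kappa> a) - \<kappa> (A 1) * der 0 (\<kappa> a)"
proof -
  have "\<kappa> (br a z) = \<kappa> (A 0) * der 1 (\<kappa> a) + (- \<kappa> (A 1)) * der 0 (\<kappa> a)"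
    by (rule derivation_eqI[OF br_der_along der_along_combination[OF der_kappa_along der_kappa_along]])
       (simp_all add: br_const der_const der_gens br_self A_def br_anti[of x z] rhom_uminus[OF to_fract_rhom])
  thus ?thesis by simp
qed

lemma br_expand:
  "\<kappa> (br a b) = \<kappa> (br a x) * der 0 (\<kappa> b) + \<kappa> (br a y) * der 1 (\<kappa> b) + \<kappa> (br a z) * der 2 (\<kappa> b)"
proof -
  have "der_along \<kappa> (\<lambda>b. 1 * (\<kappa> (br a x) * der 0 (\<kappa> b) + \<kappa> (br a y) * der 1 (\<kappa> b)) + \<kappa> (br a z) * der 2 (\<kappa> b))"
    by (intro der_along_combination der_kappa_along)
  hence "\<kappa> (br a b) = 1 * (\<kappa> (br a x) * der 0 (\<kappa> b) + \<kappa> (br a y) * der 1 (\<kappa> b)) + \<kappa> (br a z) * der 2 (\<kappa> b)"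
    by (rule derivation_eqI[OF br_der_along_r]) (simp_all add: br_const_r der_const der_gens)
  thus ?thesis by simp
qed

lemma br_ev:
  "br (ev q) x = A 1 * ev (pd 2 q) - A 2 * ev (pd 1 q)"
  "br (ev q) y = A 2 * ev (pd 0 q) - A 0 * ev (pd 2 q)"
proof -
  have "\<kappa> (br (ev q) x) = \<kappa> (A 1 * ev (pd 2 q) - A 2 * ev (pd 1 q))" by (simp add: br_x der_ev)
  thus "br (ev q) x = A 1 * ev (pd 2 q) - A 2 * ev (pd 1 q)" by (simp only: to_fract_eq_iff)
  have "\<kappa> (br (ev q) y) = \<kappa> (A 2 * ev (pd 0 q) - A 0 * ev (pd 2 q))" by (simp add: br_y der_ev)
  thus "br (ev q) y = A 2 * ev (pd 0 q) - A 0 * ev (pd 2 q)" by (simp only: to_fract_eq_iff)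
qed

text \<open>The form \<open>eta\<close> of \<open>P j\<close>, restated outside
  \<open>coords_prime\<close> so that forms belonging to different primes can be added.\<close>

definition E :: "nat \<Rightarrow> nat \<Rightarrow> 'a fract" where
  "E j a = \<kappa> (nn (T j) a) / (\<kappa> (ev (pp j)) * \<kappa> Fw)"

text \<open>The equations say that \<open>A\<close> is parallel to the gradient of \<open>g\<close>,
  that is, \<open>{g, -} = 0\<close>; the conclusion is this statement for \<open>g = a/b\<close>
  with denominators cleared.\<close>

lemma central_of_parallel:
  assumes g: "\<kappa> (A 1) * der 2 g = \<kappa> (A 2) * der 1 g" "\<kappa> (A 2) * der 0 g = \<kappa> (A 0) * der 2 g"
      "\<kappa> (A 0) * der 1 g = \<kappa> (A 1) * der 0 g"
    and ab: "g * \<kappa> b = \<kappa> a" "b \<noteq> 0"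
  shows "b * br a c - a * br b c = 0"
proof -
  have d: "der j (\<kappa> a) = g * der j (\<kappa> b) + \<kappa> b * der j g" for j
    unfolding ab(1)[symmetric] by (rule der_mult)
  have alg: "\<beta> * (u * (g * e2 + \<beta> * d2) - v * (g * e1 + \<beta> * d1)) = (g * \<beta>) * (u * e2 - v * e1)"
    if "u * d2 = v * d1" for \<beta> u v d1 d2 e1 e2 :: "'a fract"
    using that by algebra
  have X: "\<kappa> b * \<kappa> (br a x) = \<kappa> a * \<kappa> (br b x)"
    unfolding br_x d unfolding ab(1)[symmetric] by (rule alg[OF g(1)])
  have Y: "\<kappa> b * \<kappa> (br a y) = \<kappa> a * \<kappa> (br b y)"
    unfolding br_y d unfolding ab(1)[symmetric] by (rule alg[OF g(2)])
  have Z: "\<kappa> b * \<kappa> (br a z) = \<kappa> a * \<kappa> (br b z)"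
    unfolding br_z d unfolding ab(1)[symmetric] by (rule alg[OF g(3)])
  have "\<kappa> b * \<kappa> (br a c) = \<kappa> a * \<kappa> (br b c)"
    unfolding br_expand[of a c] br_expand[of b c] distrib_left mult.assoc[symmetric] X Y Z ..
  hence "\<kappa> (b * br a c) = \<kappa> (a * br b c)" by simp
  hence "b * br a c = a * br b c" by (simp only: to_fract_eq_iff)
  thus ?thesis by simp
qed

lemma exists_independent_central:
  "\<exists>a b. b \<noteq> 0 \<and> (\<forall>c. b * br a c - a * br b c = 0) \<and> (\<forall>c. a \<noteq> \<iota> c * b)"
proof -
  obtain g0 s0 where s0: "s0 \<noteq> 0" "pev ev Fw g0 * Fw = ev s0" using multiple_in_S[OF Fw_nz] by blast
  define u0 where "u0 = pev ev Fw g0"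
  have u0: "u0 \<in> range pw" "u0 * Fw = ev s0"
    using s0 range_pw_pev[OF Fw_range] by (auto simp: u0_def)

  \<comment> \<open>The primes are picked one after the other: \<open>Dl m\<close> is the product of
    \<open>ev s0\<close> and the equations chosen so far, and \<open>s m\<close> is the index of a
    prime that does not contain it.\<close>
  define J where "J = (\<lambda>D. SOME j. D \<notin> P j)"
  have J: "D \<notin> P (J D)" if "D \<noteq> 0" for D
    unfolding J_def using dense[OF that] by (rule someI_ex)
  define Dl where "Dl = rec_nat (ev s0) (\<lambda>m D. D * ev (pp (J D)))"
  have Dl: "Dl 0 = ev s0" "\<And>m. Dl (Suc m) = Dl m * ev (pp (J (Dl m)))" by (simp_all add: Dl_def)
  define s where "s = (\<lambda>m. J (Dl m))"
  have Dl0: "Dl m \<noteq> 0" for m by (induction m) (auto simp: Dl ev_eq_0 s0 pp0)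
  have sD: "Dl m \<notin> P (s m)" for m unfolding s_def by (rule J[OF Dl0])
  have I: "ideal (P j)" for j by (rule prime_idealD[OF prime_P])
  have d0: "ev s0 dvd Dl m" for m by (induction m) (auto simp: Dl)
  have dm: "m' < m \<Longrightarrow> ev (pp (s m')) dvd Dl m" for m m'
    by (induction m) (auto simp: Dl s_def less_Suc_eq intro: dvd_mult2)
  have s0P: "ev s0 \<notin> P (s m)" for m
    using sD[of m] d0[of m] ideal_mult'[OF I] by (auto simp: dvd_def)
  have ppne: "ev (pp (s m')) \<notin> P (s m)" if "m' < m" for m m'
    using sD[of m] dm[OF that] ideal_mult'[OF I] by (auto simp: dvd_def)
  have CP: "coords_prime \<iota> x y z w r f (P (s m)) (pp (s m)) (T (s m)) s0 u0" for m
    by unfold_locales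
       (use prime_P ppP pp0 TT u0 s0P independent_of_br_notin[OF prime_P poisson_P xyP] in auto)

  \<comment> \<open>A common denominator \<open>\<Delta>\<close> brings the vector field
    \<open>A\<close> into \<open>R\<close>. It is the same for all primes and so affects the bounds
    by a constant only.\<close>
  obtain d1 where d1: "d1 \<noteq> 0" "ev d1 * A 0 \<in> range pw" using denominator by blast
  obtain d2 where d2: "d2 \<noteq> 0" "ev d2 * A 1 \<in> range pw" using denominator by blast
  obtain d3 where d3: "d3 \<noteq> 0" "ev d3 * A 2 \<in> range pw" using denominator by blast
  define \<Delta> where "\<Delta> = d1 * d2 * d3"
  have D0: "ev \<Delta> \<noteq> 0" using d1 d2 d3 by (simp add: \<Delta>_def ev_eq_0)
  define \<alpha> where "\<alpha> = (\<lambda>j. ev \<Delta> * A j)"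
  have al: "\<alpha> 0 \<in> range pw" "\<alpha> 1 \<in> range pw" "\<alpha> 2 \<in> range pw"
  proof -
    have e: "\<alpha> 0 = ev (d2 * d3) * (ev d1 * A 0)" "\<alpha> 1 = ev (d1 * d3) * (ev d2 * A 1)" "\<alpha> 2 = ev (d1 * d2) * (ev d3 * A 2)"
      by (simp_all add: \<alpha>_def \<Delta>_def ev_simps mult_ac)
    show "\<alpha> 0 \<in> range pw" "\<alpha> 1 \<in> range pw" "\<alpha> 2 \<in> range pw"
      unfolding e by (rule range_pw_mult[OF range_pw_ev d1(2)] range_pw_mult[OF range_pw_ev d2(2)] range_pw_mult[OF range_pw_ev d3(2)])+
  qed

  define N where "N = (cnn + (mc (\<alpha> 1) + mc (\<alpha> 2))) + (cnn + (mc (\<alpha> 2) + mc (\<alpha> 0))) + ccurl 0 1 + ccurl 0 2 + ccurl 1 2"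
  \<comment> \<open>The five quantities attached to a form: two components of the cross product with
    \<open>A\<close> and the three components of the curl. For forms annihilated in these two
    components the third follows, as \<open>A 2\<close> is nonzero.\<close>
  define K where "K = (\<lambda>l m b. if l = (0::nat) then \<alpha> 1 * nn (T (s m)) 2 - \<alpha> 2 * nn (T (s m)) 1 = ev (pp (s m)) * b
     else if l = 1 then \<alpha> 2 * nn (T (s m)) 0 - \<alpha> 0 * nn (T (s m)) 2 = ev (pp (s m)) * b
     else if l = 2 then \<kappa> Fw ^ 3 * (der 0 (E (s m) 1) - der 1 (E (s m) 0)) = \<kappa> b
     else if l = 3 then \<kappa> Fw ^ 3 * (der 0 (E (s m) 2) - der 2 (E (s m) 0)) = \<kappa> b
     else \<kappa> Fw ^ 3 * (der 1 (E (s m) 2) - der 2 (E (s m) 1)) = \<kappa> b)"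
  have eta: "coords_prime.eta \<iota> x y z w r f (pp (s m)) (T (s m)) a = E (s m) a" for m a
    unfolding E_def by (rule coords_prime.eta_def[OF CP])
  have curl: "\<exists>b. b \<in> Rn (ccurl a c) \<and> \<kappa> Fw ^ 3 * (der a (E (s m) c) - der c (E (s m) a)) = \<kappa> b"
    for m a c
    using coords_prime.curl_bound[OF CP, of a c m] unfolding coords_prime.curl_def[OF CP] eta .
  have brP: "br (ev (pp j)) a \<in> P j" for j a
    using poisson_ideal_br[OF poisson_P, of "ev (pp j)" j a] ppP[of "pp j" j] by (simp add: ev_def)
  have h0: "\<exists>b. b \<in> Rn (cnn + (mc (\<alpha> 1) + mc (\<alpha> 2))) \<and> K 0 m b" for m
  proof -
    have "\<alpha> 1 * ev (pd 2 (pp (s m))) - \<alpha> 2 * ev (pd 1 (pp (s m))) = ev \<Delta> * br (ev (pp (s m))) x"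
      by (simp add: br_ev \<alpha>_def algebra_simps)
    also have "\<dots> \<in> P (s m)" by (intro ideal_mult I brP)
    finally show ?thesis unfolding K_def using coords_prime.contraction_bound[OF CP al(2,3)] by simp
  qed
  have h1: "\<exists>b. b \<in> Rn (cnn + (mc (\<alpha> 2) + mc (\<alpha> 0))) \<and> K 1 m b" for m
  proof -
    have "\<alpha> 2 * ev (pd 0 (pp (s m))) - \<alpha> 0 * ev (pd 2 (pp (s m))) = ev \<Delta> * br (ev (pp (s m))) y"
      by (simp add: br_ev \<alpha>_def algebra_simps)
    also have "\<dots> \<in> P (s m)" by (intro ideal_mult I brP)
    finally show ?thesis unfolding K_def using coords_prime.contraction_bound[OF CP al(3,1)] by simp
  qed
  have ex: "\<exists>b. b \<in> Rn N \<and> K l m b" for l m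
  proof -
    have up: "\<exists>b. b \<in> Rn N \<and> X b" if "\<exists>b. b \<in> Rn k \<and> X b" "k \<le> N" for k X
      using that Rn_mono by blast
    consider "l = 0" | "l = 1" | "l = 2" | "l = 3" | "l \<ge> 4" by linarith
    thus ?thesis
    proof cases
      case 1 show ?thesis unfolding 1 by (rule up[OF h0]) (simp add: N_def)
    next
      case 2 show ?thesis unfolding 2 by (rule up[OF h1]) (simp add: N_def)
    next
      case 3 thus ?thesis using up[OF curl[of 0 1 m]] by (simp add: N_def K_def)
    next
      case 4 thus ?thesis using up[OF curl[of 0 2 m]] by (simp add: N_def K_def)
    next
      case 5 thus ?thesis using up[OF curl[of 1 2 m]] by (simp add: N_def K_def)
    qed
  qed
  define a where "a = (\<lambda>m l. SOME b. b \<in> Rn N \<and> K l m b)"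
  have a: "a m l \<in> Rn N" "K l m (a m l)" for l m
    using someI_ex[OF ex[of l m]] by (simp_all add: a_def)
  \<comment> \<open>One more than the number of coefficients of five elements of
    \<open>Rn N\<close>.\<close>
  define L where "L = Suc (5 * (r * (N + 1) ^ 3))"

  define U where "U = (\<lambda>M t j. \<Sum>m\<in>M. \<kappa> (\<iota> (t m)) * E (s m) j)"
  have nz: "\<kappa> Fw \<noteq> 0" "\<kappa> (ev (pp j)) \<noteq> 0" for j using Fw_nz pp0 by (simp_all add: ev_eq_0)
  have rel: "\<kappa> (\<alpha> 1) * U M t 2 = \<kappa> (\<alpha> 2) * U M t 1 \<and> \<kappa> (\<alpha> 2) * U M t 0 = \<kappa> (\<alpha> 0) * U M t 2 \<and>
     der 0 (U M t 1) = der 1 (U M t 0) \<and> der 0 (U M t 2) = der 2 (U M t 0) \<and> der 1 (U M t 2) = der 2 (U M t 1)"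
    if z: "\<forall>l<5. (\<Sum>m\<in>M. \<iota> (t m) * a m l) = 0" for M :: "nat set" and t
  proof -
    have zk: "(\<Sum>m\<in>M. \<kappa> (\<iota> (t m)) * \<kappa> (a m l)) = 0" if "l < 5" for l
    proof -
      have "(\<Sum>m\<in>M. \<kappa> (\<iota> (t m)) * \<kappa> (a m l)) = \<kappa> (\<Sum>m\<in>M. \<iota> (t m) * a m l)"
        by (simp add: rhom_sum[OF to_fract_rhom])
      thus ?thesis using z that by simp
    qed
    have con: "\<kappa> u * U M t i' - \<kappa> v * U M t j' = 0"
      if l: "l < 5" and e: "\<And>m. u * nn (T (s m)) i' - v * nn (T (s m)) j' = ev (pp (s m)) * a m l"
        for u v i' j' l
    proof -
      have ee: "\<kappa> u * E (s m) i' - \<kappa> v * E (s m) j' = \<kappa> (a m l) / \<kappa> Fw" for m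
      proof -
        have "\<kappa> u * E (s m) i' - \<kappa> v * E (s m) j'
          = \<kappa> (u * nn (T (s m)) i' - v * nn (T (s m)) j') / (\<kappa> (ev (pp (s m))) * \<kappa> Fw)"
          by (simp add: E_def diff_divide_distrib)
        thus ?thesis unfolding e using nz by simp
      qed
      have "\<kappa> u * U M t i' - \<kappa> v * U M t j' = (\<Sum>m\<in>M. \<kappa> (\<iota> (t m)) * (\<kappa> (a m l) / \<kappa> Fw))"
        unfolding U_def sum_distrib_left sum_subtractf[symmetric] ee[symmetric]
        by (intro sum.cong) (simp_all add: algebra_simps)
      also have "\<dots> = (\<Sum>m\<in>M. \<kappa> (\<iota> (t m)) * \<kappa> (a m l)) / \<kappa> Fw" by (simp add: sum_divide_distrib)
      finally show ?thesis using zk[OF l] by simp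
    qed
    have cu: "der i' (U M t j') = der j' (U M t i')"
      if l: "l < 5" and e: "\<And>m. \<kappa> Fw ^ 3 * (der i' (E (s m) j') - der j' (E (s m) i')) = \<kappa> (a m l)"
        for i' j' l
    proof -
      have dU: "der i' (U M t j') = (\<Sum>m\<in>M. \<kappa> (\<iota> (t m)) * der i' (E (s m) j'))" for i' j'
        by (simp add: U_def der_sum der_mult der_const)
      have "\<kappa> Fw ^ 3 * (der i' (U M t j') - der j' (U M t i')) = (\<Sum>m\<in>M. \<kappa> (\<iota> (t m)) * \<kappa> (a m l))"
        unfolding dU sum_subtractf[symmetric] sum_distrib_left e[symmetric]
        by (intro sum.cong) (auto simp: algebra_simps)
      thus ?thesis using zk[OF l] nz by simp
    qed
    have "\<kappa> (\<alpha> 1) * U M t 2 - \<kappa> (\<alpha> 2) * U M t 1 = 0"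
      by (rule con[of 0]) (use a(2)[of 0] in \<open>auto simp: K_def\<close>)
    moreover have "\<kappa> (\<alpha> 2) * U M t 0 - \<kappa> (\<alpha> 0) * U M t 2 = 0"
      by (rule con[of 1]) (use a(2)[of 1] in \<open>auto simp: K_def\<close>)
    moreover have "der 0 (U M t 1) = der 1 (U M t 0)"
      by (rule cu[of 2]) (use a(2)[of 2] in \<open>auto simp: K_def\<close>)
    moreover have "der 0 (U M t 2) = der 2 (U M t 0)"
      by (rule cu[of 3]) (use a(2)[of 3] in \<open>auto simp: K_def\<close>)
    moreover have "der 1 (U M t 2) = der 2 (U M t 1)"
      by (rule cu[of 4]) (use a(2)[of 4] in \<open>auto simp: K_def\<close>)
    ultimately show ?thesis by simp
  qed

  \<comment> \<open>The poles separate the forms. With denominators cleared, every term other than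
    that of \<open>m0\<close> is divisible by the equation \<open>q m0\<close>, while the term of
    \<open>m0\<close> itself lies outside \<open>P (s m0)\<close>.\<close>
  have nv: "U M t 2 \<noteq> 0" if M: "finite M" and t: "\<exists>m\<in>M. t m \<noteq> 0" for M t
  proof
    assume zero: "U M t 2 = 0"
    define M' where "M' = {m\<in>M. t m \<noteq> 0}"
    have fM: "finite M'" and M'0: "M' \<noteq> {}" using M t by (auto simp: M'_def)
    \<comment> \<open>The largest index is taken because a chosen prime avoids the equations chosen
      before it; later equations may lie in it.\<close>
    define m0 where "m0 = Max M'"
    have m0: "m0 \<in> M'" using fM M'0 by (simp add: m0_def)
    have le: "m < m0" if "m \<in> M'" "m \<noteq> m0" for m
      using Max_ge[OF fM that(1)] that(2) by (simp add: m0_def)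
    define q where "q = (\<lambda>m. ev (pp (s m)))"
    have qP: "q m0 \<in> P (s m0)" using ppP[of "pp (s m0)" "s m0"] by (simp add: q_def ev_def)
    have "(\<Sum>m\<in>M'. \<kappa> (\<iota> (t m)) * E (s m) 2) = 0"
      using zero unfolding U_def
        by (subst (asm) sum.mono_neutral_right[OF M, of M']) (auto simp: M'_def rhom_0[OF i])
    hence "(\<kappa> Fw * \<kappa> (\<Prod>m\<in>M'. q m)) * (\<Sum>m\<in>M'. \<kappa> (\<iota> (t m)) * E (s m) 2) = 0" by simp
    also have "(\<kappa> Fw * \<kappa> (\<Prod>m\<in>M'. q m)) * (\<Sum>m\<in>M'. \<kappa> (\<iota> (t m)) * E (s m) 2)
        = (\<Sum>m\<in>M'. \<kappa> (\<iota> (t m) * nn (T (s m)) 2 * (\<Prod>m'\<in>M' - {m}. q m')))"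
      unfolding sum_distrib_left
    proof (rule sum.cong)
      fix m assume m: "m \<in> M'"
      have "\<kappa> (\<Prod>m\<in>M'. q m) = \<kappa> (q m) * \<kappa> (\<Prod>m'\<in>M' - {m}. q m')"
        using prod.remove[OF fM m, of q] by simp
      moreover have "\<kappa> Fw * \<kappa> (q m) * E (s m) 2 = \<kappa> (nn (T (s m)) 2)"
        using nz by (simp add: E_def q_def)
      ultimately show "\<kappa> Fw * \<kappa> (\<Prod>m\<in>M'. q m) * (\<kappa> (\<iota> (t m)) * E (s m) 2)
         = \<kappa> (\<iota> (t m) * nn (T (s m)) 2 * (\<Prod>m'\<in>M' - {m}. q m'))"
        by (simp add: mult_ac)
    qed simp
    also have "\<dots> = \<kappa> (\<Sum>m\<in>M'. \<iota> (t m) * nn (T (s m)) 2 * (\<Prod>m'\<in>M' - {m}. q m'))"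
      by (simp only: rhom_sum[OF to_fract_rhom])
    finally have z: "(\<Sum>m\<in>M'. \<iota> (t m) * nn (T (s m)) 2 * (\<Prod>m'\<in>M' - {m}. q m')) = 0"
      unfolding to_fract_eq_0_iff .
    define g where "g = (\<lambda>m. \<iota> (t m) * nn (T (s m)) 2 * (\<Prod>m'\<in>M' - {m}. q m'))"
    have "g m0 = - (\<Sum>m\<in>M' - {m0}. g m)"
      using z sum.remove[OF fM m0, of g] by (simp add: g_def eq_neg_iff_add_eq_0)
    also have "\<dots> \<in> P (s m0)"
    proof (intro ideal_uminus ideal_sum I)
      fix m assume m: "m \<in> M' - {m0}"
      have "(\<Prod>m'\<in>M' - {m}. q m') = q m0 * (\<Prod>m'\<in>M' - {m} - {m0}. q m')"
        using fM m0 m by (intro prod.remove) auto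
      thus "g m \<in> P (s m0)" unfolding g_def using ideal_mult[OF I ideal_mult'[OF I qP]] by simp
    qed
    finally have "\<iota> (t m0) \<in> P (s m0) \<or> nn (T (s m0)) 2 \<in> P (s m0) \<or> (\<Prod>m'\<in>M' - {m0}. q m') \<in> P (s m0)"
      unfolding g_def using prime_ideal_mult[OF prime_P] by blast
    moreover have "nn (T (s m0)) 2 \<notin> P (s m0)" by (rule coords_prime.n2P[OF CP])
    moreover have "\<iota> (t m0) \<notin> P (s m0)"
    proof
      assume "\<iota> (t m0) \<in> P (s m0)"
      hence "\<iota> (inverse (t m0)) * \<iota> (t m0) \<in> P (s m0)" by (rule ideal_mult[OF I])
      thus False using m0 prime_ideal_1[OF prime_P]
        by (simp add: M'_def rhom_mult[OF i, symmetric] rhom_1[OF i])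
    qed
    moreover have "(\<Prod>m'\<in>M' - {m0}. q m') \<notin> P (s m0)"
      using prime_ideal_prod[OF prime_P, of q "M' - {m0}" "s m0"] ppne le unfolding q_def by blast
    ultimately show False by blast
  qed

  obtain t1 where t1: "\<exists>m\<in>{..<L}. t1 m \<noteq> 0" "\<forall>l<5. (\<Sum>m\<in>{..<L}. \<iota> (t1 m) * a m l) = 0"
    using finite_dimensional[of "{..<L}" 5 N a] a(1) by (auto simp: L_def)
  obtain t2 where t2: "\<exists>m\<in>{L..<2 * L}. t2 m \<noteq> 0" "\<forall>l<5. (\<Sum>m\<in>{L..<2 * L}. \<iota> (t2 m) * a m l) = 0"
    using finite_dimensional[of "{L..<2 * L}" 5 N a] a(1) by (auto simp: L_def)
  define u where "u = U {..<L} t1"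
  define v where "v = U {L..<2 * L} t2"
  have u2: "u 2 \<noteq> 0" unfolding u_def by (rule nv) (use t1 in auto)
  have v2: "v 2 \<noteq> 0" unfolding v_def by (rule nv) (use t2 in auto)
  have ur: "\<kappa> (\<alpha> 1) * u 2 = \<kappa> (\<alpha> 2) * u 1" "\<kappa> (\<alpha> 2) * u 0 = \<kappa> (\<alpha> 0) * u 2"
     "der 0 (u 1) = der 1 (u 0)" "der 0 (u 2) = der 2 (u 0)" "der 1 (u 2) = der 2 (u 1)"
    using rel[OF t1(2)] by (simp_all add: u_def)
  have vr: "\<kappa> (\<alpha> 1) * v 2 = \<kappa> (\<alpha> 2) * v 1" "\<kappa> (\<alpha> 2) * v 0 = \<kappa> (\<alpha> 0) * v 2"
     "der 0 (v 1) = der 1 (v 0)" "der 0 (v 2) = der 2 (v 0)" "der 1 (v 2) = der 2 (v 1)"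
    using rel[OF t2(2)] by (simp_all add: v_def)
  have A2: "A 2 \<noteq> 0" using xyP[of 0] ideal_0[OF I, of 0] by (auto simp: A_def)
  have kD: "\<kappa> (ev \<Delta>) \<noteq> 0" "\<kappa> (A 2) \<noteq> 0" using D0 A2 by simp_all
  \<comment> \<open>Both forms are parallel to \<open>A\<close>, so their quotient can be read off
    from the last components, which are nonzero by \<open>nv\<close>.\<close>
  define g where "g = v 2 / u 2"
  have u1: "\<kappa> (A 2) * u 1 = \<kappa> (A 1) * u 2" and v1: "\<kappa> (A 2) * v 1 = \<kappa> (A 1) * v 2"
    and u0': "\<kappa> (A 2) * u 0 = \<kappa> (A 0) * u 2" and v0: "\<kappa> (A 2) * v 0 = \<kappa> (A 0) * v 2"
    using ur(1,2) vr(1,2) kD by (simp_all add: \<alpha>_def mult.assoc)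
  have gv: "v 2 = g * u 2" "v 1 = g * u 1" "v 0 = g * u 0"
  proof -
    show e2: "v 2 = g * u 2" using u2 by (simp add: g_def)
    have "\<kappa> (A 2) * v 1 = \<kappa> (A 2) * (g * u 1)" unfolding v1 e2 using u1 by (simp add: algebra_simps)
    thus "v 1 = g * u 1" using kD by simp
    have "\<kappa> (A 2) * v 0 = \<kappa> (A 2) * (g * u 0)" unfolding v0 e2 using u0' by (simp add: algebra_simps)
    thus "v 0 = g * u 0" using kD by simp
  qed
  \<comment> \<open>\<open>u\<close> and \<open>v = g * u\<close> are both closed, which makes
    \<open>dg\<close> parallel to \<open>u\<close> and therefore to \<open>A\<close>.\<close>
  have c01: "u 1 * der 0 g = u 0 * der 1 g" using vr(3) ur(3) unfolding gv der_mult by simp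
  have c02: "u 2 * der 0 g = u 0 * der 2 g" using vr(4) ur(4) unfolding gv der_mult by simp
  have c12: "u 2 * der 1 g = u 1 * der 2 g" using vr(5) ur(5) unfolding gv der_mult by simp
  have g1: "\<kappa> (A 1) * der 2 g = \<kappa> (A 2) * der 1 g"
  proof -
    have "u 2 * (\<kappa> (A 1) * der 2 g) = (\<kappa> (A 1) * u 2) * der 2 g" by (simp add: mult_ac)
    also have "\<dots> = \<kappa> (A 2) * (u 1 * der 2 g)" unfolding u1[symmetric] by (simp add: mult_ac)
    also have "\<dots> = u 2 * (\<kappa> (A 2) * der 1 g)" unfolding c12[symmetric] by (simp add: mult_ac)
    finally show ?thesis using u2 by simp
  qed
  have g2: "\<kappa> (A 2) * der 0 g = \<kappa> (A 0) * der 2 g"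
  proof -
    have "u 2 * (\<kappa> (A 2) * der 0 g) = \<kappa> (A 2) * (u 2 * der 0 g)" by (simp add: mult_ac)
    also have "\<dots> = (\<kappa> (A 2) * u 0) * der 2 g" unfolding c02 by (simp add: mult_ac)
    also have "\<dots> = u 2 * (\<kappa> (A 0) * der 2 g)" unfolding u0' by (simp add: mult_ac)
    finally show ?thesis using u2 by simp
  qed
  have g3: "\<kappa> (A 0) * der 1 g = \<kappa> (A 1) * der 0 g"
  proof -
    have "u 2 * (\<kappa> (A 0) * der 1 g) = (\<kappa> (A 0) * u 2) * der 1 g" by (simp add: mult_ac)
    also have "\<dots> = \<kappa> (A 2) * (u 0 * der 1 g)" unfolding u0'[symmetric] by (simp add: mult_ac)
    also have "\<dots> = (\<kappa> (A 2) * u 1) * der 0 g" unfolding c01[symmetric] by (simp add: mult_ac)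
    also have "\<dots> = u 2 * (\<kappa> (A 1) * der 0 g)" unfolding u1 by (simp add: mult_ac)
    finally show ?thesis using u2 by simp
  qed
  obtain b c where bc: "b \<noteq> 0" "g * \<kappa> b = \<kappa> c" by (rule fract_cases)
  have "c \<noteq> \<iota> k * b" for k
  proof
    assume "c = \<iota> k * b"
    hence "g * \<kappa> b = \<kappa> (\<iota> k) * \<kappa> b" using bc by simp
    hence gk: "g = \<kappa> (\<iota> k)" using bc by simp
    \<comment> \<open>If \<open>g\<close> were the constant \<open>k\<close>, then
      \<open>v - k * u = 0\<close> would be a relation over the union of the two disjoint blocks,
      nontrivial on the second one, against \<open>nv\<close>.\<close>
    define t where "t = (\<lambda>m. if m < L then - (k * t1 m) else t2 m)"
    have "U {..<2 * L} t 2 = U {..<L} t 2 + U {L..<2 * L} t 2"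
    proof -
      have "{..<2 * L} = {..<L} \<union> {L..<2 * L}" "{..<L} \<inter> {L..<2 * L} = {}" by auto
      thus ?thesis unfolding U_def by (simp add: sum.union_disjoint)
    qed
    also have "U {L..<2 * L} t 2 = v 2" unfolding v_def U_def t_def by (rule sum.cong) auto
    also have "U {..<L} t 2 = - (\<kappa> (\<iota> k) * u 2)"
      unfolding u_def U_def t_def sum_distrib_left sum_negf[symmetric]
      by (rule sum.cong) (auto simp: rhom_uminus[OF i] rhom_mult[OF i] rhom_uminus[OF to_fract_rhom] mult.assoc)
    also have "- (\<kappa> (\<iota> k) * u 2) + v 2 = 0" using gv(1) gk by simp
    finally have "U {..<2 * L} t 2 = 0" .
    moreover have "\<exists>m\<in>{..<2 * L}. t m \<noteq> 0"
    proof -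
      obtain m where "m \<in> {L..<2 * L}" "t2 m \<noteq> 0" using t2(1) by blast
      thus ?thesis by (intro bexI[of _ m]) (auto simp: t_def)
    qed
    ultimately show False using nv[of "{..<2 * L}" t] by simp
  qed
  moreover have "b * br c d - c * br b d = 0" for d
    by (rule central_of_parallel[OF g1 g2 g3 bc(2,1)])
  ultimately show ?thesis using bc by blast
qed

end

section \<open>The zero ideal and the equivalence\<close>

context poisson
begin

lemma rational_zero_imp_locally_closed:
  assumes fg: "finitely_generated \<iota>" and kd: "krull_dim_le TYPE('a) 3" and R: "poisson_rational \<iota> br {0}"
  shows "poisson_locally_closed br {0}"
proof (rule ccontr)
  assume nlc: "\<not> poisson_locally_closed br {0}"
  have dense: "\<exists>Q. poisson_prime br Q \<and> Q \<noteq> {0} \<and> D \<notin> Q" if "D \<noteq> 0" for D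
    using zero_locally_closed[OF that] nlc by blast
  have scalar: "\<exists>c. a = \<iota> c * b" if b: "b \<noteq> 0" and ct: "\<And>c. b * br a c - a * br b c = 0" for a b
  proof -
    have "b \<notin> {0} \<and> (\<forall>c. b * br a c - a * br b c \<in> {0})" using b ct by simp
    then obtain p :: "complex poly" where p: "p \<noteq> 0"
      "(\<Sum>k\<le>degree p. \<iota> (coeff p k) * a ^ k * b ^ (degree p - k)) \<in> {0}"
      using R unfolding poisson_rational_def by blast
    have "b \<notin> {0}" using b by simp
    then obtain c where "a - \<iota> c * b \<in> {0}"
      using complex_root_mod_prime[OF i prime_ideal_zero p] by blast
    thus ?thesis by auto
  qed
  \<comment> \<open>With zero bracket every element is central, so the ring is \<complex>, which has
    no nonzero prime ideal; but \<open>dense\<close> supplies one.\<close>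
  have "\<exists>a0 b0. br a0 b0 \<noteq> 0"
  proof (rule ccontr)
    assume "\<not> (\<exists>a0 b0. br a0 b0 \<noteq> 0)"
    hence sc: "\<exists>c. a = \<iota> c" for a using scalar[of 1 a] by (simp add: br_1)
    obtain Q where Q: "poisson_prime br Q" "Q \<noteq> {0}" using dense[of 1] by auto
    have pQ: "prime_ideal Q" using Q by (simp add: poisson_prime_def)
    obtain a where a: "a \<in> Q" "a \<noteq> 0" using Q(2) ideal_0[OF prime_idealD[OF pQ]] by auto
    obtain c where c: "a = \<iota> c" using sc by blast
    have "\<iota> (inverse c) * \<iota> c \<in> Q" using a c by (intro ideal_mult[OF prime_idealD[OF pQ]]) simp
    moreover have "c \<noteq> 0" using a c by (auto simp: rhom_0[OF i])
    ultimately show False using prime_ideal_1[OF pQ]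
      by (simp add: rhom_mult[OF i, symmetric] rhom_1[OF i])
  qed
  then obtain a0 b0 where h: "br a0 b0 \<noteq> 0" by blast
  obtain x y z w r f P pp T where "poisson_coords \<iota> br x y z w r f P pp T"
    using generic_coordinates[OF fg kd h dense] by blast
  then interpret C: poisson_coords \<iota> br x y z w r f P pp T .
  obtain a b where "b \<noteq> 0" "\<forall>c. b * br a c - a * br b c = 0" "\<forall>c. a \<noteq> \<iota> c * b"
    using C.exists_independent_central by blast
  thus False using scalar[of b a] by blast
qed

lemma rational_imp_locally_closed:
  assumes "finitely_generated \<iota>" "krull_dim_le TYPE('a) 3" "poisson_rational \<iota> br P"
  shows "poisson_locally_closed br P"
  using rational_zero_imp_locally_closed[OF assms(1,2)] rational_imp_locally_closed_nonzero[OF assms] assms(3)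
  by (cases "P = {0}") auto

end

theorem theorem7p3:
  fixes \<iota> :: "complex \<Rightarrow> 'a::idom" and br :: "'a \<Rightarrow> 'a \<Rightarrow> 'a"
  assumes "poisson_algebra \<iota> br"
    and "finitely_generated \<iota>"
    and "krull_dim_le TYPE('a) 3"
  shows "{P. poisson_primitive br P} = {P. poisson_locally_closed br P}
       \<and> {P. poisson_locally_closed br P} = {P. poisson_rational \<iota> br P}"
proof -
  interpret poisson \<iota> br by unfold_locales (rule assms(1))
  show ?thesis
    using locally_closed_imp_primitive[OF assms(2)] primitive_imp_rational[OF assms(2)]
      rational_imp_locally_closed[OF assms(2,3)] by blast
qed

end
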